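(* Let $V:\mathbb{R}^2\to\mathbb{R}$ satisfy $V\in L^1_{\rm loc}(\mathbb{R}^2)$, $\operatorname{ess\,inf} V<0$, and $V_-:=\max\{-V,0\}\in L^p(\mathbb{R}^2)+L^q(\mathbb{R}^2)$ for some $1<p<q<\infty$. Then there exists a constant $a_*\in[0,a^* )$ such that for all $a\in[a_*,a^* )$ the minimization problem $$E(a)=\inf_{u\in H^1(\mathbb{R}^2),\ \|u\|_{L^2}=1}\ \int_{\mathbb{R}^2}\Big(|\nabla u(x)|^2+V(x)|u(x)|^2-\frac a2|u(x)|^4\Big)\,dx$$ has at least one minimizer. If moreover $\inf\sigma(-\Delta+V)<0$, then one can choose $a_*=0$.
   Context: The constant $a^*$ is the optimal constant in the Gagliardo-Nirenberg inequality: $$a^*:=\inf_{u\in H^1(\mathbb{R}^2),\ \|u\|_{L^2}=1}\ \frac{\int_{\mathbb{R}^2}|\nabla u|^2\,dx}{\frac12\int_{\mathbb{R}^2}|u|^4\,dx}.$$ A minimizer of $E(a)$ is a function $u\in H^1(\mathbb{R}^2)$ with $\|u\|_{L^2}=1$ at which the infimum is attained. Under the assumption on $V_-$, the function $V_-|u|^2$ is integrable for every $u\in H^1(\mathbb{R}^2)$, so $\int V|u|^2\in(-\infty,+\infty]$ is well defined, and the energy is $+\infty$ when $\int V_+|u|^2=+\infty$, where $V_+=\max\{V,0\}$. The operator $-\Delta+V$ is the self-adjoint operator on $L^2(\mathbb{R}^2)$ associated with the quadratic form $u\mapsto\int(|\nabla u|^2+V|u|^2)$ on $\{u\in H^1(\mathbb{R}^2):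 V_+|u|^2\in L^1(\mathbb{R}^2)\}$, and $\sigma$ denotes its spectrum. *)

theory Defs
  imports "HOL-Analysis.Analysis" "HOL-Probability.Essential_Supremum"
begin

type_synonym plane = "real ^ 2"

text \<open>
  Elements of the function spaces below are represented by honest functions on the plane; equality
  in these spaces is equality almost everywhere with respect to \<^const>\<open>lebesgue\<close>. Wave functions are
  complex-valued.
\<close>

section \<open>Lebesgue spaces\<close>

definition Lp :: "real \<Rightarrow> (plane \<Rightarrow> 'b :: euclidean_space) set" where
  "Lp p = {f \<in> borel_measurable lebesgue. integrable lebesgue (\<lambda>x. norm (f x) powr p)}"

definition Lp_plus_Lq :: "real \<Rightarrow> real \<Rightarrow> (plane \<Rightarrow> real) set" where
  "Lp_plus_Lq p q = {f. \<exists>g\<in>Lp p. \<exists>h\<in>Lp q. AE x in lebesgue. f x = g x + h x}"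

definition locally_integrable :: "(plane \<Rightarrow> 'b :: euclidean_space) \<Rightarrow> bool" where
  "locally_integrable f \<longleftrightarrow>
     f \<in> borel_measurable lebesgue \<and> (\<forall>K. compact K \<longrightarrow> f absolutely_integrable_on K)"

definition essinf :: "(plane \<Rightarrow> real) \<Rightarrow> ereal" where
  "essinf f = - esssup lebesgue (\<lambda>x. - ereal (f x))"

definition l2_norm :: "(plane \<Rightarrow> complex) \<Rightarrow> real" where
  "l2_norm u = sqrt (\<integral>x. (norm (u x))\<^sup>2 \<partial>lebesgue)"

definition l2_inner :: "(plane \<Rightarrow> complex) \<Rightarrow> (plane \<Rightarrow> complex) \<Rightarrow> complex" where
  "l2_inner u v = (\<integral>x. u x * cnj (v x) \<partial>lebesgue)"


section \<open>The Sobolev space \<open>H\<^sup>1\<close>\<close>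

primrec C_k :: "nat \<Rightarrow> (plane \<Rightarrow> real) \<Rightarrow> bool" where
  "C_k 0 f \<longleftrightarrow> continuous_on UNIV f"
| "C_k (Suc k) f \<longleftrightarrow>
     f differentiable_on UNIV \<and> (\<forall>v. C_k k (\<lambda>x. frechet_derivative f (at x) v))"

definition test_functions :: "(plane \<Rightarrow> real) set" where
  "test_functions = {\<phi>. (\<forall>k. C_k k \<phi>) \<and> compact (closure {x. \<phi> x \<noteq> 0})}"

definition has_weak_gradient :: "(plane \<Rightarrow> complex) \<Rightarrow> (plane \<Rightarrow> complex ^ 2) \<Rightarrow> bool" where
  "has_weak_gradient u g \<longleftrightarrow>
     locally_integrable u \<and> locally_integrable g \<and>
     (\<forall>\<phi>\<in>test_functions. \<forall>i.
        (\<integral>x. frechet_derivative \<phi> (at x) (axis i 1) *\<^sub>R u x \<partial>lebesgue) =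
        - (\<integral>x. \<phi> x *\<^sub>R (g x $ i) \<partial>lebesgue))"

text \<open>The weak gradient is only determined up to null sets; the choice does not affect any of the
  integrals below.\<close>

definition weak_gradient :: "(plane \<Rightarrow> complex) \<Rightarrow> plane \<Rightarrow> complex ^ 2" where
  "weak_gradient u = (SOME g. has_weak_gradient u g)"

definition H1 :: "(plane \<Rightarrow> complex) set" where
  "H1 = {u \<in> Lp 2. \<exists>g\<in>Lp 2. has_weak_gradient u g}"

definition H1_sphere :: "(plane \<Rightarrow> complex) set" where
  "H1_sphere = {u \<in> H1. l2_norm u = 1}"


section \<open>The Gagliardo-Nirenberg constant and the minimization problem\<close>

definition gn_const :: real where
  "gn_const = (INF u\<in>H1_sphere.
     (\<integral>x. (norm (weak_gradient u x))\<^sup>2 \<partial>lebesgue) / (1/2 * (\<integral>x. norm (u x) ^ 4 \<partial>lebesgue)))"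

definition pos_potential_integrable :: "(plane \<Rightarrow> real) \<Rightarrow> (plane \<Rightarrow> complex) \<Rightarrow> bool" where
  "pos_potential_integrable V u \<longleftrightarrow> integrable lebesgue (\<lambda>x. max (V x) 0 * (norm (u x))\<^sup>2)"

text \<open>This is the intended energy when the product of the negative part of \<open>V\<close> and \<open>\<bar>u\<bar>\<^sup>2\<close> is
  integrable for all \<open>u\<close> in \<^const>\<open>H1\<close>; the integrand in the first branch is then integrable.\<close>

definition energy :: "(plane \<Rightarrow> real) \<Rightarrow> real \<Rightarrow> (plane \<Rightarrow> complex) \<Rightarrow> ereal" where
  "energy V a u =
     (if pos_potential_integrable V u
      then ereal (\<integral>x. (norm (weak_gradient u x))\<^sup>2 + V x * (norm (u x))\<^sup>2
                        - a / 2 * norm (u x) ^ 4 \<partial>lebesgue)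
      else \<infinity>)"

definition ground_energy :: "(plane \<Rightarrow> real) \<Rightarrow> real \<Rightarrow> ereal" where
  "ground_energy V a = (INF u\<in>H1_sphere. energy V a u)"

definition is_minimizer :: "(plane \<Rightarrow> real) \<Rightarrow> real \<Rightarrow> (plane \<Rightarrow> complex) \<Rightarrow> bool" where
  "is_minimizer V a u \<longleftrightarrow> u \<in> H1_sphere \<and> energy V a u = ground_energy V a"


section \<open>The Schroedinger operator and its spectrum\<close>

definition form_domain :: "(plane \<Rightarrow> real) \<Rightarrow> (plane \<Rightarrow> complex) set" where
  "form_domain V = {u \<in> H1. pos_potential_integrable V u}"

text \<open>The sesquilinear form obtained by polarization from the quadratic form
  \<open>u \<mapsto> \<integral> \<bar>\<nabla>u\<bar>\<^sup>2 + V \<bar>u\<bar>\<^sup>2\<close>.\<close>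

definition schroedinger_form ::
  "(plane \<Rightarrow> real) \<Rightarrow> (plane \<Rightarrow> complex) \<Rightarrow> (plane \<Rightarrow> complex) \<Rightarrow> complex" where
  "schroedinger_form V u v =
     (\<integral>x. (\<Sum>i\<in>UNIV. weak_gradient u x $ i * cnj (weak_gradient v x $ i))
           + complex_of_real (V x) * u x * cnj (v x) \<partial>lebesgue)"

text \<open>Unbounded operators on \<open>L\<^sup>2\<close> are given by their graphs. The operator associated with a closed
  semibounded form is the one of the first representation theorem: \<open>u\<close> is in its domain and is
  mapped to \<open>w\<close> iff \<open>u\<close> is in the form domain and the form at \<open>(u, v)\<close> is the inner product of \<open>w\<close>
  and \<open>v\<close>, for all \<open>v\<close> in the form domain.\<close>

definition schroedinger_op ::
  "(plane \<Rightarrow> real) \<Rightarrow> ((plane \<Rightarrow> complex) \<times> (plane \<Rightarrow> complex)) set" where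
  "schroedinger_op V = {(u, w). u \<in> form_domain V \<and> w \<in> Lp 2 \<and>
     (\<forall>v\<in>form_domain V. schroedinger_form V u v = l2_inner w v)}"

text \<open>A point \<open>z\<close> is in the resolvent set of \<open>T\<close> iff \<open>T - z\<close> is injective, maps its domain onto
  \<open>L\<^sup>2\<close>, and has a bounded inverse.\<close>

definition resolvent_set ::
  "((plane \<Rightarrow> complex) \<times> (plane \<Rightarrow> complex)) set \<Rightarrow> complex set" where
  "resolvent_set T = {z.
     (\<forall>(u, w)\<in>T. (AE x in lebesgue. w x - z * u x = 0) \<longrightarrow> (AE x in lebesgue. u x = 0)) \<and>
     (\<forall>f\<in>Lp 2. \<exists>(u, w)\<in>T. AE x in lebesgue. w x - z * u x = f x) \<and>
     (\<exists>C. \<forall>(u, w)\<in>T. l2_norm u \<le> C * l2_norm (\<lambda>x. w x - z * u x))}"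

definition spectrum ::
  "((plane \<Rightarrow> complex) \<times> (plane \<Rightarrow> complex)) set \<Rightarrow> complex set" where
  "spectrum T = - resolvent_set T"

text \<open>For self-adjoint \<open>T\<close> the spectrum consists of real numbers only.\<close>

definition inf_spectrum :: "((plane \<Rightarrow> complex) \<times> (plane \<Rightarrow> complex)) set \<Rightarrow> ereal" where
  "inf_spectrum T = (INF t\<in>{t::real. complex_of_real t \<in> spectrum T}. ereal t)"

end

theory Submission
  imports Defs "HOL-Complex_Analysis.Great_Picard"
begin

text \<open>If \<open>E(a) < 0\<close> and \<open>a < a\<^sup>*\<close>, then by the Gagliardo--Nirenberg inequality a minimizing sequence is bounded in
  \<open>H\<^sup>1\<close>. Let \<open>u\<close> be a weak limit along a subsequence. The negative part of \<open>V\<close> is weakly continuous, hence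
  \<open>u \<noteq> 0\<close>, since otherwise the limit of the energies would be nonnegative. By the Brezis--Lieb lemma the
  part that escapes to infinity has asymptotically nonnegative energy, so \<open>u\<close> has energy at most
  \<open>E(a)\<close>, and since \<open>E(a) < 0\<close>, normalizing \<open>u\<close> does not increase it. It remains to find trial states of negative energy. For \<open>a\<close> close to
  \<open>a\<^sup>*\<close>, take an optimizer of the Gagliardo--Nirenberg inequality, cut off and concentrated in a small ball
  around a point where \<open>V < 0\<close>: its Gagliardo--Nirenberg deficit is arbitrarily small. If the bottom of the
  spectrum is negative, the quadratic form takes a negative value, because a nonnegative form makes every
  \<open>t < 0\<close> a point of the resolvent set by the Riesz representation theorem.\<close>

section \<open>The Hilbert space of square integrable functions\<close>

text \<open>Since \<open>p\<close> may be close to 1, \<open>V_-\<close> can only be paired with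
  \<open>|u|^2\<close> if \<open>|u|\<close> has arbitrarily high powers integrable; hence the
  Gagliardo-Nirenberg inequality is proved for all even exponents. What compactness needs of
  \<open>V_-\<close> is condensed into \<open>tame_weight\<close>: up to a small multiple of the
  squared \<open>H1\<close> norm, only a bounded weight on a ball is seen. Weak limits are handled
  concretely, as strong limits in mean square on balls, with the gradient recovered by Riesz
  representation.

  Near \<open>gn_const\<close> the obstacle is that \<open>V\<close> is merely locally integrable,
  so nothing is known of the integral of \<open>V |u|^2\<close> for one given concentrated
  \<open>u\<close>. Moreover, shrinking a function by a factor \<open>l\<close> multiplies its
  deficit by \<open>l^2\<close>. Hence the radius of the ball is fixed first, from a continuous
  average of \<open>V\<close>; then the near optimizer is taken as good as that radius demands; only
  then is a favourable translate selected. Negative energy is reached at the critical coupling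
  itself. The energy of a fixed state is affine in \<open>a\<close>, so it stays negative on an
  interval below \<open>gn_const\<close>.\<close>

definition nsq :: "(plane \<Rightarrow> 'b::euclidean_space) \<Rightarrow> real" where
  "nsq f = (\<integral>x. (norm (f x))^2 \<partial>lebesgue)"

definition ip :: "(plane \<Rightarrow> 'b::euclidean_space) \<Rightarrow> (plane \<Rightarrow> 'b) \<Rightarrow> real" where
  "ip f g = (\<integral>x. f x \<bullet> g x \<partial>lebesgue)"

lemma L2_iff:
  "f \<in> Lp 2 \<longleftrightarrow> f \<in> borel_measurable lebesgue \<and> integrable lebesgue (\<lambda>x. (norm (f x))^2)"
proof -
  have "norm (f x) powr 2 = (norm (f x))^2" for x
    by (cases "f x = 0") (auto simp: powr_numeral)
  then show ?thesis by (simp add: Lp_def)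
qed

lemma L2_meas: "f \<in> Lp 2 \<Longrightarrow> f \<in> borel_measurable lebesgue"
  and L2_int: "f \<in> Lp 2 \<Longrightarrow> integrable lebesgue (\<lambda>x. (norm (f x))^2)"
  by (auto simp: L2_iff)

lemma L2_I: "f \<in> borel_measurable lebesgue \<Longrightarrow> integrable lebesgue (\<lambda>x. (norm (f x))^2) \<Longrightarrow> f \<in> Lp 2"
  by (auto simp: L2_iff)

lemma nsq_nonneg [simp]: "0 \<le> nsq f"
  by (simp add: nsq_def)

lemma norm_mult_le_sum_squares: "norm x * norm y \<le> (norm x)^2 + (norm y)^2"
  for x :: "'a::real_normed_vector" and y :: "'b::real_normed_vector"
proof -
  have "0 \<le> (norm x - norm y)^2" by simp
  moreover have "0 \<le> (norm x)^2" "0 \<le> (norm y)^2" by simp_all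
  ultimately show ?thesis unfolding power2_diff by linarith
qed

lemma L2_dominated:
  assumes "f \<in> Lp 2" "g \<in> borel_measurable lebesgue" "AE x in lebesgue. norm (g x) \<le> C * norm (f x)"
  shows "g \<in> Lp 2"
proof (rule L2_I)
  show "integrable lebesgue (\<lambda>x. (norm (g x))^2)"
  proof (rule Bochner_Integration.integrable_bound)
    show "integrable lebesgue (\<lambda>x. C^2 * (norm (f x))^2)" using L2_int[OF assms(1)] by simp
    show "AE x in lebesgue. norm ((norm (g x))^2) \<le> norm (C^2 * (norm (f x))^2)"
      using assms(3)
    proof eventually_elim
      case (elim x)
      then show ?case using power_mono[OF elim, of 2] by (simp add: power_mult_distrib)
    qed
  qed (use assms in \<open>auto intro!: borel_measurable_power borel_measurable_norm L2_meas\<close>)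
qed (use assms in auto)

lemma L2_AE_cong:
  assumes "f \<in> Lp 2" "g \<in> borel_measurable lebesgue" "AE x in lebesgue. g x = f x"
  shows "g \<in> Lp 2"
  by (rule L2_dominated[OF assms(1,2), of 1]) (use assms(3) in auto)

lemma L2_zero [simp]: "(\<lambda>x. 0) \<in> Lp 2"
  by (simp add: L2_iff)

lemma L2_add:
  assumes [THEN L2_meas, measurable]: "f \<in> Lp 2" "g \<in> Lp 2" shows "(\<lambda>x. f x + g x) \<in> Lp 2"
proof (rule L2_I)
  show "integrable lebesgue (\<lambda>x. (norm (f x + g x))^2)"
  proof (rule Bochner_Integration.integrable_bound)
    show "integrable lebesgue (\<lambda>x. 2 * (norm (f x))^2 + 2 * (norm (g x))^2)"
      using L2_int[OF assms(1)] L2_int[OF assms(2)] by simp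
    show "AE x in lebesgue. norm ((norm (f x + g x))^2) \<le> norm (2 * (norm (f x))^2 + 2 * (norm (g x))^2)"
    proof (rule AE_I2)
      fix x
      have "(norm (f x + g x))^2 \<le> (norm (f x) + norm (g x))^2"
        by (simp add: norm_triangle_ineq power_mono)
      also have "\<dots> \<le> 2 * (norm (f x))^2 + 2 * (norm (g x))^2"
        using sum_squares_bound[of "norm (f x)" "norm (g x)"] by (simp add: power2_sum)
      finally show "norm ((norm (f x + g x))^2) \<le> norm (2 * (norm (f x))^2 + 2 * (norm (g x))^2)"
        by simp
    qed
  qed measurable
qed measurable

lemma L2_scaleR: "f \<in> Lp 2 \<Longrightarrow> (\<lambda>x. c *\<^sub>R f x) \<in> Lp 2"
  by (rule L2_dominated[of f _ "\<bar>c\<bar>"]) (auto intro!: borel_measurable_scaleR intro: L2_meas)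

lemma L2_cmult: "f \<in> Lp 2 \<Longrightarrow> (\<lambda>x. c * f x) \<in> Lp 2" for c :: complex
  by (rule L2_dominated[of f _ "norm c"]) (auto simp: norm_mult intro!: borel_measurable_times intro: L2_meas)

lemma L2_uminus: "f \<in> Lp 2 \<Longrightarrow> (\<lambda>x. - f x) \<in> Lp 2"
  by (rule L2_dominated[of f _ 1]) (auto intro!: borel_measurable_uminus intro: L2_meas)

lemma L2_diff: "f \<in> Lp 2 \<Longrightarrow> g \<in> Lp 2 \<Longrightarrow> (\<lambda>x. f x - g x) \<in> Lp 2"
  using L2_add[of f "\<lambda>x. - g x"] L2_uminus[of g] by simp

lemma L2_prod_integrable:
  assumes [THEN L2_meas, measurable]: "f \<in> Lp 2" "g \<in> Lp 2"
  shows "integrable lebesgue (\<lambda>x. norm (f x) * norm (g x))"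
proof (rule Bochner_Integration.integrable_bound)
  show "integrable lebesgue (\<lambda>x. (norm (f x))^2 + (norm (g x))^2)"
    using L2_int[OF assms(1)] L2_int[OF assms(2)] by simp
qed (auto intro!: norm_mult_le_sum_squares)

lemma L2_bilinear_integrable:
  fixes f :: "plane \<Rightarrow> 'b::euclidean_space" and g :: "plane \<Rightarrow> 'c::euclidean_space"
    and h :: "plane \<Rightarrow> 'd::euclidean_space"
  assumes "f \<in> Lp 2" "g \<in> Lp 2" and "h \<in> borel_measurable lebesgue" "\<And>x. norm (h x) \<le> norm (f x) * norm (g x)"
  shows "integrable lebesgue h"
  by (rule Bochner_Integration.integrable_bound[OF L2_prod_integrable[OF assms(1,2)]]) (use assms in auto)

lemma ip_integrable: "f \<in> Lp 2 \<Longrightarrow> g \<in> Lp 2 \<Longrightarrow> integrable lebesgue (\<lambda>x. f x \<bullet> g x)"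
  by (rule L2_bilinear_integrable[of f g]) (auto simp: Cauchy_Schwarz_ineq2 intro!: borel_measurable_inner intro: L2_meas)

lemma ip_self: "ip f f = nsq f"
  by (simp add: ip_def nsq_def power2_norm_eq_inner)

lemma ip_commute: "ip f g = ip g f"
  by (simp add: ip_def inner_commute)

lemma ip_add_left: "f \<in> Lp 2 \<Longrightarrow> g \<in> Lp 2 \<Longrightarrow> h \<in> Lp 2 \<Longrightarrow> ip (\<lambda>x. f x + g x) h = ip f h + ip g h"
  by (simp add: ip_def inner_add_left ip_integrable)

lemma ip_add_right: "f \<in> Lp 2 \<Longrightarrow> g \<in> Lp 2 \<Longrightarrow> h \<in> Lp 2 \<Longrightarrow> ip h (\<lambda>x. f x + g x) = ip h f + ip h g"
  by (simp add: ip_def inner_add_right ip_integrable)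

lemma ip_diff_left: "f \<in> Lp 2 \<Longrightarrow> g \<in> Lp 2 \<Longrightarrow> h \<in> Lp 2 \<Longrightarrow> ip (\<lambda>x. f x - g x) h = ip f h - ip g h"
  by (simp add: ip_def inner_diff_left ip_integrable)

lemma ip_diff_right: "f \<in> Lp 2 \<Longrightarrow> g \<in> Lp 2 \<Longrightarrow> h \<in> Lp 2 \<Longrightarrow> ip h (\<lambda>x. f x - g x) = ip h f - ip h g"
  by (simp add: ip_def inner_diff_right ip_integrable)

lemma ip_scaleR_left: "ip (\<lambda>x. c *\<^sub>R f x) h = c * ip f h"
  and ip_scaleR_right: "ip h (\<lambda>x. c *\<^sub>R f x) = c * ip h f"
  by (simp_all add: ip_def)

lemma nsq_scaleR: "nsq (\<lambda>x. c *\<^sub>R f x) = c^2 * nsq f"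
  by (simp add: nsq_def power_mult_distrib)

lemma nsq_add: "f \<in> Lp 2 \<Longrightarrow> g \<in> Lp 2 \<Longrightarrow> nsq (\<lambda>x. f x + g x) = nsq f + 2 * ip f g + nsq g"
  by (simp add: ip_self[symmetric] ip_add_left ip_add_right L2_add ip_commute[of g f])

lemma nsq_diff: "f \<in> Lp 2 \<Longrightarrow> g \<in> Lp 2 \<Longrightarrow> nsq (\<lambda>x. f x - g x) = nsq f - 2 * ip f g + nsq g"
  by (simp add: ip_self[symmetric] ip_diff_left ip_diff_right L2_diff ip_commute[of g f])

lemma nsq_add_le: "f \<in> Lp 2 \<Longrightarrow> g \<in> Lp 2 \<Longrightarrow> nsq (\<lambda>x. f x + g x) \<le> 2 * nsq f + 2 * nsq g"
  using nsq_nonneg[of "\<lambda>x. f x - g x"] by (simp add: nsq_add nsq_diff)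

lemma nsq_diff_le: "f \<in> Lp 2 \<Longrightarrow> g \<in> Lp 2 \<Longrightarrow> nsq (\<lambda>x. f x - g x) \<le> 2 * nsq f + 2 * nsq g"
  using nsq_nonneg[of "\<lambda>x. f x + g x"] by (simp add: nsq_add nsq_diff)

lemma nsq_triangle:
  assumes "f \<in> Lp 2" "g \<in> Lp 2" "h \<in> Lp 2"
  shows "nsq (\<lambda>x. f x - h x) \<le> 2 * nsq (\<lambda>x. f x - g x) + 2 * nsq (\<lambda>x. g x - h x)"
  using nsq_add_le[of "\<lambda>x. f x - g x" "\<lambda>x. g x - h x"] assms by (simp add: L2_diff)

text \<open>Serves both Cauchy-Schwarz and the Euler-Lagrange equation in
  \<open>riesz_sequence\<close>. The forms involved are only semidefinite, so \<open>A = 0\<close>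
  is covered too: a linear function bounded below is constant.\<close>

lemma discriminant_le:
  fixes A B C :: real
  assumes "\<And>t. 0 \<le> A * t^2 + 2 * B * t + C" "0 \<le> A"
  shows "B^2 \<le> A * C"
proof (cases "A = 0")
  case True
  have "B = 0"
  proof (rule ccontr)
    assume "B \<noteq> 0"
    then show False using assms(1)[of "- (C + 1) / (2 * B)"] True by (simp add: field_simps)
  qed
  then show ?thesis using True by simp
next
  case False
  then have A: "A > 0" using assms by simp
  have "0 \<le> A * (- B / A)^2 + 2 * B * (- B / A) + C" by (rule assms(1))
  also have "\<dots> = C - B^2 / A" using A by (simp add: field_simps power2_eq_square)
  finally show ?thesis using A by (simp add: field_simps)
qed

lemma ip_CS:
  assumes "f \<in> Lp 2" "g \<in> Lp 2" shows "(ip f g)^2 \<le> nsq f * nsq g"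
proof -
  have "(ip g f)^2 \<le> nsq g * nsq f"
  proof (rule discriminant_le)
    fix t
    have "nsq (\<lambda>x. f x + t *\<^sub>R g x) = nsq f + 2 * (t * ip f g) + t^2 * nsq g"
      using assms by (simp add: nsq_add L2_scaleR ip_scaleR_right nsq_scaleR)
    then show "0 \<le> nsq g * t^2 + 2 * ip g f * t + nsq f"
      using nsq_nonneg[of "\<lambda>x. f x + t *\<^sub>R g x"] by (simp add: algebra_simps ip_commute)
  qed simp
  then show ?thesis by (simp add: ip_commute mult.commute)
qed

lemma ip_abs_le: "f \<in> Lp 2 \<Longrightarrow> g \<in> Lp 2 \<Longrightarrow> \<bar>ip f g\<bar> \<le> sqrt (nsq f) * sqrt (nsq g)"
  using real_sqrt_le_mono[OF ip_CS[of f g]] by (simp add: real_sqrt_mult)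

lemma nsq_norm [simp]: "nsq (\<lambda>x. norm (f x)) = nsq f"
  by (simp add: nsq_def)

lemma L2_norm: "f \<in> Lp 2 \<Longrightarrow> (\<lambda>x. norm (f x)) \<in> Lp 2"
  by (auto simp: L2_iff intro: borel_measurable_norm)

lemma CS_integral:
  assumes "f \<in> Lp 2" "g \<in> Lp 2"
  shows "(\<integral>x. norm (f x) * norm (g x) \<partial>lebesgue) \<le> sqrt (nsq f) * sqrt (nsq g)"
  using ip_abs_le[OF L2_norm[OF assms(1)] L2_norm[OF assms(2)]] by (simp add: ip_def)

lemma integral_CS:
  fixes f g :: "plane \<Rightarrow> real"
  assumes "f \<in> borel_measurable lebesgue" "g \<in> borel_measurable lebesgue"
    "integrable lebesgue (\<lambda>x. (f x)^2)" "integrable lebesgue (\<lambda>x. (g x)^2)"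
  shows "integrable lebesgue (\<lambda>x. f x * g x)"
    "\<bar>\<integral>x. f x * g x \<partial>lebesgue\<bar> \<le> sqrt (\<integral>x. (f x)^2 \<partial>lebesgue) * sqrt (\<integral>x. (g x)^2 \<partial>lebesgue)"
proof -
  have fg: "f \<in> Lp 2" "g \<in> Lp 2" using assms by (auto simp: L2_iff)
  show "integrable lebesgue (\<lambda>x. f x * g x)" using ip_integrable[OF fg] by simp
  show "\<bar>\<integral>x. f x * g x \<partial>lebesgue\<bar> \<le> sqrt (\<integral>x. (f x)^2 \<partial>lebesgue) * sqrt (\<integral>x. (g x)^2 \<partial>lebesgue)"
    using ip_abs_le[OF fg] by (simp add: ip_def nsq_def)
qed

lemma nsq_cong_AE:
  assumes "f \<in> borel_measurable lebesgue" "g \<in> borel_measurable lebesgue" "AE x in lebesgue. f x = g x"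
  shows "nsq f = nsq g"
  unfolding nsq_def by (rule integral_cong_AE) (use assms in auto)

lemma nsq_eq_0: "f \<in> Lp 2 \<Longrightarrow> nsq f = 0 \<Longrightarrow> AE x in lebesgue. f x = 0"
  unfolding nsq_def using integral_nonneg_eq_0_iff_AE[of lebesgue "\<lambda>x. (norm (f x))^2"] L2_int[of f] by simp

text \<open>Fatou's lemma with a convergent sequence of bounds. Integrability of the limit belongs
  to the conclusion, because this is how limits are shown to be square integrable or to have finite
  potential energy.\<close>

lemma fatou_bound:
  fixes f :: "nat \<Rightarrow> 'a \<Rightarrow> real"
  assumes int: "\<And>n. integrable M (f n)" and nn: "\<And>n x. 0 \<le> f n x"
    and ae: "AE x in M. (\<lambda>n. f n x) \<longlonglongrightarrow> g x" and g: "g \<in> borel_measurable M"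
    and bd: "\<And>n. (\<integral>x. f n x \<partial>M) \<le> C n" and C: "C \<longlonglongrightarrow> c"
  shows "integrable M g \<and> (\<integral>x. g x \<partial>M) \<le> c"
proof -
  have nng: "AE x in M. 0 \<le> g x"
    using ae by eventually_elim (auto intro: LIMSEQ_le_const simp: nn)
  have c0: "0 \<le> c"
  proof (rule LIMSEQ_le_const[OF C])
    show "\<exists>N. \<forall>n\<ge>N. 0 \<le> C n" using bd Bochner_Integration.integral_nonneg[of M "f _"] nn by (meson order_trans)
  qed
  have "(\<integral>\<^sup>+x. ennreal (g x) \<partial>M) = (\<integral>\<^sup>+x. liminf (\<lambda>n. ennreal (f n x)) \<partial>M)"
  proof (rule nn_integral_cong_AE)
    show "AE x in M. ennreal (g x) = liminf (\<lambda>n. ennreal (f n x))"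
      using ae
    proof eventually_elim
      case (elim x)
      then have "(\<lambda>n. ennreal (f n x)) \<longlonglongrightarrow> ennreal (g x)" by simp
      then show ?case by (simp add: lim_imp_Liminf)
    qed
  qed
  also have "\<dots> \<le> liminf (\<lambda>n. \<integral>\<^sup>+x. ennreal (f n x) \<partial>M)"
    by (rule nn_integral_liminf) (use int in auto)
  also have "\<dots> \<le> liminf (\<lambda>n. ennreal (C n))"
    by (rule Liminf_mono) (use int nn bd in \<open>auto simp: nn_integral_eq_integral intro!: always_eventually ennreal_leI\<close>)
  also have "\<dots> = ennreal c"
    using C by (intro lim_imp_Liminf) auto
  finally have le: "(\<integral>\<^sup>+x. ennreal (g x) \<partial>M) \<le> ennreal c" .
  have i: "integrable M g"
  proof (rule integrableI_bounded[OF g])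
    have "(\<integral>\<^sup>+x. ennreal (norm (g x)) \<partial>M) = (\<integral>\<^sup>+x. ennreal (g x) \<partial>M)"
      by (rule nn_integral_cong_AE) (use nng in eventually_elim, simp)
    then show "(\<integral>\<^sup>+x. ennreal (norm (g x)) \<partial>M) < \<infinity>" using le by (simp add: le_less_trans)
  qed
  moreover have "(\<integral>x. g x \<partial>M) \<le> c"
  proof -
    have "ennreal (\<integral>x. g x \<partial>M) = (\<integral>\<^sup>+x. ennreal (g x) \<partial>M)"
      using nn_integral_eq_integral[OF i nng] by simp
    then show ?thesis using le c0 by (metis ennreal_le_iff)
  qed
  ultimately show ?thesis by simp
qed

lemma L2_AE_subseq:
  assumes f: "\<And>n. f n \<in> Lp 2" "g \<in> Lp 2" and lim: "(\<lambda>n. nsq (\<lambda>x. f n x - g x)) \<longlonglongrightarrow> 0"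
  shows "\<exists>r. strict_mono r \<and> (AE x in lebesgue. (\<lambda>n. f (r n) x) \<longlonglongrightarrow> g x)"
proof -
  have "\<exists>r. strict_mono r \<and> (AE x in lebesgue. (\<lambda>n. (norm (f (r n) x - g x))^2) \<longlonglongrightarrow> 0)"
    using tendsto_L1_AE_subseq[of lebesgue "\<lambda>n x. (norm (f n x - g x))^2"] lim
    by (force simp: nsq_def L2_int[OF L2_diff[OF f]])
  then obtain r where r: "strict_mono r" "AE x in lebesgue. (\<lambda>n. (norm (f (r n) x - g x))^2) \<longlonglongrightarrow> 0"
    by blast
  have "AE x in lebesgue. (\<lambda>n. f (r n) x) \<longlonglongrightarrow> g x"
    using r(2)
  proof eventually_elim
    case (elim x)
    then have "(\<lambda>n. sqrt ((norm (f (r n) x - g x))^2)) \<longlonglongrightarrow> sqrt 0" by (rule tendsto_real_sqrt)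
    then show ?case by (simp add: LIM_zero_iff tendsto_norm_zero_iff)
  qed
  with r(1) show ?thesis by blast
qed

lemma ip_tendsto:
  assumes f: "\<And>n. f n \<in> Lp 2" "g \<in> Lp 2" "h \<in> Lp 2" and lim: "(\<lambda>n. nsq (\<lambda>x. f n x - g x)) \<longlonglongrightarrow> 0"
  shows "(\<lambda>n. ip (f n) h) \<longlonglongrightarrow> ip g h"
proof -
  have "(\<lambda>n. ip (f n) h - ip g h) \<longlonglongrightarrow> 0"
  proof (rule Lim_null_comparison)
    show "\<forall>\<^sub>F n in sequentially. norm (ip (f n) h - ip g h) \<le> sqrt (nsq (\<lambda>x. f n x - g x)) * sqrt (nsq h)"
      using ip_abs_le[OF L2_diff[OF f(1,2)] f(3)] by (auto simp: ip_diff_left f)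
    show "(\<lambda>n. sqrt (nsq (\<lambda>x. f n x - g x)) * sqrt (nsq h)) \<longlonglongrightarrow> 0"
      using tendsto_mult_left_zero[OF tendsto_real_sqrt[OF lim, simplified]] by simp
  qed
  then show ?thesis by (simp add: LIM_zero_iff)
qed

lemma nsq_tendsto:
  assumes f: "\<And>n. f n \<in> Lp 2" "g \<in> Lp 2" and lim: "(\<lambda>n. nsq (\<lambda>x. f n x - g x)) \<longlonglongrightarrow> 0"
  shows "(\<lambda>n. nsq (f n)) \<longlonglongrightarrow> nsq g"
proof -
  have "nsq (f n) = nsq (\<lambda>x. f n x - g x) + 2 * ip (f n) g - nsq g" for n
    by (simp add: nsq_diff f)
  moreover have "(\<lambda>n. nsq (\<lambda>x. f n x - g x) + 2 * ip (f n) g - nsq g) \<longlonglongrightarrow> 0 + 2 * ip g g - nsq g"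
    by (intro tendsto_intros lim ip_tendsto[OF f(1,2,2)])
  ultimately show ?thesis by (simp add: ip_self)
qed

text \<open>Riesz-Fischer for functions rather than classes: a rapidly convergent subsequence
  converges almost everywhere, and Fatou identifies its pointwise limit as the limit in mean
  square.\<close>

lemma L2_complete:
  fixes f :: "nat \<Rightarrow> plane \<Rightarrow> 'b::euclidean_space"
  assumes f: "\<And>n. f n \<in> Lp 2"
    and cauchy: "\<And>e. e > 0 \<Longrightarrow> \<exists>N. \<forall>m\<ge>N. \<forall>n\<ge>N. nsq (\<lambda>x. f m x - f n x) < e"
  shows "\<exists>g\<in>Lp 2. (\<lambda>n. nsq (\<lambda>x. f n x - g x)) \<longlonglongrightarrow> 0"
proof -
  note [measurable] = L2_meas[OF f]
  have "\<forall>k. \<exists>N. \<forall>m\<ge>N. \<forall>n\<ge>N. nsq (\<lambda>x. f m x - f n x) < (1/8)^k"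
    using cauchy by simp
  then obtain N where N: "\<And>k m n. m \<ge> N k \<Longrightarrow> n \<ge> N k \<Longrightarrow> nsq (\<lambda>x. f m x - f n x) < (1/8)^k" by metis
  \<comment> \<open>Summing the thresholds puts \<open>r k\<close> above \<open>N k\<close>, and
    adding \<open>k\<close> makes \<open>r\<close> strictly increasing.\<close>
  define r where "r k = (\<Sum>j\<le>k. N j) + k" for k
  have rN: "N k \<le> r k" for k unfolding r_def by (meson member_le_sum atMost_iff finite_atMost le_add1 order.trans order_refl zero_le)
  have rS: "r k < r (Suc k)" for k by (simp add: r_def)
  then have rmono: "strict_mono r" by (simp add: strict_mono_Suc_iff)
  have rN': "N k \<le> r (Suc k)" for k using rN[of k] rS[of k] by simp
  \<comment> \<open>The squared increments are below \<open>(1/8)^k\<close> on average, so the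
    factor \<open>2^k\<close> still leaves a summable series. Its terms are then bounded pointwise,
    which gives increments of order \<open>sqrt (1/2)^k\<close> and hence absolute
    convergence.\<close>
  define d where "d k x = 2^k * (norm (f (r k) x - f (r (Suc k)) x))^2" for k x
  have d_meas [measurable]: "d k \<in> borel_measurable lebesgue" for k unfolding d_def by measurable
  have d_nn: "0 \<le> d k x" for k x by (simp add: d_def)
  have d_int: "integrable lebesgue (d k)" for k
    unfolding d_def by (intro integrable_mult_right L2_int L2_diff f)
  have d_bd: "(\<integral>x. d k x \<partial>lebesgue) \<le> (1/4)^k" for k
  proof -
    have "(\<integral>x. d k x \<partial>lebesgue) = 2^k * nsq (\<lambda>x. f (r k) x - f (r (Suc k)) x)"
      by (simp add: d_def nsq_def)
    also have "\<dots> \<le> 2^k * (1/8)^k" using N[OF rN rN', of k] by simp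
    also have "\<dots> = (1/4)^k" by (simp add: power_mult_distrib[symmetric])
    finally show ?thesis .
  qed
  have "AE x in lebesgue. summable (\<lambda>k. norm (d k x))"
  proof -
    have "(\<integral>\<^sup>+x. (\<Sum>k. ennreal (d k x)) \<partial>lebesgue) = (\<Sum>k. \<integral>\<^sup>+x. ennreal (d k x) \<partial>lebesgue)"
      by (rule nn_integral_suminf) measurable
    also have "\<dots> = (\<Sum>k. ennreal (\<integral>x. d k x \<partial>lebesgue))"
      using d_int d_nn by (simp add: nn_integral_eq_integral)
    also have "\<dots> \<le> (\<Sum>k. ennreal ((1/4)^k))"
      by (intro suminf_le ennreal_leI d_bd) auto
    also have "\<dots> = ennreal (\<Sum>k. (1/4)^k)"
      by (rule suminf_ennreal2) (auto intro: summable_geometric)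
    also have "\<dots> < \<infinity>" by simp
    finally have "(\<integral>\<^sup>+x. (\<Sum>k. ennreal (d k x)) \<partial>lebesgue) \<noteq> \<infinity>" by simp
    then have "AE x in lebesgue. (\<Sum>k. ennreal (d k x)) \<noteq> \<infinity>"
      by (intro nn_integral_PInf_AE) auto
    then show ?thesis
    proof eventually_elim
      case (elim x)
      then have "summable (\<lambda>k. d k x)" by (intro summable_suminf_not_top) (auto simp: d_nn)
      then show ?case by (simp add: d_nn)
    qed
  qed
  then have conv: "AE x in lebesgue. convergent (\<lambda>k. f (r k) x)"
  proof eventually_elim
    case (elim x)
    then have "(\<lambda>k. norm (d k x)) \<longlonglongrightarrow> 0" by (rule summable_LIMSEQ_zero)
    then have "Bseq (\<lambda>k. norm (d k x))" by (intro convergent_imp_Bseq convergentI)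
    then obtain C where C: "C > 0" "\<And>k. d k x \<le> C" unfolding Bseq_def by (auto simp: d_nn)
    define q where "q = sqrt (1/2)"
    have q: "0 < q" "q < 1" by (auto simp: q_def real_sqrt_divide)
    have "norm (f (r (Suc k)) x - f (r k) x) \<le> sqrt C * q^k" for k
    proof -
      have "(norm (f (r (Suc k)) x - f (r k) x))^2 \<le> C * (1/2)^k"
        using C(2)[of k] by (simp add: d_def field_simps norm_minus_commute)
      then have "sqrt ((norm (f (r (Suc k)) x - f (r k) x))^2) \<le> sqrt (C * (1/2)^k)" by (rule real_sqrt_le_mono)
      then show ?thesis by (simp add: real_sqrt_mult q_def real_sqrt_power)
    qed
    then have "summable (\<lambda>k. norm (f (r (Suc k)) x - f (r k) x))"
      using q by (auto intro!: summable_comparison_test'[where N=0 and g = "\<lambda>k. sqrt C * q^k"] summable_mult summable_geometric)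
    then have "summable (\<lambda>k. f (r (Suc k)) x - f (r k) x)" by (rule summable_norm_cancel)
    then have "convergent (\<lambda>n. \<Sum>k<n. f (r (Suc k)) x - f (r k) x)" by (simp add: summable_iff_convergent)
    then have "convergent (\<lambda>n. f (r n) x - f (r 0) x)" by (simp add: sum_lessThan_telescope[of "\<lambda>k. f (r k) x"])
    then show ?case by (simp add: convergent_diff_const_right_iff)
  qed
  define g where "g x = lim (\<lambda>k. f (r k) x)" for x
  have g_meas [measurable]: "g \<in> borel_measurable lebesgue"
    unfolding g_def by measurable
  have lim: "AE x in lebesgue. (\<lambda>k. f (r k) x) \<longlonglongrightarrow> g x"
    using conv by eventually_elim (simp add: g_def convergent_LIMSEQ_iff)
  \<comment> \<open>Fatou in the second index of the Cauchy condition yields membership of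
    \<open>g\<close> and convergence to \<open>g\<close> at once.\<close>
  have key: "integrable lebesgue (\<lambda>x. (norm (f m x - g x))^2) \<and> nsq (\<lambda>x. f m x - g x) \<le> e"
    if M: "\<forall>m\<ge>M. \<forall>n\<ge>M. nsq (\<lambda>x. f m x - f n x) < e" "m \<ge> M" for m M e
    unfolding nsq_def
  proof (rule fatou_bound[where f = "\<lambda>k x. (norm (f m x - f (r (k + M)) x))^2" and C = "\<lambda>_. e"])
    show "AE x in lebesgue. (\<lambda>k. (norm (f m x - f (r (k + M)) x))^2) \<longlonglongrightarrow> (norm (f m x - g x))^2"
      using lim by eventually_elim (intro tendsto_intros LIMSEQ_ignore_initial_segment)
    show "(\<integral>x. (norm (f m x - f (r (k + M)) x))^2 \<partial>lebesgue) \<le> e" for k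
    proof -
      have "r (k + M) \<ge> M" using strict_mono_imp_increasing[OF rmono, of "k + M"] by simp
      then show ?thesis using M by (auto simp: nsq_def less_imp_le)
    qed
  qed (auto intro!: L2_int L2_diff f)
  obtain M1 where M1: "\<forall>m\<ge>M1. \<forall>n\<ge>M1. nsq (\<lambda>x. f m x - f n x) < 1" using cauchy[of 1] by auto
  have "(\<lambda>x. f M1 x - g x) \<in> Lp 2" using key[OF M1, of M1] by (auto intro: L2_I)
  from L2_diff[OF f[of M1] this] have g: "g \<in> Lp 2" by simp
  moreover have "(\<lambda>n. nsq (\<lambda>x. f n x - g x)) \<longlonglongrightarrow> 0"
  proof (rule LIMSEQ_I)
    fix e :: real assume "e > 0"
    then obtain M where M: "\<forall>m\<ge>M. \<forall>n\<ge>M. nsq (\<lambda>x. f m x - f n x) < e/2" using cauchy[of "e/2"] by auto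
    have "\<forall>n\<ge>M. norm (nsq (\<lambda>x. f n x - g x) - 0) < e"
      using key[OF M] \<open>e > 0\<close> by (fastforce simp: field_simps)
    then show "\<exists>M. \<forall>n\<ge>M. norm (nsq (\<lambda>x. f n x - g x) - 0) < e" by blast
  qed
  ultimately show ?thesis by blast
qed

text \<open>The Riesz representation theorem without completeness: the representing vector is replaced by
  a minimizing sequence of the functional \<open>B u u - 2 l u\<close>.\<close>

lemma riesz_sequence:
  fixes S :: "('a \<Rightarrow> 'v::real_vector) set" and B :: "('a \<Rightarrow> 'v) \<Rightarrow> ('a \<Rightarrow> 'v) \<Rightarrow> real" and l :: "('a \<Rightarrow> 'v) \<Rightarrow> real"
  assumes S0: "S \<noteq> {}" and S: "\<And>u v a b. u \<in> S \<Longrightarrow> v \<in> S \<Longrightarrow> (\<lambda>x. a *\<^sub>R u x + b *\<^sub>R v x) \<in> S"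
    and Bl: "\<And>u v w a b. u \<in> S \<Longrightarrow> v \<in> S \<Longrightarrow> w \<in> S \<Longrightarrow> B (\<lambda>x. a *\<^sub>R u x + b *\<^sub>R v x) w = a * B u w + b * B v w"
    and Bs: "\<And>u v. u \<in> S \<Longrightarrow> v \<in> S \<Longrightarrow> B u v = B v u"
    and Bp: "\<And>u. u \<in> S \<Longrightarrow> 0 \<le> B u u"
    and ll: "\<And>u v a b. u \<in> S \<Longrightarrow> v \<in> S \<Longrightarrow> l (\<lambda>x. a *\<^sub>R u x + b *\<^sub>R v x) = a * l u + b * l v"
    and C: "0 \<le> C" and lb: "\<And>u. u \<in> S \<Longrightarrow> (l u)^2 \<le> C * B u u"
  obtains s where "\<And>n. s n \<in> S"
    "\<And>e. e > 0 \<Longrightarrow> \<exists>N. \<forall>m\<ge>N. \<forall>n\<ge>N. B (\<lambda>x. s m x - s n x) (\<lambda>x. s m x - s n x) < e"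
    "\<And>v. v \<in> S \<Longrightarrow> (\<lambda>n. B (s n) v) \<longlonglongrightarrow> l v"
proof -
  define J where "J u = B u u - 2 * l u" for u
  have B2: "B (\<lambda>x. a *\<^sub>R u x + b *\<^sub>R v x) (\<lambda>x. a *\<^sub>R u x + b *\<^sub>R v x) = a^2 * B u u + 2 * a * b * B u v + b^2 * B v v"
    if "u \<in> S" "v \<in> S" for u v a b
  proof -
    let ?w = "\<lambda>x. a *\<^sub>R u x + b *\<^sub>R v x"
    have w: "?w \<in> S" using S that by blast
    have "B ?w ?w = a * B u ?w + b * B v ?w" using Bl that w by blast
    also have "B u ?w = a * B u u + b * B v u" using Bl[OF that that(1)] Bs[OF that(1) w] by simp
    also have "B v ?w = a * B u v + b * B v v" using Bl[OF that that(2)] Bs[OF that(2) w] by simp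
    finally show ?thesis using Bs[OF that] by (simp add: power2_eq_square algebra_simps)
  qed
  \<comment> \<open>By the arithmetic-geometric mean inequality, \<open>2 * l u\<close> is at most
    \<open>C + B u u\<close>.\<close>
  have Jlow: "- C \<le> J u" if "u \<in> S" for u
  proof -
    have "0 \<le> B u u" using Bp that by blast
    have "(2 * l u)^2 \<le> 4 * (C * B u u)" using lb[OF that] by simp
    also have "\<dots> \<le> (C + B u u)^2"
      using zero_le_power2[of "C - B u u"] by (simp add: power2_eq_square algebra_simps)
    finally have "2 * l u \<le> C + B u u" by (rule power2_le_imp_le) (use C \<open>0 \<le> B u u\<close> in auto)
    then show ?thesis by (simp add: J_def)
  qed
  define d where "d = (INF u\<in>S. J u)"
  have bdd: "bdd_below (J ` S)" using Jlow by (intro bdd_belowI[of _ "-C"]) auto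
  have d_le: "d \<le> J u" if "u \<in> S" for u unfolding d_def using bdd that by (rule cINF_lower)
  have "\<exists>u\<in>S. J u < d + 1 / real (Suc n)" for n
    using cINF_less_iff[OF S0 bdd, of "d + 1 / real (Suc n)"] by (auto simp: d_def)
  then obtain s where s: "\<And>n. s n \<in> S" "\<And>n. J (s n) < d + 1 / real (Suc n)" by metis
  show ?thesis
  proof
    show "s n \<in> S" for n by (rule s)
    fix e :: real assume "e > 0"
    then obtain N where N: "N \<noteq> 0" "1 / real N < e / 4"
      by (metis real_arch_inverse inverse_eq_divide divide_pos_pos zero_less_numeral)
    have "B (\<lambda>x. s m x - s n x) (\<lambda>x. s m x - s n x) < e" if "m \<ge> N" "n \<ge> N" for m n
    proof -
      have "B (\<lambda>x. s m x - s n x) (\<lambda>x. s m x - s n x) = B (s m) (s m) - 2 * B (s m) (s n) + B (s n) (s n)"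
        using B2[OF s(1) s(1), of 1 m "-1" n] by simp
      \<comment> \<open>Parallelogram identity: \<open>B\<close> of the difference equals twice
        \<open>J (s m)\<close> plus twice \<open>J (s n)\<close> minus four times \<open>J\<close>
        of the midpoint. The midpoint has \<open>J\<close> at least \<open>d\<close>, so an excess
        below \<open>e / 4\<close> for both functions gives less than \<open>e\<close>.\<close>
      moreover have "J (\<lambda>x. (1/2) *\<^sub>R s m x + (1/2) *\<^sub>R s n x) =
        (1/4) * B (s m) (s m) + (1/2) * B (s m) (s n) + (1/4) * B (s n) (s n) - l (s m) - l (s n)"
        by (simp add: J_def B2[OF s(1) s(1)] ll[OF s(1) s(1)] power2_eq_square)
      moreover have "d \<le> J (\<lambda>x. (1/2) *\<^sub>R s m x + (1/2) *\<^sub>R s n x)" by (intro d_le S s)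
      moreover have "J (s m) < d + e / 4" "J (s n) < d + e / 4"
      proof -
        have "1 / real (Suc k) \<le> 1 / real N" if "k \<ge> N" for k
          using that N(1) by (intro divide_left_mono) auto
        then show "J (s m) < d + e / 4" "J (s n) < d + e / 4"
          using s(2)[of m] s(2)[of n] N(2) that by (smt (verit))+
      qed
      ultimately show ?thesis unfolding J_def by argo
    qed
    then show "\<exists>N. \<forall>m\<ge>N. \<forall>n\<ge>N. B (\<lambda>x. s m x - s n x) (\<lambda>x. s m x - s n x) < e" by blast
  next
    fix v assume v: "v \<in> S"
    \<comment> \<open>Moving from \<open>s n\<close> in the direction \<open>v\<close> cannot lower
      \<open>J\<close> by more than \<open>1 / real (Suc n)\<close>; the resulting quadratic
      polynomial in the step size is nonnegative, and its discriminant bounds the residual of the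
      Euler-Lagrange equation.\<close>
    have sq: "(B (s n) v - l v)^2 \<le> B v v * (1 / real (Suc n))" for n
    proof (rule discriminant_le)
      fix t
      have "J (\<lambda>x. 1 *\<^sub>R s n x + t *\<^sub>R v x) = J (s n) + 2 * t * (B (s n) v - l v) + t^2 * B v v"
        by (simp only: J_def B2[OF s(1) v] ll[OF s(1) v]) (simp add: algebra_simps)
      moreover have "d \<le> J (\<lambda>x. 1 *\<^sub>R s n x + t *\<^sub>R v x)" by (intro d_le S s v)
      ultimately show "0 \<le> B v v * t^2 + 2 * (B (s n) v - l v) * t + 1 / real (Suc n)"
        using s(2)[of n] by (simp add: algebra_simps)
    qed (use Bp v in auto)
    have "(\<lambda>n. (B (s n) v - l v)^2) \<longlonglongrightarrow> 0"
    proof (rule Lim_null_comparison)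
      show "\<forall>\<^sub>F n in sequentially. norm ((B (s n) v - l v)^2) \<le> B v v * (1 / real (Suc n))"
        using sq by auto
      show "(\<lambda>n. B v v * (1 / real (Suc n))) \<longlonglongrightarrow> 0"
        using tendsto_mult_right_zero[OF LIMSEQ_inverse_real_of_nat] by (simp add: inverse_eq_divide)
    qed
    then have "(\<lambda>n. B (s n) v - l v) \<longlonglongrightarrow> 0" by simp
    then show "(\<lambda>n. B (s n) v) \<longlonglongrightarrow> l v" by (simp add: LIM_zero_iff)
  qed
qed

section \<open>Smooth functions and test functions\<close>

text \<open>One-dimensional counterpart of \<open>C_k\<close>, with the derivative quantified
  existentially so that each closure proof can exhibit its own. It serves to build a smooth step
  function, which \<open>C_k_D_k\<close> carries over to the plane.\<close>

primrec D_k :: "nat \<Rightarrow> (real \<Rightarrow> real) \<Rightarrow> bool" where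
  "D_k 0 f \<longleftrightarrow> continuous_on UNIV f"
| "D_k (Suc k) f \<longleftrightarrow> (\<exists>f'. (\<forall>x. (f has_real_derivative f' x) (at x)) \<and> D_k k f')"

lemma D_k_Suc_imp: "D_k (Suc k) f \<Longrightarrow> D_k k f"
proof (induction k arbitrary: f)
  case 0
  then show ?case by (auto intro!: continuous_at_imp_continuous_on intro: DERIV_isCont)
next
  case (Suc k)
  then show ?case by (metis D_k.simps(2))
qed

lemma D_k_const: "D_k k (\<lambda>x. c)"
proof (induction k arbitrary: c)
  case (Suc k)
  then show ?case by (auto intro!: exI[of _ "\<lambda>x. 0"])
qed simp

lemma D_k_ident: "D_k k (\<lambda>x. x)"
  by (cases k) (auto intro!: exI[of _ "\<lambda>x. 1"] D_k_const)

lemma D_k_add: "D_k k f \<Longrightarrow> D_k k g \<Longrightarrow> D_k k (\<lambda>x. f x + g x)"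
proof (induction k arbitrary: f g)
  case 0 then show ?case by (simp add: continuous_on_add)
next
  case (Suc k)
  then obtain f' g' where "\<forall>x. (f has_real_derivative f' x) (at x)" "D_k k f'"
      "\<forall>x. (g has_real_derivative g' x) (at x)" "D_k k g'" by auto
  then show ?case using Suc.IH[of f' g']
    by (auto intro!: exI[of _ "\<lambda>x. f' x + g' x"] derivative_eq_intros)
qed

lemma D_k_mult: "D_k k f \<Longrightarrow> D_k k g \<Longrightarrow> D_k k (\<lambda>x. f x * g x)"
proof (induction k arbitrary: f g)
  case 0 then show ?case by (simp add: continuous_on_mult)
next
  case (Suc k)
  then obtain f' g' where d: "\<forall>x. (f has_real_derivative f' x) (at x)" "D_k k f'"
      "\<forall>x. (g has_real_derivative g' x) (at x)" "D_k k g'" by auto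
  have "D_k k (\<lambda>x. f' x * g x + g' x * f x)"
    using Suc.IH[OF d(2) D_k_Suc_imp[OF Suc.prems(2)]] Suc.IH[OF d(4) D_k_Suc_imp[OF Suc.prems(1)]]
    by (rule D_k_add)
  then show ?case using d(1,3)
    by (auto intro!: exI[of _ "\<lambda>x. f' x * g x + g' x * f x"] DERIV_mult)
qed

lemma D_k_inverse: "D_k k f \<Longrightarrow> (\<And>x. f x \<noteq> 0) \<Longrightarrow> D_k k (\<lambda>x. inverse (f x))"
proof (induction k arbitrary: f)
  case 0 then show ?case by (simp add: continuous_on_inverse)
next
  case (Suc k)
  then obtain f' where d: "\<forall>x. (f has_real_derivative f' x) (at x)" "D_k k f'" by auto
  have i: "D_k k (\<lambda>x. inverse (f x))" by (rule Suc.IH[OF D_k_Suc_imp[OF Suc.prems(1)] Suc.prems(2)])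
  have "D_k k (\<lambda>x. (-1) * (f' x * (inverse (f x) * inverse (f x))))"
    by (intro D_k_mult D_k_const i d)
  moreover have "((\<lambda>x. inverse (f x)) has_real_derivative (-1) * (f' x * (inverse (f x) * inverse (f x)))) (at x)" for x
    using DERIV_inverse'[of f "f' x" x] d(1) Suc.prems(2) by (simp add: mult_ac)
  ultimately show ?case unfolding D_k.simps
    by (intro exI[of _ "\<lambda>x. (-1) * (f' x * (inverse (f x) * inverse (f x)))"]) blast
qed

lemma D_k_comp: "D_k k f \<Longrightarrow> D_k k g \<Longrightarrow> D_k k (\<lambda>x. f (g x))"
proof (induction k arbitrary: f g)
  case 0 then show ?case by (auto intro: continuous_on_compose2)
next
  case (Suc k)
  then obtain f' g' where d: "\<forall>x. (f has_real_derivative f' x) (at x)" "D_k k f'"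
      "\<forall>x. (g has_real_derivative g' x) (at x)" "D_k k g'" by auto
  have "D_k k (\<lambda>x. f' (g x) * g' x)"
    by (rule D_k_mult[OF Suc.IH[OF d(2) D_k_Suc_imp[OF Suc.prems(2)]] d(4)])
  then show ?case using d(1,3) unfolding D_k.simps
    by (intro exI[of _ "\<lambda>x. f' (g x) * g' x"] conjI allI DERIV_chain2[of f]) blast+
qed

text \<open>The classical flat function \<open>exp (- 1 / t)\<close>, with a polynomial factor in
  \<open>1 / t\<close> as parameter: the enlarged family is closed under differentiation, so
  smoothness follows by induction.\<close>

definition exp_recip :: "real poly \<Rightarrow> real \<Rightarrow> real" where
  "exp_recip p t = (if 0 < t then poly p (1 / t) * exp (- (1 / t)) else 0)"

lemma poly_exp_tendsto_0: "((\<lambda>s::real. poly p s * exp (- s)) \<longlongrightarrow> 0) at_top"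
proof -
  have "((\<lambda>s. \<Sum>i\<le>degree p. coeff p i * (s ^ i / exp s)) \<longlongrightarrow> (\<Sum>i\<le>degree p. coeff p i * 0)) at_top"
    by (intro tendsto_intros tendsto_power_div_exp_0)
  then show ?thesis
    by (simp add: poly_altdef exp_minus field_simps sum_distrib_left sum_distrib_right)
qed

lemma exp_recip_tendsto_0: "((\<lambda>t. poly p (1 / t) * exp (- (1 / t))) \<longlongrightarrow> 0) (at_right (0::real))"
  using filterlim_compose[OF poly_exp_tendsto_0[of p] filterlim_inverse_at_top_right]
  by (simp add: inverse_eq_divide)

text \<open>In the variable \<open>s = 1 / t\<close>, differentiation replaces the polynomial
  \<open>p\<close> by \<open>s^2 * (p - p')\<close>; the two applications of \<open>pCons 0\<close>
  are the factor \<open>s^2\<close>.\<close>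

lemma exp_recip_deriv:
  "(exp_recip p has_real_derivative exp_recip (pCons 0 (pCons 0 (p - pderiv p))) t) (at t)"
proof -
  consider "t > 0" | "t < 0" | "t = 0" by linarith
  then show ?thesis
  proof cases
    case 1
    have "((\<lambda>t. poly p (1 / t) * exp (- (1 / t))) has_real_derivative
        exp_recip (pCons 0 (pCons 0 (p - pderiv p))) t) (at t)"
      using 1 by (auto intro!: derivative_eq_intros poly_DERIV[THEN DERIV_chain2] simp: exp_recip_def)
        (simp add: field_simps power2_eq_square)
    moreover have "\<forall>\<^sub>F s in nhds t. exp_recip p s = poly p (1 / s) * exp (- (1 / s))"
      using eventually_nhds_in_open[OF open_greaterThan[of 0], of t] 1
      by (auto simp: exp_recip_def elim!: eventually_mono)
    ultimately show ?thesis by (subst DERIV_cong_ev[OF refl _ refl])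
  next
    case 2
    have "((\<lambda>t. 0) has_real_derivative exp_recip (pCons 0 (pCons 0 (p - pderiv p))) t) (at t)"
      using 2 by (simp add: exp_recip_def)
    moreover have "\<forall>\<^sub>F s in nhds t. exp_recip p s = 0"
      using eventually_nhds_in_open[OF open_lessThan[of 0], of t] 2
      by (auto simp: exp_recip_def elim!: eventually_mono)
    ultimately show ?thesis by (subst DERIV_cong_ev[OF refl _ refl])
  next
    case 3
    have "((\<lambda>h. exp_recip p h / h) \<longlongrightarrow> 0) (at 0)"
      proof (rule filterlim_split_at)
      show "((\<lambda>h. exp_recip p h / h) \<longlongrightarrow> 0) (at_left 0)"
        by (rule tendsto_eventually) (auto simp: eventually_at_filter exp_recip_def)
      \<comment> \<open>Division by \<open>h\<close> only raises the degree of the polynomial, so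
        the difference quotient at 0 is again of a kind that tends to 0.\<close>
      have "((\<lambda>t. poly (pCons 0 p) (1 / t) * exp (- (1 / t))) \<longlongrightarrow> 0) (at_right (0::real))"
        by (rule exp_recip_tendsto_0)
      then show "((\<lambda>h. exp_recip p h / h) \<longlongrightarrow> 0) (at_right 0)"
        by (rule Lim_transform_eventually) (auto simp: eventually_at_filter exp_recip_def)
    qed
    then show ?thesis using 3 by (simp add: DERIV_def exp_recip_def)
  qed
qed

lemma D_k_exp_recip: "D_k k (exp_recip p)"
proof (induction k arbitrary: p)
  case 0
  then show ?case by (auto intro!: continuous_at_imp_continuous_on DERIV_isCont exp_recip_deriv)
next
  case (Suc k)
  then show ?case unfolding D_k.simps using exp_recip_deriv by blast
qed

definition smooth_step :: "real \<Rightarrow> real" where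
  "smooth_step t = exp_recip 1 t * inverse (exp_recip 1 t + exp_recip 1 (1 - t))"

lemma exp_recip_1: "exp_recip 1 t = (if 0 < t then exp (- (1 / t)) else 0)"
  by (simp add: exp_recip_def)

lemma exp_recip_sum_pos: "0 < exp_recip 1 t + exp_recip 1 (1 - t)"
  by (auto simp: exp_recip_1 add_pos_pos)

lemma D_k_smooth_step: "D_k k smooth_step"
proof -
  have "D_k k (\<lambda>t. 1 + (-1) * t)" by (intro D_k_add D_k_mult D_k_const D_k_ident)
  then have "D_k k (\<lambda>t. exp_recip 1 (1 - t))"
    using D_k_comp[OF D_k_exp_recip[of k 1], of "\<lambda>t. 1 + (-1) * t"] by simp
  then have "D_k k (\<lambda>t. exp_recip 1 t * inverse (exp_recip 1 t + exp_recip 1 (1 - t)))"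
    by (intro D_k_mult D_k_inverse D_k_add D_k_exp_recip less_imp_neq[THEN not_sym] exp_recip_sum_pos)
  then show ?thesis by (simp add: smooth_step_def[abs_def])
qed

lemma smooth_step_simps: "t \<le> 0 \<Longrightarrow> smooth_step t = 0" "1 \<le> t \<Longrightarrow> smooth_step t = 1"
  by (auto simp: smooth_step_def exp_recip_1)

lemma smooth_step_range: "0 \<le> smooth_step t" "smooth_step t \<le> 1"
  using exp_recip_sum_pos[of t] by (auto simp: smooth_step_def exp_recip_1 field_simps)

section \<open>Calculus of \<open>C_k\<close> functions on the plane\<close>

lemma C_kI:
  assumes "\<And>x. (f has_derivative f' x) (at x)" "\<And>v. C_k k (\<lambda>x. f' x v)"
  shows "C_k (Suc k) f"
proof -
  have "frechet_derivative f (at x) = f' x" for x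
    using frechet_derivative_at[OF assms(1)] by simp
  then show ?thesis using assms by (auto simp: differentiable_on_def differentiable_def intro: has_derivative_at_withinI)
qed

lemma C_k_has_derivative:
  "C_k (Suc k) f \<Longrightarrow> (f has_derivative frechet_derivative f (at x)) (at x)"
  by (simp add: differentiable_on_def frechet_derivative_works[symmetric])

lemma C_k_Suc_imp: "C_k (Suc k) f \<Longrightarrow> C_k k f"
proof (induction k arbitrary: f)
  case 0
  then show ?case by (auto intro!: continuous_at_imp_continuous_on differentiable_imp_continuous_within
      simp: differentiable_on_def)
next
  case (Suc k)
  then show ?case by (metis C_k.simps(2))
qed

lemma C_k_const: "C_k k (\<lambda>x. c)"
proof (induction k arbitrary: c)
  case (Suc k)
  show ?case by (rule C_kI[where f' = "\<lambda>x v. 0"]) (use Suc in auto)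
qed simp

lemma C_k_add: "C_k k f \<Longrightarrow> C_k k g \<Longrightarrow> C_k k (\<lambda>x. f x + g x)"
proof (induction k arbitrary: f g)
  case 0 then show ?case by (simp add: continuous_on_add)
next
  case (Suc k)
  show ?case
    by (rule C_kI[where f' = "\<lambda>x v. frechet_derivative f (at x) v + frechet_derivative g (at x) v"])
      (use Suc in \<open>auto intro!: has_derivative_add C_k_has_derivative Suc.IH simp del: C_k.simps\<close>, simp_all)
qed

lemma C_k_mult: "C_k k f \<Longrightarrow> C_k k g \<Longrightarrow> C_k k (\<lambda>x. f x * g x)"
proof (induction k arbitrary: f g)
  case 0 then show ?case by (simp add: continuous_on_mult)
next
  case (Suc k)
  have c: "C_k k f" "C_k k g" using Suc.prems C_k_Suc_imp by blast+
  have d: "C_k k (\<lambda>x. frechet_derivative f (at x) v)" "C_k k (\<lambda>x. frechet_derivative g (at x) v)" for v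
    using Suc.prems by auto
  show ?case
    by (rule C_kI[where f' = "\<lambda>x v. f x * frechet_derivative g (at x) v + frechet_derivative f (at x) v * g x"])
      (intro has_derivative_mult C_k_has_derivative[OF Suc.prems(1)] C_k_has_derivative[OF Suc.prems(2)],
       intro C_k_add Suc.IH c d)
qed

lemma C_k_D_k: "D_k k f \<Longrightarrow> C_k k g \<Longrightarrow> C_k k (\<lambda>x. f (g x))"
proof (induction k arbitrary: f g)
  case 0 then show ?case by (auto intro: continuous_on_compose2)
next
  case (Suc k)
  then obtain f' where d: "\<forall>x. (f has_real_derivative f' x) (at x)" "D_k k f'" by auto
  have c: "C_k k g" using Suc.prems C_k_Suc_imp by blast
  have e: "C_k k (\<lambda>x. frechet_derivative g (at x) v)" for v using Suc.prems by auto
  have h: "((\<lambda>x. f (g x)) has_derivative (\<lambda>v. f' (g x) * frechet_derivative g (at x) v)) (at x)" for x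
    using has_derivative_compose[OF C_k_has_derivative[OF Suc.prems(2)], of f "times (f' (g x))"] d(1)
    by (simp add: has_field_derivative_def)
  show ?case by (rule C_kI[OF h]) (rule C_k_mult[OF Suc.IH[OF d(2) c] e])
qed

lemma C_k_inner: "C_k k (\<lambda>x. x \<bullet> a)"
proof (cases k)
  case 0
  then show ?thesis by (simp add: continuous_on_inner)
next
  case (Suc n)
  show ?thesis unfolding Suc
    by (rule C_kI[where f' = "\<lambda>x v. v \<bullet> a"]) (auto intro!: derivative_eq_intros C_k_const)
qed

lemma C_k_norm_sq: "C_k k (\<lambda>x. x \<bullet> x)"
proof (cases k)
  case 0
  then show ?thesis by (simp add: continuous_on_inner)
next
  case (Suc n)
  show ?thesis unfolding Suc
  proof (rule C_kI[where f' = "\<lambda>x v. 2 * (x \<bullet> v)"])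
    show "((\<lambda>x. x \<bullet> x) has_derivative (\<lambda>v. 2 * (x \<bullet> v))) (at x)" for x :: plane
      by (auto intro!: derivative_eq_intros simp: inner_commute)
    show "C_k n (\<lambda>x. 2 * (x \<bullet> v))" for v by (intro C_k_mult C_k_const C_k_inner)
  qed
qed

lemma C_k_affine: "C_k k f \<Longrightarrow> C_k k (\<lambda>x. f (c *\<^sub>R x + a))"
proof (induction k arbitrary: f)
  case 0
  then have "continuous_on UNIV f" by simp
  then have "continuous_on UNIV (\<lambda>x. f (c *\<^sub>R x + a))"
    by (rule continuous_on_compose2) (auto intro!: continuous_intros)
  then show ?case by simp
next
  case (Suc k)
  have e: "C_k k (\<lambda>x. frechet_derivative f (at x) v)" for v using Suc.prems by auto
  have h: "((\<lambda>x. f (c *\<^sub>R x + a)) has_derivative (\<lambda>v. frechet_derivative f (at (c *\<^sub>R x + a)) (c *\<^sub>R v))) (at x)" for x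
    by (rule has_derivative_compose[OF _ C_k_has_derivative[OF Suc.prems]]) (auto intro!: derivative_eq_intros)
  show ?case by (rule C_kI[OF h]) (rule Suc.IH[OF e])
qed

definition smooth :: "(plane \<Rightarrow> real) \<Rightarrow> bool" where "smooth f \<longleftrightarrow> (\<forall>k. C_k k f)"

definition pd :: "2 \<Rightarrow> (plane \<Rightarrow> real) \<Rightarrow> plane \<Rightarrow> real" where
  "pd i f x = frechet_derivative f (at x) (axis i 1)"

lemma smooth_const: "smooth (\<lambda>x. c)"
  and smooth_add: "smooth f \<Longrightarrow> smooth g \<Longrightarrow> smooth (\<lambda>x. f x + g x)"
  and smooth_mult: "smooth f \<Longrightarrow> smooth g \<Longrightarrow> smooth (\<lambda>x. f x * g x)"
  and smooth_affine: "smooth f \<Longrightarrow> smooth (\<lambda>x. f (c *\<^sub>R x + a))"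
  and smooth_norm_sq: "smooth (\<lambda>x. x \<bullet> x)"
  and smooth_D_k: "(\<And>k. D_k k h) \<Longrightarrow> smooth f \<Longrightarrow> smooth (\<lambda>x. h (f x))"
  by (simp_all add: smooth_def C_k_const C_k_add C_k_mult C_k_affine C_k_norm_sq C_k_D_k)

lemma smooth_uminus: "smooth f \<Longrightarrow> smooth (\<lambda>x. - f x)"
  using smooth_mult[OF smooth_const[of "-1"], of f] by simp

lemma smooth_diff: "smooth f \<Longrightarrow> smooth g \<Longrightarrow> smooth (\<lambda>x. f x - g x)"
  using smooth_add[OF _ smooth_uminus, of f g] by simp

lemma smooth_prod: "(\<And>i. i \<in> I \<Longrightarrow> smooth (f i)) \<Longrightarrow> smooth (\<lambda>x. \<Prod>i\<in>I. f i x)"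
  by (induction I rule: infinite_finite_induct) (auto intro: smooth_const smooth_mult)

lemma smooth_has_derivative: "smooth f \<Longrightarrow> (f has_derivative frechet_derivative f (at x)) (at x)"
  using C_k_has_derivative unfolding smooth_def by blast

lemma smooth_continuous: "smooth f \<Longrightarrow> continuous_on UNIV f"
  unfolding smooth_def by (metis C_k.simps(1))

lemma smooth_pd: "smooth f \<Longrightarrow> smooth (pd i f)"
  unfolding smooth_def pd_def[abs_def] by (metis C_k.simps(2))

lemma pd_eqI: "(f has_derivative f') (at x) \<Longrightarrow> pd i f x = f' (axis i 1)"
  unfolding pd_def using frechet_derivative_at[of f f' x] by simp

lemma pd_mult: "smooth f \<Longrightarrow> smooth g \<Longrightarrow> pd i (\<lambda>x. f x * g x) x = f x * pd i g x + pd i f x * g x"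
  by (subst pd_eqI[OF has_derivative_mult[OF smooth_has_derivative smooth_has_derivative]]) (simp_all add: pd_def)

lemma pd_affine:
  assumes "smooth f" shows "pd i (\<lambda>x. f (c *\<^sub>R x + a)) x = c * pd i f (c *\<^sub>R x + a)"
proof -
  have "((\<lambda>x. f (c *\<^sub>R x + a)) has_derivative (\<lambda>v. frechet_derivative f (at (c *\<^sub>R x + a)) (c *\<^sub>R v))) (at x)"
    by (rule has_derivative_compose[OF _ smooth_has_derivative[OF assms]]) (auto intro!: derivative_eq_intros)
  then have "pd i (\<lambda>x. f (c *\<^sub>R x + a)) x = frechet_derivative f (at (c *\<^sub>R x + a)) (c *\<^sub>R axis i 1)"
    by (rule pd_eqI)
  then show ?thesis
    using linear_cmul[OF has_derivative_linear[OF smooth_has_derivative[OF assms]]] by (simp add: pd_def)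
qed

section \<open>Test functions and cut-offs\<close>

lemma test_smooth: "\<phi> \<in> test_functions \<Longrightarrow> smooth \<phi>"
  by (simp add: test_functions_def smooth_def)

lemma test_bounded_support:
  assumes "\<phi> \<in> test_functions"
  shows "\<exists>R>0. \<forall>x. R \<le> norm x \<longrightarrow> \<phi> x = 0 \<and> (\<forall>i. pd i \<phi> x = 0)"
proof -
  have "bounded (closure {x. \<phi> x \<noteq> 0})" using assms by (auto simp: test_functions_def compact_imp_bounded)
  then obtain R where R: "R > 0" "\<And>x. x \<in> closure {x. \<phi> x \<noteq> 0} \<Longrightarrow> norm x \<le> R"
    using bounded_pos by blast
  have z: "\<phi> x = 0" if "norm x > R" for x
  proof (rule ccontr)
    assume "\<phi> x \<noteq> 0"
    then have "x \<in> closure {x. \<phi> x \<noteq> 0}" by (intro subsetD[OF closure_subset]) simp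
    with R(2) that show False by fastforce
  qed
  have "pd i \<phi> x = 0" if "norm x > R" for x i
  proof -
    have "(\<phi> has_derivative (\<lambda>v. 0)) (at x)"
      by (rule has_derivative_transform_within_open[of "\<lambda>x. 0" _ _ _ "{x. norm x > R}"])
        (use that z in \<open>auto intro!: open_Collect_less continuous_intros\<close>)
    then show ?thesis by (simp add: pd_eqI)
  qed
  then show ?thesis using z R(1) by (intro exI[of _ "R + 1"]) auto
qed

lemma test_I:
  assumes "smooth \<phi>" "\<And>x. norm x > R \<Longrightarrow> \<phi> x = 0"
  shows "\<phi> \<in> test_functions"
proof -
  have "bounded {x. \<phi> x \<noteq> 0}"
    using assms(2) by (intro boundedI[of _ R]) (auto simp: not_less[symmetric])
  then show ?thesis using assms(1) by (auto simp: test_functions_def smooth_def compact_closure)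
qed

lemma test_continuous: "\<phi> \<in> test_functions \<Longrightarrow> continuous_on UNIV \<phi>"
  by (simp add: smooth_continuous test_smooth)

lemma test_pd:
  assumes "\<phi> \<in> test_functions" shows "pd i \<phi> \<in> test_functions"
proof -
  obtain R where "R > 0" "\<forall>x. R \<le> norm x \<longrightarrow> \<phi> x = 0 \<and> (\<forall>i. pd i \<phi> x = 0)"
    using test_bounded_support[OF assms] by blast
  then show ?thesis using assms by (auto intro!: test_I[of _ R] smooth_pd intro: test_smooth)
qed

lemma test_bounded:
  assumes "\<phi> \<in> test_functions" obtains C where "C > 0" "\<And>x. \<bar>\<phi> x\<bar> \<le> C"
proof -
  obtain R where R: "R > 0" "\<forall>x. R \<le> norm x \<longrightarrow> \<phi> x = 0 \<and> (\<forall>i. pd i \<phi> x = 0)"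
    using test_bounded_support[OF assms] by blast
  have "compact (\<phi> ` cball 0 R)"
    by (intro compact_continuous_image continuous_on_subset[OF test_continuous[OF assms]]) auto
  then obtain C where C: "C > 0" "\<And>x. x \<in> cball 0 R \<Longrightarrow> \<bar>\<phi> x\<bar> \<le> C"
    using compact_imp_bounded[of "\<phi> ` cball 0 R"] by (auto simp: bounded_pos)
  have "\<bar>\<phi> x\<bar> \<le> C" for x using C R(2) by (cases "norm x \<le> R") auto
  with C(1) that show ?thesis by blast
qed

lemma test_mult_smooth:
  assumes "\<phi> \<in> test_functions" "smooth f" shows "(\<lambda>x. \<phi> x * f x) \<in> test_functions"
proof -
  obtain R where "R > 0" "\<forall>x. R \<le> norm x \<longrightarrow> \<phi> x = 0 \<and> (\<forall>i. pd i \<phi> x = 0)"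
    using test_bounded_support[OF assms(1)] by blast
  then show ?thesis using assms by (auto intro!: test_I[of _ R] smooth_mult intro: test_smooth)
qed

lemma test_affine:
  assumes "\<phi> \<in> test_functions" "c \<noteq> 0" shows "(\<lambda>x. \<phi> (c *\<^sub>R x + a)) \<in> test_functions"
proof -
  obtain R where R: "R > 0" "\<forall>x. R \<le> norm x \<longrightarrow> \<phi> x = 0 \<and> (\<forall>i. pd i \<phi> x = 0)"
    using test_bounded_support[OF assms(1)] by blast
  show ?thesis
  proof (rule test_I[of _ "(R + norm a) / \<bar>c\<bar>"])
    fix x :: plane assume "(R + norm a) / \<bar>c\<bar> < norm x"
    then have "R + norm a < norm (c *\<^sub>R x)" using assms(2) by (simp add: field_simps)
    also have "\<dots> \<le> norm (c *\<^sub>R x + a) + norm a" using norm_triangle_ineq4[of "c *\<^sub>R x + a" a] by simp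
    finally show "\<phi> (c *\<^sub>R x + a) = 0" using R(2) by simp
  qed (intro smooth_affine test_smooth assms)
qed

lemma test_add:
  assumes "\<phi> \<in> test_functions" "\<psi> \<in> test_functions" shows "(\<lambda>x. \<phi> x + \<psi> x) \<in> test_functions"
proof -
  obtain R where "R > 0" "\<forall>x. R \<le> norm x \<longrightarrow> \<phi> x = 0 \<and> (\<forall>i. pd i \<phi> x = 0)"
    using test_bounded_support[OF assms(1)] by blast
  moreover obtain S where "S > 0" "\<forall>x. S \<le> norm x \<longrightarrow> \<psi> x = 0 \<and> (\<forall>i. pd i \<psi> x = 0)"
    using test_bounded_support[OF assms(2)] by blast
  ultimately show ?thesis using assms by (auto intro!: test_I[of _ "max R S"] smooth_add intro: test_smooth)
qed

lemma test_scale: "\<phi> \<in> test_functions \<Longrightarrow> (\<lambda>x. c * \<phi> x) \<in> test_functions"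
  using test_mult_smooth[OF _ smooth_const[of c]] by (simp add: mult.commute)

text \<open>The squared distance keeps the argument of the step a polynomial, hence smooth at the
  centre as well. The transition takes place between the radii \<open>r\<close> and
  \<open>sqrt 2 * r\<close>; the lemmas below use the rounder radius \<open>2 * r\<close>.\<close>

definition cutoff :: "real \<Rightarrow> plane \<Rightarrow> plane \<Rightarrow> real" where
  "cutoff r a x = smooth_step (2 - ((1 / r) *\<^sub>R (x - a)) \<bullet> ((1 / r) *\<^sub>R (x - a)))"

lemma smooth_cutoff: "smooth (cutoff r a)"
proof -
  have "smooth (\<lambda>x. ((1 / r) *\<^sub>R x + (- (1 / r)) *\<^sub>R a) \<bullet> ((1 / r) *\<^sub>R x + (- (1 / r)) *\<^sub>R a))"
    by (rule smooth_affine[OF smooth_norm_sq])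
  then have "smooth (\<lambda>x. smooth_step (2 - ((1 / r) *\<^sub>R x + (- (1 / r)) *\<^sub>R a) \<bullet> ((1 / r) *\<^sub>R x + (- (1 / r)) *\<^sub>R a)))"
    by (intro smooth_D_k[OF D_k_smooth_step] smooth_diff smooth_const)
  then show ?thesis by (simp add: cutoff_def[abs_def] scaleR_diff_right)
qed

lemma cutoff_range: "0 \<le> cutoff r a x" "cutoff r a x \<le> 1"
  by (simp_all add: cutoff_def smooth_step_range)

lemma cutoff_arg: "r > 0 \<Longrightarrow> ((1 / r) *\<^sub>R (x - a)) \<bullet> ((1 / r) *\<^sub>R (x - a)) = (norm (x - a) / r)^2"
  by (simp add: power2_norm_eq_inner[symmetric] power_divide power2_eq_square)

lemma cutoff_1: "r > 0 \<Longrightarrow> norm (x - a) \<le> r \<Longrightarrow> cutoff r a x = 1"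
  unfolding cutoff_def by (subst cutoff_arg) (auto intro!: smooth_step_simps power_le_one)

lemma cutoff_0:
  assumes "r > 0" "norm (x - a) \<ge> 2 * r" shows "cutoff r a x = 0"
proof -
  have "2 \<le> norm (x - a) / r" using assms by (simp add: field_simps)
  then have "2^2 \<le> (norm (x - a) / r)^2" by (intro power_mono) auto
  then show ?thesis unfolding cutoff_def using assms by (subst cutoff_arg) (auto intro!: smooth_step_simps)
qed

lemma test_cutoff: assumes "r > 0" shows "cutoff r a \<in> test_functions"
proof (rule test_I[of _ "2 * r + norm a"])
  fix x :: plane assume "2 * r + norm a < norm x"
  then have "2 * r \<le> norm (x - a)" using norm_triangle_ineq2[of x a] by simp
  then show "cutoff r a x = 0" using cutoff_0 assms by blast
qed (rule smooth_cutoff)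

text \<open>Supplies the indicator of a compact set as a bounded limit of test functions with common
  support, so that dominated convergence can carry information from test functions to sets.\<close>

lemma test_approx_compact:
  assumes K: "compact K"
  obtains \<phi> :: "nat \<Rightarrow> plane \<Rightarrow> real" and R where "\<And>n. \<phi> n \<in> test_functions" "\<And>n x. 0 \<le> \<phi> n x" "\<And>n x. \<phi> n x \<le> 1"
    "\<And>n x. norm x > R \<Longrightarrow> \<phi> n x = 0" "\<And>x. (\<lambda>n. \<phi> n x) \<longlonglongrightarrow> indicator K x"
proof -
  obtain R0 where R0: "\<And>x. x \<in> K \<Longrightarrow> norm x \<le> R0" using compact_imp_bounded[OF K] unfolding bounded_iff by blast
  have ex: "\<exists>\<psi>\<in>test_functions. (\<forall>x. 0 \<le> \<psi> x \<and> \<psi> x \<le> 1) \<and> (\<forall>x\<in>K. \<psi> x = 1) \<and> (\<forall>x. (\<forall>y\<in>K. norm (x - y) \<ge> 2 * r) \<longrightarrow> \<psi> x = 0)"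
    if r: "r > 0" for r
  proof -
    have "K \<subseteq> (\<Union>a\<in>K. ball a r)" using r by auto
    then obtain F where F: "F \<subseteq> K" "finite F" "K \<subseteq> (\<Union>a\<in>F. ball a r)"
      by (rule compactE_image[OF K open_ball])
    \<comment> \<open>One minus a finite product of complementary cut-offs: smooth without any
      normalization, equal to 1 as soon as one cut-off is, and equal to 0 where all of them
      vanish.\<close>
    define \<psi> where "\<psi> x = 1 - (\<Prod>a\<in>F. (1 - cutoff r a x))" for x
    have p: "0 \<le> (\<Prod>a\<in>F. (1 - cutoff r a x))" "(\<Prod>a\<in>F. (1 - cutoff r a x)) \<le> 1" for x
      by (auto intro!: prod_nonneg prod_le_1 simp: cutoff_range)
    have z: "\<psi> x = 0" if "\<forall>y\<in>K. norm (x - y) \<ge> 2 * r" for x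
    proof -
      have "cutoff r a x = 0" if "a \<in> F" for a
        using that F(1) \<open>\<forall>y\<in>K. norm (x - y) \<ge> 2 * r\<close> r by (intro cutoff_0) auto
      then show ?thesis by (simp add: \<psi>_def)
    qed
    have "\<psi> \<in> test_functions"
    proof (rule test_I[of _ "R0 + 2 * r"])
      show "smooth \<psi>" unfolding \<psi>_def[abs_def] by (intro smooth_diff smooth_const smooth_prod smooth_cutoff)
      fix x :: plane assume x: "R0 + 2 * r < norm x"
      show "\<psi> x = 0"
      proof (rule z, rule ballI)
        fix y assume "y \<in> K"
        then show "2 * r \<le> norm (x - y)" using R0[of y] x norm_triangle_ineq2[of x y] by simp
      qed
    qed
    moreover have "\<psi> x = 1" if x: "x \<in> K" for x
    proof -
      obtain a where "a \<in> F" "x \<in> ball a r" using F(3) x by blast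
      then have "cutoff r a x = 1" using r by (intro cutoff_1) (auto simp: dist_norm norm_minus_commute)
      then have "(\<Prod>a\<in>F. (1 - cutoff r a x)) = 0" using F(2) \<open>a \<in> F\<close> by (auto intro!: prod_zero)
      then show ?thesis by (simp add: \<psi>_def)
    qed
    moreover have "0 \<le> \<psi> x \<and> \<psi> x \<le> 1" for x using p[of x] by (simp add: \<psi>_def)
    ultimately show ?thesis using z by blast
  qed
  then have "\<forall>n. \<exists>\<psi>\<in>test_functions. (\<forall>x. 0 \<le> \<psi> x \<and> \<psi> x \<le> 1) \<and> (\<forall>x\<in>K. \<psi> x = 1) \<and>
      (\<forall>x. (\<forall>y\<in>K. norm (x - y) \<ge> 2 * (1 / real (Suc n))) \<longrightarrow> \<psi> x = 0)"
    by (intro allI ex) simp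
  then obtain \<phi> where \<phi>: "\<And>n. \<phi> n \<in> test_functions" "\<And>n x. 0 \<le> \<phi> n x \<and> \<phi> n x \<le> 1" "\<And>n x. x \<in> K \<Longrightarrow> \<phi> n x = 1"
    "\<And>n x. (\<forall>y\<in>K. norm (x - y) \<ge> 2 * (1 / real (Suc n))) \<Longrightarrow> \<phi> n x = 0" by metis
  show ?thesis
  proof (rule that[of \<phi> "R0 + 2"])
    show "\<phi> n x = 0" if "R0 + 2 < norm x" for n x
    proof (rule \<phi>(4), rule ballI)
      fix y assume "y \<in> K"
      then have "2 \<le> norm (x - y)" using R0[of y] that norm_triangle_ineq2[of x y] by simp
      moreover have "2 * (1 / real (Suc n)) \<le> 2" by (simp add: field_simps)
      ultimately show "2 * (1 / real (Suc n)) \<le> norm (x - y)" by linarith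
    qed
    show "(\<lambda>n. \<phi> n x) \<longlonglongrightarrow> indicator K x" for x
    proof (cases "x \<in> K")
      case True then show ?thesis by (simp add: \<phi>)
    next
      case False
      have "\<exists>e>0. \<forall>y\<in>K. e \<le> dist x y" using separate_point_closed[OF compact_imp_closed[OF K] False] by blast
      then obtain e where e: "e > 0" "\<And>y. y \<in> K \<Longrightarrow> e \<le> norm (x - y)" by (auto simp: dist_norm)
      obtain N where N: "1 / real (Suc N) < e / 2" using e(1) by (metis half_gt_zero nat_approx_posE)
      have "\<phi> n x = 0" if "n \<ge> N" for n
      proof (rule \<phi>(4), rule ballI)
        fix y assume "y \<in> K"
        have "1 / real (Suc n) \<le> 1 / real (Suc N)" using that by (intro divide_left_mono) auto
        then show "2 * (1 / real (Suc n)) \<le> norm (x - y)" using e(2)[OF \<open>y \<in> K\<close>] N by linarith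
      qed
      then have "\<forall>\<^sub>F n in sequentially. \<phi> n x = indicator K x"
        using False by (auto simp: eventually_sequentially)
      then show ?thesis by (rule tendsto_eventually)
    qed
  qed (use \<phi> in auto)
qed

section \<open>The fundamental lemma of the calculus of variations\<close>

lemma locally_integrable_meas: "locally_integrable f \<Longrightarrow> f \<in> borel_measurable lebesgue"
  by (simp add: locally_integrable_def)

lemma locally_integrable_set: "locally_integrable f \<Longrightarrow> compact K \<Longrightarrow> integrable lebesgue (\<lambda>x. indicator K x *\<^sub>R f x)"
  by (simp add: locally_integrable_def set_integrable_def)

lemma continuous_measurable_lebesgue: "continuous_on UNIV (f :: plane \<Rightarrow> 'b::euclidean_space) \<Longrightarrow> f \<in> borel_measurable lebesgue"
  by (simp add: borel_measurable_continuous_onI measurable_completion)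

lemma borel_lebesgue: "(f :: plane \<Rightarrow> 'b::topological_space) \<in> borel_measurable borel \<Longrightarrow> f \<in> borel_measurable lebesgue"
  by (simp add: measurable_completion)

lemma locally_integrable_scaleR:
  fixes f :: "plane \<Rightarrow> 'b::euclidean_space"
  assumes f: "locally_integrable f" and h: "h \<in> borel_measurable lebesgue" "\<And>x. \<bar>h x\<bar> \<le> C" "\<And>x. norm x > R \<Longrightarrow> h x = 0"
  shows "integrable lebesgue (\<lambda>x. h x *\<^sub>R f x)"
proof (rule Bochner_Integration.integrable_bound)
  show "integrable lebesgue (\<lambda>x. C * norm (indicator (cball 0 R) x *\<^sub>R f x))"
    using locally_integrable_set[OF f compact_cball] by (intro integrable_mult_right integrable_norm)
  show "(\<lambda>x. h x *\<^sub>R f x) \<in> borel_measurable lebesgue"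
    using locally_integrable_meas[OF f] h(1) by simp
  show "AE x in lebesgue. norm (h x *\<^sub>R f x) \<le> norm (C * norm (indicator (cball 0 R) x *\<^sub>R f x))"
  proof (rule AE_I2)
    fix x
    show "norm (h x *\<^sub>R f x) \<le> norm (C * norm (indicator (cball 0 R) x *\<^sub>R f x))"
      using h(2)[of x] h(3)[of x] by (cases "norm x \<le> R") (auto simp: abs_mult intro!: mult_right_mono)
  qed
qed

lemma test_meas: "\<phi> \<in> test_functions \<Longrightarrow> \<phi> \<in> borel_measurable lebesgue"
  by (intro continuous_measurable_lebesgue test_continuous)

lemma test_scaleR_integrable:
  fixes f :: "plane \<Rightarrow> 'b::euclidean_space"
  assumes "locally_integrable f" "\<phi> \<in> test_functions"
  shows "integrable lebesgue (\<lambda>x. \<phi> x *\<^sub>R f x)"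
proof -
  obtain C where "C > 0" "\<And>x. \<bar>\<phi> x\<bar> \<le> C" using test_bounded[OF assms(2)] by metis
  moreover obtain R where "R > 0" "\<forall>x. R \<le> norm x \<longrightarrow> \<phi> x = 0 \<and> (\<forall>i. pd i \<phi> x = 0)"
    using test_bounded_support[OF assms(2)] by blast
  ultimately show ?thesis
    by (intro locally_integrable_scaleR[OF assms(1), of _ C R] test_meas assms) auto
qed

text \<open>A one-sided fundamental lemma. A compact set on which \<open>f\<close> is at most
  \<open>- c\<close> must be null, since its indicator is a limit of admissible test functions;
  inner regularity then exhausts the set where \<open>f < 0\<close>. The contrapositive later
  supplies the averaging weight for a potential with a negative part.\<close>

lemma ae_nonneg_if_test_nonneg:
  fixes f :: "plane \<Rightarrow> real"
  assumes f: "locally_integrable f"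
    and pos: "\<And>\<phi>. \<phi> \<in> test_functions \<Longrightarrow> (\<And>x. 0 \<le> \<phi> x) \<Longrightarrow> 0 \<le> (\<integral>x. \<phi> x * f x \<partial>lebesgue)"
  shows "AE x in lebesgue. 0 \<le> f x"
proof -
  have [measurable]: "f \<in> borel_measurable lebesgue" by (rule locally_integrable_meas[OF f])
  have comp0: "emeasure lebesgue T = 0" if T: "compact T" "\<And>x. x \<in> T \<Longrightarrow> f x \<le> - c" and c: "c > 0" for T c
  proof -
    obtain \<phi> R where \<phi>: "\<And>n. \<phi> n \<in> test_functions" "\<And>n x. 0 \<le> \<phi> n x" "\<And>n x. \<phi> n x \<le> (1::real)"
      "\<And>n x. norm x > R \<Longrightarrow> \<phi> n x = 0" "\<And>x. (\<lambda>n. \<phi> n x) \<longlonglongrightarrow> indicator T x"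
      by (rule test_approx_compact[OF T(1)]) blast
    have Tm [measurable]: "T \<in> sets lebesgue" "T \<in> lmeasurable"
      using T(1) by (auto simp: lmeasurable_compact fmeasurableD)
    have "(\<lambda>n. \<integral>x. \<phi> n x * f x \<partial>lebesgue) \<longlonglongrightarrow> (\<integral>x. indicator T x * f x \<partial>lebesgue)"
    proof (rule integral_dominated_convergence[where w = "\<lambda>x. norm (indicator (cball 0 R) x *\<^sub>R f x)"])
      show "AE x in lebesgue. (\<lambda>n. \<phi> n x * f x) \<longlonglongrightarrow> indicator T x * f x"
        by (intro AE_I2 tendsto_intros \<phi>)
      show "AE x in lebesgue. norm (\<phi> n x * f x) \<le> norm (indicator (cball 0 R) x *\<^sub>R f x)" for n
      proof (rule AE_I2)
        fix x
        show "norm (\<phi> n x * f x) \<le> norm (indicator (cball 0 R) x *\<^sub>R f x)"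
          using \<phi>(2)[of n x] \<phi>(3)[of n x] \<phi>(4)[of x n] by (cases "norm x \<le> R") (auto simp: abs_mult mult_left_le_one_le)
      qed
      show "integrable lebesgue (\<lambda>x. norm (indicator (cball 0 R) x *\<^sub>R f x))"
        using locally_integrable_set[OF f compact_cball] by (rule integrable_norm)
    qed (use \<phi>(1) test_meas in auto)
    moreover have "0 \<le> (\<integral>x. \<phi> n x * f x \<partial>lebesgue)" for n using pos \<phi> by blast
    ultimately have "0 \<le> (\<integral>x. indicator T x * f x \<partial>lebesgue)" by (intro LIMSEQ_le_const) auto
    also have "\<dots> \<le> (\<integral>x. - c * indicator T x \<partial>lebesgue)"
    proof (rule integral_mono)
      show "integrable lebesgue (\<lambda>x. indicator T x * f x)"
        using locally_integrable_set[OF f T(1)] by simp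
      show "integrable lebesgue (\<lambda>x. - c * indicator T x)"
        using Tm(2) by (intro integrable_mult_right) (auto simp: fmeasurable_def)
    qed (use T(2) in \<open>auto simp: indicator_def\<close>)
    also have "\<dots> = - c * measure lebesgue T" by simp
    finally have "measure lebesgue T \<le> 0" using c by (simp add: mult_le_0_iff)
    then show ?thesis using Tm(2) by (simp add: emeasure_eq_measure2 measure_le_0_iff)
  qed
  define A where "A n = {x. f x < - (1 / real (Suc n))} \<inter> cball 0 (real n)" for n
  have A [measurable]: "A n \<in> sets lebesgue" for n
  proof -
    have "{x \<in> space lebesgue. f x < - (1 / real (Suc n))} \<in> sets lebesgue" by measurable
    moreover have "cball 0 (real n) \<in> sets (lebesgue :: plane measure)" by (simp add: fmeasurableD)
    ultimately show ?thesis unfolding A_def by (auto intro: sets.Int)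
  qed
  have "A n \<in> null_sets lebesgue" for n
  proof -
    \<comment> \<open>\<open>A n\<close> is bounded, so its closed inner approximations are compact
      and \<open>comp0\<close> applies to them.\<close>
    have eb: "emeasure lebesgue (A n) \<le> 0 + ennreal e" if "e > 0" for e
    proof -
      obtain T where T: "closed T" "T \<subseteq> A n" "A n - T \<in> lmeasurable" "emeasure lebesgue (A n - T) < ennreal e"
        by (rule sets_lebesgue_inner_closed[OF A \<open>e > 0\<close>])
      have "compact T" using T(1,2) by (auto simp: A_def compact_eq_bounded_closed intro: bounded_subset[OF bounded_cball])
      then have 0: "emeasure lebesgue T = 0"
        by (rule comp0[of _ "1 / real (Suc n)"]) (use T(2) in \<open>auto simp: A_def less_imp_le\<close>)
      have "emeasure lebesgue (A n) \<le> emeasure lebesgue (T \<union> (A n - T))"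
        using T \<open>compact T\<close> by (intro emeasure_mono) (auto simp: lmeasurable_compact fmeasurableD)
      also have "\<dots> \<le> emeasure lebesgue T + emeasure lebesgue (A n - T)"
        using T \<open>compact T\<close> by (intro emeasure_subadditive) (auto simp: lmeasurable_compact fmeasurableD)
      finally show ?thesis using 0 T(4) by simp
    qed
    have "emeasure lebesgue (A n) \<le> 0" by (rule ennreal_le_epsilon, rule eb)
    then show ?thesis using A by auto
  qed
  then have "(\<Union>n. A n) \<in> null_sets lebesgue" by auto
  moreover have "{x. \<not> 0 \<le> f x} \<subseteq> (\<Union>n. A n)"
  proof
    fix x assume "x \<in> {x. \<not> 0 \<le> f x}"
    then have "0 < - f x" by simp
    then obtain m where m: "1 / real (Suc m) < - f x" using nat_approx_posE by blast
    obtain k where k: "norm x \<le> real k" using real_arch_simple by blast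
    have "1 / real (Suc (max m k)) \<le> 1 / real (Suc m)" by (intro divide_left_mono) auto
    then have "f x < - (1 / real (Suc (max m k)))" using m by linarith
    then have "x \<in> A (max m k)" using k by (auto simp: A_def)
    then show "x \<in> (\<Union>n. A n)" by blast
  qed
  ultimately show ?thesis by (intro AE_I'[of "\<Union>n. A n"]) auto
qed

lemma locally_integrable_inner:
  assumes "locally_integrable (f :: plane \<Rightarrow> 'b::euclidean_space)" shows "locally_integrable (\<lambda>x. f x \<bullet> b)"
  unfolding locally_integrable_def
proof (intro conjI allI impI)
  show "(\<lambda>x. f x \<bullet> b) \<in> borel_measurable lebesgue" using locally_integrable_meas[OF assms] by simp
  fix K :: "plane set" assume "compact K"
  from integrable_inner_left[OF locally_integrable_set[OF assms this], of b]
  show "(\<lambda>x. f x \<bullet> b) absolutely_integrable_on K" by (simp add: set_integrable_def)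
qed

text \<open>The one-sided lemma applies to every coordinate and to its negative.\<close>

lemma ae_zero_if_test_zero:
  fixes f :: "plane \<Rightarrow> 'b::euclidean_space"
  assumes f: "locally_integrable f" and z: "\<And>\<phi>. \<phi> \<in> test_functions \<Longrightarrow> (\<integral>x. \<phi> x *\<^sub>R f x \<partial>lebesgue) = 0"
  shows "AE x in lebesgue. f x = 0"
proof -
  have "AE x in lebesgue. f x \<bullet> b = 0" for b
  proof -
    have fb: "locally_integrable (\<lambda>x. f x \<bullet> c)" for c by (rule locally_integrable_inner[OF f])
    have z': "(\<integral>x. \<phi> x * (f x \<bullet> c) \<partial>lebesgue) = 0" if "\<phi> \<in> test_functions" for \<phi> c
      using integral_inner_left[OF test_scaleR_integrable[OF f that], of c] z[OF that] by simp
    have "AE x in lebesgue. 0 \<le> f x \<bullet> b" by (rule ae_nonneg_if_test_nonneg[OF fb]) (simp add: z')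
    moreover have "AE x in lebesgue. 0 \<le> f x \<bullet> (- b)" by (rule ae_nonneg_if_test_nonneg[OF fb]) (simp only: z')
    ultimately show ?thesis by eventually_elim simp
  qed
  then have "AE x in lebesgue. \<forall>b\<in>Basis. f x \<bullet> b = 0" by (intro AE_finite_allI) auto
  then show ?thesis by eventually_elim (simp add: euclidean_eq_iff[of "f _" 0])
qed

section \<open>Closure properties of local integrability\<close>

lemma locally_integrable_add:
  fixes f g :: "plane \<Rightarrow> 'b::euclidean_space"
  assumes "locally_integrable f" "locally_integrable g" shows "locally_integrable (\<lambda>x. f x + g x)"
  using assms unfolding locally_integrable_def by (auto simp: set_integral_add intro!: borel_measurable_add)

lemma locally_integrable_cscale:
  fixes f :: "plane \<Rightarrow> 'b::euclidean_space"
  assumes "locally_integrable f" shows "locally_integrable (\<lambda>x. c *\<^sub>R f x)"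
  using assms unfolding locally_integrable_def by auto

lemma locally_integrable_diff:
  fixes f g :: "plane \<Rightarrow> 'b::euclidean_space"
  assumes "locally_integrable f" "locally_integrable g" shows "locally_integrable (\<lambda>x. f x - g x)"
  using locally_integrable_add[OF assms(1) locally_integrable_cscale[OF assms(2), of "-1"]] by simp

lemma locally_integrable_L2:
  fixes f :: "plane \<Rightarrow> 'b::euclidean_space"
  assumes "f \<in> Lp 2" shows "locally_integrable f"
  unfolding locally_integrable_def set_integrable_def
proof (intro conjI allI impI)
  show m [measurable]: "f \<in> borel_measurable lebesgue" by (rule L2_meas[OF assms])
  fix K :: "plane set" assume K: "compact K"
  have i: "integrable lebesgue (indicator K :: plane \<Rightarrow> real)"
    using lmeasurable_compact[OF K] by (auto simp: fmeasurable_def)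
  show "integrable lebesgue (\<lambda>x. indicator K x *\<^sub>R f x)"
  proof (rule Bochner_Integration.integrable_bound)
    show "integrable lebesgue (\<lambda>x. indicator K x + (norm (f x))^2)" using i L2_int[OF assms] by simp
    show "(\<lambda>x. indicator K x *\<^sub>R f x) \<in> borel_measurable lebesgue" using i by measurable
    show "AE x in lebesgue. norm (indicator K x *\<^sub>R f x) \<le> norm (indicator K x + (norm (f x))^2)"
    proof (rule AE_I2)
      fix x
      show "norm (indicator K x *\<^sub>R f x) \<le> norm (indicator K x + (norm (f x))^2)"
        using norm_mult_le_sum_squares[of "1::real" "f x"] by (auto simp: indicator_def)
    qed
  qed
qed

lemma locally_integrable_bounded:
  fixes f :: "plane \<Rightarrow> 'b::euclidean_space"
  assumes [measurable]: "f \<in> borel_measurable lebesgue" and C: "\<And>x. norm (f x) \<le> C"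
  shows "locally_integrable f"
  unfolding locally_integrable_def set_integrable_def
proof (intro conjI allI impI assms(1))
  fix K :: "plane set" assume K: "compact K"
  have i: "integrable lebesgue (\<lambda>x. C * indicator K x)"
    using lmeasurable_compact[OF K] by (intro integrable_mult_right) (auto simp: fmeasurable_def)
  have [measurable]: "K \<in> sets lebesgue" using lmeasurable_compact[OF K] by (rule fmeasurableD)
  show "integrable lebesgue (\<lambda>x. indicator K x *\<^sub>R f x)"
    by (rule Bochner_Integration.integrable_bound[OF i])
      (use C in \<open>auto simp: indicator_def intro: order_trans[OF _ abs_ge_self]\<close>)
qed

lemma test_mult_integrable:
  assumes "\<phi> \<in> test_functions" "\<psi> \<in> test_functions" shows "integrable lebesgue (\<lambda>x. \<phi> x * \<psi> x)"
proof -
  obtain C where "C > 0" "\<And>x. \<bar>\<psi> x\<bar> \<le> C" using test_bounded[OF assms(2)] by metis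
  then have "locally_integrable \<psi>" by (intro locally_integrable_bounded test_meas assms) auto
  from test_scaleR_integrable[OF this assms(1)] show ?thesis by simp
qed

lemma test_L2: "\<phi> \<in> test_functions \<Longrightarrow> \<phi> \<in> Lp 2"
  using test_mult_integrable[of \<phi> \<phi>] by (auto intro!: L2_I test_meas simp: power2_eq_square)

lemma test_integrable:
  assumes "\<phi> \<in> test_functions" shows "integrable lebesgue \<phi>"
proof -
  have "locally_integrable (\<lambda>x. 1::real)" by (rule locally_integrable_bounded[where C=1]) auto
  from test_scaleR_integrable[OF this assms] show ?thesis by simp
qed

section \<open>Weak gradients\<close>

lemma has_weak_gradient_iff:
  "has_weak_gradient u g \<longleftrightarrow> locally_integrable u \<and> locally_integrable g \<and>
     (\<forall>\<phi>\<in>test_functions. \<forall>i. (\<integral>x. pd i \<phi> x *\<^sub>R u x \<partial>lebesgue) = - (\<integral>x. \<phi> x *\<^sub>R (g x $ i) \<partial>lebesgue))"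
  by (simp add: has_weak_gradient_def pd_def)

lemma locally_integrable_bound:
  fixes f :: "plane \<Rightarrow> 'b::euclidean_space" and h :: "plane \<Rightarrow> 'c::euclidean_space"
  assumes f: "locally_integrable f" and h: "h \<in> borel_measurable lebesgue" "\<And>x. norm (h x) \<le> C * norm (f x)"
  shows "locally_integrable h"
  unfolding locally_integrable_def set_integrable_def
proof (intro conjI allI impI h(1))
  fix K :: "plane set" assume K: "compact K"
  have [measurable]: "K \<in> sets lebesgue" using lmeasurable_compact[OF K] by (rule fmeasurableD)
  show "integrable lebesgue (\<lambda>x. indicator K x *\<^sub>R h x)"
  proof (rule Bochner_Integration.integrable_bound)
    show "integrable lebesgue (\<lambda>x. C * norm (indicator K x *\<^sub>R f x))"
      by (intro integrable_mult_right integrable_norm locally_integrable_set[OF f K])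
    show "(\<lambda>x. indicator K x *\<^sub>R h x) \<in> borel_measurable lebesgue" using h(1) by measurable
    show "AE x in lebesgue. norm (indicator K x *\<^sub>R h x) \<le> norm (C * norm (indicator K x *\<^sub>R f x))"
      using h(2) by (intro AE_I2) (auto simp: indicator_def intro: order_trans[OF _ abs_ge_self])
  qed
qed

lemma borel_measurable_vec_nth: "f \<in> borel_measurable M \<Longrightarrow> (\<lambda>x. f x $ i) \<in> borel_measurable M"
  for f :: "'a \<Rightarrow> complex ^ 2"
  by (rule borel_measurable_continuous_on[of "\<lambda>y. y $ i"]) (auto intro: continuous_intros)

lemma borel_measurable_vec_lambda:
  fixes f :: "'a \<Rightarrow> 2 \<Rightarrow> complex"
  assumes "\<And>i. (\<lambda>x. f x i) \<in> borel_measurable M"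
  shows "(\<lambda>x. \<chi> i. f x i) \<in> borel_measurable M"
proof (subst borel_measurable_euclidean_space, intro ballI)
  fix b :: "complex ^ 2" assume "b \<in> Basis"
  then obtain i c where "b = axis i c" by (auto simp: Basis_vec_def)
  then show "(\<lambda>x. (\<chi> i. f x i) \<bullet> b) \<in> borel_measurable M"
    using assms[of i] by (simp add: inner_axis)
qed

lemma norm_vec2_sq: "(norm (v :: complex ^ 2))^2 = (norm (v $ 1))^2 + (norm (v $ 2))^2"
  by (simp add: norm_vec_def L2_set_def UNIV_2 add_nonneg_nonneg)

lemma locally_integrable_nth: "locally_integrable g \<Longrightarrow> locally_integrable (\<lambda>x. g x $ i)"
  for g :: "plane \<Rightarrow> complex ^ 2"
  by (rule locally_integrable_bound[of g _ 1])
    (auto intro: borel_measurable_vec_nth locally_integrable_meas Finite_Cartesian_Product.norm_nth_le)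

lemma weak_gradient_unique:
  assumes "has_weak_gradient u g" "has_weak_gradient v h" "AE x in lebesgue. u x = v x"
  shows "AE x in lebesgue. g x = h x"
proof -
  have l: "locally_integrable u" "locally_integrable g" "locally_integrable v" "locally_integrable h"
    using assms by (auto simp: has_weak_gradient_iff)
  have "AE x in lebesgue. g x $ i - h x $ i = 0" for i
  proof (rule ae_zero_if_test_zero)
    show "locally_integrable (\<lambda>x. g x $ i - h x $ i)"
      by (intro locally_integrable_diff locally_integrable_nth l)
    fix \<phi> assume \<phi>: "\<phi> \<in> test_functions"
    have "(\<integral>x. \<phi> x *\<^sub>R (g x $ i) \<partial>lebesgue) = (\<integral>x. \<phi> x *\<^sub>R (h x $ i) \<partial>lebesgue)"
    proof -
      have "(\<integral>x. pd i \<phi> x *\<^sub>R u x \<partial>lebesgue) = (\<integral>x. pd i \<phi> x *\<^sub>R v x \<partial>lebesgue)"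
        using assms(3) test_scaleR_integrable[OF l(1) test_pd[OF \<phi>]] test_scaleR_integrable[OF l(3) test_pd[OF \<phi>]]
        by (intro integral_cong_AE) auto
      then show ?thesis using assms(1,2) \<phi> by (simp add: has_weak_gradient_iff)
    qed
    then show "(\<integral>x. \<phi> x *\<^sub>R (g x $ i - h x $ i) \<partial>lebesgue) = 0"
      using test_scaleR_integrable[OF locally_integrable_nth[OF l(2)] \<phi>]
        test_scaleR_integrable[OF locally_integrable_nth[OF l(4)] \<phi>]
      by (simp add: scaleR_diff_right)
  qed
  then have "AE x in lebesgue. \<forall>i. g x $ i - h x $ i = 0" by (intro AE_finite_allI[of UNIV, simplified]) auto
  then show ?thesis by eventually_elim (simp add: vec_eq_iff)
qed

lemma has_weak_gradient_weak_gradient: "has_weak_gradient u g \<Longrightarrow> has_weak_gradient u (weak_gradient u)"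
  unfolding weak_gradient_def by (rule someI[where P = "has_weak_gradient u"])

lemma weak_gradient_AE: "has_weak_gradient u g \<Longrightarrow> AE x in lebesgue. weak_gradient u x = g x"
  by (rule weak_gradient_unique[OF has_weak_gradient_weak_gradient]) auto

lemma H1_weak_gradient:
  assumes "u \<in> H1" shows "u \<in> Lp 2" "weak_gradient u \<in> Lp 2" "has_weak_gradient u (weak_gradient u)"
proof -
  obtain g where g: "g \<in> Lp 2" "has_weak_gradient u g" using assms by (auto simp: H1_def)
  show "u \<in> Lp 2" using assms by (auto simp: H1_def)
  show h: "has_weak_gradient u (weak_gradient u)" using has_weak_gradient_weak_gradient g by blast
  then show "weak_gradient u \<in> Lp 2"
    by (intro L2_AE_cong[OF g(1)] weak_gradient_AE g locally_integrable_meas) (auto simp: has_weak_gradient_iff)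
qed

lemma H1_I: "u \<in> Lp 2 \<Longrightarrow> g \<in> Lp 2 \<Longrightarrow> has_weak_gradient u g \<Longrightarrow> u \<in> H1"
  by (auto simp: H1_def)

abbreviation kin :: "(plane \<Rightarrow> complex) \<Rightarrow> real" where "kin u \<equiv> nsq (weak_gradient u)"

lemma kin_eq:
  assumes "g \<in> Lp 2" "has_weak_gradient u g" shows "kin u = nsq g"
  using assms has_weak_gradient_weak_gradient[OF assms(2)]
  by (intro nsq_cong_AE weak_gradient_AE) (auto simp: has_weak_gradient_iff locally_integrable_meas)

lemma norm_smult_vec: "norm (c *s (v :: complex ^ 2)) = norm c * norm v"
proof -
  have "(norm (c *s v))^2 = (norm c * norm v)^2"
    by (simp add: norm_vec2_sq power_mult_distrib norm_mult algebra_simps)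
  then show ?thesis by (simp add: power2_eq_iff_nonneg)
qed

lemma borel_measurable_smult_vec: "f \<in> borel_measurable M \<Longrightarrow> (\<lambda>x. c *s f x) \<in> borel_measurable M"
  for f :: "'a \<Rightarrow> complex ^ 2"
  by (auto simp: vector_scalar_mult_def intro!: borel_measurable_vec_lambda borel_measurable_times borel_measurable_vec_nth)

lemma has_weak_gradient_lincomb:
  assumes u: "has_weak_gradient u g" and v: "has_weak_gradient v h"
  shows "has_weak_gradient (\<lambda>x. c * u x + d * v x) (\<lambda>x. c *s g x + d *s h x)"
proof -
  have l: "locally_integrable u" "locally_integrable g" "locally_integrable v" "locally_integrable h"
    using assms by (auto simp: has_weak_gradient_iff)
  have lc: "locally_integrable (\<lambda>x. c * u x)" if "locally_integrable u" for c and u :: "plane \<Rightarrow> complex"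
    by (rule locally_integrable_bound[OF that, of _ "norm c"]) (use that in \<open>auto simp: norm_mult intro!: borel_measurable_times intro: locally_integrable_meas\<close>)
  have lv: "locally_integrable (\<lambda>x. c *s g x)" if "locally_integrable g" for c and g :: "plane \<Rightarrow> complex ^ 2"
    by (rule locally_integrable_bound[OF that, of _ "norm c"])
      (use that in \<open>auto simp: norm_smult_vec borel_measurable_smult_vec locally_integrable_meas\<close>)
  show ?thesis
    unfolding has_weak_gradient_iff
  proof (intro conjI ballI allI)
    show "locally_integrable (\<lambda>x. c * u x + d * v x)" "locally_integrable (\<lambda>x. c *s g x + d *s h x)"
      by (intro locally_integrable_add lc lv l)+
    fix \<phi> i assume \<phi>: "\<phi> \<in> test_functions"
    note p = test_pd[OF \<phi>, of i]
    have e: "k *\<^sub>R (c * z + d * w) = c * (k *\<^sub>R z) + d * (k *\<^sub>R w)" for k z w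
      by (simp add: scaleR_conv_of_real algebra_simps)
    have "(\<integral>x. pd i \<phi> x *\<^sub>R (c * u x + d * v x) \<partial>lebesgue)
        = c * (\<integral>x. pd i \<phi> x *\<^sub>R u x \<partial>lebesgue) + d * (\<integral>x. pd i \<phi> x *\<^sub>R v x \<partial>lebesgue)"
      unfolding e using test_scaleR_integrable[OF l(1) p] test_scaleR_integrable[OF l(3) p] by (simp del: mult_scaleR_right)
    also have "\<dots> = - (c * (\<integral>x. \<phi> x *\<^sub>R (g x $ i) \<partial>lebesgue) + d * (\<integral>x. \<phi> x *\<^sub>R (h x $ i) \<partial>lebesgue))"
      using u v \<phi> by (simp add: has_weak_gradient_iff)
    also have "\<dots> = - (\<integral>x. \<phi> x *\<^sub>R (c * g x $ i + d * h x $ i) \<partial>lebesgue)"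
      unfolding e using test_scaleR_integrable[OF locally_integrable_nth[OF l(2)] \<phi>, of i]
         test_scaleR_integrable[OF locally_integrable_nth[OF l(4)] \<phi>, of i] by (simp del: mult_scaleR_right)
    finally show "(\<integral>x. pd i \<phi> x *\<^sub>R (c * u x + d * v x) \<partial>lebesgue) = - (\<integral>x. \<phi> x *\<^sub>R ((c *s g x + d *s h x) $ i) \<partial>lebesgue)"
      by simp
  qed
qed

lemma of_real_smult_vec: "complex_of_real a *s (v :: complex ^ 2) = a *\<^sub>R v"
  by (rule vec_eq_iff[THEN iffD2]) (auto simp: scaleR_conv_of_real[where 'a = complex])

lemma has_weak_gradient_scaleR_add:
  assumes "has_weak_gradient u g" "has_weak_gradient v h"
  shows "has_weak_gradient (\<lambda>x. a *\<^sub>R u x + b *\<^sub>R v x) (\<lambda>x. a *\<^sub>R g x + b *\<^sub>R h x)"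
  using has_weak_gradient_lincomb[OF assms, of "complex_of_real a" "complex_of_real b"]
  by (simp only: of_real_smult_vec scaleR_conv_of_real[symmetric])

lemma has_weak_gradient_diff:
  assumes "has_weak_gradient u g" "has_weak_gradient v h"
  shows "has_weak_gradient (\<lambda>x. u x - v x) (\<lambda>x. g x - h x)"
  using has_weak_gradient_scaleR_add[OF assms, of 1 "-1"] by simp

lemma has_weak_gradient_scaleR:
  assumes "has_weak_gradient u g" shows "has_weak_gradient (\<lambda>x. a *\<^sub>R u x) (\<lambda>x. a *\<^sub>R g x)"
  using has_weak_gradient_scaleR_add[OF assms assms, of a 0] by simp

lemma has_weak_gradient_cong:
  assumes "has_weak_gradient u g" "v \<in> borel_measurable lebesgue" "h \<in> borel_measurable lebesgue"
    "AE x in lebesgue. u x = v x" "AE x in lebesgue. g x = h x"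
  shows "has_weak_gradient v h"
proof -
  have lc: "locally_integrable k" if "locally_integrable f" "AE x in lebesgue. f x = k x" "k \<in> borel_measurable lebesgue"
    for f k :: "plane \<Rightarrow> 'b::euclidean_space"
    unfolding locally_integrable_def set_integrable_def
  proof (intro conjI allI impI that)
    fix K :: "plane set" assume K: "compact K"
    have [measurable]: "K \<in> sets lebesgue" using lmeasurable_compact[OF K] by (rule fmeasurableD)
    note [measurable] = that(3)
    show "integrable lebesgue (\<lambda>x. indicator K x *\<^sub>R k x)"
      by (rule integrable_cong_AE_imp[OF locally_integrable_set[OF that(1) K]]) (use that(2) in auto)
  qed
  have l: "locally_integrable u" "locally_integrable g" using assms(1) by (auto simp: has_weak_gradient_iff)
  note l' = lc[OF l(1) assms(4,2)] lc[OF l(2) assms(5,3)]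
  show ?thesis unfolding has_weak_gradient_iff
  proof (intro conjI ballI allI l')
    fix \<phi> i assume \<phi>: "\<phi> \<in> test_functions"
    note p = test_pd[OF \<phi>, of i]
    have "(\<integral>x. pd i \<phi> x *\<^sub>R v x \<partial>lebesgue) = (\<integral>x. pd i \<phi> x *\<^sub>R u x \<partial>lebesgue)"
      using test_scaleR_integrable[OF l(1) p] test_scaleR_integrable[OF l'(1) p] assms(4)
      by (intro integral_cong_AE) auto
    also have "\<dots> = - (\<integral>x. \<phi> x *\<^sub>R (g x $ i) \<partial>lebesgue)" using assms(1) \<phi> by (simp add: has_weak_gradient_iff)
    also have "(\<integral>x. \<phi> x *\<^sub>R (g x $ i) \<partial>lebesgue) = (\<integral>x. \<phi> x *\<^sub>R (h x $ i) \<partial>lebesgue)"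
      using test_scaleR_integrable[OF locally_integrable_nth[OF l(2)] \<phi>, of i]
        test_scaleR_integrable[OF locally_integrable_nth[OF l'(2)] \<phi>, of i] assms(5)
      by (intro integral_cong_AE) auto
    finally show "(\<integral>x. pd i \<phi> x *\<^sub>R v x \<partial>lebesgue) = - (\<integral>x. \<phi> x *\<^sub>R (h x $ i) \<partial>lebesgue)" .
  qed
qed

text \<open>Leibniz rule: the weak gradient of \<open>u\<close> is tested with
  \<open>\<phi> x * c x\<close>, which is a test function although \<open>c\<close> may have
  unbounded support, as one of the two localizing functions in the IMS formula does.\<close>

lemma has_weak_gradient_mult_smooth:
  assumes u: "has_weak_gradient u g" and c: "smooth c" "\<And>x. \<bar>c x\<bar> \<le> C" "\<And>i x. \<bar>pd i c x\<bar> \<le> C"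
  shows "has_weak_gradient (\<lambda>x. c x *\<^sub>R u x) (\<lambda>x. c x *\<^sub>R g x + (\<chi> i. pd i c x *\<^sub>R u x))"
proof -
  have l: "locally_integrable u" "locally_integrable g" using u by (auto simp: has_weak_gradient_iff)
  note [measurable] = locally_integrable_meas[OF l(1)] locally_integrable_meas[OF l(2)]
  have cm [measurable]: "c \<in> borel_measurable lebesgue" "pd i c \<in> borel_measurable lebesgue" for i
    by (intro continuous_measurable_lebesgue smooth_continuous smooth_pd c)+
  have C: "0 \<le> C" using c(2)[of 0] by linarith
  have lm: "locally_integrable (\<lambda>x. f x *\<^sub>R w x)" if "f \<in> borel_measurable lebesgue" "\<And>x. \<bar>f x\<bar> \<le> C" "locally_integrable w"
    for f and w :: "plane \<Rightarrow> 'b::euclidean_space"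
    by (rule locally_integrable_bound[OF that(3), of _ C])
     (use that in \<open>auto simp: locally_integrable_meas mult_right_mono intro!: borel_measurable_scaleR\<close>)
  have lv: "locally_integrable (\<lambda>x. \<chi> i. pd i c x *\<^sub>R u x)"
  proof (rule locally_integrable_bound[OF l(1), of _ "2 * C"])
    show "norm (\<chi> i. pd i c x *\<^sub>R u x) \<le> 2 * C * norm (u x)" for x
    proof -
      have "norm (\<chi> i. pd i c x *\<^sub>R u x) \<le> (\<Sum>i\<in>UNIV. norm ((\<chi> i. pd i c x *\<^sub>R u x) $ i))"
        by (simp add: norm_vec_def L2_set_le_sum)
      also have "\<dots> \<le> (\<Sum>i\<in>(UNIV::2 set). C * norm (u x))"
        by (intro sum_mono) (auto intro!: mult_right_mono c)
      finally show ?thesis by (simp add: UNIV_2)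
    qed
  qed (auto intro!: borel_measurable_vec_lambda)
  show ?thesis unfolding has_weak_gradient_iff
  proof (intro conjI ballI allI)
    show "locally_integrable (\<lambda>x. c x *\<^sub>R u x)" by (intro lm cm c l)
    show "locally_integrable (\<lambda>x. c x *\<^sub>R g x + (\<chi> i. pd i c x *\<^sub>R u x))"
      by (intro locally_integrable_add lm cm c l lv)
    fix \<phi> i assume \<phi>: "\<phi> \<in> test_functions"
    have t: "(\<lambda>x. \<phi> x * c x) \<in> test_functions" by (rule test_mult_smooth[OF \<phi> c(1)])
    have i1: "integrable lebesgue (\<lambda>x. pd i \<phi> x *\<^sub>R (c x *\<^sub>R u x))"
      by (rule test_scaleR_integrable[OF lm[OF cm(1) c(2) l(1)] test_pd[OF \<phi>]])
    have i2: "integrable lebesgue (\<lambda>x. \<phi> x *\<^sub>R (pd i c x *\<^sub>R u x))"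
      by (rule test_scaleR_integrable[OF lm[OF cm(2) c(3) l(1)] \<phi>])
    have i3: "integrable lebesgue (\<lambda>x. \<phi> x *\<^sub>R (c x *\<^sub>R (g x $ i)))"
      by (rule test_scaleR_integrable[OF lm[OF cm(1) c(2) locally_integrable_nth[OF l(2)]] \<phi>])
    have "(\<integral>x. pd i (\<lambda>x. \<phi> x * c x) x *\<^sub>R u x \<partial>lebesgue) = - (\<integral>x. (\<phi> x * c x) *\<^sub>R (g x $ i) \<partial>lebesgue)"
      using u t by (simp add: has_weak_gradient_iff)
    moreover have "(\<integral>x. pd i (\<lambda>x. \<phi> x * c x) x *\<^sub>R u x \<partial>lebesgue) =
       (\<integral>x. pd i \<phi> x *\<^sub>R (c x *\<^sub>R u x) \<partial>lebesgue) + (\<integral>x. \<phi> x *\<^sub>R (pd i c x *\<^sub>R u x) \<partial>lebesgue)"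
      using i1 i2 by (subst Bochner_Integration.integral_add[symmetric])
        (auto simp: pd_mult[OF test_smooth[OF \<phi>] c(1)] scaleR_add_left add.commute mult.commute)
    moreover have "(\<integral>x. \<phi> x *\<^sub>R ((c x *\<^sub>R g x + (\<chi> i. pd i c x *\<^sub>R u x)) $ i) \<partial>lebesgue) =
       (\<integral>x. (\<phi> x * c x) *\<^sub>R (g x $ i) \<partial>lebesgue) + (\<integral>x. \<phi> x *\<^sub>R (pd i c x *\<^sub>R u x) \<partial>lebesgue)"
      using i3 i2 by (subst Bochner_Integration.integral_add[symmetric]) (auto simp: scaleR_add_right)
    ultimately show "(\<integral>x. pd i \<phi> x *\<^sub>R (c x *\<^sub>R u x) \<partial>lebesgue) =
        - (\<integral>x. \<phi> x *\<^sub>R ((c x *\<^sub>R g x + (\<chi> i. pd i c x *\<^sub>R u x)) $ i) \<partial>lebesgue)"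
      by (simp add: eq_diff_eq[symmetric])
  qed
qed

section \<open>Affine changes of variables\<close>

lemma
  fixes t :: plane
  assumes "c > 0"
  shows affine_measurable: "(\<lambda>x. t + c *\<^sub>R x) \<in> lebesgue \<rightarrow>\<^sub>M lebesgue"
    and affine_density: "lebesgue = density (distr lebesgue lebesgue (\<lambda>x. t + c *\<^sub>R x)) (\<lambda>_. ennreal (c^2))"
proof -
  have e: "(\<lambda>x. t + (\<Sum>j\<in>Basis. (c * (x \<bullet> j)) *\<^sub>R j)) = (\<lambda>x. t + c *\<^sub>R x)"
    unfolding scaleR_scaleR[symmetric] scaleR_sum_right[symmetric] euclidean_representation ..
  show "(\<lambda>x. t + c *\<^sub>R x) \<in> lebesgue \<rightarrow>\<^sub>M lebesgue"
    using lebesgue_affine_measurable[of "\<lambda>_. c" t] assms unfolding e by auto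
  have "(\<Prod>j\<in>(Basis::plane set). \<bar>c\<bar>) = c^2" using assms by simp
  then show "lebesgue = density (distr lebesgue lebesgue (\<lambda>x. t + c *\<^sub>R x)) (\<lambda>_. ennreal (c^2))"
    using lebesgue_affine_euclidean[of "\<lambda>_. c" t] assms unfolding e by auto
qed

lemma integrable_affine_iff:
  fixes f :: "plane \<Rightarrow> 'b::euclidean_space"
  assumes c: "c > 0" and f: "f \<in> borel_measurable lebesgue"
  shows "integrable lebesgue (\<lambda>x. f (t + c *\<^sub>R x)) \<longleftrightarrow> integrable lebesgue f"
proof -
  note [measurable] = f affine_measurable[OF c, of t]
  have "integrable lebesgue f \<longleftrightarrow> integrable (distr lebesgue lebesgue (\<lambda>x. t + c *\<^sub>R x)) (\<lambda>x. (c^2) *\<^sub>R f x)"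
    by (subst affine_density[OF c, of t]) (use c in \<open>auto simp: integrable_density\<close>)
  also have "\<dots> \<longleftrightarrow> integrable lebesgue (\<lambda>x. (c^2) *\<^sub>R f (t + c *\<^sub>R x))"
    by (subst integrable_distr_eq) auto
  also have "\<dots> \<longleftrightarrow> integrable lebesgue (\<lambda>x. f (t + c *\<^sub>R x))"
    using integrable_scaleR_right[of "1 / c^2" lebesgue "\<lambda>x. c^2 *\<^sub>R f (t + c *\<^sub>R x)"]
      integrable_scaleR_right[of "c^2" lebesgue "\<lambda>x. f (t + c *\<^sub>R x)"] c by auto
  finally show ?thesis by simp
qed

lemma integral_affine:
  fixes f :: "plane \<Rightarrow> 'b::euclidean_space"
  assumes c: "c > 0" and f: "f \<in> borel_measurable lebesgue"
  shows "(\<integral>x. f x \<partial>lebesgue) = c^2 *\<^sub>R (\<integral>x. f (t + c *\<^sub>R x) \<partial>lebesgue)"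
proof -
  note [measurable] = f affine_measurable[OF c, of t]
  have "(\<integral>x. f x \<partial>lebesgue) = (\<integral>x. (c^2) *\<^sub>R f x \<partial>distr lebesgue lebesgue (\<lambda>x. t + c *\<^sub>R x))"
    by (subst affine_density[OF c, of t]) (use c in \<open>auto simp: integral_density\<close>)
  also have "\<dots> = (\<integral>x. (c^2) *\<^sub>R f (t + c *\<^sub>R x) \<partial>lebesgue)" by (subst integral_distr) auto
  finally show ?thesis by simp
qed

lemma has_weak_gradient_affine:
  assumes u: "has_weak_gradient u g" and c: "c > 0"
  shows "has_weak_gradient (\<lambda>x. u (t + c *\<^sub>R x)) (\<lambda>x. c *\<^sub>R g (t + c *\<^sub>R x))"
proof -
  have l: "locally_integrable u" "locally_integrable g" using u by (auto simp: has_weak_gradient_iff)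
  have la: "locally_integrable (\<lambda>x. f (t + c *\<^sub>R x))" if f: "locally_integrable f" for f :: "plane \<Rightarrow> 'b::euclidean_space"
    unfolding locally_integrable_def set_integrable_def
  proof (intro conjI allI impI)
    note m = locally_integrable_meas[OF f]
    show "(\<lambda>x. f (t + c *\<^sub>R x)) \<in> borel_measurable lebesgue" using m affine_measurable[OF c, of t] by measurable
    fix K :: "plane set" assume K: "compact K"
    define L where "L = (\<lambda>x. t + c *\<^sub>R x) ` K"
    have L: "compact L" unfolding L_def by (intro compact_continuous_image K continuous_intros)
    have e: "indicator L (t + c *\<^sub>R x) = (indicator K x :: real)" for x
      using c by (auto simp: L_def indicator_def)
    have i: "integrable lebesgue (\<lambda>x. indicator L x *\<^sub>R f x)" by (rule locally_integrable_set[OF f L])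
    then have "integrable lebesgue (\<lambda>x. indicator L (t + c *\<^sub>R x) *\<^sub>R f (t + c *\<^sub>R x))"
      by (subst integrable_affine_iff[OF c, of "\<lambda>x. indicator L x *\<^sub>R f x"]) auto
    then show "integrable lebesgue (\<lambda>x. indicator K x *\<^sub>R f (t + c *\<^sub>R x))" by (simp only: e)
  qed
  show ?thesis unfolding has_weak_gradient_iff
  proof (intro conjI ballI allI)
    show "locally_integrable (\<lambda>x. u (t + c *\<^sub>R x))" "locally_integrable (\<lambda>x. c *\<^sub>R g (t + c *\<^sub>R x))"
      by (intro locally_integrable_cscale la l)+
    fix \<phi> i assume \<phi>: "\<phi> \<in> test_functions"
    define \<psi> where "\<psi> = (\<lambda>x. \<phi> ((1/c) *\<^sub>R x + (- (1/c)) *\<^sub>R t))"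
    have \<psi>: "\<psi> \<in> test_functions" unfolding \<psi>_def using c by (intro test_affine \<phi>) auto
    have e: "\<psi> (t + c *\<^sub>R x) = \<phi> x" for x using c by (simp add: \<psi>_def scaleR_add_right)
    have pe: "pd i \<psi> (t + c *\<^sub>R x) = (1/c) * pd i \<phi> x" for x
      using c unfolding \<psi>_def by (subst pd_affine[OF test_smooth[OF \<phi>]]) (simp add: scaleR_add_right)
    have "(\<integral>x. pd i \<psi> x *\<^sub>R u x \<partial>lebesgue) = c^2 *\<^sub>R (\<integral>x. pd i \<psi> (t + c *\<^sub>R x) *\<^sub>R u (t + c *\<^sub>R x) \<partial>lebesgue)"
      by (rule integral_affine[OF c]) (auto intro!: borel_measurable_scaleR test_meas test_pd \<psi> intro: locally_integrable_meas l)
    moreover have "(\<integral>x. \<psi> x *\<^sub>R (g x $ i) \<partial>lebesgue) = c^2 *\<^sub>R (\<integral>x. \<psi> (t + c *\<^sub>R x) *\<^sub>R (g (t + c *\<^sub>R x) $ i) \<partial>lebesgue)"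
      by (rule integral_affine[OF c, of "\<lambda>x. \<psi> x *\<^sub>R (g x $ i)"])
        (auto intro!: borel_measurable_scaleR test_meas \<psi> borel_measurable_vec_nth intro: locally_integrable_meas l)
    moreover have "(\<integral>x. pd i \<psi> x *\<^sub>R u x \<partial>lebesgue) = - (\<integral>x. \<psi> x *\<^sub>R (g x $ i) \<partial>lebesgue)"
      using u \<psi> by (simp add: has_weak_gradient_iff)
    ultimately have "c^2 *\<^sub>R (\<integral>x. (1/c) *\<^sub>R (pd i \<phi> x *\<^sub>R u (t + c *\<^sub>R x)) \<partial>lebesgue) =
        c^2 *\<^sub>R (- (\<integral>x. \<phi> x *\<^sub>R (g (t + c *\<^sub>R x) $ i) \<partial>lebesgue))"
      by (simp add: e pe)
    then have "(1/c) *\<^sub>R (\<integral>x. pd i \<phi> x *\<^sub>R u (t + c *\<^sub>R x) \<partial>lebesgue) = - (\<integral>x. \<phi> x *\<^sub>R (g (t + c *\<^sub>R x) $ i) \<partial>lebesgue)"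
      using c by (simp only: integral_scaleR_right scaleR_cancel_left) simp
    then have "c *\<^sub>R ((1/c) *\<^sub>R (\<integral>x. pd i \<phi> x *\<^sub>R u (t + c *\<^sub>R x) \<partial>lebesgue)) = c *\<^sub>R (- (\<integral>x. \<phi> x *\<^sub>R (g (t + c *\<^sub>R x) $ i) \<partial>lebesgue))"
      by simp
    then have "(\<integral>x. pd i \<phi> x *\<^sub>R u (t + c *\<^sub>R x) \<partial>lebesgue) = - (c *\<^sub>R (\<integral>x. \<phi> x *\<^sub>R (g (t + c *\<^sub>R x) $ i) \<partial>lebesgue))"
      using c by simp
    also have "c *\<^sub>R (\<integral>x. \<phi> x *\<^sub>R (g (t + c *\<^sub>R x) $ i) \<partial>lebesgue) = (\<integral>x. \<phi> x *\<^sub>R ((c *\<^sub>R g (t + c *\<^sub>R x)) $ i) \<partial>lebesgue)"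
      by (subst integral_scaleR_right[symmetric]) (simp add: mult.commute)
    finally show "(\<integral>x. pd i \<phi> x *\<^sub>R u (t + c *\<^sub>R x) \<partial>lebesgue) = - (\<integral>x. \<phi> x *\<^sub>R ((c *\<^sub>R g (t + c *\<^sub>R x)) $ i) \<partial>lebesgue)" .
  qed
qed

section \<open>Regularization\<close>

text \<open>Correlation with \<open>\<phi>\<close>, which is convolution for the radial kernels
  \<open>moll d\<close>. Without a reflection of the argument, the kernel is a plain translate of
  \<open>\<phi>\<close> in the integration variable, hence itself a test function to which the
  definition of weak gradients applies.\<close>

definition corr :: "(plane \<Rightarrow> real) \<Rightarrow> (plane \<Rightarrow> 'b::euclidean_space) \<Rightarrow> plane \<Rightarrow> 'b" where
  "corr \<phi> u z = (\<integral>x. \<phi> (x - z) *\<^sub>R u x \<partial>lebesgue)"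

lemma test_shift: "\<phi> \<in> test_functions \<Longrightarrow> (\<lambda>x. \<phi> (x - z)) \<in> test_functions"
  using test_affine[of \<phi> 1 "- z"] by simp

lemma pd_shift: "\<phi> \<in> test_functions \<Longrightarrow> pd i (\<lambda>x. \<phi> (x - z)) x = pd i \<phi> (x - z)"
  using pd_affine[OF test_smooth, of \<phi> i 1 "- z" x] by simp

lemma frechet_pd:
  assumes "smooth \<phi>" shows "frechet_derivative \<phi> (at x) v = (\<Sum>i\<in>UNIV. v $ i * pd i \<phi> x)"
proof -
  have l: "linear (frechet_derivative \<phi> (at x))"
    using smooth_has_derivative[OF assms] by (rule has_derivative_linear)
  have "v = (\<Sum>i\<in>UNIV. v $ i *\<^sub>R axis i 1)"
    by (simp add: vec_eq_iff axis_def if_distrib cong: if_cong)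
  then have "frechet_derivative \<phi> (at x) v = frechet_derivative \<phi> (at x) (\<Sum>i\<in>UNIV. v $ i *\<^sub>R axis i 1)" by simp
  also have "\<dots> = (\<Sum>i\<in>UNIV. v $ i * pd i \<phi> x)"
    by (simp add: linear_sum[OF l] linear_cmul[OF l] pd_def)
  finally show ?thesis .
qed

lemma test_lipschitz:
  assumes \<phi>: "\<phi> \<in> test_functions" shows "\<exists>L>0. \<forall>x y. \<bar>\<phi> x - \<phi> y\<bar> \<le> L * norm (x - y)"
proof -
  have "\<exists>C. C > 0 \<and> (\<forall>x. \<bar>pd i \<phi> x\<bar> \<le> C)" for i using test_bounded[OF test_pd[OF \<phi>]] by metis
  then obtain C where C: "\<And>i. C i > 0" "\<And>i x. \<bar>pd i \<phi> x\<bar> \<le> C i" by metis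
  define L where "L = (\<Sum>i\<in>UNIV. C i)"
  have L: "L > 0" unfolding L_def by (intro sum_pos C) auto
  have "norm (\<phi> x - \<phi> y) \<le> L * norm (x - y)" for x y
  proof (rule differentiable_bound[OF convex_UNIV])
    show "(\<phi> has_derivative frechet_derivative \<phi> (at x)) (at x within UNIV)" for x
      using smooth_has_derivative[OF test_smooth[OF \<phi>]] by simp
    show "onorm (frechet_derivative \<phi> (at x)) \<le> L" for x
    proof (rule onorm_le)
      fix v
      have "norm (frechet_derivative \<phi> (at x) v) \<le> (\<Sum>i\<in>UNIV. \<bar>v $ i * pd i \<phi> x\<bar>)"
        unfolding frechet_pd[OF test_smooth[OF \<phi>]] real_norm_def by (rule sum_abs)
      also have "\<dots> \<le> (\<Sum>i\<in>UNIV. norm v * C i)"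
        by (intro sum_mono) (auto simp: abs_mult intro!: mult_mono C component_le_norm_cart)
      finally show "norm (frechet_derivative \<phi> (at x) v) \<le> L * norm v" by (simp add: L_def sum_distrib_left mult.commute)
    qed
  qed auto
  with L show ?thesis by auto
qed

lemma corr_dominated_convergence:
  fixes u :: "plane \<Rightarrow> 'b::euclidean_space"
  assumes u: "locally_integrable u" and h: "\<And>n. h n \<in> borel_measurable lebesgue"
    and bd: "\<And>n x. \<bar>h n x\<bar> \<le> C" "\<And>n x. norm x > R \<Longrightarrow> h n x = 0"
    and lim: "\<And>x. (\<lambda>n. h n x) \<longlonglongrightarrow> k x"
  shows "(\<lambda>n. \<integral>x. h n x *\<^sub>R u x \<partial>lebesgue) \<longlonglongrightarrow> (\<integral>x. k x *\<^sub>R u x \<partial>lebesgue)"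
proof (rule integral_dominated_convergence)
  show "integrable lebesgue (\<lambda>x. C * norm (indicator (cball 0 R) x *\<^sub>R u x))"
    using locally_integrable_set[OF u compact_cball] by (intro integrable_mult_right integrable_norm)
  show "AE x in lebesgue. (\<lambda>n. h n x *\<^sub>R u x) \<longlonglongrightarrow> k x *\<^sub>R u x" by (intro AE_I2 tendsto_intros lim)
  have "k \<in> borel_measurable lebesgue" by (rule borel_measurable_LIMSEQ_real[OF lim h])
  then show "(\<lambda>x. k x *\<^sub>R u x) \<in> borel_measurable lebesgue" "\<And>n. (\<lambda>x. h n x *\<^sub>R u x) \<in> borel_measurable lebesgue"
    using h locally_integrable_meas[OF u] by auto
  show "AE x in lebesgue. norm (h n x *\<^sub>R u x) \<le> C * norm (indicator (cball 0 R) x *\<^sub>R u x)" for n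
  proof (rule AE_I2)
    fix x
    show "norm (h n x *\<^sub>R u x) \<le> C * norm (indicator (cball 0 R) x *\<^sub>R u x)"
      using bd(1)[of n x] bd(2)[of x n] by (cases "norm x \<le> R") (auto intro!: mult_right_mono)
  qed
qed

lemma test_shift_support:
  assumes "\<phi> \<in> test_functions"
  shows "\<exists>R>0. \<forall>x z. norm z \<le> B \<longrightarrow> norm x > R \<longrightarrow> \<phi> (x - z) = 0"
proof -
  obtain R where R: "R > 0" "\<forall>x. R \<le> norm x \<longrightarrow> \<phi> x = 0 \<and> (\<forall>i. pd i \<phi> x = 0)"
    using test_bounded_support[OF assms] by blast
  have "\<phi> (x - z) = 0" if "norm z \<le> B" "norm x > R + \<bar>B\<bar>" for x z
    using R(2) norm_triangle_ineq2[of x z] that by auto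
  then show ?thesis using R(1) by (intro exI[of _ "R + \<bar>B\<bar>"]) auto
qed

lemma corr_continuous:
  fixes u :: "plane \<Rightarrow> 'b::euclidean_space"
  assumes \<phi>: "\<phi> \<in> test_functions" and u: "locally_integrable u"
  shows "continuous_on UNIV (corr \<phi> u)"
proof -
  have "(corr \<phi> u \<circ> x) \<longlonglongrightarrow> corr \<phi> u a" if x: "x \<longlonglongrightarrow> a" for x a
  proof -
    have "Bseq x" using x by (intro convergent_imp_Bseq convergentI)
    then obtain B where B: "\<And>n. norm (x n) \<le> B" unfolding Bseq_def by blast
    obtain R where R: "R > 0" "\<forall>y z. norm z \<le> B \<longrightarrow> norm y > R \<longrightarrow> \<phi> (y - z) = 0"
      using test_shift_support[OF \<phi>, of B] by blast
    obtain C where C: "C > 0" "\<And>x. \<bar>\<phi> x\<bar> \<le> C" using test_bounded[OF \<phi>] by metis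
    show ?thesis unfolding corr_def o_def
    proof (rule corr_dominated_convergence[OF u, of _ C R])
      have "isCont \<phi> y" for y using test_continuous[OF \<phi>] by (simp add: continuous_on_eq_continuous_at)
      then show "(\<lambda>n. \<phi> (y - x n)) \<longlonglongrightarrow> \<phi> (y - a)" for y
        by (rule isCont_tendsto_compose) (intro tendsto_intros x)
    qed (use R B C test_meas[OF test_shift[OF \<phi>]] in auto)
  qed
  then show ?thesis by (auto simp: continuous_on_sequentially)
qed

lemma has_vector_derivativeI_quotient:
  fixes F :: "real \<Rightarrow> 'b::real_normed_vector"
  assumes "((\<lambda>s. (F s - F t) /\<^sub>R (s - t)) \<longlongrightarrow> D) (at t)"
  shows "(F has_vector_derivative D) (at t)"
  unfolding has_vector_derivative_def has_derivative_at2
proof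
  show "bounded_linear (\<lambda>x. x *\<^sub>R D)" by (rule bounded_linear_scaleR_left)
  have "((\<lambda>s. norm ((F s - F t) /\<^sub>R (s - t) - D)) \<longlongrightarrow> 0) (at t)"
    using assms by (simp add: LIM_zero tendsto_norm_zero)
  then show "((\<lambda>s. (1 / norm (s - t)) *\<^sub>R (F s - (F t + (s - t) *\<^sub>R D))) \<longlongrightarrow> 0) (at t)"
  proof (rule tendsto_norm_zero_cancel[OF Lim_transform_eventually])
    show "\<forall>\<^sub>F s in at t. norm ((F s - F t) /\<^sub>R (s - t) - D) = norm ((1 / norm (s - t)) *\<^sub>R (F s - (F t + (s - t) *\<^sub>R D)))"
      unfolding eventually_at_filter
    proof (rule always_eventually, intro allI impI)
      fix s assume "s \<noteq> t"
      then have "(F s - F t) /\<^sub>R (s - t) - D = (1 / (s - t)) *\<^sub>R (F s - (F t + (s - t) *\<^sub>R D))"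
        by (simp add: scaleR_diff_right scaleR_add_right inverse_eq_divide)
      then show "norm ((F s - F t) /\<^sub>R (s - t) - D) = norm ((1 / norm (s - t)) *\<^sub>R (F s - (F t + (s - t) *\<^sub>R D)))"
        by simp
    qed
  qed
qed

text \<open>Differentiation under the integral, with the Lipschitz bound of \<open>\<phi>\<close>
  dominating the difference quotients. Derivatives along lines suffice, both for the translation
  estimate and for the one-dimensional integrations behind the Sobolev inequality.\<close>

lemma corr_deriv_pd:
  fixes u :: "plane \<Rightarrow> 'b::euclidean_space"
  assumes \<phi>: "\<phi> \<in> test_functions" and u: "locally_integrable u"
  shows "((\<lambda>t. corr \<phi> u (z + t *\<^sub>R v)) has_vector_derivative
           - (\<Sum>i\<in>UNIV. v $ i *\<^sub>R corr (pd i \<phi>) u (z + t *\<^sub>R v))) (at t)"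
proof -
  let ?k = "\<lambda>x. - (\<Sum>i\<in>UNIV. v $ i * pd i \<phi> (x - (z + t *\<^sub>R v)))"
  obtain L where L: "L > 0" "\<And>x y. \<bar>\<phi> x - \<phi> y\<bar> \<le> L * norm (x - y)" using test_lipschitz[OF \<phi>] by auto
  have fi: "integrable lebesgue (\<lambda>x. \<phi> (x - w) *\<^sub>R u x)" for w
    by (rule test_scaleR_integrable[OF u test_shift[OF \<phi>]])
  have "((\<lambda>s. (corr \<phi> u (z + s *\<^sub>R v) - corr \<phi> u (z + t *\<^sub>R v)) /\<^sub>R (s - t)) \<longlongrightarrow> (\<integral>x. ?k x *\<^sub>R u x \<partial>lebesgue)) (at t)"
    unfolding tendsto_at_iff_sequentially
  proof (intro allI impI)
    fix X :: "nat \<Rightarrow> real" assume X: "\<forall>i. X i \<in> UNIV - {t}" "X \<longlonglongrightarrow> t"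
    have Xt: "X n \<noteq> t" for n using X(1) by auto
    have "Bseq (\<lambda>n. z + X n *\<^sub>R v)" using X(2)
      by (intro convergent_imp_Bseq convergentI[of _ "z + t *\<^sub>R v"] tendsto_intros)
    then obtain B where B: "\<And>n. norm (z + X n *\<^sub>R v) \<le> B" unfolding Bseq_def by blast
    obtain R where R: "R > 0" "\<forall>y w. norm w \<le> max B (norm (z + t *\<^sub>R v)) \<longrightarrow> norm y > R \<longrightarrow> \<phi> (y - w) = 0"
      using test_shift_support[OF \<phi>, of "max B (norm (z + t *\<^sub>R v))"] by blast
    let ?h = "\<lambda>n x. (\<phi> (x - (z + X n *\<^sub>R v)) - \<phi> (x - (z + t *\<^sub>R v))) / (X n - t)"
    have "(\<lambda>n. \<integral>x. ?h n x *\<^sub>R u x \<partial>lebesgue) \<longlonglongrightarrow> (\<integral>x. ?k x *\<^sub>R u x \<partial>lebesgue)"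
    proof (rule corr_dominated_convergence[OF u, of ?h "L * norm v" R])
      show "?h n \<in> borel_measurable lebesgue" for n
        using test_meas[OF test_shift[OF \<phi>]] by auto
      show "\<bar>?h n x\<bar> \<le> L * norm v" for n x
      proof -
        have e: "x - (z + X n *\<^sub>R v) - (x - (z + t *\<^sub>R v)) = (t - X n) *\<^sub>R v" by (simp add: algebra_simps)
        have "\<bar>\<phi> (x - (z + X n *\<^sub>R v)) - \<phi> (x - (z + t *\<^sub>R v))\<bar> \<le> L * (\<bar>t - X n\<bar> * norm v)"
          using L(2)[of "x - (z + X n *\<^sub>R v)" "x - (z + t *\<^sub>R v)"] unfolding e by simp
        then show ?thesis using Xt[of n] by (simp add: field_simps abs_minus_commute)
      qed
      show "?h n x = 0" if "norm x > R" for n x using R(2) B[of n] that by (simp add: le_max_iff_disj)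
      show "(\<lambda>n. ?h n x) \<longlonglongrightarrow> ?k x" for x
      proof -
        have "((\<lambda>s. \<phi> (x - (z + s *\<^sub>R v))) has_derivative
           (\<lambda>h. frechet_derivative \<phi> (at (x - (z + t *\<^sub>R v))) (- (h *\<^sub>R v)))) (at t)"
          by (rule has_derivative_compose[OF _ smooth_has_derivative[OF test_smooth[OF \<phi>]]])
            (auto intro!: derivative_eq_intros)
        moreover have "(\<lambda>h. frechet_derivative \<phi> (at (x - (z + t *\<^sub>R v))) (- (h *\<^sub>R v))) = times (?k x)"
          by (rule ext) (simp add: frechet_pd[OF test_smooth[OF \<phi>]] sum_distrib_left sum_distrib_right sum_negf mult_ac)
        ultimately have "((\<lambda>s. \<phi> (x - (z + s *\<^sub>R v))) has_real_derivative ?k x) (at t)"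
          unfolding has_field_derivative_def by simp
        then show ?thesis using X Xt
          unfolding has_field_derivative_iff tendsto_at_iff_sequentially by (auto simp: o_def)
      qed
    qed
    moreover have "(\<integral>x. ?h n x *\<^sub>R u x \<partial>lebesgue) = (corr \<phi> u (z + X n *\<^sub>R v) - corr \<phi> u (z + t *\<^sub>R v)) /\<^sub>R (X n - t)" for n
    proof -
      have "(\<lambda>x. ?h n x *\<^sub>R u x) = (\<lambda>x. (\<phi> (x - (z + X n *\<^sub>R v)) *\<^sub>R u x - \<phi> (x - (z + t *\<^sub>R v)) *\<^sub>R u x) /\<^sub>R (X n - t))"
        by (simp add: fun_eq_iff divide_inverse scaleR_diff_left[symmetric] mult.commute)
      then show ?thesis unfolding corr_def using fi by simp
    qed
    ultimately show "((\<lambda>s. (corr \<phi> u (z + s *\<^sub>R v) - corr \<phi> u (z + t *\<^sub>R v)) /\<^sub>R (s - t)) \<circ> X) \<longlonglongrightarrow> (\<integral>x. ?k x *\<^sub>R u x \<partial>lebesgue)"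
      by (simp add: o_def)
  qed
  then have "((\<lambda>t. corr \<phi> u (z + t *\<^sub>R v)) has_vector_derivative (\<integral>x. ?k x *\<^sub>R u x \<partial>lebesgue)) (at t)"
    by (rule has_vector_derivativeI_quotient)
  moreover have "(\<integral>x. ?k x *\<^sub>R u x \<partial>lebesgue) = - (\<Sum>i\<in>UNIV. v $ i *\<^sub>R corr (pd i \<phi>) u (z + t *\<^sub>R v))"
  proof -
    have "(\<integral>x. ?k x *\<^sub>R u x \<partial>lebesgue) = (\<integral>x. - (\<Sum>i\<in>UNIV. v $ i *\<^sub>R (pd i \<phi> (x - (z + t *\<^sub>R v)) *\<^sub>R u x)) \<partial>lebesgue)"
      by (simp add: scaleR_sum_left)
    also have "\<dots> = - (\<Sum>i\<in>UNIV. v $ i *\<^sub>R corr (pd i \<phi>) u (z + t *\<^sub>R v))"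
    proof -
      have "integrable lebesgue (\<lambda>x. v $ i *\<^sub>R (pd i \<phi> (x - (z + t *\<^sub>R v)) *\<^sub>R u x))" for i
        by (intro integrable_scaleR_right test_scaleR_integrable[OF u test_shift[OF test_pd[OF \<phi>]]])
      then show ?thesis unfolding corr_def
        by (simp only: integral_minus Bochner_Integration.integral_sum integral_scaleR_right)
    qed
    finally show ?thesis .
  qed
  ultimately show ?thesis by simp
qed

text \<open>The derivative falling on \<open>\<phi>\<close> is moved onto \<open>u\<close> by the
  definition of the weak gradient: regularization commutes with differentiation.\<close>

lemma corr_deriv:
  assumes \<phi>: "\<phi> \<in> test_functions" and u: "has_weak_gradient u g"
  shows "((\<lambda>t. corr \<phi> u (z + t *\<^sub>R v)) has_vector_derivative
           (\<Sum>i\<in>UNIV. v $ i *\<^sub>R corr \<phi> (\<lambda>x. g x $ i) (z + t *\<^sub>R v))) (at t)"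
proof -
  have "corr (pd i \<phi>) u w = - corr \<phi> (\<lambda>x. g x $ i) w" for i w
  proof -
    have "(\<integral>x. pd i (\<lambda>x. \<phi> (x - w)) x *\<^sub>R u x \<partial>lebesgue) = - (\<integral>x. \<phi> (x - w) *\<^sub>R (g x $ i) \<partial>lebesgue)"
      using u test_shift[OF \<phi>] unfolding has_weak_gradient_iff by blast
    then show ?thesis by (simp add: corr_def pd_shift[OF \<phi>])
  qed
  moreover have "locally_integrable u" using u by (simp add: has_weak_gradient_iff)
  ultimately show ?thesis using corr_deriv_pd[OF \<phi>, of u z v t] by (simp add: sum_negf)
qed

section \<open>Translations, density of test functions and duality\<close>

lemma L2_translate:
  fixes f :: "plane \<Rightarrow> 'b::euclidean_space"
  assumes "f \<in> Lp 2" shows "(\<lambda>x. f (x + h)) \<in> Lp 2" "nsq (\<lambda>x. f (x + h)) = nsq f"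
proof -
  have m: "f \<in> borel_measurable lebesgue" using L2_meas[OF assms] .
  have m2: "(\<lambda>x. (norm (f x))^2) \<in> borel_measurable lebesgue" using m by simp
  have "(\<lambda>x. f (h + 1 *\<^sub>R x)) \<in> borel_measurable lebesgue"
    using m affine_measurable[of 1 h] by measurable
  moreover have "integrable lebesgue (\<lambda>x. (norm (f (h + 1 *\<^sub>R x)))^2)"
    by (subst integrable_affine_iff[OF _ m2]) (use L2_int[OF assms] in auto)
  ultimately show "(\<lambda>x. f (x + h)) \<in> Lp 2" by (intro L2_I) (simp_all add: add.commute)
  show "nsq (\<lambda>x. f (x + h)) = nsq f"
    unfolding nsq_def using integral_affine[OF _ m2, of 1 h] by (simp add: add.commute)
qed

lemma corr_bound:
  fixes u :: "plane \<Rightarrow> 'b::euclidean_space"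
  assumes \<phi>: "\<phi> \<in> test_functions" and u: "u \<in> Lp 2"
  shows "norm (corr \<phi> u z) \<le> sqrt (nsq \<phi>) * sqrt (nsq u)"
proof -
  have t: "(\<lambda>x. \<phi> (x - z)) \<in> Lp 2" "nsq (\<lambda>x. \<phi> (x - z)) = nsq \<phi>"
    using L2_translate[OF test_L2[OF \<phi>], of "- z"] by auto
  have "norm (corr \<phi> u z) \<le> (\<integral>x. norm (\<phi> (x - z) *\<^sub>R u x) \<partial>lebesgue)"
    unfolding corr_def by (rule integral_norm_bound)
  also have "\<dots> \<le> sqrt (nsq (\<lambda>x. \<phi> (x - z))) * sqrt (nsq u)"
    using CS_integral[OF t(1) u] by simp
  finally show ?thesis by (simp add: t)
qed

lemma corr_translate:
  fixes u :: "plane \<Rightarrow> 'b::euclidean_space"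
  assumes u: "locally_integrable u" and \<phi>: "\<phi> \<in> test_functions"
  shows "corr \<phi> u z = (\<integral>x. \<phi> x *\<^sub>R u (x + z) \<partial>lebesgue)"
  unfolding corr_def
  using integral_affine[of 1 "\<lambda>x. \<phi> (x - z) *\<^sub>R u x" z] test_scaleR_integrable[OF u test_shift[OF \<phi>, of z]]
  by (simp add: add.commute)

text \<open>Density by duality: the sequence representing the functional \<open>ip f\<close> on test
  functions is Cauchy, and its limit differs from \<open>f\<close> by a function orthogonal to all
  test functions, which is null by the fundamental lemma.\<close>

lemma test_dense:
  assumes f: "f \<in> Lp 2"
  shows "\<exists>\<psi>. (\<forall>n. \<psi> n \<in> test_functions) \<and> (\<lambda>n. nsq (\<lambda>x. \<psi> n x - f x)) \<longlonglongrightarrow> 0"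
proof -
  have tl: "(\<lambda>x. a *\<^sub>R \<phi> x + b *\<^sub>R \<psi> x) \<in> test_functions" if "\<phi> \<in> test_functions" "\<psi> \<in> test_functions" for a b \<phi> \<psi>
    using test_add[OF test_scale[OF that(1), of a] test_scale[OF that(2), of b]] by simp
  obtain s where s: "\<And>n. s n \<in> test_functions"
    "\<And>e. e > 0 \<Longrightarrow> \<exists>N. \<forall>m\<ge>N. \<forall>n\<ge>N. ip (\<lambda>x. s m x - s n x) (\<lambda>x. s m x - s n x) < e"
    "\<And>v. v \<in> test_functions \<Longrightarrow> (\<lambda>n. ip (s n) v) \<longlonglongrightarrow> ip f v"
  proof (rule riesz_sequence[of test_functions ip "ip f" "nsq f"])
    show "test_functions \<noteq> {}" using test_cutoff[of 1 0] by auto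
    show "(ip f u)^2 \<le> nsq f * ip u u" if "u \<in> test_functions" for u
      using ip_CS[OF f test_L2[OF that]] by (simp add: ip_self)
    show "ip (\<lambda>x. a *\<^sub>R u x + b *\<^sub>R v x) w = a * ip u w + b * ip v w"
      if "u \<in> test_functions" "v \<in> test_functions" "w \<in> test_functions" for u v w a b
      by (simp only: ip_add_left L2_scaleR test_L2 that ip_scaleR_left)
    show "ip f (\<lambda>x. a *\<^sub>R u x + b *\<^sub>R v x) = a * ip f u + b * ip f v"
      if "u \<in> test_functions" "v \<in> test_functions" for u v a b
      by (simp only: ip_add_right L2_scaleR test_L2 that ip_scaleR_right f)
  qed (use tl in \<open>auto simp: ip_self intro: ip_commute\<close>)
  have "\<exists>g\<in>Lp 2. (\<lambda>n. nsq (\<lambda>x. s n x - g x)) \<longlonglongrightarrow> 0"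
    by (rule L2_complete) (use s(2) in \<open>auto simp: test_L2 s(1) ip_self\<close>)
  then obtain g where g: "g \<in> Lp 2" "(\<lambda>n. nsq (\<lambda>x. s n x - g x)) \<longlonglongrightarrow> 0" by blast
  have "AE x in lebesgue. g x - f x = 0"
  proof (rule ae_zero_if_test_zero)
    show "locally_integrable (\<lambda>x. g x - f x)" by (intro locally_integrable_L2 L2_diff g f)
    fix \<phi> assume \<phi>: "\<phi> \<in> test_functions"
    have "ip g \<phi> = ip f \<phi>"
      using LIMSEQ_unique[OF ip_tendsto[OF test_L2[OF s(1)] g(1) test_L2[OF \<phi>] g(2)] s(3)[OF \<phi>]] .
    then have "ip (\<lambda>x. g x - f x) \<phi> = 0" by (simp add: ip_diff_left g f test_L2 \<phi>)
    then show "(\<integral>x. \<phi> x *\<^sub>R (g x - f x) \<partial>lebesgue) = 0" by (simp add: ip_def mult.commute)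
  qed
  then have "nsq (\<lambda>x. s n x - g x) = nsq (\<lambda>x. s n x - f x)" for n
    using L2_meas[OF L2_diff[OF test_L2[OF s(1)] g(1)]] L2_meas[OF L2_diff[OF test_L2[OF s(1)] f]]
    by (intro nsq_cong_AE) auto
  then show ?thesis using s(1) g(2) by auto
qed

text \<open>Density allows \<open>\<psi>\<close> to approach \<open>f\<close> itself. Test functions
  are real, so complex functions are treated through their real and imaginary parts.\<close>

lemma nsq_le_dual:
  fixes f :: "plane \<Rightarrow> real"
  assumes f: "f \<in> Lp 2" and B: "0 \<le> B" "\<And>\<psi>. \<psi> \<in> test_functions \<Longrightarrow> \<bar>ip f \<psi>\<bar> \<le> B * sqrt (nsq \<psi>)"
  shows "nsq f \<le> B^2"
proof -
  obtain \<psi> where \<psi>: "\<And>n. \<psi> n \<in> test_functions" "(\<lambda>n. nsq (\<lambda>x. \<psi> n x - f x)) \<longlonglongrightarrow> 0"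
    using test_dense[OF f] by blast
  have "(\<lambda>n. \<bar>ip (\<psi> n) f\<bar>) \<longlonglongrightarrow> \<bar>ip f f\<bar>"
    by (intro tendsto_intros ip_tendsto test_L2 \<psi> f)
  moreover have "(\<lambda>n. B * sqrt (nsq (\<psi> n))) \<longlonglongrightarrow> B * sqrt (nsq f)"
    by (intro tendsto_intros nsq_tendsto test_L2 \<psi> f)
  ultimately have "\<bar>ip f f\<bar> \<le> B * sqrt (nsq f)"
    by (rule LIMSEQ_le) (use B(2)[OF \<psi>(1)] in \<open>auto simp: ip_commute[of _ f]\<close>)
  then have *: "sqrt (nsq f) * sqrt (nsq f) \<le> B * sqrt (nsq f)" by (simp add: ip_self)
  have "sqrt (nsq f) \<le> B"
  proof (cases "nsq f = 0")
    case False
    then have "0 < sqrt (nsq f)" using nsq_nonneg[of f] by (simp add: less_le)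
    with * show ?thesis by (rule mult_right_le_imp_le)
  qed (use B in simp)
  then show ?thesis using sqrt_le_D by blast
qed

lemma nsq_complex:
  fixes f :: "plane \<Rightarrow> complex"
  assumes "f \<in> Lp 2"
  shows "(\<lambda>x. Re (f x)) \<in> Lp 2" "(\<lambda>x. Im (f x)) \<in> Lp 2" "nsq f = nsq (\<lambda>x. Re (f x)) + nsq (\<lambda>x. Im (f x))"
proof -
  have [measurable]: "f \<in> borel_measurable lebesgue" by (rule L2_meas[OF assms])
  show r: "(\<lambda>x. Re (f x)) \<in> Lp 2" by (rule L2_dominated[OF assms, of _ 1]) (auto simp: abs_Re_le_cmod)
  show i: "(\<lambda>x. Im (f x)) \<in> Lp 2" by (rule L2_dominated[OF assms, of _ 1]) (auto simp: abs_Im_le_cmod)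
  show "nsq f = nsq (\<lambda>x. Re (f x)) + nsq (\<lambda>x. Im (f x))"
    using L2_int[OF r] L2_int[OF i] by (simp add: nsq_def cmod_power2)
qed

lemma L2_nth:
  fixes g :: "plane \<Rightarrow> complex ^ 2"
  assumes "g \<in> Lp 2" shows "(\<lambda>x. g x $ i) \<in> Lp 2" "nsq (\<lambda>x. g x $ i) \<le> nsq g"
proof -
  show l: "(\<lambda>x. g x $ i) \<in> Lp 2"
    by (rule L2_dominated[OF assms, of _ 1])
      (auto intro!: borel_measurable_vec_nth intro: L2_meas assms simp: Finite_Cartesian_Product.norm_nth_le)
  show "nsq (\<lambda>x. g x $ i) \<le> nsq g" unfolding nsq_def
    by (rule integral_mono) (auto intro!: L2_int l assms power_mono simp: Finite_Cartesian_Product.norm_nth_le)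
qed

text \<open>Tested with \<psi>, the increment \<open>u (x + h) - u x\<close> is the increment of
  \<open>corr \<psi> u\<close> along the segment from 0 to \<open>h\<close>, and the derivative
  there involves only the weak gradient; the norm is then recovered by duality. The two coordinates
  give the factor 2 in \<open>B\<close>, and the real and imaginary parts double \<open>B^2\<close>,
  whence 8.\<close>

lemma translation_estimate:
  assumes u: "u \<in> Lp 2" and g: "g \<in> Lp 2" "has_weak_gradient u g"
  shows "nsq (\<lambda>x. u (x + h) - u x) \<le> 8 * (norm h)^2 * nsq g"
proof -
  define B where "B = 2 * norm h * sqrt (nsq g)"
  have B0: "0 \<le> B" by (simp add: B_def)
  have loc: "locally_integrable u" by (rule locally_integrable_L2[OF u])
  let ?f = "\<lambda>x. u (x + h) - u x"
  have f: "?f \<in> Lp 2" by (intro L2_diff L2_translate u)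
  have key: "norm (\<integral>x. \<psi> x *\<^sub>R ?f x \<partial>lebesgue) \<le> B * sqrt (nsq \<psi>)" if \<psi>: "\<psi> \<in> test_functions" for \<psi>
  proof -
    let ?F = "\<lambda>t. corr \<psi> u (0 + t *\<^sub>R h)"
    have "norm (?F 1 - ?F 0) \<le> B * sqrt (nsq \<psi>) * norm (1 - (0::real))"
    proof (rule differentiable_bound[of "{0..1}" ?F "\<lambda>t s. s *\<^sub>R (\<Sum>i\<in>UNIV. h $ i *\<^sub>R corr \<psi> (\<lambda>x. g x $ i) (0 + t *\<^sub>R h))"])
      show "(?F has_derivative (\<lambda>s. s *\<^sub>R (\<Sum>i\<in>UNIV. h $ i *\<^sub>R corr \<psi> (\<lambda>x. g x $ i) (0 + t *\<^sub>R h)))) (at t within {0..1})" for t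
        using corr_deriv[OF \<psi> g(2), of 0 h t] unfolding has_vector_derivative_def
        by (rule has_derivative_at_withinI)
      show "onorm (\<lambda>s. s *\<^sub>R (\<Sum>i\<in>UNIV. h $ i *\<^sub>R corr \<psi> (\<lambda>x. g x $ i) (0 + t *\<^sub>R h))) \<le> B * sqrt (nsq \<psi>)" for t :: real
      proof (rule onorm_le)
        fix s :: real
        have "norm (\<Sum>i\<in>UNIV. h $ i *\<^sub>R corr \<psi> (\<lambda>x. g x $ i) (0 + t *\<^sub>R h))
          \<le> (\<Sum>i\<in>(UNIV::2 set). norm h * (sqrt (nsq \<psi>) * sqrt (nsq g)))"
        proof (rule sum_norm_le)
          fix i
          have "norm (corr \<psi> (\<lambda>x. g x $ i) (0 + t *\<^sub>R h)) \<le> sqrt (nsq \<psi>) * sqrt (nsq (\<lambda>x. g x $ i))"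
            by (rule corr_bound[OF \<psi> L2_nth(1)[OF g(1)]])
          also have "\<dots> \<le> sqrt (nsq \<psi>) * sqrt (nsq g)" by (intro mult_left_mono real_sqrt_le_mono L2_nth g) auto
          finally show "norm (h $ i *\<^sub>R corr \<psi> (\<lambda>x. g x $ i) (0 + t *\<^sub>R h)) \<le> norm h * (sqrt (nsq \<psi>) * sqrt (nsq g))"
            by (auto intro!: mult_mono component_le_norm_cart)
        qed
        also have "\<dots> = B * sqrt (nsq \<psi>)" by (simp add: B_def)
        finally show "norm (s *\<^sub>R (\<Sum>i\<in>UNIV. h $ i *\<^sub>R corr \<psi> (\<lambda>x. g x $ i) (0 + t *\<^sub>R h))) \<le> B * sqrt (nsq \<psi>) * norm s"
          by (simp add: mult.commute mult_left_mono)
      qed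
    qed auto
    moreover have "(\<integral>x. \<psi> x *\<^sub>R ?f x \<partial>lebesgue) = ?F 1 - ?F 0"
    proof -
      have "integrable lebesgue (\<lambda>x. \<psi> x *\<^sub>R u (x + h))" "integrable lebesgue (\<lambda>x. \<psi> x *\<^sub>R u x)"
        by (intro test_scaleR_integrable locally_integrable_L2 L2_translate u \<psi>)+
      then show ?thesis using corr_translate[OF loc \<psi>, of h] corr_translate[OF loc \<psi>, of 0]
        by (simp add: scaleR_diff_right)
    qed
    ultimately show ?thesis by simp
  qed
  have i: "integrable lebesgue (\<lambda>x. \<psi> x *\<^sub>R ?f x)" if "\<psi> \<in> test_functions" for \<psi>
    by (intro test_scaleR_integrable locally_integrable_L2 f that)
  have "nsq (\<lambda>x. Re (?f x)) \<le> B^2"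
  proof (rule nsq_le_dual[OF nsq_complex(1)[OF f] B0])
    fix \<psi> assume \<psi>: "\<psi> \<in> test_functions"
    have "ip (\<lambda>x. Re (?f x)) \<psi> = Re (\<integral>x. \<psi> x *\<^sub>R ?f x \<partial>lebesgue)"
      using integral_Re[OF i[OF \<psi>]] by (simp add: ip_def mult.commute)
    then show "\<bar>ip (\<lambda>x. Re (?f x)) \<psi>\<bar> \<le> B * sqrt (nsq \<psi>)"
      using key[OF \<psi>] abs_Re_le_cmod[of "\<integral>x. \<psi> x *\<^sub>R ?f x \<partial>lebesgue"] by simp
  qed
  moreover have "nsq (\<lambda>x. Im (?f x)) \<le> B^2"
  proof (rule nsq_le_dual[OF nsq_complex(2)[OF f] B0])
    fix \<psi> assume \<psi>: "\<psi> \<in> test_functions"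
    have "ip (\<lambda>x. Im (?f x)) \<psi> = Im (\<integral>x. \<psi> x *\<^sub>R ?f x \<partial>lebesgue)"
      using integral_Im[OF i[OF \<psi>]] by (simp add: ip_def mult.commute)
    then show "\<bar>ip (\<lambda>x. Im (?f x)) \<psi>\<bar> \<le> B * sqrt (nsq \<psi>)"
      using key[OF \<psi>] abs_Im_le_cmod[of "\<integral>x. \<psi> x *\<^sub>R ?f x \<partial>lebesgue"] by simp
  qed
  ultimately have "nsq ?f \<le> 2 * B^2" using nsq_complex(3)[OF f] by simp
  also have "\<dots> = 8 * (norm h)^2 * nsq g" by (simp add: B_def power_mult_distrib)
  finally show ?thesis .
qed

text \<open>Tonelli's theorem is applied to functions of sums such as \<open>y + z\<close>, whose
  joint measurability is clear for Borel functions; so functions measurable for the completed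
  measure are first replaced almost everywhere.\<close>

lemma borel_representative:
  fixes f :: "plane \<Rightarrow> 'b::euclidean_space"
  assumes f: "f \<in> borel_measurable lebesgue"
  shows "\<exists>f'\<in>borel_measurable borel. AE x in lebesgue. f x = f' x"
proof -
  have "\<exists>h\<in>borel_measurable lborel. AE x in lborel. f x \<bullet> b = h x" for b
    using f by (intro completion_ex_borel_measurable_real) auto
  then obtain h where h: "\<And>b. h b \<in> borel_measurable lborel" "\<And>b. AE x in lborel. f x \<bullet> b = h b x" by metis
  define f' where "f' x = (\<Sum>b\<in>Basis. h b x *\<^sub>R b)" for x
  have "AE x in lborel. \<forall>b\<in>Basis. f x \<bullet> b = h b x" by (intro AE_finite_allI h) auto
  then have "AE x in lborel. f x = f' x"
  proof eventually_elim
    case (elim x)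
    then have "f' x = (\<Sum>b\<in>Basis. (f x \<bullet> b) *\<^sub>R b)" unfolding f'_def by (intro sum.cong) auto
    then show ?case by (simp add: euclidean_representation)
  qed
  moreover have "f' \<in> borel_measurable borel" unfolding f'_def using h(1) by measurable
  ultimately show ?thesis by (intro bexI[of _ f'] AE_completion)
qed

section \<open>Mollifiers and averages of translates\<close>

definition moll :: "real \<Rightarrow> plane \<Rightarrow> real" where
  "moll d x = cutoff d 0 x / (\<integral>y. cutoff d 0 y \<partial>lebesgue)"

lemma cutoff_integral_pos: assumes "d > 0" shows "0 < (\<integral>y. cutoff d 0 y \<partial>lebesgue)"
proof -
  have "0 < measure lebesgue (cball (0::plane) d)" using content_cball_pos[OF assms] by simp
  also have "\<dots> = (\<integral>y. indicator (cball (0::plane) d) y \<partial>lebesgue)" by simp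
  also have "\<dots> \<le> (\<integral>y. cutoff d 0 y \<partial>lebesgue)"
  proof (rule integral_mono)
    show "integrable lebesgue (indicator (cball 0 d) :: plane \<Rightarrow> real)"
      using lmeasurable_cball[of "0::plane" d] by (simp add: fmeasurable_def)
    show "integrable lebesgue (cutoff d 0)" by (rule test_integrable[OF test_cutoff[OF assms]])
    show "indicator (cball 0 d) y \<le> cutoff d 0 y" for y
      using cutoff_1[OF assms, of y 0] cutoff_range[of d 0 y] by (auto simp: indicator_def)
  qed
  finally show ?thesis .
qed

lemma moll:
  assumes "d > 0"
  shows test_moll: "moll d \<in> test_functions" and moll_nonneg: "0 \<le> moll d x"
    and moll_integral: "(\<integral>x. moll d x \<partial>lebesgue) = 1" and moll_0: "2 * d \<le> norm x \<Longrightarrow> moll d x = 0"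
proof -
  have e: "moll d = (\<lambda>x. (1 / (\<integral>y. cutoff d 0 y \<partial>lebesgue)) * cutoff d 0 x)"
    by (simp add: moll_def fun_eq_iff)
  show "moll d \<in> test_functions" unfolding e by (intro test_scale test_cutoff assms)
  show "0 \<le> moll d x" using cutoff_integral_pos[OF assms] cutoff_range by (simp add: moll_def)
  show "(\<integral>x. moll d x \<partial>lebesgue) = 1" using cutoff_integral_pos[OF assms] by (simp add: moll_def)
  show "2 * d \<le> norm x \<Longrightarrow> moll d x = 0" using cutoff_0[OF assms, of x 0] by (simp add: moll_def)
qed

text \<open>Cauchy-Schwarz for the factors \<open>sqrt (\<rho> y)\<close> and
  \<open>sqrt (\<rho> y) * norm (h y)\<close>. With an extended nonnegative integral on the right,
  the case of an infinite bound is trivial.\<close>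

lemma jensen_square:
  fixes h :: "plane \<Rightarrow> 'b::euclidean_space"
  assumes \<rho>: "\<rho> \<in> test_functions" "\<And>x. 0 \<le> \<rho> x" "(\<integral>x. \<rho> x \<partial>lebesgue) = 1" and h: "h \<in> borel_measurable lebesgue"
  shows "ennreal ((norm (\<integral>y. \<rho> y *\<^sub>R h y \<partial>lebesgue))^2) \<le> (\<integral>\<^sup>+y. ennreal (\<rho> y * (norm (h y))^2) \<partial>lebesgue)"
proof (cases "(\<integral>\<^sup>+y. ennreal (\<rho> y * (norm (h y))^2) \<partial>lebesgue) = \<infinity>")
  case False
  note [measurable] = h test_meas[OF \<rho>(1)]
  have i: "integrable lebesgue (\<lambda>y. \<rho> y * (norm (h y))^2)"
    using False \<rho>(2) by (intro integrableI_nonneg) (auto simp: top.not_eq_extremum)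
  let ?f = "\<lambda>y. sqrt (\<rho> y)" and ?g = "\<lambda>y. sqrt (\<rho> y) * norm (h y)"
  have f: "?f \<in> Lp 2" using test_integrable[OF \<rho>(1)] \<rho>(2) by (intro L2_I) auto
  have g: "?g \<in> Lp 2" using i \<rho>(2) by (intro L2_I) (auto simp: power_mult_distrib)
  have "norm (\<integral>y. \<rho> y *\<^sub>R h y \<partial>lebesgue) \<le> (\<integral>y. norm (\<rho> y *\<^sub>R h y) \<partial>lebesgue)" by (rule integral_norm_bound)
  also have "\<dots> = (\<integral>y. norm (?f y) * norm (?g y) \<partial>lebesgue)"
    using \<rho>(2) by (intro Bochner_Integration.integral_cong) (auto simp: abs_mult mult.assoc[symmetric])
  also have "\<dots> \<le> sqrt (nsq ?f) * sqrt (nsq ?g)" by (rule CS_integral[OF f g])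
  also have "nsq ?f = 1" using \<rho> by (simp add: nsq_def)
  also have "nsq ?g = (\<integral>y. \<rho> y * (norm (h y))^2 \<partial>lebesgue)" using \<rho> by (simp add: nsq_def power_mult_distrib)
  finally have "(norm (\<integral>y. \<rho> y *\<^sub>R h y \<partial>lebesgue))^2 \<le> (sqrt (\<integral>y. \<rho> y * (norm (h y))^2 \<partial>lebesgue))^2"
    by (intro power_mono) auto
  also have "\<dots> = (\<integral>y. \<rho> y * (norm (h y))^2 \<partial>lebesgue)" using \<rho> by simp
  finally show ?thesis using \<rho> i by (subst nn_integral_eq_integral) (auto intro: ennreal_leI)
qed simp

text \<open>An average of functions with mean square at most \<open>B\<close> has mean square at
  most \<open>B\<close>: Jensen's inequality inside, then exchange of the integrals. The bound is
  asked for only where \<rho> is nonzero, so that a kernel of small support needs only small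
  displacements.\<close>

lemma minkowski_square:
  fixes H :: "plane \<Rightarrow> plane \<Rightarrow> 'b::euclidean_space"
  assumes \<rho>: "\<rho> \<in> test_functions" "\<And>x. 0 \<le> \<rho> x" "(\<integral>x. \<rho> x \<partial>lebesgue) = 1"
    and H: "(\<lambda>(z, y). H z y) \<in> borel_measurable (borel \<Otimes>\<^sub>M borel)"
    and bd: "\<And>y. \<rho> y \<noteq> 0 \<Longrightarrow> (\<integral>\<^sup>+z. ennreal ((norm (H z y))^2) \<partial>lebesgue) \<le> ennreal B"
  shows "(\<integral>\<^sup>+z. ennreal ((norm (\<integral>y. \<rho> y *\<^sub>R H z y \<partial>lebesgue))^2) \<partial>lebesgue) \<le> ennreal B"
proof -
  have H' [measurable]: "(\<lambda>(z, y). H z y) \<in> borel_measurable (lborel \<Otimes>\<^sub>M lborel)"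
    using H by (simp cong: measurable_cong_sets)
  have Hz: "(\<lambda>y. H z y) \<in> borel_measurable lebesgue" for z
    using measurable_Pair2[OF H'] by (auto intro!: measurable_completion)
  have \<rho>m [measurable]: "\<rho> \<in> borel_measurable lborel"
    using test_continuous[OF \<rho>(1)] by (simp add: borel_measurable_continuous_onI)
  have "(\<integral>\<^sup>+z. ennreal ((norm (\<integral>y. \<rho> y *\<^sub>R H z y \<partial>lebesgue))^2) \<partial>lebesgue)
     \<le> (\<integral>\<^sup>+z. (\<integral>\<^sup>+y. ennreal (\<rho> y * (norm (H z y))^2) \<partial>lebesgue) \<partial>lebesgue)"
    by (intro nn_integral_mono jensen_square \<rho> Hz)
  also have "\<dots> = (\<integral>\<^sup>+z. (\<integral>\<^sup>+y. ennreal (\<rho> y * (norm (H z y))^2) \<partial>lborel) \<partial>lborel)"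
    by (simp add: nn_integral_completion)
  also have "\<dots> = (\<integral>\<^sup>+y. (\<integral>\<^sup>+z. ennreal (\<rho> y * (norm (H z y))^2) \<partial>lborel) \<partial>lborel)"
    by (rule lborel_pair.Fubini') measurable
  also have "\<dots> = (\<integral>\<^sup>+y. ennreal (\<rho> y) * (\<integral>\<^sup>+z. ennreal ((norm (H z y))^2) \<partial>lborel) \<partial>lborel)"
  proof (rule nn_integral_cong)
    fix y
    have [measurable]: "(\<lambda>z. H z y) \<in> borel_measurable lborel" using measurable_Pair1[OF H'] by auto
    show "(\<integral>\<^sup>+z. ennreal (\<rho> y * (norm (H z y))^2) \<partial>lborel) = ennreal (\<rho> y) * (\<integral>\<^sup>+z. ennreal ((norm (H z y))^2) \<partial>lborel)"
      using \<rho>(2) by (simp add: ennreal_mult nn_integral_cmult)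
  qed
  also have "\<dots> \<le> (\<integral>\<^sup>+y. ennreal (\<rho> y) * ennreal B \<partial>lborel)"
  proof (rule nn_integral_mono)
    fix y
    show "ennreal (\<rho> y) * (\<integral>\<^sup>+z. ennreal ((norm (H z y))^2) \<partial>lborel) \<le> ennreal (\<rho> y) * ennreal B"
      using bd[of y] by (cases "\<rho> y = 0") (auto simp: nn_integral_completion intro: mult_left_mono)
  qed
  also have "\<dots> = (\<integral>\<^sup>+y. ennreal (\<rho> y) \<partial>lebesgue) * ennreal B"
    by (simp add: nn_integral_multc nn_integral_completion)
  also have "(\<integral>\<^sup>+y. ennreal (\<rho> y) \<partial>lebesgue) = 1"
    using nn_integral_eq_integral[OF test_integrable[OF \<rho>(1)]] \<rho> by simp
  finally show ?thesis by simp
qed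

lemma nsq_nn_integral: "f \<in> Lp 2 \<Longrightarrow> (\<integral>\<^sup>+x. ennreal ((norm (f x))^2) \<partial>lebesgue) = ennreal (nsq f)"
  unfolding nsq_def by (rule nn_integral_eq_integral) (auto intro: L2_int)

lemma L2_from_nn_integral:
  assumes "f \<in> borel_measurable lebesgue" "(\<integral>\<^sup>+x. ennreal ((norm (f x))^2) \<partial>lebesgue) \<le> ennreal B" "0 \<le> B"
  shows "f \<in> Lp 2" "nsq f \<le> B"
proof -
  show f: "f \<in> Lp 2"
    using assms by (intro L2_I integrableI_nonneg) (auto intro: le_less_trans)
  show "nsq f \<le> B" using assms(2,3) unfolding nsq_nn_integral[OF f] by simp
qed

lemma corr_cong_AE:
  fixes f f' :: "plane \<Rightarrow> 'b::euclidean_space"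
  assumes "\<phi> \<in> test_functions" "f \<in> borel_measurable lebesgue" "f' \<in> borel_measurable lebesgue" "AE x in lebesgue. f x = f' x"
  shows "corr \<phi> f = corr \<phi> f'"
  unfolding corr_def using assms(2-4) test_meas[OF test_shift[OF assms(1)]]
  by (intro ext integral_cong_AE) auto

lemma corr_L2:
  fixes f :: "plane \<Rightarrow> 'b::euclidean_space"
  assumes \<rho>: "\<rho> \<in> test_functions" "\<And>x. 0 \<le> \<rho> x" "(\<integral>x. \<rho> x \<partial>lebesgue) = 1" and f: "f \<in> Lp 2"
  shows "corr \<rho> f \<in> Lp 2" "nsq (corr \<rho> f) \<le> nsq f"
proof -
  obtain f' where f': "f' \<in> borel_measurable borel" "AE x in lebesgue. f x = f' x"
    using borel_representative[OF L2_meas[OF f]] by blast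
  have f'l: "f' \<in> borel_measurable lebesgue" by (rule borel_lebesgue[OF f'(1)])
  have f'2: "f' \<in> Lp 2" by (rule L2_AE_cong[OF f f'l]) (use f'(2) in eventually_elim, simp)
  have e: "corr \<rho> f = corr \<rho> f'" by (rule corr_cong_AE[OF \<rho>(1) L2_meas[OF f] f'l f'(2)])
  have n: "nsq f' = nsq f" using f'(2) by (intro nsq_cong_AE f'l L2_meas f) auto
  have t: "corr \<rho> f' z = (\<integral>y. \<rho> y *\<^sub>R f' (y + z) \<partial>lebesgue)" for z
    by (rule corr_translate[OF locally_integrable_L2[OF f'2] \<rho>(1)])
  have "(\<integral>\<^sup>+z. ennreal ((norm (\<integral>y. \<rho> y *\<^sub>R f' (y + z) \<partial>lebesgue))^2) \<partial>lebesgue) \<le> ennreal (nsq f)"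
  proof (rule minkowski_square[OF \<rho>])
    show "(\<lambda>(z, y). f' (y + z)) \<in> borel_measurable (borel \<Otimes>\<^sub>M borel)" using f'(1) by measurable
    show "(\<integral>\<^sup>+z. ennreal ((norm (f' (y + z)))^2) \<partial>lebesgue) \<le> ennreal (nsq f)" for y
      using nsq_nn_integral[OF L2_translate(1)[OF f'2, of y]] L2_translate(2)[OF f'2, of y] n by (simp add: add.commute)
  qed
  then have b: "(\<integral>\<^sup>+z. ennreal ((norm (corr \<rho> f z))^2) \<partial>lebesgue) \<le> ennreal (nsq f)" by (simp add: e t)
  have m: "corr \<rho> f \<in> borel_measurable lebesgue"
    by (intro continuous_measurable_lebesgue corr_continuous \<rho> locally_integrable_L2 f)
  show "corr \<rho> f \<in> Lp 2" "nsq (corr \<rho> f) \<le> nsq f" using L2_from_nn_integral[OF m b] by auto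
qed

text \<open>The error is an average of translation differences with displacement at most
  \<open>2 * d\<close>, so the constant is \<open>8 * 2^2\<close>. This rate, uniform on bounded
  sets of \<open>H1\<close>, is the quantitative source of local compactness and of
  \<open>nonvanishing\<close>.\<close>

lemma corr_moll_close:
  assumes d: "d > 0" and u: "u \<in> Lp 2" and g: "g \<in> Lp 2" "has_weak_gradient u g"
  shows "nsq (\<lambda>z. corr (moll d) u z - u z) \<le> 32 * d^2 * nsq g"
proof -
  obtain f' where f': "f' \<in> borel_measurable borel" "AE x in lebesgue. u x = f' x"
    using borel_representative[OF L2_meas[OF u]] by blast
  have f'l: "f' \<in> borel_measurable lebesgue" by (rule borel_lebesgue[OF f'(1)])
  have f'2: "f' \<in> Lp 2" by (rule L2_AE_cong[OF u f'l]) (use f'(2) in eventually_elim, simp)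
  note \<rho> = test_moll[OF d] moll_nonneg[OF d] moll_integral[OF d]
  have e: "corr (moll d) u = corr (moll d) f'" by (rule corr_cong_AE[OF \<rho>(1) L2_meas[OF u] f'l f'(2)])
  have wf: "has_weak_gradient f' g"
    by (rule has_weak_gradient_cong[OF g(2) f'l L2_meas[OF g(1)] f'(2)]) simp
  have t: "corr (moll d) f' z - f' z = (\<integral>y. moll d y *\<^sub>R (f' (y + z) - f' z) \<partial>lebesgue)" for z
  proof -
    have "integrable lebesgue (\<lambda>y. moll d y *\<^sub>R f' (y + z))"
      by (intro test_scaleR_integrable locally_integrable_L2 L2_translate f'2 \<rho>)
    moreover have "integrable lebesgue (\<lambda>y. moll d y *\<^sub>R f' z)"
      by (rule integrable_scaleR_left) (use test_integrable[OF \<rho>(1)] in simp)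
    ultimately show ?thesis
      using corr_translate[OF locally_integrable_L2[OF f'2] \<rho>(1), of z] \<rho>(3) test_integrable[OF \<rho>(1)]
      by (simp add: scaleR_diff_right)
  qed
  have "(\<integral>\<^sup>+z. ennreal ((norm (\<integral>y. moll d y *\<^sub>R (f' (y + z) - f' z) \<partial>lebesgue))^2) \<partial>lebesgue) \<le> ennreal (32 * d^2 * nsq g)"
  proof (rule minkowski_square[OF \<rho>])
    show "(\<lambda>(z, y). f' (y + z) - f' z) \<in> borel_measurable (borel \<Otimes>\<^sub>M borel)" using f'(1) by measurable
    fix y assume "moll d y \<noteq> 0"
    then have "norm y \<le> 2 * d" using moll_0[OF d, of y] by force
    then have "(norm y)^2 \<le> 4 * d^2" using power_mono[of "norm y" "2 * d" 2] by simp
    then have "8 * (norm y)^2 * nsq g \<le> 32 * d^2 * nsq g" by (intro mult_right_mono) auto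
    then have "nsq (\<lambda>z. f' (z + y) - f' z) \<le> 32 * d^2 * nsq g"
      using translation_estimate[OF f'2 g(1) wf, of y] by linarith
    then show "(\<integral>\<^sup>+z. ennreal ((norm (f' (y + z) - f' z))^2) \<partial>lebesgue) \<le> ennreal (32 * d^2 * nsq g)"
      using nsq_nn_integral[OF L2_diff[OF L2_translate(1)[OF f'2, of y] f'2]] by (simp add: add.commute ennreal_leI)
  qed
  then have b: "(\<integral>\<^sup>+z. ennreal ((norm (corr (moll d) u z - f' z))^2) \<partial>lebesgue) \<le> ennreal (32 * d^2 * nsq g)"
    by (simp add: e t)
  have c: "corr (moll d) u \<in> borel_measurable lebesgue"
    by (intro continuous_measurable_lebesgue corr_continuous \<rho> locally_integrable_L2 u)
  then have m: "(\<lambda>z. corr (moll d) u z - f' z) \<in> borel_measurable lebesgue" using f'l by simp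
  have "nsq (\<lambda>z. corr (moll d) u z - f' z) \<le> 32 * d^2 * nsq g" by (rule L2_from_nn_integral[OF m b]) simp
  moreover have "nsq (\<lambda>z. corr (moll d) u z - u z) = nsq (\<lambda>z. corr (moll d) u z - f' z)"
    by (rule nsq_cong_AE) (use c f'l L2_meas[OF u] f'(2) in auto)
  ultimately show ?thesis by simp
qed

section \<open>Gagliardo--Nirenberg inequalities\<close>

definition vec2 :: "real \<times> real \<Rightarrow> plane" where
  "vec2 p = fst p *\<^sub>R axis 1 1 + snd p *\<^sub>R axis 2 1"

lemma vec2_nth [simp]: "vec2 p $ 1 = fst p" "vec2 p $ 2 = snd p"
  by (simp_all add: vec2_def axis_def)

lemma vec2_measurable [measurable]: "vec2 \<in> borel \<Otimes>\<^sub>M borel \<rightarrow>\<^sub>M borel"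
  unfolding vec2_def by (intro borel_measurable_add borel_measurable_scaleR) auto

lemma Basis_plane: "(Basis :: plane set) = {axis 1 1, axis 2 1}"
  by (auto simp: Basis_vec_def) (metis exhaust_2)

text \<open>Tonelli is a statement about product measures, while the plane is a type of vectors;
  agreement on boxes identifies the two measures.\<close>

lemma lborel_vec2: "lborel = distr (lborel \<Otimes>\<^sub>M lborel) borel vec2"
proof (rule lborel_eqI)
  fix l u :: plane
  assume le: "\<And>b. b \<in> Basis \<Longrightarrow> l \<bullet> b \<le> u \<bullet> b"
  have le': "l $ i \<le> u $ i" for i using le[of "axis i 1"] by (auto simp: inner_axis axis_in_Basis_iff)
  have v: "vec2 -` box l u = {l $ 1 <..< u $ 1} \<times> {l $ 2 <..< u $ 2}"
    by (auto simp: mem_box_cart forall_2)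
  have "emeasure (distr (lborel \<Otimes>\<^sub>M lborel) borel vec2) (box l u) = emeasure (lborel \<Otimes>\<^sub>M lborel) (vec2 -` box l u)"
    by (subst emeasure_distr) (auto simp: space_pair_measure)
  also have "\<dots> = emeasure lborel {l $ 1 <..< u $ 1} * emeasure lborel {l $ 2 <..< u $ 2}"
    unfolding v by (rule lborel.emeasure_pair_measure_Times) auto
  also have "\<dots> = ennreal ((u $ 1 - l $ 1) * (u $ 2 - l $ 2))"
    using le' by (simp add: ennreal_mult)
  also have "(u $ 1 - l $ 1) * (u $ 2 - l $ 2) = (\<Prod>b\<in>Basis. (u - l) \<bullet> b)"
  proof -
    have "(axis 1 1 :: plane) \<noteq> axis 2 1" by (simp add: axis_eq_axis)
    then show ?thesis by (simp add: Basis_plane inner_axis)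
  qed
  finally show "emeasure (distr (lborel \<Otimes>\<^sub>M lborel) borel vec2) (box l u) = (\<Prod>b\<in>Basis. (u - l) \<bullet> b)" .
qed simp

lemma nn_integral_plane:
  assumes [measurable]: "F \<in> borel_measurable (borel :: plane measure)"
  shows "(\<integral>\<^sup>+x. F x \<partial>lebesgue) = (\<integral>\<^sup>+a. \<integral>\<^sup>+b. F (vec2 (a, b)) \<partial>lborel \<partial>lborel)"
    and "(\<integral>\<^sup>+x. F x \<partial>lebesgue) = (\<integral>\<^sup>+b. \<integral>\<^sup>+a. F (vec2 (a, b)) \<partial>lborel \<partial>lborel)"
proof -
  have m: "(\<lambda>p. F (vec2 p)) \<in> borel_measurable (lborel \<Otimes>\<^sub>M lborel)" by measurable
  have "(\<integral>\<^sup>+x. F x \<partial>lebesgue) = (\<integral>\<^sup>+x. F x \<partial>distr (lborel \<Otimes>\<^sub>M lborel) borel vec2)"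
    by (simp add: nn_integral_completion lborel_vec2[symmetric])
  also have "\<dots> = (\<integral>\<^sup>+p. F (vec2 p) \<partial>(lborel \<Otimes>\<^sub>M lborel))"
    by (rule nn_integral_distr) auto
  finally have e: "(\<integral>\<^sup>+x. F x \<partial>lebesgue) = (\<integral>\<^sup>+p. F (vec2 p) \<partial>(lborel \<Otimes>\<^sub>M lborel))" .
  then show 1: "(\<integral>\<^sup>+x. F x \<partial>lebesgue) = (\<integral>\<^sup>+a. \<integral>\<^sup>+b. F (vec2 (a, b)) \<partial>lborel \<partial>lborel)"
    by (simp add: lborel.nn_integral_fst[OF m, symmetric])
  show "(\<integral>\<^sup>+x. F x \<partial>lebesgue) = (\<integral>\<^sup>+b. \<integral>\<^sup>+a. F (vec2 (a, b)) \<partial>lborel \<partial>lborel)"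
    unfolding 1 by (rule lborel_pair.Fubini'[symmetric]) (use m in auto)
qed

text \<open>The power of \<open>f\<close> is the integral of its derivative from a point where
  \<open>f\<close> vanishes. The bound is enlarged to the whole line, so that it no longer depends
  on the point \<open>s\<close>.\<close>

lemma power_le_integral_deriv:
  fixes f f' :: "real \<Rightarrow> real"
  assumes d: "\<And>s. (f has_real_derivative f' s) (at s)" and c: "continuous_on UNIV f'"
    and L: "\<And>s. \<bar>s\<bar> \<ge> L \<Longrightarrow> f s = 0"
  shows "ennreal (\<bar>f s\<bar> ^ Suc k) \<le> (\<integral>\<^sup>+t. ennreal (real (Suc k) * \<bar>f t\<bar> ^ k * \<bar>f' t\<bar>) \<partial>lborel)"
proof (cases "\<bar>s\<bar> < L")
  case False
  then show ?thesis using L by simp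
next
  case True
  let ?F = "\<lambda>t. f t ^ Suc k" and ?f = "\<lambda>t. real (Suc k) * f t ^ k * f' t"
  have cf: "continuous_on UNIV f"
    using d by (auto intro!: continuous_at_imp_continuous_on intro: DERIV_isCont)
  have h: "has_bochner_integral lborel (\<lambda>x. ?f x * indicator {-L..s} x) (?F s - ?F (-L))"
  proof (rule has_bochner_integral_FTC_Icc_real)
    show "(?F has_real_derivative ?f x) (at x)" for x
      using DERIV_power[OF d[of x], of "Suc k"] by (simp add: mult_ac)
    have "continuous_on UNIV ?f" by (intro continuous_intros cf c)
    then show "isCont ?f x" for x by (simp add: continuous_on_eq_continuous_at)
  qed (use True in auto)
  have "?F (-L) = 0" using L[of "-L"] True by simp
  then have "?F s = (\<integral>x. ?f x * indicator {-L..s} x \<partial>lborel)" using h by (simp add: has_bochner_integral_iff)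
  then have "ennreal (\<bar>f s\<bar> ^ Suc k) = ennreal (norm (\<integral>x. ?f x * indicator {-L..s} x \<partial>lborel))"
    by (simp only: power_abs[symmetric] real_norm_def)
  also have "\<dots> \<le> (\<integral>\<^sup>+x. norm (?f x * indicator {-L..s} x) \<partial>lborel)"
    using h by (intro integral_norm_bound_ennreal) (simp add: has_bochner_integral_iff)
  also have "\<dots> \<le> (\<integral>\<^sup>+t. ennreal (real (Suc k) * \<bar>f t\<bar> ^ k * \<bar>f' t\<bar>) \<partial>lborel)"
    by (intro nn_integral_mono ennreal_leI) (auto simp: abs_mult power_abs indicator_def)
  finally show ?thesis .
qed

section \<open>Sobolev inequalities for compactly supported functions\<close>

lemma continuous_compact_support_integrable:
  fixes f :: "plane \<Rightarrow> real"
  assumes c: "continuous_on UNIV f" and R: "\<And>x. norm x \<ge> R \<Longrightarrow> f x = 0"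
  shows "integrable lebesgue f"
proof -
  have "compact (f ` cball 0 R)"
    by (intro compact_continuous_image continuous_on_subset[OF c]) auto
  then obtain C where C: "C > 0" "\<And>x. x \<in> cball 0 R \<Longrightarrow> \<bar>f x\<bar> \<le> C"
    using compact_imp_bounded[of "f ` cball 0 R"] by (auto simp: bounded_pos)
  have "\<bar>f x\<bar> \<le> C" for x using C R[of x] by (cases "norm x \<le> R") auto
  moreover have "locally_integrable (\<lambda>x. 1::real)" by (rule locally_integrable_bounded[where C=1]) auto
  ultimately have "integrable lebesgue (\<lambda>x. f x *\<^sub>R (1::real))"
    using R by (intro locally_integrable_scaleR[of _ f C R] continuous_measurable_lebesgue c) auto
  then show ?thesis by simp
qed

text \<open>Records what integration along coordinate lines uses, with the partial derivatives named
  explicitly. Regularized functions satisfy it directly by \<open>corr_deriv\<close>.\<close>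

definition C1c :: "(plane \<Rightarrow> real) \<Rightarrow> (2 \<Rightarrow> plane \<Rightarrow> real) \<Rightarrow> bool" where
  "C1c v p \<longleftrightarrow> continuous_on UNIV v \<and> (\<forall>i. continuous_on UNIV (p i)) \<and>
     (\<exists>R. \<forall>x. norm x \<ge> R \<longrightarrow> v x = 0 \<and> (\<forall>i. p i x = 0)) \<and>
     (\<forall>i x t. ((\<lambda>t. v (x + t *\<^sub>R axis i 1)) has_real_derivative p i (x + t *\<^sub>R axis i 1)) (at t))"

text \<open>Gagliardo's argument. At the point with coordinates \<open>a\<close> and
  \<open>b\<close>, the power \<open>Suc (Suc k)\<close> of \<open>\<bar>v\<bar>\<close> is bounded
  by an integral along the horizontal line, which depends on \<open>b\<close> only, and by one along
  the vertical line, which depends on \<open>a\<close> only. The product of the two bounds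
  integrates to a product of plane integrals, and Cauchy-Schwarz in each factor lowers the exponent
  by 2.\<close>

lemma sobolev_step:
  assumes v: "C1c v p"
  shows "(\<integral>x. \<bar>v x\<bar> ^ (2 * Suc (Suc k)) \<partial>lebesgue)
    \<le> (real (Suc (Suc k)))^2 * (\<integral>x. \<bar>v x\<bar> ^ (2 * Suc k) \<partial>lebesgue) * (\<integral>x. (p 1 x)^2 + (p 2 x)^2 \<partial>lebesgue)"
proof -
  obtain R where cv: "continuous_on UNIV v" and cp: "\<And>i. continuous_on UNIV (p i)"
    and R: "\<And>x. norm x \<ge> R \<Longrightarrow> v x = 0" "\<And>x i. norm x \<ge> R \<Longrightarrow> p i x = 0"
    and d: "\<And>i x t. ((\<lambda>t. v (x + t *\<^sub>R axis i 1)) has_real_derivative p i (x + t *\<^sub>R axis i 1)) (at t)"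
    using v unfolding C1c_def by blast
  have [measurable]: "v \<in> borel_measurable borel" "\<And>i. p i \<in> borel_measurable borel"
    using cv cp by (auto intro: borel_measurable_continuous_onI)
  let ?G = "\<lambda>i x. real (Suc (Suc k)) * \<bar>v x\<bar> ^ Suc k * \<bar>p i x\<bar>"
  have vec2_line: "vec2 (a, b) = vec2 (0, b) + a *\<^sub>R axis 1 1" "vec2 (a, b) = vec2 (a, 0) + b *\<^sub>R axis 2 1" for a b
    by (simp_all add: vec2_def)
  have big: "norm (vec2 (a, b)) \<ge> \<bar>a\<bar>" "norm (vec2 (a, b)) \<ge> \<bar>b\<bar>" for a b
    using component_le_norm_cart[of "vec2 (a, b)" 1] component_le_norm_cart[of "vec2 (a, b)" 2] by auto
  have contline: "continuous_on UNIV (\<lambda>t. p i (z + t *\<^sub>R w))" for i z w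
    by (rule continuous_on_compose2[OF cp]) (auto intro!: continuous_intros)
  have A: "ennreal (\<bar>v (vec2 (a, b))\<bar> ^ Suc (Suc k)) \<le> (\<integral>\<^sup>+s. ennreal (?G 1 (vec2 (s, b))) \<partial>lborel)" for a b
  proof (rule power_le_integral_deriv[of "\<lambda>t. v (vec2 (t, b))" "\<lambda>t. p 1 (vec2 (t, b))" R])
    show "((\<lambda>t. v (vec2 (t, b))) has_real_derivative p 1 (vec2 (s, b))) (at s)" for s
      using d[of "vec2 (0, b)" 1 s] unfolding vec2_line(1)[symmetric] .
    show "continuous_on UNIV (\<lambda>t. p 1 (vec2 (t, b)))"
      using contline[of 1 "vec2 (0, b)" "axis 1 1"] unfolding vec2_line(1)[symmetric] .
    show "v (vec2 (s, b)) = 0" if "R \<le> \<bar>s\<bar>" for s using that big(1)[of s b] by (intro R(1)) linarith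
  qed
  have B: "ennreal (\<bar>v (vec2 (a, b))\<bar> ^ Suc (Suc k)) \<le> (\<integral>\<^sup>+s. ennreal (?G 2 (vec2 (a, s))) \<partial>lborel)" for a b
  proof (rule power_le_integral_deriv[of "\<lambda>t. v (vec2 (a, t))" "\<lambda>t. p 2 (vec2 (a, t))" R])
    show "((\<lambda>t. v (vec2 (a, t))) has_real_derivative p 2 (vec2 (a, s))) (at s)" for s
      using d[of "vec2 (a, 0)" 2 s] unfolding vec2_line(2)[symmetric] .
    show "continuous_on UNIV (\<lambda>t. p 2 (vec2 (a, t)))"
      using contline[of 2 "vec2 (a, 0)" "axis 2 1"] unfolding vec2_line(2)[symmetric] .
    show "v (vec2 (a, s)) = 0" if "R \<le> \<bar>s\<bar>" for s using that big(2)[of s a] by (intro R(1)) linarith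
  qed
  have "(\<integral>\<^sup>+x. ennreal (\<bar>v x\<bar> ^ (2 * Suc (Suc k))) \<partial>lebesgue)
     = (\<integral>\<^sup>+a. \<integral>\<^sup>+b. ennreal (\<bar>v (vec2 (a, b))\<bar> ^ (2 * Suc (Suc k))) \<partial>lborel \<partial>lborel)"
    by (rule nn_integral_plane) measurable
  also have "\<dots> \<le> (\<integral>\<^sup>+a. \<integral>\<^sup>+b. (\<integral>\<^sup>+s. ennreal (?G 2 (vec2 (a, s))) \<partial>lborel) * (\<integral>\<^sup>+s. ennreal (?G 1 (vec2 (s, b))) \<partial>lborel) \<partial>lborel \<partial>lborel)"
  proof (intro nn_integral_mono)
    fix a b
    have "ennreal (\<bar>v (vec2 (a, b))\<bar> ^ (2 * Suc (Suc k))) =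
       ennreal (\<bar>v (vec2 (a, b))\<bar> ^ Suc (Suc k)) * ennreal (\<bar>v (vec2 (a, b))\<bar> ^ Suc (Suc k))"
      by (subst ennreal_mult[symmetric]) (auto simp: power_add[symmetric] mult_2)
    then show "ennreal (\<bar>v (vec2 (a, b))\<bar> ^ (2 * Suc (Suc k))) \<le>
       (\<integral>\<^sup>+s. ennreal (?G 2 (vec2 (a, s))) \<partial>lborel) * (\<integral>\<^sup>+s. ennreal (?G 1 (vec2 (s, b))) \<partial>lborel)"
      using mult_mono[OF B A] by simp
  qed
  also have "\<dots> = (\<integral>\<^sup>+a. (\<integral>\<^sup>+s. ennreal (?G 2 (vec2 (a, s))) \<partial>lborel) \<partial>lborel) * (\<integral>\<^sup>+b. (\<integral>\<^sup>+s. ennreal (?G 1 (vec2 (s, b))) \<partial>lborel) \<partial>lborel)"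
    by (simp add: nn_integral_cmult nn_integral_multc)
  also have "(\<integral>\<^sup>+a. (\<integral>\<^sup>+s. ennreal (?G 2 (vec2 (a, s))) \<partial>lborel) \<partial>lborel) = (\<integral>\<^sup>+x. ennreal (?G 2 x) \<partial>lebesgue)"
    by (rule nn_integral_plane(1)[symmetric]) measurable
  also have "(\<integral>\<^sup>+b. (\<integral>\<^sup>+s. ennreal (?G 1 (vec2 (s, b))) \<partial>lborel) \<partial>lborel) = (\<integral>\<^sup>+x. ennreal (?G 1 x) \<partial>lebesgue)"
    by (rule nn_integral_plane(2)[symmetric]) measurable
  finally have *: "(\<integral>\<^sup>+x. ennreal (\<bar>v x\<bar> ^ (2 * Suc (Suc k))) \<partial>lebesgue) \<le>
    (\<integral>\<^sup>+x. ennreal (?G 2 x) \<partial>lebesgue) * (\<integral>\<^sup>+x. ennreal (?G 1 x) \<partial>lebesgue)" .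
  have iv: "integrable lebesgue (\<lambda>x. \<bar>v x\<bar> ^ (Suc n))" for n
    by (rule continuous_compact_support_integrable[of _ R]) (auto intro!: continuous_intros cv simp: R)
  have iG: "integrable lebesgue (?G i)" for i
    by (rule continuous_compact_support_integrable[of _ R]) (auto intro!: continuous_intros cv cp simp: R)
  have ip2: "integrable lebesgue (\<lambda>x. (p i x)^2)" for i
    by (rule continuous_compact_support_integrable[of _ R]) (auto intro!: continuous_intros cp simp: R)
  have G: "(\<integral>\<^sup>+x. ennreal (?G i x) \<partial>lebesgue) = ennreal (\<integral>x. ?G i x \<partial>lebesgue)" for i
    by (rule nn_integral_eq_integral[OF iG]) auto
  have Gn: "0 \<le> (\<integral>x. ?G i x \<partial>lebesgue)" for i by (rule Bochner_Integration.integral_nonneg) auto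
  have I: "(\<integral>x. \<bar>v x\<bar> ^ (2 * Suc (Suc k)) \<partial>lebesgue) \<le> (\<integral>x. ?G 2 x \<partial>lebesgue) * (\<integral>x. ?G 1 x \<partial>lebesgue)"
  proof -
    have "(\<integral>\<^sup>+x. ennreal (\<bar>v x\<bar> ^ (2 * Suc (Suc k))) \<partial>lebesgue) = ennreal (\<integral>x. \<bar>v x\<bar> ^ (2 * Suc (Suc k)) \<partial>lebesgue)"
      using iv[of "Suc (2 * k) + 2"] by (intro nn_integral_eq_integral) auto
    then show ?thesis using * Gn unfolding G
      by (simp add: ennreal_mult[symmetric] ennreal_le_iff del: mult_Suc_right power_Suc)
  qed
  define N P1 P2 where "N = (\<integral>x. \<bar>v x\<bar> ^ (2 * Suc k) \<partial>lebesgue)" and "P1 = (\<integral>x. (p 1 x)^2 \<partial>lebesgue)"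
    and "P2 = (\<integral>x. (p 2 x)^2 \<partial>lebesgue)"
  have nn: "0 \<le> N" "0 \<le> P1" "0 \<le> P2" unfolding N_def P1_def P2_def
    by (auto intro!: Bochner_Integration.integral_nonneg)
  have CS: "(\<integral>x. ?G i x \<partial>lebesgue) \<le> real (Suc (Suc k)) * (sqrt N * sqrt (\<integral>x. (p i x)^2 \<partial>lebesgue))" for i
  proof -
    have e: "(\<bar>v x\<bar> ^ Suc k)^2 = \<bar>v x\<bar> ^ (2 * Suc k)" for x by (simp only: power_mult[symmetric] mult.commute)
    have m: "v \<in> borel_measurable lebesgue" "p i \<in> borel_measurable lebesgue" by (auto intro: borel_lebesgue)
    have "\<bar>\<integral>x. (\<bar>v x\<bar> ^ Suc k) * \<bar>p i x\<bar> \<partial>lebesgue\<bar> \<le> sqrt N * sqrt (\<integral>x. (p i x)^2 \<partial>lebesgue)"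
      using integral_CS(2)[of "\<lambda>x. \<bar>v x\<bar> ^ Suc k" "\<lambda>x. \<bar>p i x\<bar>"] iv[of "Suc (2 * k)"] ip2[of i] m
      unfolding e N_def by (simp del: power_Suc)
    then have "(\<integral>x. (\<bar>v x\<bar> ^ Suc k) * \<bar>p i x\<bar> \<partial>lebesgue) \<le> sqrt N * sqrt (\<integral>x. (p i x)^2 \<partial>lebesgue)" by simp
    then have "real (Suc (Suc k)) * (\<integral>x. (\<bar>v x\<bar> ^ Suc k) * \<bar>p i x\<bar> \<partial>lebesgue) \<le> real (Suc (Suc k)) * (sqrt N * sqrt (\<integral>x. (p i x)^2 \<partial>lebesgue))"
      by (intro mult_left_mono) auto
    then show ?thesis by (simp only: mult.assoc integral_mult_right_zero)
  qed
  have "(\<integral>x. ?G 2 x \<partial>lebesgue) * (\<integral>x. ?G 1 x \<partial>lebesgue) \<le>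
      (real (Suc (Suc k)) * (sqrt N * sqrt P2)) * (real (Suc (Suc k)) * (sqrt N * sqrt P1))"
    unfolding P1_def P2_def by (intro mult_mono CS Gn) (use nn in \<open>auto simp: P1_def P2_def N_def\<close>)
  also have "\<dots> = (real (Suc (Suc k)))^2 * N * (sqrt P1 * sqrt P2)"
    using nn by (simp add: power2_eq_square)
  also have "\<dots> \<le> (real (Suc (Suc k)))^2 * N * (P1 + P2)"
  proof (rule mult_left_mono)
    have "sqrt P1 * sqrt P2 \<le> (sqrt P1)^2 + (sqrt P2)^2" using norm_mult_le_sum_squares[of "sqrt P1" "sqrt P2"] nn by simp
    then show "sqrt P1 * sqrt P2 \<le> P1 + P2" using nn by simp
  qed (use nn in simp)
  also have "P1 + P2 = (\<integral>x. (p 1 x)^2 + (p 2 x)^2 \<partial>lebesgue)"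
    unfolding P1_def P2_def using ip2 by simp
  finally show ?thesis using I unfolding N_def by linarith
qed

lemma sobolev_C1c:
  assumes v: "C1c v p"
  shows "(\<integral>x. \<bar>v x\<bar> ^ (2 * Suc k) \<partial>lebesgue) \<le> (fact (Suc k))^2 * (\<integral>x. (v x)^2 \<partial>lebesgue) * (\<integral>x. (p 1 x)^2 + (p 2 x)^2 \<partial>lebesgue) ^ k"
proof (induction k)
  case 0
  then show ?case by simp
next
  case (Suc k)
  let ?P = "\<integral>x. (p 1 x)^2 + (p 2 x)^2 \<partial>lebesgue"
  have P: "0 \<le> ?P" by (rule Bochner_Integration.integral_nonneg) auto
  have "(\<integral>x. \<bar>v x\<bar> ^ (2 * Suc (Suc k)) \<partial>lebesgue) \<le> (real (Suc (Suc k)))^2 * (\<integral>x. \<bar>v x\<bar> ^ (2 * Suc k) \<partial>lebesgue) * ?P"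
    by (rule sobolev_step[OF v])
  also have "\<dots> \<le> (real (Suc (Suc k)))^2 * ((fact (Suc k))^2 * (\<integral>x. (v x)^2 \<partial>lebesgue) * ?P ^ k) * ?P"
    by (intro mult_right_mono mult_left_mono Suc.IH P) auto
  also have "\<dots> = (fact (Suc (Suc k)))^2 * (\<integral>x. (v x)^2 \<partial>lebesgue) * ?P ^ Suc k"
    by (simp add: power_mult_distrib algebra_simps del: of_nat_Suc fact_Suc) (simp add: power_mult_distrib fact_Suc[of "Suc k"] algebra_simps del: of_nat_Suc)
  finally show ?case .
qed

section \<open>Passage to \<open>H1\<close> by cut-off and mollification\<close>

lemma cutoff_pd_bound: "\<exists>C>0. \<forall>r>0. \<forall>a i x. \<bar>pd i (cutoff r a) x\<bar> \<le> C / r"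
proof -
  have "\<exists>C. C > 0 \<and> (\<forall>x. \<bar>pd i (cutoff 1 0) x\<bar> \<le> C)" for i
    using test_bounded[OF test_pd[OF test_cutoff[of 1 0], of i]] by (metis zero_less_one)
  then obtain C where C: "\<And>i. C i > 0" "\<And>i x. \<bar>pd i (cutoff 1 0) x\<bar> \<le> C i" by metis
  have "\<bar>pd i (cutoff r a) x\<bar> \<le> (C 1 + C 2) / r" if r: "r > 0" for r a i x
  proof -
    have "cutoff r a = (\<lambda>x. cutoff 1 0 ((1 / r) *\<^sub>R x + (- (1 / r)) *\<^sub>R a))"
      by (simp add: cutoff_def fun_eq_iff scaleR_diff_right)
    then have "pd i (cutoff r a) x = (1 / r) * pd i (cutoff 1 0) ((1 / r) *\<^sub>R x + (- (1 / r)) *\<^sub>R a)"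
      by (simp only: pd_affine[OF smooth_cutoff])
    also have "\<bar>\<dots>\<bar> \<le> (1 / r) * C i" using r C(2)[of i] by (simp add: abs_mult divide_right_mono)
    also have "\<dots> \<le> (C 1 + C 2) / r"
      using r exhaust_2[of i] C(1)[of 1] C(1)[of 2] by (auto simp: field_simps)
    finally show ?thesis .
  qed
  moreover have "C 1 + C 2 > 0" using C(1)[of 1] C(1)[of 2] by simp
  ultimately show ?thesis by blast
qed

text \<open>\<open>T\<close> will be \<open>Re\<close> or \<open>Im\<close>, since the
  one-dimensional integrations concern real functions. The second argument of \<open>C1c\<close> is
  the Leibniz rule for a cut-off regularization.\<close>

lemma C1c_regularized:
  assumes T: "bounded_linear (T :: complex \<Rightarrow> real)" and c: "c \<in> test_functions" and \<rho>: "\<rho> \<in> test_functions"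
    and u: "has_weak_gradient u g"
  shows "C1c (\<lambda>x. T (c x *\<^sub>R corr \<rho> u x)) (\<lambda>i x. T (c x *\<^sub>R corr \<rho> (\<lambda>x. g x $ i) x + pd i c x *\<^sub>R corr \<rho> u x))"
  unfolding C1c_def
proof (intro conjI allI)
  have l: "locally_integrable u" "locally_integrable (\<lambda>x. g x $ i)" for i
    using u by (auto simp: has_weak_gradient_iff locally_integrable_nth)
  note cont = corr_continuous[OF \<rho> l(1)] corr_continuous[OF \<rho> l(2)] test_continuous[OF c] test_continuous[OF test_pd[OF c]]
  show "continuous_on UNIV (\<lambda>x. T (c x *\<^sub>R corr \<rho> u x))"
    by (intro continuous_on_compose2[OF linear_continuous_on[OF T, of UNIV]] continuous_on_scaleR cont) auto
  show "continuous_on UNIV (\<lambda>x. T (c x *\<^sub>R corr \<rho> (\<lambda>x. g x $ i) x + pd i c x *\<^sub>R corr \<rho> u x))" for i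
    by (intro continuous_on_compose2[OF linear_continuous_on[OF T, of UNIV]] continuous_on_add continuous_on_scaleR cont) auto
  obtain R where "R > 0" "\<forall>x. R \<le> norm x \<longrightarrow> c x = 0 \<and> (\<forall>i. pd i c x = 0)"
    using test_bounded_support[OF c] by blast
  then show "\<exists>R. \<forall>x. norm x \<ge> R \<longrightarrow> T (c x *\<^sub>R corr \<rho> u x) = 0 \<and>
      (\<forall>i. T (c x *\<^sub>R corr \<rho> (\<lambda>x. g x $ i) x + pd i c x *\<^sub>R corr \<rho> u x) = 0)"
    using linear_0[OF bounded_linear.linear[OF T]] by (intro exI[of _ R]) auto
  show "((\<lambda>t. T (c (x + t *\<^sub>R axis i 1) *\<^sub>R corr \<rho> u (x + t *\<^sub>R axis i 1))) has_real_derivative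
      T (c (x + t *\<^sub>R axis i 1) *\<^sub>R corr \<rho> (\<lambda>x. g x $ i) (x + t *\<^sub>R axis i 1) +
         pd i c (x + t *\<^sub>R axis i 1) *\<^sub>R corr \<rho> u (x + t *\<^sub>R axis i 1))) (at t)" for i x t
    unfolding has_real_derivative_iff_has_vector_derivative
  proof (rule bounded_linear.has_vector_derivative[OF T])
    have s: "(\<Sum>j\<in>UNIV. axis i 1 $ j *\<^sub>R corr \<rho> (\<lambda>x. g x $ j) (x + t *\<^sub>R axis i 1)) = corr \<rho> (\<lambda>x. g x $ i) (x + t *\<^sub>R axis i 1)"
      by (simp add: axis_def if_distrib[of "\<lambda>c. c *\<^sub>R _"] cong: if_cong)
    have d1: "((\<lambda>t. corr \<rho> u (x + t *\<^sub>R axis i 1)) has_vector_derivative corr \<rho> (\<lambda>x. g x $ i) (x + t *\<^sub>R axis i 1)) (at t)"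
      using corr_deriv[OF \<rho> u, of x "axis i 1" t] unfolding s .
    have "((\<lambda>t. c (x + t *\<^sub>R axis i 1)) has_derivative (\<lambda>h. frechet_derivative c (at (x + t *\<^sub>R axis i 1)) (h *\<^sub>R axis i 1))) (at t)"
      by (rule has_derivative_compose[OF _ smooth_has_derivative[OF test_smooth[OF c]]]) (auto intro!: derivative_eq_intros)
    moreover have "(\<lambda>h. frechet_derivative c (at (x + t *\<^sub>R axis i 1)) (h *\<^sub>R axis i 1)) = times (pd i c (x + t *\<^sub>R axis i 1))"
      by (rule ext) (simp add: linear_cmul[OF has_derivative_linear[OF smooth_has_derivative[OF test_smooth[OF c]]]] pd_def mult.commute)
    ultimately have d2: "((\<lambda>t. c (x + t *\<^sub>R axis i 1)) has_real_derivative pd i c (x + t *\<^sub>R axis i 1)) (at t)"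
      unfolding has_field_derivative_def by simp
    show "((\<lambda>t. c (x + t *\<^sub>R axis i 1) *\<^sub>R corr \<rho> u (x + t *\<^sub>R axis i 1)) has_vector_derivative
      c (x + t *\<^sub>R axis i 1) *\<^sub>R corr \<rho> (\<lambda>x. g x $ i) (x + t *\<^sub>R axis i 1) +
         pd i c (x + t *\<^sub>R axis i 1) *\<^sub>R corr \<rho> u (x + t *\<^sub>R axis i 1)) (at t)"
      by (rule has_vector_derivative_scaleR[OF d2 d1])
  qed
qed

lemma C1c_continuous_bounds:
  assumes "C1c v p"
  shows "integrable lebesgue (\<lambda>x. \<bar>v x\<bar> ^ Suc n)" "integrable lebesgue (\<lambda>x. (p i x)^2)"
proof -
  obtain R where cv: "continuous_on UNIV v" and cp: "\<And>i. continuous_on UNIV (p i)"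
    and R: "\<And>x. norm x \<ge> R \<Longrightarrow> v x = 0" "\<And>x i. norm x \<ge> R \<Longrightarrow> p i x = 0"
    using assms unfolding C1c_def by blast
  show "integrable lebesgue (\<lambda>x. \<bar>v x\<bar> ^ Suc n)"
    by (rule continuous_compact_support_integrable[of _ R]) (auto intro!: continuous_intros cv simp: R)
  show "integrable lebesgue (\<lambda>x. (p i x)^2)"
    by (rule continuous_compact_support_integrable[of _ R]) (auto intro!: continuous_intros cp simp: R)
qed

lemma norm_power_le_Re_Im: "norm (z::complex) ^ (2 * k) \<le> 2 ^ k * (\<bar>Re z\<bar> ^ (2 * k) + \<bar>Im z\<bar> ^ (2 * k))"
proof -
  define m where "m = max ((Re z)^2) ((Im z)^2)"
  have "norm z ^ (2 * k) = ((Re z)^2 + (Im z)^2) ^ k" by (simp add: power_mult cmod_power2)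
  also have "\<dots> \<le> (2 * m) ^ k" by (intro power_mono) (auto simp: m_def)
  also have "\<dots> = 2 ^ k * m ^ k" by (simp add: power_mult_distrib)
  also have "m ^ k \<le> ((Re z)^2) ^ k + ((Im z)^2) ^ k" unfolding m_def by (auto simp: max_def)
  finally show ?thesis by (simp add: power_mult)
qed

lemma sobolev_complex:
  fixes w :: "plane \<Rightarrow> complex" and p :: "2 \<Rightarrow> plane \<Rightarrow> complex"
  assumes re: "C1c (\<lambda>x. Re (w x)) (\<lambda>i x. Re (p i x))" and im: "C1c (\<lambda>x. Im (w x)) (\<lambda>i x. Im (p i x))"
    and w: "w \<in> Lp 2" and p: "\<And>i. p i \<in> Lp 2"
  shows "integrable lebesgue (\<lambda>x. norm (w x) ^ (2 * Suc k))"
    "(\<integral>x. norm (w x) ^ (2 * Suc k) \<partial>lebesgue) \<le> 2 ^ (k + 2) * (fact (Suc k))^2 * nsq w * (nsq (p 1) + nsq (p 2)) ^ k"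
proof -
  have ir: "integrable lebesgue (\<lambda>x. 2 ^ Suc k * (\<bar>Re (w x)\<bar> ^ (2 * Suc k) + \<bar>Im (w x)\<bar> ^ (2 * Suc k)))"
    using C1c_continuous_bounds(1)[OF re, of "Suc (2 * k)"] C1c_continuous_bounds(1)[OF im, of "Suc (2 * k)"] by simp
  show iw: "integrable lebesgue (\<lambda>x. norm (w x) ^ (2 * Suc k))"
    by (rule Bochner_Integration.integrable_bound[OF ir])
      (use L2_meas[OF w] norm_power_le_Re_Im[of _ "Suc k"] in \<open>auto intro!: AE_I2 simp del: power_Suc mult_Suc_right intro: order_trans[OF _ abs_ge_self]\<close>)
  let ?N = "nsq w" and ?P = "nsq (p 1) + nsq (p 2)" and ?F = "(fact (Suc k))^2 :: real"
  have one: "(\<integral>x. \<bar>T (w x)\<bar> ^ (2 * Suc k) \<partial>lebesgue) \<le> ?F * ?N * ?P ^ k"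
    if C: "C1c (\<lambda>x. T (w x)) (\<lambda>i x. T (p i x))" and T: "\<And>z. \<bar>T z\<bar> \<le> norm z" for T
  proof -
    have sq: "(T z)^2 \<le> (norm z)^2" for z using power_mono[OF T[of z], of 2] by simp
    have i2: "integrable lebesgue (\<lambda>x. (T (w x))^2)" using C1c_continuous_bounds(1)[OF C, of 1] by (simp add: numeral_2_eq_2)
    note ip2 = C1c_continuous_bounds(2)[OF C]
    have "(\<integral>x. (T (w x))^2 \<partial>lebesgue) \<le> ?N"
      unfolding nsq_def by (intro integral_mono i2 L2_int w sq)
    moreover have "(\<integral>x. (T (p 1 x))^2 + (T (p 2 x))^2 \<partial>lebesgue) \<le> ?P"
    proof -
      have "(\<integral>x. (T (p i x))^2 \<partial>lebesgue) \<le> nsq (p i)" for i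
        unfolding nsq_def by (intro integral_mono ip2 L2_int p sq)
      from add_mono[OF this[of 1] this[of 2]] show ?thesis using ip2 by simp
    qed
    moreover have "0 \<le> (\<integral>x. (T (p 1 x))^2 + (T (p 2 x))^2 \<partial>lebesgue)"
      by (rule Bochner_Integration.integral_nonneg) auto
    ultimately have "?F * (\<integral>x. (T (w x))^2 \<partial>lebesgue) * (\<integral>x. (T (p 1 x))^2 + (T (p 2 x))^2 \<partial>lebesgue) ^ k \<le> ?F * ?N * ?P ^ k"
      by (intro mult_mono power_mono mult_nonneg_nonneg zero_le_power) auto
    then show ?thesis using sobolev_C1c[OF C, of k] by linarith
  qed
  have "(\<integral>x. norm (w x) ^ (2 * Suc k) \<partial>lebesgue) \<le> (\<integral>x. 2 ^ Suc k * (\<bar>Re (w x)\<bar> ^ (2 * Suc k) + \<bar>Im (w x)\<bar> ^ (2 * Suc k)) \<partial>lebesgue)"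
    by (intro integral_mono iw ir norm_power_le_Re_Im)
  also have "\<dots> = 2 ^ Suc k * ((\<integral>x. \<bar>Re (w x)\<bar> ^ (2 * Suc k) \<partial>lebesgue) + (\<integral>x. \<bar>Im (w x)\<bar> ^ (2 * Suc k) \<partial>lebesgue))"
    using C1c_continuous_bounds(1)[OF re, of "Suc (2 * k)"] C1c_continuous_bounds(1)[OF im, of "Suc (2 * k)"]
    by simp
  also have "\<dots> \<le> 2 ^ Suc k * (?F * ?N * ?P ^ k + ?F * ?N * ?P ^ k)"
    by (intro mult_left_mono add_mono one re im abs_Re_le_cmod abs_Im_le_cmod) auto
  also have "\<dots> = 2 ^ (k + 2) * ?F * ?N * ?P ^ k" by simp
  finally show "(\<integral>x. norm (w x) ^ (2 * Suc k) \<partial>lebesgue) \<le> 2 ^ (k + 2) * ?F * ?N * ?P ^ k" .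
qed

lemma integral_vanishing_weight:
  fixes f :: "plane \<Rightarrow> real"
  assumes f: "integrable lebesgue f" and c: "\<And>n. c n \<in> borel_measurable lebesgue" "\<And>n x. \<bar>c n x\<bar> \<le> 1"
    and z: "\<And>x. (\<lambda>n. c n x) \<longlonglongrightarrow> 0"
  shows "(\<lambda>n. \<integral>x. c n x * f x \<partial>lebesgue) \<longlonglongrightarrow> 0"
proof -
  have "(\<lambda>n. \<integral>x. c n x * f x \<partial>lebesgue) \<longlonglongrightarrow> (\<integral>x. 0 * f x \<partial>lebesgue)"
  proof (rule integral_dominated_convergence)
    show "integrable lebesgue (\<lambda>x. \<bar>f x\<bar>)" using f by simp
    show "AE x in lebesgue. (\<lambda>n. c n x * f x) \<longlonglongrightarrow> 0 * f x" by (intro AE_I2 tendsto_intros z)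
    show "AE x in lebesgue. norm (c n x * f x) \<le> \<bar>f x\<bar>" for n
      using c(2) by (intro AE_I2) (auto simp: abs_mult intro!: mult_left_le_one_le)
  qed (use f c in auto)
  then show ?thesis by simp
qed

lemma cutoff_tendsto: "(\<lambda>n. cutoff (real (Suc n)) 0 x) \<longlonglongrightarrow> 1"
proof -
  obtain N where "norm x \<le> real N" using real_arch_simple by blast
  then have "cutoff (real (Suc n)) 0 x = 1" if "n \<ge> N" for n
    using that by (intro cutoff_1) auto
  then show ?thesis by (intro tendsto_eventually) (auto simp: eventually_sequentially)
qed

lemma nsq_vec:
  fixes g :: "plane \<Rightarrow> complex ^ 2"
  assumes "g \<in> Lp 2" shows "nsq g = nsq (\<lambda>x. g x $ 1) + nsq (\<lambda>x. g x $ 2)"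
  unfolding nsq_def using L2_int[OF L2_nth(1)[OF assms]] by (simp add: norm_vec2_sq)

lemma L2_mult_bounded:
  fixes f :: "plane \<Rightarrow> 'b::euclidean_space"
  assumes f: "f \<in> Lp 2" and c: "c \<in> borel_measurable lebesgue" "\<And>x. \<bar>c x\<bar> \<le> C"
  shows "(\<lambda>x. c x *\<^sub>R f x) \<in> Lp 2" "nsq (\<lambda>x. c x *\<^sub>R f x) \<le> C^2 * nsq f"
proof -
  show l: "(\<lambda>x. c x *\<^sub>R f x) \<in> Lp 2"
    by (rule L2_dominated[OF f, of _ C]) (use c L2_meas[OF f] in \<open>auto intro!: AE_I2 mult_right_mono\<close>)
  have "nsq (\<lambda>x. c x *\<^sub>R f x) \<le> (\<integral>x. C^2 * (norm (f x))^2 \<partial>lebesgue)"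
    unfolding nsq_def
  proof (rule integral_mono)
    show "(norm (c x *\<^sub>R f x))^2 \<le> C^2 * (norm (f x))^2" for x
    proof -
      have "norm (c x *\<^sub>R f x) \<le> C * norm (f x)" using c(2)[of x] by (auto intro: mult_right_mono)
      from power_mono[OF this, of 2] show ?thesis by (simp add: power_mult_distrib)
    qed
  qed (use L2_int[OF l] L2_int[OF f] in auto)
  then show "nsq (\<lambda>x. c x *\<^sub>R f x) \<le> C^2 * nsq f" by (simp add: nsq_def)
qed

text \<open>Cutting off at radius \<open>Suc n\<close> and mollifying at scale
  \<open>1 / real (Suc n)\<close> puts \<open>u\<close> within reach of
  \<open>sobolev_complex\<close>. The derivative of the cut-off contributes a term that vanishes
  with \<open>n\<close>, and Fatou passes the inequality to \<open>u\<close> along an almost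
  everywhere convergent subsequence.\<close>

theorem gagliardo_nirenberg_power:
  "\<exists>C\<ge>0. \<forall>u\<in>H1. integrable lebesgue (\<lambda>x. norm (u x) ^ (2 * Suc k)) \<and>
     (\<integral>x. norm (u x) ^ (2 * Suc k) \<partial>lebesgue) \<le> C * nsq u * kin u ^ k"
proof -
  obtain K where K: "K > 0" "\<forall>r>0. \<forall>a i x. \<bar>pd i (cutoff r a) x\<bar> \<le> K / r" using cutoff_pd_bound by blast
  \<comment> \<open>The constant of \<open>sobolev_complex\<close> times \<open>2 ^ k\<close>, where
    each factor 2 comes from splitting the square of a sum in the gradient of the cut-off
    function.\<close>
  define F where "F = 2 ^ (k + 2) * (fact (Suc k))^2 * (2::real) ^ k"
  have F0: "0 \<le> F" by (simp add: F_def)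
  have "integrable lebesgue (\<lambda>x. norm (u x) ^ (2 * Suc k)) \<and>
     (\<integral>x. norm (u x) ^ (2 * Suc k) \<partial>lebesgue) \<le> F * nsq u * kin u ^ k" if u: "u \<in> H1" for u
  proof -
    define g where "g = weak_gradient u"
    have u2: "u \<in> Lp 2" and g2: "g \<in> Lp 2" and wg: "has_weak_gradient u g"
      using H1_weak_gradient[OF u] by (auto simp: g_def)
    define c where "c n = cutoff (real (Suc n)) 0" for n
    define \<rho> where "\<rho> n = moll (1 / real (Suc n))" for n
    have dpos: "1 / real (Suc n) > 0" for n by simp
    have c: "c n \<in> test_functions" for n unfolding c_def by (rule test_cutoff) simp
    note \<rho> = test_moll[OF dpos, folded \<rho>_def] moll_nonneg[OF dpos, folded \<rho>_def] moll_integral[OF dpos, folded \<rho>_def]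
    have crange: "\<bar>c n x\<bar> \<le> 1" for n x using cutoff_range by (simp add: c_def)
    have cpd: "\<bar>pd i (c n) x\<bar> \<le> K / real (Suc n)" for n i x using K(2) by (simp add: c_def)
    define w where "w n x = c n x *\<^sub>R corr (\<rho> n) u x" for n x
    define p where "p n i x = c n x *\<^sub>R corr (\<rho> n) (\<lambda>x. g x $ i) x + pd i (c n) x *\<^sub>R corr (\<rho> n) u x" for n i x
    have C1: "C1c (\<lambda>x. T (w n x)) (\<lambda>i x. T (p n i x))" if "bounded_linear T" for T n
      unfolding w_def p_def by (rule C1c_regularized[OF that c \<rho>(1) wg])
    have U: "corr (\<rho> n) u \<in> Lp 2" "nsq (corr (\<rho> n) u) \<le> nsq u" for n by (rule corr_L2[OF \<rho> u2])+
    have G: "corr (\<rho> n) (\<lambda>x. g x $ i) \<in> Lp 2" "nsq (corr (\<rho> n) (\<lambda>x. g x $ i)) \<le> nsq (\<lambda>x. g x $ i)" for n i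
      by (rule corr_L2[OF \<rho> L2_nth(1)[OF g2]])+
    have w2: "w n \<in> Lp 2" "nsq (w n) \<le> nsq u" for n
      using L2_mult_bounded[OF U(1)[of n] test_meas[OF c[of n]] crange[of n]] U(2)[of n] by (auto simp: w_def[abs_def])
    have p2: "p n i \<in> Lp 2" "nsq (p n i) \<le> 2 * nsq (\<lambda>x. g x $ i) + 2 * ((K / real (Suc n))^2 * nsq u)" for n i
    proof -
      note 1 = L2_mult_bounded[OF G(1)[of n i] test_meas[OF c[of n]] crange[of n]]
      note 2 = L2_mult_bounded[OF U(1)[of n] test_meas[OF test_pd[OF c[of n]]] cpd[of i n]]
      show "p n i \<in> Lp 2" unfolding p_def[abs_def] by (rule L2_add[OF 1(1) 2(1)])
      have "(K / real (Suc n))^2 * nsq (corr (\<rho> n) u) \<le> (K / real (Suc n))^2 * nsq u"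
        by (intro mult_left_mono U) auto
      then show "nsq (p n i) \<le> 2 * nsq (\<lambda>x. g x $ i) + 2 * ((K / real (Suc n))^2 * nsq u)"
        unfolding p_def[abs_def] using nsq_add_le[OF 1(1) 2(1)] 1(2)[unfolded power_one mult_1] 2(2) G(2)[of n i] by linarith
    qed
    have lim: "(\<lambda>n. nsq (\<lambda>x. w n x - u x)) \<longlonglongrightarrow> 0"
    proof (rule tendsto_sandwich[OF _ _ tendsto_const])
      let ?b = "\<lambda>n. 2 * (32 * (1 / real (Suc n))^2 * nsq g) + 2 * (\<integral>x. (1 - c n x)^2 * (norm (u x))^2 \<partial>lebesgue)"
      have "nsq (\<lambda>x. w n x - u x) \<le> ?b n" for n
      proof -
        have d2: "(\<lambda>x. corr (\<rho> n) u x - u x) \<in> Lp 2" by (intro L2_diff U u2)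
        have r: "\<bar>c n x - 1\<bar> \<le> 1" for x using cutoff_range[of "real (Suc n)" 0 x] by (auto simp: c_def)
        have m: "(\<lambda>x. c n x - 1) \<in> borel_measurable lebesgue" using test_meas[OF c] by simp
        note 1 = L2_mult_bounded[OF d2 test_meas[OF c[of n]] crange[of n]]
        note 2 = L2_mult_bounded[OF u2 m r]
        \<comment> \<open>The mollification error inside the cut-off, plus the part of
          \<open>u\<close> that the cut-off removes.\<close>
        have "nsq (\<lambda>x. w n x - u x) = nsq (\<lambda>x. c n x *\<^sub>R (corr (\<rho> n) u x - u x) + (c n x - 1) *\<^sub>R u x)"
          by (simp add: w_def algebra_simps)
        also have "\<dots> \<le> 2 * nsq (\<lambda>x. c n x *\<^sub>R (corr (\<rho> n) u x - u x)) + 2 * nsq (\<lambda>x. (c n x - 1) *\<^sub>R u x)"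
          by (rule nsq_add_le[OF 1(1) 2(1)])
        also have "nsq (\<lambda>x. (c n x - 1) *\<^sub>R u x) = (\<integral>x. (1 - c n x)^2 * (norm (u x))^2 \<partial>lebesgue)"
          by (simp add: nsq_def power_mult_distrib power2_commute)
        finally show ?thesis
          using 1(2) corr_moll_close[OF dpos[of n] u2 g2 wg] by (simp add: \<rho>_def)
      qed
      then show "\<forall>\<^sub>F n in sequentially. nsq (\<lambda>x. w n x - u x) \<le> ?b n" by simp
      have a: "(\<lambda>n. (1 / real (Suc n))^2) \<longlonglongrightarrow> 0^2"
        by (intro tendsto_power) (use LIMSEQ_inverse_real_of_nat in \<open>simp add: inverse_eq_divide\<close>)
      have b: "(\<lambda>n. \<integral>x. (1 - c n x)^2 * (norm (u x))^2 \<partial>lebesgue) \<longlonglongrightarrow> 0"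
      proof (rule integral_vanishing_weight[OF L2_int[OF u2]])
        show "(\<lambda>x. (1 - c n x)^2) \<in> borel_measurable lebesgue" for n using test_meas[OF c] by simp
        show "\<bar>(1 - c n x)^2\<bar> \<le> 1" for n x using cutoff_range[of "real (Suc n)" 0 x] by (auto simp: c_def intro!: power_le_one)
        show "(\<lambda>n. (1 - c n x)^2) \<longlonglongrightarrow> 0" for x
          using tendsto_power[OF tendsto_diff[OF tendsto_const cutoff_tendsto[of x]], of 1 2] by (simp add: c_def)
      qed
      have "?b \<longlonglongrightarrow> 2 * (32 * 0^2 * nsq g) + 2 * 0" by (intro tendsto_intros a b)
      then show "?b \<longlonglongrightarrow> 0" by simp
    qed simp
    obtain r where r: "strict_mono r" "AE x in lebesgue. (\<lambda>n. w (r n) x) \<longlonglongrightarrow> u x"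
      using L2_AE_subseq[OF w2(1) u2 lim] by blast
    define Cn where "Cn n = 2 ^ (k + 2) * (fact (Suc k))^2 * nsq u * (2 * nsq g + 4 * ((K / real (Suc n))^2 * nsq u)) ^ k" for n
    have bd: "(\<integral>x. norm (w n x) ^ (2 * Suc k) \<partial>lebesgue) \<le> Cn n" for n
    proof -
      have "nsq (p n 1) + nsq (p n 2) \<le> 2 * nsq g + 4 * ((K / real (Suc n))^2 * nsq u)"
        using p2(2)[of n 1] p2(2)[of n 2] nsq_vec[OF g2] by simp
      then have "2 ^ (k + 2) * (fact (Suc k))^2 * nsq (w n) * (nsq (p n 1) + nsq (p n 2)) ^ k \<le> Cn n"
        unfolding Cn_def by (intro mult_mono power_mono w2 mult_nonneg_nonneg zero_le_power) auto
      then show ?thesis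
        using sobolev_complex(2)[OF C1[OF bounded_linear_Re] C1[OF bounded_linear_Im] w2(1) p2(1), of n k] by linarith
    qed
    have Clim: "(\<lambda>n. Cn (r n)) \<longlonglongrightarrow> 2 ^ (k + 2) * (fact (Suc k))^2 * nsq u * (2 * nsq g + 4 * (0^2 * nsq u)) ^ k"
    proof -
      have "(\<lambda>n. K / real (Suc n)) \<longlonglongrightarrow> 0"
        using tendsto_mult_right_zero[OF LIMSEQ_inverse_real_of_nat, of K] by (simp add: divide_inverse)
      then have "Cn \<longlonglongrightarrow> 2 ^ (k + 2) * (fact (Suc k))^2 * nsq u * (2 * nsq g + 4 * (0^2 * nsq u)) ^ k"
        unfolding Cn_def[abs_def] by (intro tendsto_intros)
      then show ?thesis using LIMSEQ_subseq_LIMSEQ[OF _ r(1)] by (simp add: o_def)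
    qed
    have "integrable lebesgue (\<lambda>x. norm (u x) ^ (2 * Suc k)) \<and> (\<integral>x. norm (u x) ^ (2 * Suc k) \<partial>lebesgue)
       \<le> 2 ^ (k + 2) * (fact (Suc k))^2 * nsq u * (2 * nsq g + 4 * (0^2 * nsq u)) ^ k"
    proof (rule fatou_bound[where f = "\<lambda>n x. norm (w (r n) x) ^ (2 * Suc k)" and C = "\<lambda>n. Cn (r n)"])
      show "integrable lebesgue (\<lambda>x. norm (w (r n) x) ^ (2 * Suc k))" for n
        by (rule sobolev_complex(1)[OF C1[OF bounded_linear_Re] C1[OF bounded_linear_Im] w2(1) p2(1)])
      show "AE x in lebesgue. (\<lambda>n. norm (w (r n) x) ^ (2 * Suc k)) \<longlonglongrightarrow> norm (u x) ^ (2 * Suc k)"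
        using r(2) by eventually_elim (intro tendsto_intros)
      show "(\<lambda>x. norm (u x) ^ (2 * Suc k)) \<in> borel_measurable lebesgue" using L2_meas[OF u2] by simp
    qed (use bd Clim in auto)
    moreover have "2 ^ (k + 2) * (fact (Suc k))^2 * nsq u * (2 * nsq g + 4 * (0^2 * nsq u)) ^ k = F * nsq u * nsq g ^ k"
      by (simp add: F_def power_mult_distrib)
    ultimately show ?thesis by (simp only: g_def)
  qed
  with F0 show ?thesis by blast
qed

section \<open>Compactness\<close>

lemma H1_lincomb:
  assumes "u \<in> H1" "v \<in> H1"
  shows "(\<lambda>x. a *\<^sub>R u x + b *\<^sub>R v x) \<in> H1"
    "has_weak_gradient (\<lambda>x. a *\<^sub>R u x + b *\<^sub>R v x) (\<lambda>x. a *\<^sub>R weak_gradient u x + b *\<^sub>R weak_gradient v x)"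
    "kin (\<lambda>x. a *\<^sub>R u x + b *\<^sub>R v x) = nsq (\<lambda>x. a *\<^sub>R weak_gradient u x + b *\<^sub>R weak_gradient v x)"
proof -
  note u = H1_weak_gradient[OF assms(1)] and v = H1_weak_gradient[OF assms(2)]
  show w: "has_weak_gradient (\<lambda>x. a *\<^sub>R u x + b *\<^sub>R v x) (\<lambda>x. a *\<^sub>R weak_gradient u x + b *\<^sub>R weak_gradient v x)"
    by (rule has_weak_gradient_scaleR_add[OF u(3) v(3)])
  have g: "(\<lambda>x. a *\<^sub>R weak_gradient u x + b *\<^sub>R weak_gradient v x) \<in> Lp 2"
    by (intro L2_add L2_scaleR u v)
  show "(\<lambda>x. a *\<^sub>R u x + b *\<^sub>R v x) \<in> H1"
    by (rule H1_I[OF _ g w]) (intro L2_add L2_scaleR u v)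
  show "kin (\<lambda>x. a *\<^sub>R u x + b *\<^sub>R v x) = nsq (\<lambda>x. a *\<^sub>R weak_gradient u x + b *\<^sub>R weak_gradient v x)"
    by (rule kin_eq[OF g w])
qed

lemma H1_scaleR: assumes "u \<in> H1" shows "(\<lambda>x. a *\<^sub>R u x) \<in> H1" "kin (\<lambda>x. a *\<^sub>R u x) = a^2 * kin u"
  using H1_lincomb[OF assms assms, of a 0] nsq_scaleR[of a "weak_gradient u"] by simp_all

lemma H1_diff: assumes "u \<in> H1" "v \<in> H1"
  shows "(\<lambda>x. u x - v x) \<in> H1" "kin (\<lambda>x. u x - v x) = nsq (\<lambda>x. weak_gradient u x - weak_gradient v x)"
  using H1_lincomb[OF assms, of 1 "-1"] by simp_all

lemma H1_kin_diff_le: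
  assumes "u \<in> H1" "v \<in> H1" shows "kin (\<lambda>x. u x - v x) \<le> 2 * kin u + 2 * kin v"
  using H1_diff(2)[OF assms] nsq_diff_le[OF H1_weak_gradient(2)[OF assms(1)] H1_weak_gradient(2)[OF assms(2)]] by simp

lemma H1_L2: "u \<in> H1 \<Longrightarrow> u \<in> Lp 2" by (rule H1_weak_gradient)

section \<open>Potentials that are small relative to the \<open>H1\<close> norm\<close>

lemma young_powr:
  fixes a b r s :: real
  assumes "0 \<le> a" "0 \<le> b" "1 < r" "1 < s" "1 / r + 1 / s = 1"
  shows "a * b \<le> a powr r + b powr s"
proof -
  have "a * b \<le> a powr r / r + b powr s / s"
    using Youngs_inequality[of r s a b] assms by auto
  also have "\<dots> \<le> a powr r + b powr s"
    using assms by (intro add_mono) (auto simp: divide_le_eq mult_le_cancel_left1)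
  finally show ?thesis .
qed

text \<open>Where both \<open>norm x\<close> and \<open>\<bar>W x\<bar>\<close> are at most
  \<open>n\<close>, the weight is bounded and localized, which is the \<open>M\<close> term. The
  rest of \<open>W\<close> has a small integral of its power \<open>r\<close>; it is paired with
  \<open>|u|^2\<close> by Young's inequality, and the conjugate power of \<open>|u|^2\<close> is
  controlled by Gagliardo-Nirenberg.\<close>

lemma Lp_weight_bound:
  fixes W :: "plane \<Rightarrow> real"
  assumes W: "W \<in> Lp r" and r: "1 < r" and \<eta>: "\<eta> > 0"
  shows "\<exists>M\<ge>0. \<forall>u\<in>H1. integrable lebesgue (\<lambda>x. \<bar>W x\<bar> * (norm (u x))^2) \<and>
    (\<integral>x. \<bar>W x\<bar> * (norm (u x))^2 \<partial>lebesgue) \<le> M * (\<integral>x. indicator (cball 0 M) x * (norm (u x))^2 \<partial>lebesgue) + \<eta> * (nsq u + kin u)"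
proof -
  have Wm [measurable]: "W \<in> borel_measurable lebesgue" and Wi: "integrable lebesgue (\<lambda>x. \<bar>W x\<bar> powr r)"
    using W by (auto simp: Lp_def)
  \<comment> \<open>The conjugate exponent, which is large when \<open>r\<close> is close to 1. The
    even power \<open>2 * Suc k\<close> lies above \<open>2 * s\<close>, so powers between the
    square and this one are dominated by their sum.\<close>
  define s where "s = r / (r - 1)"
  have s: "1 < s" "1 / r + 1 / s = 1" using r by (auto simp: s_def field_simps)
  obtain k where k: "s \<le> real k" using real_arch_simple by blast
  obtain C where C: "C \<ge> 0" "\<forall>u\<in>H1. integrable lebesgue (\<lambda>x. norm (u x) ^ (2 * Suc k)) \<and>
     (\<integral>x. norm (u x) ^ (2 * Suc k) \<partial>lebesgue) \<le> C * nsq u * kin u ^ k"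
    using gagliardo_nirenberg_power[of k] by blast
  have sp: "(t^2) powr s \<le> t^2 + t ^ (2 * Suc k)" if "0 \<le> t" for t :: real
  proof (cases "t^2 \<le> 1")
    case True
    have "(t^2) powr s \<le> (t^2) powr 1" using True s(1) by (intro powr_mono') auto
    also have "\<dots> = t^2" by (cases "t = 0") auto
    finally show ?thesis using zero_le_power[OF that, of "2 * Suc k"] by linarith
  next
    case False
    then have "(t^2) powr s \<le> (t^2) powr (real (Suc k))" using k by (intro powr_mono) auto
    also have "\<dots> = (t^2) ^ (Suc k)" using False by (subst powr_realpow) auto
    also have "\<dots> = t ^ (2 * Suc k)" by (simp only: power_mult)
    finally show ?thesis using zero_le_power2[of t] by linarith
  qed
  \<comment> \<open>Young's inequality is weighted by \<epsilon> so that the term in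
    \<open>u\<close> contributes at most \<open>\<eta> / 2\<close> on the unit ball of
    \<open>H1\<close>, where \<open>1 + C\<close> bounds the two integrals of powers of
    \<open>u\<close>. Afterwards \<open>n\<close> is taken so large that the term in
    \<open>W\<close> contributes at most the other half.\<close>
  define \<epsilon> where "\<epsilon> = (\<eta> / (2 * (1 + C))) powr (1 / s)"
  have \<epsilon>: "\<epsilon> > 0" "\<epsilon> powr s * (1 + C) = \<eta> / 2"
  proof -
    have "\<epsilon> powr s = \<eta> / (2 * (1 + C))" using \<eta> C(1) s(1) by (simp add: \<epsilon>_def powr_powr)
    moreover have "1 + C \<noteq> 0" using C(1) by simp
    moreover have "x / (2 * D) * D = x / 2" if "D \<noteq> 0" for x D :: real using that by simp
    ultimately show "\<epsilon> powr s * (1 + C) = \<eta> / 2" by metis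
    show "\<epsilon> > 0" using \<eta> C(1) by (simp add: \<epsilon>_def)
  qed
  define B where "B n = {x. \<not> (norm x \<le> real n \<and> \<bar>W x\<bar> \<le> real n)}" for n
  have B [measurable]: "B n \<in> sets lebesgue" for n
  proof -
    have "{x \<in> space lebesgue. \<not> (norm x \<le> real n \<and> \<bar>W x\<bar> \<le> real n)} \<in> sets lebesgue"
      using continuous_measurable_lebesgue[OF continuous_on_norm_id] by measurable
    then show ?thesis by (simp add: B_def)
  qed
  have "(\<lambda>n. \<integral>x. indicator (B n) x * \<bar>W x\<bar> powr r \<partial>lebesgue) \<longlonglongrightarrow> 0"
  proof (rule integral_vanishing_weight[OF Wi])
    show "(\<lambda>n. indicator (B n) x :: real) \<longlonglongrightarrow> 0" for x
    proof -
      obtain N where "max (norm x) \<bar>W x\<bar> \<le> real N" using real_arch_simple by blast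
      then have "indicator (B n) x = (0::real)" if "n \<ge> N" for n
        using that by (auto simp: B_def)
      then show ?thesis by (intro tendsto_eventually) (auto simp: eventually_sequentially)
    qed
  qed (auto simp: indicator_def)
  moreover have "0 < \<eta> / 2 * \<epsilon> powr r" using \<eta> \<epsilon> by simp
  ultimately have "\<forall>\<^sub>F n in sequentially. (\<integral>x. indicator (B n) x * \<bar>W x\<bar> powr r \<partial>lebesgue) < \<eta> / 2 * \<epsilon> powr r"
    by (rule order_tendstoD(2))
  then obtain n where n: "(\<integral>x. indicator (B n) x * \<bar>W x\<bar> powr r \<partial>lebesgue) < \<eta> / 2 * \<epsilon> powr r"
    unfolding eventually_sequentially by blast
  define Wb where "Wb x = indicator (B n) x * \<bar>W x\<bar>" for x
  have Wb0: "0 \<le> Wb x" for x by (simp add: Wb_def)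
  have [measurable]: "Wb \<in> borel_measurable lebesgue" unfolding Wb_def by measurable
  have Wbp: "Wb x powr r = indicator (B n) x * \<bar>W x\<bar> powr r" for x by (simp add: Wb_def indicator_def)
  have Wbi: "integrable lebesgue (\<lambda>x. Wb x powr r)"
    unfolding Wbp by (rule Bochner_Integration.integrable_bound[OF Wi]) (auto simp: indicator_def)
  have small: "integrable lebesgue (\<lambda>x. Wb x * (norm (u x))^2) \<and> (\<integral>x. Wb x * (norm (u x))^2 \<partial>lebesgue) \<le> \<eta>"
    if u: "u \<in> H1" "nsq u + kin u \<le> 1" for u
  proof -
    have [measurable]: "u \<in> borel_measurable lebesgue" by (rule L2_meas[OF H1_L2[OF u(1)]])
    let ?b = "\<lambda>x. \<epsilon> powr (- r) * Wb x powr r + \<epsilon> powr s * ((norm (u x))^2 + norm (u x) ^ (2 * Suc k))"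
    have i: "integrable lebesgue (\<lambda>x. (norm (u x))^2)" "integrable lebesgue (\<lambda>x. norm (u x) ^ (2 * Suc k))"
      using L2_int[OF H1_L2[OF u(1)]] C(2) u(1) by auto
    have bi: "integrable lebesgue ?b"
      using i Wbi by (intro Bochner_Integration.integrable_add integrable_mult_right)
    have le: "Wb x * (norm (u x))^2 \<le> ?b x" for x
    proof -
      have "Wb x * (norm (u x))^2 = (Wb x / \<epsilon>) * (\<epsilon> * (norm (u x))^2)" using \<epsilon> by simp
      also have "\<dots> \<le> (Wb x / \<epsilon>) powr r + (\<epsilon> * (norm (u x))^2) powr s"
        using \<epsilon> Wb0 r s by (intro young_powr) auto
      also have "\<dots> = \<epsilon> powr (- r) * Wb x powr r + \<epsilon> powr s * ((norm (u x))^2) powr s"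
        using \<epsilon> Wb0 by (simp add: powr_divide powr_mult powr_minus_divide)
      also have "\<dots> \<le> ?b x" by (intro add_left_mono mult_left_mono sp) auto
      finally show ?thesis .
    qed
    have int: "integrable lebesgue (\<lambda>x. Wb x * (norm (u x))^2)"
      by (rule Bochner_Integration.integrable_bound[OF bi])
        (use le Wb0 in \<open>auto intro!: AE_I2 intro: order_trans[OF _ abs_ge_self]\<close>)
    have "(\<integral>x. Wb x * (norm (u x))^2 \<partial>lebesgue) \<le> (\<integral>x. ?b x \<partial>lebesgue)"
      by (intro integral_mono int bi le)
    also have "\<dots> = \<epsilon> powr (- r) * (\<integral>x. Wb x powr r \<partial>lebesgue) + \<epsilon> powr s * (nsq u + (\<integral>x. norm (u x) ^ (2 * Suc k) \<partial>lebesgue))"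
      using i Wbi by (simp add: nsq_def del: power_Suc mult_Suc_right)
    also have "\<dots> \<le> \<epsilon> powr (- r) * (\<eta> / 2 * \<epsilon> powr r) + \<epsilon> powr s * (1 + C)"
    proof (intro add_mono mult_left_mono)
      show "(\<integral>x. Wb x powr r \<partial>lebesgue) \<le> \<eta> / 2 * \<epsilon> powr r" using n by (simp add: Wbp)
      show "nsq u \<le> 1" using u(2) nsq_nonneg[of "weak_gradient u"] by linarith
      have "kin u \<le> 1" using u(2) nsq_nonneg[of u] by linarith
      then have "C * nsq u * kin u ^ k \<le> C * 1 * 1" using \<open>nsq u \<le> 1\<close> C(1)
        by (intro mult_mono power_le_one) auto
      then show "(\<integral>x. norm (u x) ^ (2 * Suc k) \<partial>lebesgue) \<le> C" using C(2) u(1) by force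
    qed auto
    also have "\<epsilon> powr (- r) * (\<eta> / 2 * \<epsilon> powr r) = \<eta> / 2" using \<epsilon> by (simp add: powr_minus_divide)
    also have "\<eta> / 2 + \<epsilon> powr s * (1 + C) = \<eta>" using \<epsilon>(2) by simp
    finally show ?thesis using int by simp
  qed
  \<comment> \<open>Both sides are quadratic in \<open>u\<close>, so the bound on the unit ball
    extends by scaling; a null function is treated separately.\<close>
  have tail: "integrable lebesgue (\<lambda>x. Wb x * (norm (u x))^2) \<and> (\<integral>x. Wb x * (norm (u x))^2 \<partial>lebesgue) \<le> \<eta> * (nsq u + kin u)"
    if u: "u \<in> H1" for u
  proof (cases "nsq u + kin u = 0")
    case True
    then have "nsq u = 0" using nsq_nonneg[of u] nsq_nonneg[of "weak_gradient u"] by linarith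
    then have z: "AE x in lebesgue. u x = 0" by (rule nsq_eq_0[OF H1_L2[OF u]])
    have [measurable]: "u \<in> borel_measurable lebesgue" by (rule L2_meas[OF H1_L2[OF u]])
    have "AE x in lebesgue. Wb x * (norm (u x))^2 = 0" using z by eventually_elim simp
    then have "integrable lebesgue (\<lambda>x. Wb x * (norm (u x))^2)" "(\<integral>x. Wb x * (norm (u x))^2 \<partial>lebesgue) = 0"
      using integrable_cong_AE[of "\<lambda>x. Wb x * (norm (u x))^2" lebesgue "\<lambda>x. 0"]
        integral_cong_AE[of "\<lambda>x. Wb x * (norm (u x))^2" lebesgue "\<lambda>x. 0"] by auto
    then show ?thesis using True by simp
  next
    case False
    define N where "N = nsq u + kin u"
    have N: "N > 0" using False nsq_nonneg[of u] nsq_nonneg[of "weak_gradient u"] unfolding N_def by linarith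
    let ?v = "\<lambda>x. (1 / sqrt N) *\<^sub>R u x"
    have v: "?v \<in> H1" "kin ?v = (1 / N) * kin u" "nsq ?v = (1 / N) * nsq u"
      using H1_scaleR[OF u, of "1 / sqrt N"] N by (auto simp: nsq_scaleR power_divide)
    have "nsq u + kin u = N" by (simp add: N_def)
    then have "nsq ?v + kin ?v = (1 / N) * N"
      using v(2,3) distrib_left[of "1 / N" "nsq u" "kin u"] by simp
    then have "nsq ?v + kin ?v \<le> 1" using N by simp
    note sm = small[OF v(1) this]
    have e: "Wb x * (norm (?v x))^2 = (1 / N) * (Wb x * (norm (u x))^2)" for x
      using N by (simp add: power_divide power_mult_distrib)
    have i: "integrable lebesgue (\<lambda>x. (1 / N) * (Wb x * (norm (u x))^2))" using sm unfolding e by (rule conjunct1)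
    have "integrable lebesgue (\<lambda>x. N * ((1 / N) * (Wb x * (norm (u x))^2)))"
      by (rule integrable_mult_right) (rule i)
    then have "integrable lebesgue (\<lambda>x. Wb x * (norm (u x))^2)" using N by simp
    moreover have "(\<integral>x. Wb x * (norm (u x))^2 \<partial>lebesgue) \<le> \<eta> * N"
      using sm N unfolding e by (simp add: field_simps)
    ultimately show ?thesis by (simp add: N_def)
  qed
  show ?thesis
  proof (intro exI[of _ "real n"] conjI ballI)
    fix u assume u: "u \<in> H1"
    have [measurable]: "u \<in> borel_measurable lebesgue" by (rule L2_meas[OF H1_L2[OF u]])
    have cb [measurable]: "cball (0::plane) (real n) \<in> sets lebesgue" by (simp add: fmeasurableD)
    let ?g = "\<lambda>x. indicator (cball 0 (real n)) x * (norm (u x))^2" and ?t = "\<lambda>x. Wb x * (norm (u x))^2"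
    have gi: "integrable lebesgue ?g"
      by (rule Bochner_Integration.integrable_bound[OF L2_int[OF H1_L2[OF u]]]) (measurable, auto simp: indicator_def)
    have le: "\<bar>W x\<bar> * (norm (u x))^2 \<le> real n * ?g x + ?t x" for x
      by (cases "x \<in> B n") (auto simp: Wb_def B_def indicator_def intro!: mult_right_mono)
    have ri: "integrable lebesgue (\<lambda>x. real n * ?g x + ?t x)" using gi tail[OF u] by auto
    show int: "integrable lebesgue (\<lambda>x. \<bar>W x\<bar> * (norm (u x))^2)"
      by (rule Bochner_Integration.integrable_bound[OF ri]) (use le in \<open>auto intro!: AE_I2 intro: order_trans[OF _ abs_ge_self]\<close>)
    have "(\<integral>x. \<bar>W x\<bar> * (norm (u x))^2 \<partial>lebesgue) \<le> (\<integral>x. real n * ?g x + ?t x \<partial>lebesgue)"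
      by (intro integral_mono int ri le)
    also have "\<dots> = real n * (\<integral>x. ?g x \<partial>lebesgue) + (\<integral>x. ?t x \<partial>lebesgue)" using gi tail[OF u] by simp
    finally show "(\<integral>x. \<bar>W x\<bar> * (norm (u x))^2 \<partial>lebesgue) \<le> real n * (\<integral>x. ?g x \<partial>lebesgue) + \<eta> * (nsq u + kin u)"
      using tail[OF u] by linarith
  qed simp
qed

text \<open>Relative form smallness combined with localization: in the form sense, multiplication by
  \<open>W\<close> is a compact perturbation of the squared \<open>H1\<close> norm. A single number
  \<open>M\<close> serves as height and as radius, which is harmless as it may grow.\<close>

definition tame_weight :: "(plane \<Rightarrow> real) \<Rightarrow> bool" where
  "tame_weight W \<longleftrightarrow> W \<in> borel_measurable lebesgue \<and> (\<forall>\<eta>>0. \<exists>M\<ge>0. \<forall>u\<in>H1. integrable lebesgue (\<lambda>x. \<bar>W x\<bar> * (norm (u x))^2) \<and>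
    (\<integral>x. \<bar>W x\<bar> * (norm (u x))^2 \<partial>lebesgue) \<le> M * (\<integral>x. indicator (cball 0 M) x * (norm (u x))^2 \<partial>lebesgue) + \<eta> * (nsq u + kin u))"

lemma tame_weight_Lp: "W \<in> Lp r \<Longrightarrow> 1 < r \<Longrightarrow> tame_weight W"
  unfolding tame_weight_def using Lp_weight_bound by (auto simp: Lp_def)

lemma indicator_sq_integrable:
  fixes u :: "plane \<Rightarrow> 'b::euclidean_space"
  assumes "u \<in> Lp 2"
  shows "integrable lebesgue (\<lambda>x. indicator (cball 0 M) x * (norm (u x))^2)"
proof -
  have [measurable]: "cball (0::plane) M \<in> sets lebesgue" by (simp add: fmeasurableD)
  have [measurable]: "u \<in> borel_measurable lebesgue" by (rule L2_meas[OF assms])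
  show ?thesis
    by (rule Bochner_Integration.integrable_bound[OF L2_int[OF assms]]) (measurable, auto simp: indicator_def)
qed

text \<open>Reduces \<open>Lp + Lq\<close> to its two summands. \<open>M1 + M2\<close> exceeds both
  radii and bounds the combined height, while \<eta> is shared equally.\<close>

lemma tame_weight_dominated:
  assumes f: "tame_weight f" and g: "tame_weight g" and W: "W \<in> borel_measurable lebesgue"
    and le: "AE x in lebesgue. \<bar>W x\<bar> \<le> \<bar>f x\<bar> + \<bar>g x\<bar>"
  shows "tame_weight W"
  unfolding tame_weight_def
proof (intro conjI allI impI W)
  fix \<eta> :: real assume "\<eta> > 0"
  then have h: "\<eta> / 2 > 0" by simp
  obtain M1 where M1: "M1 \<ge> 0" "\<forall>u\<in>H1. integrable lebesgue (\<lambda>x. \<bar>f x\<bar> * (norm (u x))^2) \<and>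
    (\<integral>x. \<bar>f x\<bar> * (norm (u x))^2 \<partial>lebesgue) \<le> M1 * (\<integral>x. indicator (cball 0 M1) x * (norm (u x))^2 \<partial>lebesgue) + \<eta>/2 * (nsq u + kin u)"
    using f h unfolding tame_weight_def by blast
  obtain M2 where M2: "M2 \<ge> 0" "\<forall>u\<in>H1. integrable lebesgue (\<lambda>x. \<bar>g x\<bar> * (norm (u x))^2) \<and>
    (\<integral>x. \<bar>g x\<bar> * (norm (u x))^2 \<partial>lebesgue) \<le> M2 * (\<integral>x. indicator (cball 0 M2) x * (norm (u x))^2 \<partial>lebesgue) + \<eta>/2 * (nsq u + kin u)"
    using g h unfolding tame_weight_def by blast
  show "\<exists>M\<ge>0. \<forall>u\<in>H1. integrable lebesgue (\<lambda>x. \<bar>W x\<bar> * (norm (u x))^2) \<and>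
    (\<integral>x. \<bar>W x\<bar> * (norm (u x))^2 \<partial>lebesgue) \<le> M * (\<integral>x. indicator (cball 0 M) x * (norm (u x))^2 \<partial>lebesgue) + \<eta> * (nsq u + kin u)"
  proof (intro exI[of _ "M1 + M2"] conjI ballI)
    fix u assume u: "u \<in> H1"
    note [measurable] = L2_meas[OF H1_L2[OF u]] W
    have i: "integrable lebesgue (\<lambda>x. \<bar>f x\<bar> * (norm (u x))^2 + \<bar>g x\<bar> * (norm (u x))^2)" using M1 M2 u by simp
    have le': "AE x in lebesgue. \<bar>W x\<bar> * (norm (u x))^2 \<le> \<bar>f x\<bar> * (norm (u x))^2 + \<bar>g x\<bar> * (norm (u x))^2"
      using le by eventually_elim (simp add: distrib_right[symmetric] mult_right_mono)
    show int: "integrable lebesgue (\<lambda>x. \<bar>W x\<bar> * (norm (u x))^2)"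
      by (rule Bochner_Integration.integrable_bound[OF i]) (use le' in \<open>auto elim!: eventually_mono\<close>)
    have "(\<integral>x. \<bar>W x\<bar> * (norm (u x))^2 \<partial>lebesgue) \<le> (\<integral>x. \<bar>f x\<bar> * (norm (u x))^2 + \<bar>g x\<bar> * (norm (u x))^2 \<partial>lebesgue)"
      by (intro integral_mono_AE int i le')
    also have "\<dots> = (\<integral>x. \<bar>f x\<bar> * (norm (u x))^2 \<partial>lebesgue) + (\<integral>x. \<bar>g x\<bar> * (norm (u x))^2 \<partial>lebesgue)"
      using M1 M2 u by simp
    also have "\<dots> \<le> (M1 * (\<integral>x. indicator (cball 0 M1) x * (norm (u x))^2 \<partial>lebesgue) + \<eta>/2 * (nsq u + kin u)) +
      (M2 * (\<integral>x. indicator (cball 0 M2) x * (norm (u x))^2 \<partial>lebesgue) + \<eta>/2 * (nsq u + kin u))"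
      using M1(2) M2(2) u by (intro add_mono) auto
    also have "\<dots> \<le> (M1 + M2) * (\<integral>x. indicator (cball 0 (M1 + M2)) x * (norm (u x))^2 \<partial>lebesgue) + \<eta> * (nsq u + kin u)"
    proof -
      have "(\<integral>x. indicator (cball 0 M) x * (norm (u x))^2 \<partial>lebesgue) \<le> (\<integral>x. indicator (cball 0 (M1 + M2)) x * (norm (u x))^2 \<partial>lebesgue)"
        if "M \<le> M1 + M2" for M
        using that by (intro integral_mono indicator_sq_integrable H1_L2 u) (auto simp: indicator_def)
      from mult_left_mono[OF this[of M1] M1(1)] mult_left_mono[OF this[of M2] M2(1)] show ?thesis
        using M1(1) M2(1) by (simp add: algebra_simps)
    qed
    finally show "(\<integral>x. \<bar>W x\<bar> * (norm (u x))^2 \<partial>lebesgue) \<le> (M1 + M2) * (\<integral>x. indicator (cball 0 (M1 + M2)) x * (norm (u x))^2 \<partial>lebesgue) + \<eta> * (nsq u + kin u)" .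
  qed (use M1 M2 in simp)
qed

lemma tame_weight_integrable: "tame_weight W \<Longrightarrow> u \<in> H1 \<Longrightarrow> integrable lebesgue (\<lambda>x. \<bar>W x\<bar> * (norm (u x))^2)"
  unfolding tame_weight_def using zero_less_one by blast

lemma tame_weight_form_bound:
  assumes "tame_weight W" "\<eta> > 0"
  shows "\<exists>C\<ge>0. \<forall>u\<in>H1. (\<integral>x. \<bar>W x\<bar> * (norm (u x))^2 \<partial>lebesgue) \<le> C * nsq u + \<eta> * kin u"
proof -
  obtain M where M: "M \<ge> 0" "\<forall>u\<in>H1. (\<integral>x. \<bar>W x\<bar> * (norm (u x))^2 \<partial>lebesgue) \<le>
      M * (\<integral>x. indicator (cball 0 M) x * (norm (u x))^2 \<partial>lebesgue) + \<eta> * (nsq u + kin u)"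
    using assms unfolding tame_weight_def by blast
  have "(\<integral>x. \<bar>W x\<bar> * (norm (u x))^2 \<partial>lebesgue) \<le> (M + \<eta>) * nsq u + \<eta> * kin u" if u: "u \<in> H1" for u
  proof -
    have "(\<integral>x. indicator (cball 0 M) x * (norm (u x))^2 \<partial>lebesgue) \<le> nsq u"
      unfolding nsq_def by (intro integral_mono indicator_sq_integrable L2_int H1_L2 u) (auto simp: indicator_def)
    from mult_left_mono[OF this M(1)] show ?thesis using M(2) u by (fastforce simp: algebra_simps)
  qed
  then show ?thesis using M(1) assms(2) by (intro exI[of _ "M + \<eta>"]) auto
qed

section \<open>Local convergence in mean square\<close>

definition loc_nsq :: "real \<Rightarrow> (plane \<Rightarrow> 'b::euclidean_space) \<Rightarrow> real" where
  "loc_nsq R f = (\<integral>x. indicator (cball 0 R) x * (norm (f x))^2 \<partial>lebesgue)"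

lemma loc_nsq_nonneg [simp]: "0 \<le> loc_nsq R f"
  unfolding loc_nsq_def by (rule Bochner_Integration.integral_nonneg) auto

lemma cball_sets [measurable]: "cball (0::plane) M \<in> sets lebesgue"
  by (simp add: fmeasurableD)

lemma loc_nsq_eq: "loc_nsq R f = nsq (\<lambda>x. indicator (cball 0 R) x *\<^sub>R f x)"
  unfolding loc_nsq_def nsq_def by (rule Bochner_Integration.integral_cong) (auto simp: indicator_def)

lemma L2_indicator:
  fixes f :: "plane \<Rightarrow> 'b::euclidean_space"
  assumes "f \<in> Lp 2" shows "(\<lambda>x. indicator (cball 0 R) x *\<^sub>R f x) \<in> Lp 2"
  by (rule L2_mult_bounded(1)[OF assms, where C=1]) (rule borel_measurable_indicator[OF cball_sets], simp add: indicator_def)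

lemma L2_indicator_ball: "(indicator (cball 0 R) :: plane \<Rightarrow> real) \<in> Lp 2"
proof (rule L2_I)
  have e: "(\<lambda>x. (norm (indicator (cball (0::plane) R) x :: real))^2) = indicator (cball 0 R)"
    by (auto simp: indicator_def fun_eq_iff)
  show "integrable lebesgue (\<lambda>x. (norm (indicator (cball (0::plane) R) x :: real))^2)"
    unfolding e using lmeasurable_cball[of "0::plane" R] by (simp add: fmeasurable_def)
qed (rule borel_measurable_indicator[OF cball_sets])

lemma loc_nsq_le:
  fixes f :: "plane \<Rightarrow> 'b::euclidean_space"
  assumes "f \<in> Lp 2" shows "loc_nsq R f \<le> nsq f"
  unfolding loc_nsq_def nsq_def by (intro integral_mono indicator_sq_integrable L2_int assms) (auto simp: indicator_def)

lemma loc_nsq_triangle: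
  fixes f g h :: "plane \<Rightarrow> 'b::euclidean_space"
  assumes "f \<in> Lp 2" "g \<in> Lp 2" "h \<in> Lp 2"
  shows "loc_nsq R (\<lambda>x. f x - h x) \<le> 2 * loc_nsq R (\<lambda>x. f x - g x) + 2 * loc_nsq R (\<lambda>x. g x - h x)"
  using nsq_triangle[OF L2_indicator[OF assms(1)] L2_indicator[OF assms(2)] L2_indicator[OF assms(3)], of R R R]
  by (simp add: loc_nsq_eq scaleR_diff_right)

text \<open>Moving the centre of the kernel changes it by at most its Lipschitz constant times the
  displacement, within a fixed ball; there \<open>norm (u z)\<close> is integrable with a bound
  depending on \<open>K\<close> only. The point is the uniformity in \<open>u\<close>, as in the
  theorem of Arzela and Ascoli.\<close>

lemma corr_equicontinuous:
  fixes u :: "plane \<Rightarrow> 'b::euclidean_space"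
  assumes \<phi>: "\<phi> \<in> test_functions" and K: "0 \<le> K" and e: "e > 0"
  shows "\<exists>d>0. \<forall>u y. u \<in> Lp 2 \<longrightarrow> nsq u \<le> K \<longrightarrow> norm (y - x) < d \<longrightarrow> norm (corr \<phi> u y - corr \<phi> (u :: plane \<Rightarrow> 'b) x) < e"
proof -
  obtain L where L: "L > 0" "\<And>x y. \<bar>\<phi> x - \<phi> y\<bar> \<le> L * norm (x - y)" using test_lipschitz[OF \<phi>] by auto
  obtain B where B: "B > 0" "\<forall>z w. norm w \<le> norm x + 1 \<longrightarrow> norm z > B \<longrightarrow> \<phi> (z - w) = 0"
    using test_shift_support[OF \<phi>, of "norm x + 1"] by blast
  define m where "m = measure lebesgue (cball (0::plane) B)"
  have m0: "0 \<le> m" by (simp add: m_def)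
  define d where "d = min 1 (e / (L * (m + K + 1)))"
  have "d > 0" using L e K m0 by (simp add: d_def)
  moreover have "norm (corr \<phi> u y - corr \<phi> u x) < e" if u: "u \<in> Lp 2" "nsq u \<le> K" and y: "norm (y - x) < d" for u :: "plane \<Rightarrow> 'b" and y
  proof -
    have l: "locally_integrable u" by (rule locally_integrable_L2[OF u(1)])
    have i: "integrable lebesgue (\<lambda>z. \<phi> (z - w) *\<^sub>R u z)" for w by (rule test_scaleR_integrable[OF l test_shift[OF \<phi>]])
    have ny: "norm y \<le> norm x + 1" using y norm_triangle_ineq2[of y x] by (simp add: d_def)
    let ?b = "\<lambda>z. L * norm (y - x) * (indicator (cball 0 B) z + (norm (u z))^2)"
    have ind: "integrable lebesgue (indicator (cball 0 B) :: plane \<Rightarrow> real)"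
      using lmeasurable_cball[of "0::plane" B] by (simp add: fmeasurable_def)
    have bi: "integrable lebesgue ?b"
      by (intro integrable_mult_right Bochner_Integration.integrable_add ind L2_int u)
    have "norm (corr \<phi> u y - corr \<phi> u x) = norm (\<integral>z. \<phi> (z - y) *\<^sub>R u z - \<phi> (z - x) *\<^sub>R u z \<partial>lebesgue)"
      using i by (simp add: corr_def)
    also have "\<dots> \<le> (\<integral>z. norm (\<phi> (z - y) *\<^sub>R u z - \<phi> (z - x) *\<^sub>R u z) \<partial>lebesgue)" by (rule integral_norm_bound)
    also have "\<dots> \<le> (\<integral>z. ?b z \<partial>lebesgue)"
    proof (rule integral_mono)
      show "integrable lebesgue (\<lambda>z. norm (\<phi> (z - y) *\<^sub>R u z - \<phi> (z - x) *\<^sub>R u z))" using i by simp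
      show "norm (\<phi> (z - y) *\<^sub>R u z - \<phi> (z - x) *\<^sub>R u z) \<le> ?b z" for z
      proof (cases "norm z > B")
        case True
        then show ?thesis using B(2) ny L(1) by (simp add: scaleR_diff_left[symmetric])
      next
        case False
        have "norm (\<phi> (z - y) *\<^sub>R u z - \<phi> (z - x) *\<^sub>R u z) = \<bar>\<phi> (z - y) - \<phi> (z - x)\<bar> * norm (u z)"
          by (simp add: scaleR_diff_left[symmetric])
        also have "\<dots> \<le> (L * norm (y - x)) * norm (u z)"
          using L(2)[of "z - y" "z - x"] by (intro mult_right_mono) (auto simp: norm_minus_commute)
        also have "\<dots> \<le> (L * norm (y - x)) * (1 + (norm (u z))^2)"
          using norm_mult_le_sum_squares[of "1::real" "u z"] L(1) by (intro mult_left_mono) auto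
        finally show ?thesis using False by simp
      qed
    qed (rule bi)
    also have "\<dots> = L * norm (y - x) * (m + nsq u)"
      using ind L2_int[OF u(1)] by (simp add: m_def nsq_def)
    also have "\<dots> \<le> L * norm (y - x) * (m + K)" using u(2) L(1) by (intro mult_left_mono) auto
    also have "\<dots> \<le> L * norm (y - x) * (m + K + 1)" using L(1) by (intro mult_left_mono) auto
    also have "\<dots> < L * (e / (L * (m + K + 1))) * (m + K + 1)"
      using y L(1) m0 K by (intro mult_strict_right_mono mult_strict_left_mono) (auto simp: d_def)
    also have "\<dots> = e" using L(1) m0 K by simp
    finally show ?thesis .
  qed
  ultimately show ?thesis by blast
qed

lemma bounded_pointwise_loc_nsq:
  fixes f :: "nat \<Rightarrow> plane \<Rightarrow> 'b::euclidean_space"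
  assumes f: "\<And>n. f n \<in> borel_measurable lebesgue" and bd: "\<And>n x. norm (f n x) \<le> C" and lim: "\<And>x. (\<lambda>n. f n x) \<longlonglongrightarrow> F x"
  shows "F \<in> borel_measurable lebesgue" "(\<lambda>n. loc_nsq R (\<lambda>x. f n x - F x)) \<longlonglongrightarrow> 0"
proof -
  show F: "F \<in> borel_measurable lebesgue" by (rule borel_measurable_LIMSEQ_metric[OF f lim])
  have bF: "norm (F x) \<le> C" for x
    by (rule LIMSEQ_le_const2[OF tendsto_norm[OF lim[of x]]]) (use bd in auto)
  note [measurable] = f F
  have "(\<lambda>n. loc_nsq R (\<lambda>x. f n x - F x)) \<longlonglongrightarrow> (\<integral>x. indicator (cball 0 R) x * (norm (F x - F x))^2 \<partial>(lebesgue :: plane measure))"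
    unfolding loc_nsq_def
  proof (rule integral_dominated_convergence)
    show "integrable lebesgue (\<lambda>x. (2 * C)^2 * indicator (cball (0::plane) R) x)"
      using lmeasurable_cball[of "0::plane" R] by (intro integrable_mult_right) (simp add: fmeasurable_def)
    show "AE x in lebesgue. (\<lambda>n. indicator (cball 0 R) x * (norm (f n x - F x))^2) \<longlonglongrightarrow> indicator (cball 0 R) x * (norm (F x - F x))^2"
      by (intro AE_I2 tendsto_intros lim)
    show "AE x in lebesgue. norm (indicator (cball 0 R) x * (norm (f n x - F x))^2) \<le> (2 * C)^2 * indicator (cball 0 R) x" for n
    proof (rule AE_I2)
      fix x
      have "norm (f n x - F x) \<le> 2 * C" using norm_triangle_ineq4[of "f n x" "F x"] bd[of n x] bF[of x] by linarith
      from power_mono[OF this, of 2] show "norm (indicator (cball 0 R) x * (norm (f n x - F x))^2) \<le> (2 * C)^2 * indicator (cball 0 R) x"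
        by (simp add: indicator_def)
    qed
  qed measurable
  then show "(\<lambda>n. loc_nsq R (\<lambda>x. f n x - F x)) \<longlonglongrightarrow> 0" by simp
qed

text \<open>A diagonal subsequence over the countable set of pairs of a point of a dense set and a
  mollification scale; equicontinuity then extends the convergence to all points. One subsequence
  has to serve every scale, since the scale is chosen afterwards according to the desired
  accuracy.\<close>

lemma corr_subsequence:
  fixes u :: "nat \<Rightarrow> plane \<Rightarrow> complex"
  assumes u: "\<And>n. u n \<in> Lp 2" "\<And>n. nsq (u n) \<le> K"
  shows "\<exists>r. strict_mono r \<and> (\<forall>m x. convergent (\<lambda>n. corr (moll (1 / real (Suc m))) (u (r n)) x))"
proof -
  have K: "0 \<le> K" using u(2)[of 0] nsq_nonneg[of "u 0"] by linarith
  define \<rho> where "\<rho> m = moll (1 / real (Suc m))" for m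
  have \<rho>: "\<rho> m \<in> test_functions" for m unfolding \<rho>_def by (rule test_moll) simp
  obtain D :: "plane set" where D: "countable D" "\<And>X. open X \<Longrightarrow> X \<noteq> {} \<Longrightarrow> \<exists>d\<in>D. d \<in> X"
    using countable_dense_exists by blast
  \<comment> \<open>Small scales have kernels of large norm; dividing by this norm gives the single
    bound for all indices that the diagonal argument asks for.\<close>
  define f where "f n p = (1 / (1 + sqrt (nsq (\<rho> (snd p))))) *\<^sub>R corr (\<rho> (snd p)) (u n) (fst p)" for n and p :: "plane \<times> nat"
  have fb: "norm (f n p) \<le> sqrt K" if "p \<in> D \<times> UNIV" for n p
  proof -
    let ?s = "sqrt (nsq (\<rho> (snd p)))"
    have "norm (corr (\<rho> (snd p)) (u n) (fst p)) \<le> ?s * sqrt (nsq (u n))" by (rule corr_bound[OF \<rho> u(1)])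
    also have "\<dots> \<le> (1 + ?s) * sqrt K" using u(2) by (intro mult_mono) auto
    finally have "(1 / (1 + ?s)) * norm (corr (\<rho> (snd p)) (u n) (fst p)) \<le> (1 / (1 + ?s)) * ((1 + ?s) * sqrt K)"
      by (intro mult_left_mono) auto
    also have "\<dots> = sqrt K" by (simp add: add_nonneg_eq_0_iff)
    finally show ?thesis by (simp add: f_def)
  qed
  have cD: "countable (D \<times> (UNIV::nat set))" using D(1) by simp
  have "\<exists>r. strict_mono r \<and> (\<forall>p\<in>D \<times> UNIV. \<exists>l. (\<lambda>n. f (r n) p) \<longlonglongrightarrow> l)"
  proof (rule function_convergent_subsequence[of _ f, OF cD fb])
    fix k :: "nat \<Rightarrow> nat"
    assume k: "strict_mono k" "\<And>p. p \<in> D \<times> UNIV \<Longrightarrow> \<exists>l. (\<lambda>n. f (k n) p) \<longlonglongrightarrow> l"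
    show ?thesis by (intro exI[of _ k] conjI ballI k)
  qed
  then obtain r where r: "strict_mono r" "\<forall>p\<in>D \<times> UNIV. \<exists>l. (\<lambda>n. f (r n) p) \<longlonglongrightarrow> l" by blast
  have dense: "convergent (\<lambda>n. corr (\<rho> m) (u (r n)) d)" if d: "d \<in> D" for d m
  proof -
    obtain l where "(\<lambda>n. f (r n) (d, m)) \<longlonglongrightarrow> l" using r(2) d by blast
    then have "(\<lambda>n. (1 + sqrt (nsq (\<rho> m))) *\<^sub>R f (r n) (d, m)) \<longlonglongrightarrow> (1 + sqrt (nsq (\<rho> m))) *\<^sub>R l"
      by (intro tendsto_intros)
    moreover have "1 + sqrt (nsq (\<rho> m)) \<noteq> 0" by (simp add: add_nonneg_eq_0_iff)
    ultimately show ?thesis by (auto simp: f_def convergent_def)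
  qed
  have "convergent (\<lambda>n. corr (\<rho> m) (u (r n)) x)" for m x
  proof -
    have "Cauchy (\<lambda>n. corr (\<rho> m) (u (r n)) x)"
    proof (rule metric_CauchyI)
      fix e :: real assume e: "e > 0"
      then have e3: "e / 3 > 0" by simp
      obtain d where d: "d > 0" "\<forall>u y. u \<in> Lp 2 \<longrightarrow> nsq u \<le> K \<longrightarrow> norm (y - x) < d \<longrightarrow> norm (corr (\<rho> m) u y - corr (\<rho> m) (u :: plane \<Rightarrow> complex) x) < e / 3"
        using corr_equicontinuous[OF \<rho>[of m] K e3, of x] by blast
      obtain y where y: "y \<in> D" "y \<in> ball x d" using D(2)[of "ball x d"] d(1) by auto
      have near: "norm (corr (\<rho> m) (u (r n)) y - corr (\<rho> m) (u (r n)) x) < e / 3" for n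
      proof -
        have "norm (y - x) < d" using y(2) by (simp add: dist_norm norm_minus_commute)
        then show ?thesis using d(2) u by blast
      qed
      have "Cauchy (\<lambda>n. corr (\<rho> m) (u (r n)) y)" using dense[OF y(1)] by (rule convergent_Cauchy)
      then obtain N where N: "\<forall>i\<ge>N. \<forall>j\<ge>N. dist (corr (\<rho> m) (u (r i)) y) (corr (\<rho> m) (u (r j)) y) < e / 3"
        using e3 unfolding Cauchy_def by blast
      have "dist (corr (\<rho> m) (u (r i)) x) (corr (\<rho> m) (u (r j)) x) < e" if "i \<ge> N" "j \<ge> N" for i j
      proof -
        have "norm (corr (\<rho> m) (u (r i)) x - corr (\<rho> m) (u (r j)) x) \<le>
          norm (corr (\<rho> m) (u (r i)) y - corr (\<rho> m) (u (r i)) x) + norm (corr (\<rho> m) (u (r i)) y - corr (\<rho> m) (u (r j)) y)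
          + norm (corr (\<rho> m) (u (r j)) y - corr (\<rho> m) (u (r j)) x)"
          by norm
        also have "\<dots> < e / 3 + e / 3 + e / 3"
          using N that near[of i] near[of j] by (intro add_strict_mono) (auto simp: dist_norm)
        finally show ?thesis by (simp add: dist_norm)
      qed
      then show "\<exists>N. \<forall>i\<ge>N. \<forall>j\<ge>N. dist (corr (\<rho> m) (u (r i)) x) (corr (\<rho> m) (u (r j)) x) < e" by blast
    qed
    then show ?thesis by (rule Cauchy_convergent)
  qed
  with r(1) show ?thesis unfolding \<rho>_def by blast
qed

text \<open>The mollified functions converge pointwise, hence locally in \<open>L\<^sup>2\<close>, and they are
  uniformly close to the original ones.\<close>

lemma rellich:
  fixes u :: "nat \<Rightarrow> plane \<Rightarrow> complex"
  assumes u: "\<And>n. u n \<in> H1" and K: "\<And>n. nsq (u n) \<le> K" "\<And>n. kin (u n) \<le> K"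
  shows "\<exists>r v. strict_mono r \<and> v \<in> Lp 2 \<and> (AE x in lebesgue. (\<lambda>n. u (r n) x) \<longlonglongrightarrow> v x) \<and>
     (\<forall>R. (\<lambda>n. loc_nsq R (\<lambda>x. u (r n) x - v x)) \<longlonglongrightarrow> 0)"
proof -
  have u2: "u n \<in> Lp 2" for n by (rule H1_L2[OF u])
  have K0: "0 \<le> K" using K(1)[of 0] nsq_nonneg[of "u 0"] by linarith
  obtain r where r: "strict_mono r" "\<And>m x. convergent (\<lambda>n. corr (moll (1 / real (Suc m))) (u (r n)) x)"
    using corr_subsequence[of u K, OF u2 K(1)] by blast
  have locC: "\<exists>N. \<forall>i\<ge>N. \<forall>j\<ge>N. loc_nsq R (\<lambda>x. u (r i) x - u (r j) x) < e" if e: "e > 0" for R e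
  proof -
    \<comment> \<open>Each triangle inequality for squares costs a factor 2: the sum is
      \<open>2 * (e/12) + 4 * (e/9) + 4 * (e/12)\<close>, which is below \<open>e\<close>, and
      \<open>e/9\<close> in turn comes from two terms below \<open>e/36\<close>.\<close>
    obtain m where m: "32 * (1 / real (Suc m))^2 * K < e / 12"
    proof -
      have "(\<lambda>m. 32 * (1 / real (Suc m))^2 * K) \<longlonglongrightarrow> 32 * 0^2 * K"
        by (intro tendsto_intros) (use LIMSEQ_inverse_real_of_nat in \<open>simp add: inverse_eq_divide\<close>)
      then have "\<forall>\<^sub>F m in sequentially. 32 * (1 / real (Suc m))^2 * K < e / 12"
        by (rule order_tendstoD) (use e in simp)
      then show ?thesis using that unfolding eventually_sequentially by blast
    qed
    define \<rho> where "\<rho> = moll (1 / real (Suc m))"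
    have \<rho>: "\<rho> \<in> test_functions" unfolding \<rho>_def by (rule test_moll) simp
    have \<rho>2: "corr \<rho> (u n) \<in> Lp 2" for n unfolding \<rho>_def
      by (rule corr_L2(1)[OF moll(1-3) u2]) simp_all
    have close: "loc_nsq R (\<lambda>x. corr \<rho> (u n) x - u n x) < e / 12" for n
    proof -
      have "loc_nsq R (\<lambda>x. corr \<rho> (u n) x - u n x) \<le> nsq (\<lambda>x. corr \<rho> (u n) x - u n x)"
        by (intro loc_nsq_le L2_diff \<rho>2 u2)
      also have "\<dots> \<le> 32 * (1 / real (Suc m))^2 * kin (u n)"
        unfolding \<rho>_def by (rule corr_moll_close[OF _ H1_weak_gradient[OF u]]) simp
      also have "\<dots> \<le> 32 * (1 / real (Suc m))^2 * K" by (intro mult_left_mono K) auto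
      finally show ?thesis using m by simp
    qed
    define F where "F x = lim (\<lambda>n. corr \<rho> (u (r n)) x)" for x
    have lim: "(\<lambda>n. corr \<rho> (u (r n)) x) \<longlonglongrightarrow> F x" for x
      using r(2)[of m x] unfolding F_def \<rho>_def by (simp add: convergent_LIMSEQ_iff)
    have cm: "corr \<rho> (u (r n)) \<in> borel_measurable lebesgue" for n by (rule L2_meas[OF \<rho>2])
    have cb: "norm (corr \<rho> (u (r n)) x) \<le> sqrt (nsq \<rho>) * sqrt K" for n x
      using corr_bound[OF \<rho> u2[of "r n"], of x] K(1)[of "r n"]
      by (smt (verit) mult_left_mono nsq_nonneg real_sqrt_ge_zero real_sqrt_le_mono)
    have "(\<lambda>n. loc_nsq R (\<lambda>x. corr \<rho> (u (r n)) x - F x)) \<longlonglongrightarrow> 0" by (rule bounded_pointwise_loc_nsq[OF cm cb lim])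
    then have "\<forall>\<^sub>F n in sequentially. loc_nsq R (\<lambda>x. corr \<rho> (u (r n)) x - F x) < e / 36"
      by (rule order_tendstoD) (use e in simp)
    then obtain N where N: "\<And>n. n \<ge> N \<Longrightarrow> loc_nsq R (\<lambda>x. corr \<rho> (u (r n)) x - F x) < e / 36"
      unfolding eventually_sequentially by blast
    have Fm: "F \<in> borel_measurable lebesgue" by (rule bounded_pointwise_loc_nsq(1)[OF cm cb lim])
    have "loc_nsq R (\<lambda>x. u (r i) x - u (r j) x) < e" if "i \<ge> N" "j \<ge> N" for i j
    proof -
      let ?a = "u (r i)" and ?b = "corr \<rho> (u (r i))" and ?c = "corr \<rho> (u (r j))" and ?d = "u (r j)"
      have FL: "(\<lambda>x. indicator (cball 0 R) x *\<^sub>R F x) \<in> Lp 2"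
      proof (rule L2_dominated[of "indicator (cball 0 R)" _ "sqrt (nsq \<rho>) * sqrt K"])
        show "(indicator (cball 0 R) :: plane \<Rightarrow> real) \<in> Lp 2" by (rule L2_indicator_ball)
        show "(\<lambda>x. indicator (cball 0 R) x *\<^sub>R F x) \<in> borel_measurable lebesgue" using Fm by measurable
        show "AE x in lebesgue. norm (indicator (cball 0 R) x *\<^sub>R F x) \<le> sqrt (nsq \<rho>) * sqrt K * norm (indicator (cball 0 R) x :: real)"
        proof (rule AE_I2)
          fix x
          have "norm (F x) \<le> sqrt (nsq \<rho>) * sqrt K"
            by (rule LIMSEQ_le_const2[OF tendsto_norm[OF lim[of x]]]) (use cb in auto)
          then show "norm (indicator (cball 0 R) x *\<^sub>R F x) \<le> sqrt (nsq \<rho>) * sqrt K * norm (indicator (cball 0 R) x :: real)"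
            by (simp add: indicator_def)
        qed
      qed
      have "loc_nsq R (\<lambda>x. ?b x - ?c x) \<le> 2 * loc_nsq R (\<lambda>x. ?b x - F x) + 2 * loc_nsq R (\<lambda>x. F x - ?c x)"
        using nsq_triangle[OF L2_indicator[OF \<rho>2] FL L2_indicator[OF \<rho>2], of R "r i" R "r j"]
        by (simp add: loc_nsq_eq scaleR_diff_right)
      moreover have "loc_nsq R (\<lambda>x. F x - ?c x) = loc_nsq R (\<lambda>x. ?c x - F x)"
        by (simp add: loc_nsq_def norm_minus_commute)
      ultimately have bc: "loc_nsq R (\<lambda>x. ?b x - ?c x) < e / 9"
        using N[OF that(1)] N[OF that(2)] by simp
      have "loc_nsq R (\<lambda>x. ?a x - ?d x) \<le> 2 * loc_nsq R (\<lambda>x. ?a x - ?b x) + 2 * loc_nsq R (\<lambda>x. ?b x - ?d x)"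
        by (rule loc_nsq_triangle[OF u2 \<rho>2 u2])
      moreover have "loc_nsq R (\<lambda>x. ?b x - ?d x) \<le> 2 * loc_nsq R (\<lambda>x. ?b x - ?c x) + 2 * loc_nsq R (\<lambda>x. ?c x - ?d x)"
        by (rule loc_nsq_triangle[OF \<rho>2 \<rho>2 u2])
      moreover have "loc_nsq R (\<lambda>x. ?a x - ?b x) = loc_nsq R (\<lambda>x. ?b x - ?a x)"
        by (simp add: loc_nsq_def norm_minus_commute)
      ultimately show ?thesis using bc close[of "r i"] close[of "r j"] e by linarith
    qed
    then show ?thesis by blast
  qed
  \<comment> \<open>So far the sequence is Cauchy only on each ball. A positive weight decaying at
    infinity makes it Cauchy on the whole plane, so that completeness provides one limit for all
    radii; the weight is divided out again.\<close>
  define \<omega> where "\<omega> x = 1 / (1 + norm x)" for x :: plane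
  have npos: "0 < 1 + norm x" for x :: plane by (simp add: add_pos_nonneg)
  have \<omega>: "0 < \<omega> x" "\<omega> x \<le> 1" "\<omega> x \<noteq> 0" for x using npos[of x] by (simp_all add: \<omega>_def)
  have \<omega>m [measurable]: "\<omega> \<in> borel_measurable lebesgue"
    unfolding \<omega>_def by (intro continuous_measurable_lebesgue continuous_intros) (auto simp: add_nonneg_eq_0_iff)
  define w where "w n x = \<omega> x *\<^sub>R u (r n) x" for n x
  have wL: "(\<lambda>x. \<omega> x *\<^sub>R f x) \<in> Lp 2" "nsq (\<lambda>x. \<omega> x *\<^sub>R f x) \<le> nsq f" if "f \<in> Lp 2" for f :: "plane \<Rightarrow> complex"
    using L2_mult_bounded[OF that \<omega>m, of 1] \<omega> by (auto simp: less_imp_le)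
  have w2: "w n \<in> Lp 2" for n unfolding w_def by (rule wL[OF u2])
  have wc: "\<exists>N. \<forall>i\<ge>N. \<forall>j\<ge>N. nsq (\<lambda>x. w i x - w j x) < e" if e: "e > 0" for e
  proof -
    \<comment> \<open>Outside this radius the squared weight is at most
      \<open>(1 / (1 + R))^2\<close>, and a difference of two members of the sequence has total mass
      at most \<open>4 * K\<close>.\<close>
    obtain R where R: "R > 0" "(1 / (1 + R))^2 * (4 * K) < e / 2"
    proof -
      have "(\<lambda>n. (1 / real (Suc n))^2 * (4 * K)) \<longlonglongrightarrow> 0^2 * (4 * K)"
        by (intro tendsto_intros) (use LIMSEQ_inverse_real_of_nat in \<open>simp add: inverse_eq_divide\<close>)
      then have "\<forall>\<^sub>F n in sequentially. (1 / real (Suc n))^2 * (4 * K) < e / 2"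
        by (rule order_tendstoD) (use e in simp)
      then obtain n0 where "\<And>n. n \<ge> n0 \<Longrightarrow> (1 / real (Suc n))^2 * (4 * K) < e / 2"
        unfolding eventually_sequentially by blast
      from this[of "Suc n0"] that[of "real (Suc n0)"] show ?thesis by (simp add: add.commute)
    qed
    obtain N where N: "\<forall>i\<ge>N. \<forall>j\<ge>N. loc_nsq R (\<lambda>x. u (r i) x - u (r j) x) < e / 2" using locC[of "e/2" R] e by auto
    have "nsq (\<lambda>x. w i x - w j x) < e" if "i \<ge> N" "j \<ge> N" for i j
    proof -
      let ?d = "\<lambda>x. u (r i) x - u (r j) x"
      have d2: "?d \<in> Lp 2" by (intro L2_diff u2)
      have ii: "integrable lebesgue (\<lambda>x. indicator (cball 0 R) x * (norm (?d x))^2)" by (rule indicator_sq_integrable[OF d2])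
      have "nsq (\<lambda>x. w i x - w j x) = nsq (\<lambda>x. \<omega> x *\<^sub>R ?d x)" by (simp add: w_def scaleR_diff_right)
      also have "\<dots> \<le> (\<integral>x. indicator (cball 0 R) x * (norm (?d x))^2 + (1 / (1 + R))^2 * (norm (?d x))^2 \<partial>lebesgue)"
        unfolding nsq_def
      proof (rule integral_mono)
        show "integrable lebesgue (\<lambda>x. (norm (\<omega> x *\<^sub>R ?d x))^2)" by (intro L2_int wL d2)
        show "integrable lebesgue (\<lambda>x. indicator (cball 0 R) x * (norm (?d x))^2 + (1 / (1 + R))^2 * (norm (?d x))^2)"
          using ii L2_int[OF d2] by simp
        fix x
        show "(norm (\<omega> x *\<^sub>R ?d x))^2 \<le> indicator (cball 0 R) x * (norm (?d x))^2 + (1 / (1 + R))^2 * (norm (?d x))^2"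
        proof (cases "norm x \<le> R")
          case True
          have "(\<omega> x)^2 \<le> 1" using \<omega>[of x] by (simp add: power_le_one)
          then have "(\<omega> x)^2 * (norm (?d x))^2 \<le> 1 * (norm (?d x))^2" by (intro mult_right_mono) auto
          then show ?thesis using True by (auto simp: power_mult_distrib intro!: add_increasing2)
        next
          case False
          then have "\<omega> x \<le> 1 / (1 + R)" using R(1) unfolding \<omega>_def by (intro divide_left_mono) auto
          then have "(\<omega> x)^2 \<le> (1 / (1 + R))^2" using \<omega>(1)[of x] by (intro power_mono) auto
          then have "(\<omega> x)^2 * (norm (?d x))^2 \<le> (1 / (1 + R))^2 * (norm (?d x))^2" by (intro mult_right_mono) auto
          then show ?thesis using False by (simp add: power_mult_distrib)
        qed
      qed
      also have "\<dots> = loc_nsq R ?d + (1 / (1 + R))^2 * nsq ?d"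
        using ii L2_int[OF d2] by (simp add: loc_nsq_def nsq_def)
      also have "\<dots> < e / 2 + e / 2"
      proof (rule add_less_le_mono)
        show "loc_nsq R ?d < e / 2" using N that by blast
        have "nsq ?d \<le> 4 * K" using nsq_diff_le[OF u2 u2, of "r i" "r j"] K(1)[of "r i"] K(1)[of "r j"] by linarith
        then have "(1 / (1 + R))^2 * nsq ?d \<le> (1 / (1 + R))^2 * (4 * K)" by (intro mult_left_mono) auto
        then show "(1 / (1 + R))^2 * nsq ?d \<le> e / 2" using R(2) by linarith
      qed
      finally show ?thesis by simp
    qed
    then show ?thesis by blast
  qed
  obtain f where f: "f \<in> Lp 2" "(\<lambda>n. nsq (\<lambda>x. w n x - f x)) \<longlonglongrightarrow> 0"
    using L2_complete[OF w2 wc] by blast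
  obtain s where s: "strict_mono s" "AE x in lebesgue. (\<lambda>n. w (s n) x) \<longlonglongrightarrow> f x"
    using L2_AE_subseq[OF w2 f] by blast
  define v where "v x = (1 / \<omega> x) *\<^sub>R f x" for x
  have fv: "f x = \<omega> x *\<^sub>R v x" for x using \<omega>(3) by (simp add: v_def)
  have vm [measurable]: "v \<in> borel_measurable lebesgue" unfolding v_def[abs_def] using L2_meas[OF f(1)] by measurable
  have ae: "AE x in lebesgue. (\<lambda>n. u (r (s n)) x) \<longlonglongrightarrow> v x"
    using s(2)
  proof eventually_elim
    case (elim x)
    then have "(\<lambda>n. (1 / \<omega> x) *\<^sub>R w (s n) x) \<longlonglongrightarrow> (1 / \<omega> x) *\<^sub>R f x" by (intro tendsto_intros)
    then show ?case using \<omega>(3) by (simp add: w_def v_def)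
  qed
  \<comment> \<open>Dividing by the weight could spoil square integrability of \<open>v\<close>; the
    uniform bound \<open>K\<close> and Fatou restore it.\<close>
  have "integrable lebesgue (\<lambda>x. (norm (v x))^2) \<and> (\<integral>x. (norm (v x))^2 \<partial>lebesgue) \<le> K"
  proof (rule fatou_bound[where f = "\<lambda>n x. (norm (u (r (s n)) x))^2" and C = "\<lambda>_. K"])
    show "AE x in lebesgue. (\<lambda>n. (norm (u (r (s n)) x))^2) \<longlonglongrightarrow> (norm (v x))^2"
      using ae by eventually_elim (intro tendsto_intros)
    show "(\<integral>x. (norm (u (r (s n)) x))^2 \<partial>lebesgue) \<le> K" for n using K(1) by (simp add: nsq_def)
  qed (use L2_int[OF u2] in auto)
  then have v2: "v \<in> Lp 2" by (intro L2_I) auto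
  have "(\<lambda>n. loc_nsq R (\<lambda>x. u (r (s n)) x - v x)) \<longlonglongrightarrow> 0" for R
  proof (rule tendsto_sandwich[OF _ _ tendsto_const])
    let ?b = "\<lambda>n. (1 + \<bar>R\<bar>)^2 * nsq (\<lambda>x. w (s n) x - f x)"
    have "loc_nsq R (\<lambda>x. u (r (s n)) x - v x) \<le> ?b n" for n
    proof -
      let ?d = "\<lambda>x. u (r (s n)) x - v x"
      have d2: "?d \<in> Lp 2" by (intro L2_diff u2 v2)
      have "loc_nsq R ?d \<le> (\<integral>x. (1 + \<bar>R\<bar>)^2 * (norm (\<omega> x *\<^sub>R ?d x))^2 \<partial>lebesgue)"
        unfolding loc_nsq_def
      proof (rule integral_mono)
        show "integrable lebesgue (\<lambda>x. (1 + \<bar>R\<bar>)^2 * (norm (\<omega> x *\<^sub>R ?d x))^2)" by (intro integrable_mult_right L2_int wL d2)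
        show "indicator (cball 0 R) x * (norm (?d x))^2 \<le> (1 + \<bar>R\<bar>)^2 * (norm (\<omega> x *\<^sub>R ?d x))^2" for x
        proof (cases "norm x \<le> R")
          case True
          have "1 + norm x > 0" by (simp add: add_pos_nonneg)
          then have "1 \<le> (1 + \<bar>R\<bar>) * \<omega> x" using True unfolding \<omega>_def by (simp add: field_simps)
          then have "1 \<le> ((1 + \<bar>R\<bar>) * \<omega> x)^2" by simp
          then have "1 * (norm (?d x))^2 \<le> ((1 + \<bar>R\<bar>) * \<omega> x)^2 * (norm (?d x))^2" by (intro mult_right_mono) auto
          then show ?thesis using True by (simp add: power_mult_distrib mult.assoc)
        qed simp
      qed (rule indicator_sq_integrable[OF d2])
      also have "\<dots> = ?b n" by (simp add: nsq_def w_def fv scaleR_diff_right)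
      finally show ?thesis .
    qed
    then show "\<forall>\<^sub>F n in sequentially. loc_nsq R (\<lambda>x. u (r (s n)) x - v x) \<le> ?b n" by simp
    have "(\<lambda>n. nsq (\<lambda>x. w (s n) x - f x)) \<longlonglongrightarrow> 0" using LIMSEQ_subseq_LIMSEQ[OF f(2) s(1)] by (simp add: o_def)
    from tendsto_mult_right_zero[OF this] show "?b \<longlonglongrightarrow> 0" .
  qed simp
  then show ?thesis using ae v2 strict_mono_o[OF r(1) s(1)]
    by (intro exI[of _ "r \<circ> s"] exI[of _ v]) (simp add: o_def)
qed

text \<open>Boundedness and local convergence give weak convergence: outside a large ball the fixed
  function \<open>f\<close> has little mass, inside the ball \<open>d n\<close> does.\<close>

lemma ip_tendsto_0_loc:
  fixes d :: "nat \<Rightarrow> plane \<Rightarrow> 'b::euclidean_space"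
  assumes d: "\<And>n. d n \<in> Lp 2" "\<And>n. nsq (d n) \<le> K" and loc: "\<And>R. (\<lambda>n. loc_nsq R (d n)) \<longlonglongrightarrow> 0" and f: "f \<in> Lp 2"
  shows "(\<lambda>n. ip (d n) f) \<longlonglongrightarrow> 0"
proof (rule LIMSEQ_I)
  fix e :: real assume e: "e > 0"
  define t where "t m = (\<integral>x. (1 - indicator (cball 0 (real m)) x) * (norm (f x))^2 \<partial>lebesgue)" for m :: nat
  have "t \<longlonglongrightarrow> 0" unfolding t_def[abs_def]
  proof (rule integral_vanishing_weight[OF L2_int[OF f]])
    show "(\<lambda>x. 1 - indicator (cball 0 (real m)) x :: real) \<in> borel_measurable (lebesgue :: plane measure)" for m
      by (intro borel_measurable_diff borel_measurable_const borel_measurable_indicator cball_sets)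
    show "(\<lambda>m. 1 - indicator (cball 0 (real m)) x :: real) \<longlonglongrightarrow> 0" for x :: plane
    proof -
      obtain N where "norm x \<le> real N" using real_arch_simple by blast
      then have "1 - indicator (cball 0 (real m)) x = (0::real)" if "m \<ge> N" for m using that by simp
      then show ?thesis by (intro tendsto_eventually) (auto simp: eventually_sequentially)
    qed
  qed (auto simp: indicator_def)
  then have "(\<lambda>m. sqrt K * sqrt (t m)) \<longlonglongrightarrow> sqrt K * sqrt 0" by (intro tendsto_intros)
  then have "\<forall>\<^sub>F m in sequentially. sqrt K * sqrt (t m) < e / 2" by (rule order_tendstoD) (use e in simp)
  then obtain m where m: "sqrt K * sqrt (t m) < e / 2" unfolding eventually_sequentially by blast
  let ?B = "indicator (cball 0 (real m)) :: plane \<Rightarrow> real"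
  have "(\<lambda>n. sqrt (loc_nsq (real m) (d n)) * sqrt (nsq f)) \<longlonglongrightarrow> sqrt 0 * sqrt (nsq f)"
    by (intro tendsto_intros loc)
  then have "\<forall>\<^sub>F n in sequentially. sqrt (loc_nsq (real m) (d n)) * sqrt (nsq f) < e / 2" by (rule order_tendstoD) (use e in simp)
  then obtain N where N: "\<And>n. n \<ge> N \<Longrightarrow> sqrt (loc_nsq (real m) (d n)) * sqrt (nsq f) < e / 2"
    unfolding eventually_sequentially by blast
  have cB: "(\<lambda>x. (1 - ?B x) *\<^sub>R f x) \<in> Lp 2"
  proof (rule L2_mult_bounded(1)[OF f, where C=1])
    show "(\<lambda>x. 1 - ?B x) \<in> borel_measurable lebesgue"
      by (intro borel_measurable_diff borel_measurable_const borel_measurable_indicator cball_sets)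
  qed (simp add: indicator_def)
  have tn: "nsq (\<lambda>x. (1 - ?B x) *\<^sub>R f x) = t m"
    unfolding nsq_def t_def by (rule Bochner_Integration.integral_cong) (auto simp: indicator_def)
  have "\<bar>ip (d n) f\<bar> < e" if n: "n \<ge> N" for n
  proof -
    have "ip (d n) f = ip (d n) (\<lambda>x. ?B x *\<^sub>R f x + (1 - ?B x) *\<^sub>R f x)"
      by (simp add: scaleR_add_left[symmetric])
    also have "\<dots> = ip (d n) (\<lambda>x. ?B x *\<^sub>R f x) + ip (d n) (\<lambda>x. (1 - ?B x) *\<^sub>R f x)"
      by (intro ip_add_right L2_indicator cB f d)
    also have "ip (d n) (\<lambda>x. ?B x *\<^sub>R f x) = ip (\<lambda>x. ?B x *\<^sub>R d n x) f" by (simp add: ip_def)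
    finally have "\<bar>ip (d n) f\<bar> \<le> \<bar>ip (\<lambda>x. ?B x *\<^sub>R d n x) f\<bar> + \<bar>ip (d n) (\<lambda>x. (1 - ?B x) *\<^sub>R f x)\<bar>" by linarith
    also have "\<dots> \<le> sqrt (loc_nsq (real m) (d n)) * sqrt (nsq f) + sqrt (nsq (d n)) * sqrt (t m)"
      using ip_abs_le[OF L2_indicator[OF d(1)] f, of "real m" n] ip_abs_le[OF d(1) cB, of n]
      unfolding tn loc_nsq_eq by linarith
    also have "sqrt (nsq (d n)) * sqrt (t m) \<le> sqrt K * sqrt (t m)"
      using d(2) tn nsq_nonneg[of "\<lambda>x. (1 - ?B x) *\<^sub>R f x"] by (intro mult_right_mono) auto
    finally show ?thesis using N[OF n] m by linarith
  qed
  then show "\<exists>N. \<forall>n\<ge>N. norm (ip (d n) f - 0) < e" by auto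
qed

lemma test_integral_tendsto_loc:
  fixes d :: "nat \<Rightarrow> plane \<Rightarrow> 'b::euclidean_space"
  assumes \<phi>: "\<phi> \<in> test_functions" and d: "\<And>n. d n \<in> Lp 2" and loc: "\<And>R. (\<lambda>n. loc_nsq R (d n)) \<longlonglongrightarrow> 0"
  shows "(\<lambda>n. \<integral>x. \<phi> x *\<^sub>R d n x \<partial>lebesgue) \<longlonglongrightarrow> 0"
proof -
  obtain R where R: "R > 0" "\<forall>x. R \<le> norm x \<longrightarrow> \<phi> x = 0 \<and> (\<forall>i. pd i \<phi> x = 0)"
    using test_bounded_support[OF \<phi>] by blast
  have "norm (\<integral>x. \<phi> x *\<^sub>R d n x \<partial>lebesgue) \<le> sqrt (nsq \<phi>) * sqrt (loc_nsq R (d n))" for n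
  proof -
    have "norm (\<integral>x. \<phi> x *\<^sub>R d n x \<partial>lebesgue) \<le> (\<integral>x. norm (\<phi> x *\<^sub>R d n x) \<partial>lebesgue)" by (rule integral_norm_bound)
    also have "\<dots> = (\<integral>x. norm (\<phi> x) * norm (indicator (cball 0 R) x *\<^sub>R d n x) \<partial>lebesgue)"
      using R(2) by (intro Bochner_Integration.integral_cong) (auto simp: indicator_def)
    also have "\<dots> \<le> sqrt (nsq \<phi>) * sqrt (loc_nsq R (d n))"
      unfolding loc_nsq_eq by (rule CS_integral[OF test_L2[OF \<phi>] L2_indicator[OF d]])
    finally show ?thesis .
  qed
  then have ev: "\<forall>\<^sub>F n in sequentially. norm (\<integral>x. \<phi> x *\<^sub>R d n x \<partial>lebesgue) \<le> sqrt (nsq \<phi>) * sqrt (loc_nsq R (d n))" by simp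
  have "(\<lambda>n. sqrt (nsq \<phi>) * sqrt (loc_nsq R (d n))) \<longlonglongrightarrow> sqrt (nsq \<phi>) * sqrt 0" by (intro tendsto_intros loc)
  then have "(\<lambda>n. sqrt (nsq \<phi>) * sqrt (loc_nsq R (d n))) \<longlonglongrightarrow> 0" by simp
  with ev show ?thesis by (rule Lim_null_comparison)
qed

text \<open>The weak limit of the gradients is represented, via \<open>riesz_sequence\<close>, on the space of all \<open>w\<close> for
  which the inner products converge; this space is closed and contains all test fields.\<close>

lemma weak_gradient_limit:
  assumes v: "\<And>n. v n \<in> H1" and K: "\<And>n. kin (v n) \<le> K" and u: "u \<in> Lp 2"
    and loc: "\<And>R. (\<lambda>n. loc_nsq R (\<lambda>x. v n x - u x)) \<longlonglongrightarrow> 0"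
  shows "u \<in> H1" "(\<lambda>n. ip (weak_gradient (v n)) (weak_gradient u)) \<longlonglongrightarrow> kin u"
proof -
  define g where "g n = weak_gradient (v n)" for n
  have g2: "g n \<in> Lp 2" and wg: "has_weak_gradient (v n) (g n)" and v2: "v n \<in> Lp 2" for n
    using H1_weak_gradient[OF v] by (auto simp: g_def)
  have gK: "nsq (g n) \<le> K" for n using K by (simp add: g_def)
  have K0: "0 \<le> K" using gK[of 0] nsq_nonneg[of "g 0"] by linarith
  define S where "S = {w \<in> Lp 2. convergent (\<lambda>n. ip (g n) w)}"
  define l where "l w = lim (\<lambda>n. ip (g n) w)" for w
  have SL: "w \<in> Lp 2" "(\<lambda>n. ip (g n) w) \<longlonglongrightarrow> l w" if "w \<in> S" for w
    using that by (auto simp: S_def l_def convergent_LIMSEQ_iff)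
  have SI: "w \<in> S" "l w = a" if "w \<in> Lp 2" "(\<lambda>n. ip (g n) w) \<longlonglongrightarrow> a" for w a
    using that by (auto simp: S_def l_def convergent_def limI)
  have comb: "(\<lambda>x. a *\<^sub>R u x + b *\<^sub>R w x) \<in> S" "l (\<lambda>x. a *\<^sub>R u x + b *\<^sub>R w x) = a * l u + b * l w" if "u \<in> S" "w \<in> S" for a b u w
  proof -
    have "ip (g n) (\<lambda>x. a *\<^sub>R u x + b *\<^sub>R w x) = a * ip (g n) u + b * ip (g n) w" for n
      using SL that by (simp add: ip_add_right L2_scaleR g2 ip_scaleR_right)
    moreover have "(\<lambda>n. a * ip (g n) u + b * ip (g n) w) \<longlonglongrightarrow> a * l u + b * l w" by (intro tendsto_intros SL that)
    ultimately have "(\<lambda>n. ip (g n) (\<lambda>x. a *\<^sub>R u x + b *\<^sub>R w x)) \<longlonglongrightarrow> a * l u + b * l w" by simp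
    moreover have "(\<lambda>x. a *\<^sub>R u x + b *\<^sub>R w x) \<in> Lp 2" by (intro L2_add L2_scaleR SL that)
    ultimately show "(\<lambda>x. a *\<^sub>R u x + b *\<^sub>R w x) \<in> S" "l (\<lambda>x. a *\<^sub>R u x + b *\<^sub>R w x) = a * l u + b * l w"
      using SI by blast+
  qed
  have zS: "(\<lambda>x. 0) \<in> S" by (rule SI(1)[of _ 0]) (auto simp: ip_def)
  have lb: "(l w)^2 \<le> K * ip w w" if w: "w \<in> S" for w
  proof (rule LIMSEQ_le_const2[OF tendsto_power[OF SL(2)[OF w]]])
    have "(ip (g n) w)^2 \<le> K * ip w w" for n
      using ip_CS[OF g2 SL(1)[OF w], of n] mult_right_mono[OF gK[of n] nsq_nonneg[of w]] by (simp add: ip_self)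
    then show "\<exists>N. \<forall>n\<ge>N. (ip (g n) w)^2 \<le> K * ip w w" by blast
  qed
  have Bl: "ip (\<lambda>x. a *\<^sub>R u x + b *\<^sub>R w x) z = a * ip u z + b * ip w z" if "u \<in> S" "w \<in> S" "z \<in> S" for a b u w z
    using SL(1)[OF that(1)] SL(1)[OF that(2)] SL(1)[OF that(3)] by (simp add: ip_add_left L2_scaleR ip_scaleR_left)
  have "\<exists>s. (\<forall>n. s n \<in> S) \<and> (\<forall>e>0. \<exists>N. \<forall>m\<ge>N. \<forall>n\<ge>N. ip (\<lambda>x. s m x - s n x) (\<lambda>x. s m x - s n x) < e) \<and> (\<forall>w\<in>S. (\<lambda>n. ip (s n) w) \<longlonglongrightarrow> l w)"
  proof (rule riesz_sequence[of S ip l K])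
    fix s assume s: "\<And>n. s n \<in> S" "\<And>e. e > 0 \<Longrightarrow> \<exists>N. \<forall>m\<ge>N. \<forall>n\<ge>N. ip (\<lambda>x. s m x - s n x) (\<lambda>x. s m x - s n x) < e"
      "\<And>w. w \<in> S \<Longrightarrow> (\<lambda>n. ip (s n) w) \<longlonglongrightarrow> l w"
    show ?thesis by (intro exI[of _ s] conjI allI impI ballI s)
  qed (use comb lb Bl zS K0 in \<open>auto simp: ip_self intro: ip_commute\<close>)
  then obtain s where s: "\<And>n. s n \<in> S" "\<forall>e>0. \<exists>N. \<forall>m\<ge>N. \<forall>n\<ge>N. ip (\<lambda>x. s m x - s n x) (\<lambda>x. s m x - s n x) < e"
     "\<forall>w\<in>S. (\<lambda>n. ip (s n) w) \<longlonglongrightarrow> l w" by blast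
  have sc: "\<exists>N. \<forall>m\<ge>N. \<forall>n\<ge>N. nsq (\<lambda>x. s m x - s n x) < e" if "e > 0" for e
    using s(2) that by (simp add: ip_self)
  obtain h where h: "h \<in> Lp 2" "(\<lambda>n. nsq (\<lambda>x. s n x - h x)) \<longlonglongrightarrow> 0"
    using L2_complete[OF SL(1)[OF s(1)] sc] by blast
  have hl: "ip h w = l w" if w: "w \<in> S" for w
    using LIMSEQ_unique[OF ip_tendsto[OF SL(1)[OF s(1)] h(1) SL(1)[OF w] h(2)]] s(3) w by blast
  \<comment> \<open>\<open>S\<close> is closed, because the functionals \<open>ip (g n)\<close> are
    bounded uniformly by \<open>sqrt K\<close>. Only with \<open>h\<close> in \<open>S\<close> can
    the limit of \<open>ip (g n) h\<close> be evaluated as \<open>nsq h\<close>, which is the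
    convergence of gradient products claimed at the end.\<close>
  have hS: "h \<in> S"
  proof -
    have "Cauchy (\<lambda>n. ip (g n) h)"
    proof (rule metric_CauchyI)
      fix e :: real assume e: "e > 0"
      have "(\<lambda>j. sqrt K * sqrt (nsq (\<lambda>x. s j x - h x))) \<longlonglongrightarrow> sqrt K * sqrt 0" by (intro tendsto_intros h)
      then have "\<forall>\<^sub>F j in sequentially. sqrt K * sqrt (nsq (\<lambda>x. s j x - h x)) < e / 3" by (rule order_tendstoD) (use e in simp)
      then obtain j where j: "sqrt K * sqrt (nsq (\<lambda>x. s j x - h x)) < e / 3" unfolding eventually_sequentially by blast
      have near: "\<bar>ip (g n) (s j) - ip (g n) h\<bar> < e / 3" for n
      proof -
        have "\<bar>ip (g n) (s j) - ip (g n) h\<bar> = \<bar>ip (g n) (\<lambda>x. s j x - h x)\<bar>"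
          by (simp add: ip_diff_right SL(1)[OF s(1)] h(1) g2)
        also have "\<dots> \<le> sqrt (nsq (g n)) * sqrt (nsq (\<lambda>x. s j x - h x))"
          by (intro ip_abs_le g2 L2_diff SL(1)[OF s(1)] h)
        also have "\<dots> \<le> sqrt K * sqrt (nsq (\<lambda>x. s j x - h x))" using gK by (intro mult_right_mono) auto
        finally show ?thesis using j by linarith
      qed
      have "Cauchy (\<lambda>n. ip (g n) (s j))" using SL(2)[OF s(1)] by (intro LIMSEQ_imp_Cauchy)
      then obtain N where N: "\<forall>m\<ge>N. \<forall>n\<ge>N. dist (ip (g m) (s j)) (ip (g n) (s j)) < e / 3"
        using e unfolding Cauchy_def by (metis zero_less_divide_iff zero_less_numeral)
      have "dist (ip (g m) h) (ip (g n) h) < e" if "m \<ge> N" "n \<ge> N" for m n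
      proof -
        have "\<bar>ip (g m) (s j) - ip (g n) (s j)\<bar> < e / 3" using N that by (simp add: dist_real_def)
        then have "\<bar>ip (g m) h - ip (g n) h\<bar> < e / 3 + e / 3 + e / 3" using near[of m] near[of n] by linarith
        then show ?thesis by (simp add: dist_real_def)
      qed
      then show "\<exists>N. \<forall>m\<ge>N. \<forall>n\<ge>N. dist (ip (g m) h) (ip (g n) h) < e" by blast
    qed
    then obtain a where "(\<lambda>n. ip (g n) h) \<longlonglongrightarrow> a" using Cauchy_convergent unfolding convergent_def by blast
    then show ?thesis by (rule SI(1)[OF h(1)])
  qed
  have hw: "has_weak_gradient u h"
    unfolding has_weak_gradient_iff
  proof (intro conjI ballI allI locally_integrable_L2 u h(1))
    fix \<phi> i assume \<phi>: "\<phi> \<in> test_functions"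
    have tp: "(\<lambda>n. \<integral>x. pd i \<phi> x *\<^sub>R v n x \<partial>lebesgue) \<longlonglongrightarrow> (\<integral>x. pd i \<phi> x *\<^sub>R u x \<partial>lebesgue)"
    proof -
      have "(\<integral>x. pd i \<phi> x *\<^sub>R (v n x - u x) \<partial>lebesgue) = (\<integral>x. pd i \<phi> x *\<^sub>R v n x \<partial>lebesgue) - (\<integral>x. pd i \<phi> x *\<^sub>R u x \<partial>lebesgue)" for n
        using test_scaleR_integrable[OF locally_integrable_L2[OF v2[of n]] test_pd[OF \<phi>, of i]]
          test_scaleR_integrable[OF locally_integrable_L2[OF u] test_pd[OF \<phi>, of i]] by (simp add: scaleR_diff_right)
      then show ?thesis using test_integral_tendsto_loc[OF test_pd[OF \<phi>] L2_diff[OF v2 u] loc, of i]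
        by (simp add: LIM_zero_iff)
    qed
    have e: "ip f (\<lambda>x. axis i (\<phi> x *\<^sub>R c)) = (\<integral>x. \<phi> x *\<^sub>R (f x $ i) \<partial>lebesgue) \<bullet> c" if "f \<in> Lp 2" for f :: "plane \<Rightarrow> complex ^ 2" and c
    proof -
      have "ip f (\<lambda>x. axis i (\<phi> x *\<^sub>R c)) = (\<integral>x. (\<phi> x *\<^sub>R (f x $ i)) \<bullet> c \<partial>lebesgue)"
        unfolding ip_def by (simp add: inner_axis)
      also have "\<dots> = (\<integral>x. \<phi> x *\<^sub>R (f x $ i) \<partial>lebesgue) \<bullet> c"
        by (rule integral_inner_left) (rule test_scaleR_integrable[OF locally_integrable_L2[OF L2_nth(1)[OF that]] \<phi>])
      finally show ?thesis .
    qed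
    have "(\<integral>x. \<phi> x *\<^sub>R (h x $ i) \<partial>lebesgue) \<bullet> c = (- (\<integral>x. pd i \<phi> x *\<^sub>R u x \<partial>lebesgue)) \<bullet> c" for c
    proof -
      \<comment> \<open>A field in the direction \<open>c\<close> of the component \<open>i\<close>.
        The inner product of fields is real, so running over all complex \<open>c\<close> recovers
        both real coordinates of the integral.\<close>
      let ?\<Phi> = "\<lambda>x. axis i (\<phi> x *\<^sub>R c) :: complex ^ 2"
      have \<Phi>2: "?\<Phi> \<in> Lp 2"
      proof (rule L2_dominated[OF test_L2[OF \<phi>], of _ "norm c"])
        have "?\<Phi> = (\<lambda>x. \<chi> j. if j = i then \<phi> x *\<^sub>R c else 0)" by (simp add: axis_def fun_eq_iff)
        moreover have "(\<lambda>x. \<chi> j. if j = i then \<phi> x *\<^sub>R c else 0) \<in> borel_measurable lebesgue"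
        proof (rule borel_measurable_vec_lambda)
          show "(\<lambda>x. if j = i then \<phi> x *\<^sub>R c else 0) \<in> borel_measurable lebesgue" for j
            using test_meas[OF \<phi>] by (cases "j = i") auto
        qed
        ultimately show "?\<Phi> \<in> borel_measurable lebesgue" by simp
        have "norm (axis i z :: complex ^ 2) = norm z" for z
        proof -
          have "(norm (axis i z :: complex ^ 2))^2 = (norm z)^2"
            using exhaust_2[of i] by (auto simp: norm_vec2_sq axis_def)
          then show ?thesis by (simp add: power2_eq_iff_nonneg)
        qed
        then show "AE x in lebesgue. norm (?\<Phi> x) \<le> norm c * norm (\<phi> x)" by simp
      qed
      have "ip (g n) ?\<Phi> = (- (\<integral>x. pd i \<phi> x *\<^sub>R v n x \<partial>lebesgue)) \<bullet> c" for n
        using wg[of n] \<phi> unfolding e[OF g2] has_weak_gradient_iff by simp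
      then have "(\<lambda>n. ip (g n) ?\<Phi>) \<longlonglongrightarrow> (- (\<integral>x. pd i \<phi> x *\<^sub>R u x \<partial>lebesgue)) \<bullet> c"
        by (simp only:) (intro tendsto_intros tp)
      from SI[OF \<Phi>2 this] have "ip h ?\<Phi> = (- (\<integral>x. pd i \<phi> x *\<^sub>R u x \<partial>lebesgue)) \<bullet> c" using hl by simp
      then show ?thesis unfolding e[OF h(1)] .
    qed
    then have "(\<integral>x. \<phi> x *\<^sub>R (h x $ i) \<partial>lebesgue) = - (\<integral>x. pd i \<phi> x *\<^sub>R u x \<partial>lebesgue)"
      using vector_eq_rdot by blast
    then show "(\<integral>x. pd i \<phi> x *\<^sub>R u x \<partial>lebesgue) = - (\<integral>x. \<phi> x *\<^sub>R (h x $ i) \<partial>lebesgue)" by simp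
  qed
  show uH: "u \<in> H1" by (rule H1_I[OF u h(1) hw])
  have "ip (g n) (weak_gradient u) = ip (g n) h" for n
    unfolding ip_def using weak_gradient_AE[OF hw] L2_meas[OF g2[of n]] L2_meas[OF h(1)] L2_meas[OF H1_weak_gradient(2)[OF uH]]
    by (intro integral_cong_AE) auto
  moreover have "(\<lambda>n. ip (g n) h) \<longlonglongrightarrow> nsq h"
    using SL(2)[OF hS] hl[OF hS] by (simp add: ip_self)
  ultimately show "(\<lambda>n. ip (weak_gradient (v n)) (weak_gradient u)) \<longlonglongrightarrow> kin u"
    using kin_eq[OF h(1) hw] by (simp add: g_def)
qed

section \<open>The quartic term and compactness in \<open>H1\<close>\<close>

abbreviation quartic :: "(plane \<Rightarrow> complex) \<Rightarrow> real" where
  "quartic u \<equiv> (\<integral>x. norm (u x) ^ 4 \<partial>lebesgue)"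

lemma quartic_nonneg [simp]: "0 \<le> quartic u"
  by (rule Bochner_Integration.integral_nonneg) auto

lemma quartic_integrable: "u \<in> H1 \<Longrightarrow> integrable lebesgue (\<lambda>x. norm (u x) ^ 4)"
  using gagliardo_nirenberg_power[of 1] by (auto simp: numeral_eq_Suc)

lemma quartic_bound: "\<exists>C>0. \<forall>u\<in>H1. quartic u \<le> C * nsq u * kin u"
proof -
  obtain C where C: "C \<ge> 0" "\<forall>u\<in>H1. quartic u \<le> C * nsq u * kin u"
    using gagliardo_nirenberg_power[of 1] by (auto simp: numeral_eq_Suc)
  have "quartic u \<le> (C + 1) * nsq u * kin u" if "u \<in> H1" for u
  proof -
    have "C * nsq u * kin u \<le> (C + 1) * nsq u * kin u"
      by (intro mult_right_mono) auto
    with C that show ?thesis by fastforce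
  qed
  then show ?thesis using C(1) by (intro exI[of _ "C + 1"]) auto
qed

text \<open>With \<open>|v|^2\<close> in the role of a potential, the mixed terms in the expansion
  of the quartic integral are an instance of \<open>tame_weight_vanish\<close>.\<close>

lemma tame_weight_norm_sq:
  assumes "u \<in> H1" shows "tame_weight (\<lambda>x. (norm (u x))^2)"
proof (rule tame_weight_Lp)
  have "norm ((norm (u x))^2) powr 2 = norm (u x) ^ 4" for x
    by (cases "u x = 0") (auto simp: powr_numeral)
  then show "(\<lambda>x. (norm (u x))^2) \<in> Lp 2"
    using quartic_integrable[OF assms] L2_meas[OF H1_L2[OF assms]] by (auto simp: Lp_def)
qed simp

text \<open>The localized term tends to 0 by local convergence; the remaining term is a small factor
  times a bounded \<open>H1\<close> norm.\<close>

lemma tame_weight_vanish: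
  assumes W: "tame_weight W" and d: "\<And>n. d n \<in> H1" "\<And>n. nsq (d n) \<le> K" "\<And>n. kin (d n) \<le> K"
    and loc: "\<And>R. (\<lambda>n. loc_nsq R (d n)) \<longlonglongrightarrow> 0"
  shows "(\<lambda>n. \<integral>x. \<bar>W x\<bar> * (norm (d n x))^2 \<partial>lebesgue) \<longlonglongrightarrow> 0"
proof (rule LIMSEQ_I)
  fix e :: real assume e: "e > 0"
  have K0: "0 \<le> K" using d(2)[of 0] nsq_nonneg[of "d 0"] by linarith
  \<comment> \<open>\<open>2 * K\<close> bounds the squared \<open>H1\<close> norm; the added 1
    keeps the denominator positive when \<open>K = 0\<close>.\<close>
  define \<eta> where "\<eta> = e / (2 * (2 * K + 1))"
  have \<eta>: "\<eta> > 0" "\<eta> * (2 * K) < e / 2"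
  proof -
    show "\<eta> > 0" using e K0 by (simp add: \<eta>_def)
    then have "\<eta> * (2 * K) < \<eta> * (2 * K + 1)" by simp
    also have "\<dots> = e / 2"
    proof -
      have "x / (2 * c) * c = x / 2" if "c \<noteq> 0" for x c :: real using that by simp
      then show ?thesis using K0 unfolding \<eta>_def by (metis add_nonneg_eq_0_iff mult_nonneg_nonneg zero_le_numeral zero_le_one zero_neq_one)
    qed
    finally show "\<eta> * (2 * K) < e / 2" .
  qed
  obtain M where M: "M \<ge> 0" "\<forall>u\<in>H1. integrable lebesgue (\<lambda>x. \<bar>W x\<bar> * (norm (u x))^2) \<and>
    (\<integral>x. \<bar>W x\<bar> * (norm (u x))^2 \<partial>lebesgue) \<le> M * (\<integral>x. indicator (cball 0 M) x * (norm (u x))^2 \<partial>lebesgue) + \<eta> * (nsq u + kin u)"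
    using W \<eta>(1) unfolding tame_weight_def by blast
  have "(\<lambda>n. M * loc_nsq M (d n)) \<longlonglongrightarrow> M * 0" by (intro tendsto_intros loc)
  then have "\<forall>\<^sub>F n in sequentially. M * loc_nsq M (d n) < e / 2" by (rule order_tendstoD) (use e in simp)
  then obtain N where N: "\<And>n. n \<ge> N \<Longrightarrow> M * loc_nsq M (d n) < e / 2" unfolding eventually_sequentially by blast
  have "norm ((\<integral>x. \<bar>W x\<bar> * (norm (d n x))^2 \<partial>lebesgue) - 0) < e" if "n \<ge> N" for n
  proof -
    have "0 \<le> (\<integral>x. \<bar>W x\<bar> * (norm (d n x))^2 \<partial>lebesgue)" by (rule Bochner_Integration.integral_nonneg) auto
    moreover have "(\<integral>x. \<bar>W x\<bar> * (norm (d n x))^2 \<partial>lebesgue) \<le> M * loc_nsq M (d n) + \<eta> * (nsq (d n) + kin (d n))"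
      using M(2) d(1) unfolding loc_nsq_def by blast
    moreover have "\<eta> * (nsq (d n) + kin (d n)) \<le> \<eta> * (2 * K)"
      using d(2)[of n] d(3)[of n] \<eta>(1) by (intro mult_left_mono) auto
    ultimately show ?thesis using N[OF that] \<eta>(2) by simp
  qed
  then show "\<exists>N. \<forall>n\<ge>N. norm ((\<integral>x. \<bar>W x\<bar> * (norm (d n x))^2 \<partial>lebesgue) - 0) < e" by blast
qed

text \<open>Behind the Brezis--Lieb splitting of the quartic term.\<close>

lemma norm_add_pow4:
  fixes a b :: "'a::real_inner"
  shows "\<bar>norm (a + b) ^ 4 - norm a ^ 4 - norm b ^ 4\<bar> \<le>
    6 * ((norm a)^2 * (norm b)^2) + 4 * ((norm a * norm b) * (norm a)^2) + 4 * ((norm a * norm b) * (norm b)^2)"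
proof -
  define A D t where "A = (norm a)^2" and "D = (norm b)^2" and "t = a \<bullet> b"
  have t: "\<bar>t\<bar> \<le> norm a * norm b" unfolding t_def by (rule Cauchy_Schwarz_ineq2)
  have nn: "0 \<le> A" "0 \<le> D" by (auto simp: A_def D_def)
  have t2: "t^2 \<le> A * D" using power_mono[OF t, of 2] by (simp add: A_def D_def power_mult_distrib)
  have "norm (a + b) ^ 4 = ((norm (a + b))^2)^2" by (simp add: power_mult[symmetric])
  also have "(norm (a + b))^2 = A + 2 * t + D"
    by (simp add: A_def D_def t_def power2_norm_eq_inner inner_add_left inner_add_right inner_commute)
  finally have "norm (a + b) ^ 4 - A^2 - D^2 = 4 * t^2 + 2 * (A * D) + 4 * (t * A) + 4 * (t * D)"
    by (simp add: power2_eq_square algebra_simps)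
  moreover have "A^2 = norm a ^ 4" "D^2 = norm b ^ 4" by (simp_all add: A_def D_def power_mult[symmetric])
  moreover have "\<bar>t * A\<bar> \<le> (norm a * norm b) * A" "\<bar>t * D\<bar> \<le> (norm a * norm b) * D"
    using t nn by (auto simp: abs_mult intro!: mult_right_mono)
  moreover have "0 \<le> t^2" "0 \<le> A * D" using nn by auto
  ultimately have "\<bar>norm (a + b) ^ 4 - norm a ^ 4 - norm b ^ 4\<bar> \<le> 6 * (A * D) + 4 * ((norm a * norm b) * A) + 4 * ((norm a * norm b) * D)"
    using t2 by linarith
  then show ?thesis by (simp only: A_def D_def)
qed

text \<open>Shared by the energy problem and by the search for optimizers of the inequality. The
  splittings are stated for differences of functionals of the sequence and of its remainder, so that
  neither of the two terms has to converge by itself.\<close>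

theorem H1_compactness:
  fixes u :: "nat \<Rightarrow> plane \<Rightarrow> complex"
  assumes u: "\<And>n. u n \<in> H1" "\<And>n. nsq (u n) \<le> K" "\<And>n. kin (u n) \<le> K"
  shows "\<exists>r v. strict_mono r \<and> v \<in> H1 \<and> (AE x in lebesgue. (\<lambda>n. u (r n) x) \<longlonglongrightarrow> v x)
    \<and> (\<forall>R. (\<lambda>n. loc_nsq R (\<lambda>x. u (r n) x - v x)) \<longlonglongrightarrow> 0)
    \<and> (\<lambda>n. nsq (u (r n)) - nsq (\<lambda>x. u (r n) x - v x)) \<longlonglongrightarrow> nsq v
    \<and> (\<lambda>n. kin (u (r n)) - kin (\<lambda>x. u (r n) x - v x)) \<longlonglongrightarrow> kin v
    \<and> (\<lambda>n. quartic (u (r n)) - quartic (\<lambda>x. u (r n) x - v x)) \<longlonglongrightarrow> quartic v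
    \<and> (\<forall>W. tame_weight W \<longrightarrow> (\<lambda>n. \<integral>x. W x * (norm (u (r n) x))^2 \<partial>lebesgue) \<longlonglongrightarrow> (\<integral>x. W x * (norm (v x))^2 \<partial>lebesgue))"
proof -
  obtain r v where r: "strict_mono r" and v2: "v \<in> Lp 2" and ae: "AE x in lebesgue. (\<lambda>n. u (r n) x) \<longlonglongrightarrow> v x"
    and loc: "\<forall>R. (\<lambda>n. loc_nsq R (\<lambda>x. u (r n) x - v x)) \<longlonglongrightarrow> 0"
    using rellich[of u K, OF u] by blast
  define w where "w n = u (r n)" for n
  have w: "w n \<in> H1" "nsq (w n) \<le> K" "kin (w n) \<le> K" for n using u by (auto simp: w_def)
  have loc': "(\<lambda>n. loc_nsq R (\<lambda>x. w n x - v x)) \<longlonglongrightarrow> 0" for R using loc by (simp add: w_def)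
  note vg = weak_gradient_limit[of w K v, OF w(1,3) v2 loc']
  have vH: "v \<in> H1" by (rule vg)
  have K0: "0 \<le> K" using u(2)[of 0] nsq_nonneg[of "u 0"] by linarith
  define d where "d n x = w n x - v x" for n x
  have dH: "d n \<in> H1" for n unfolding d_def[abs_def] by (rule H1_diff(1)[OF w(1) vH])
  define K' where "K' = 2 * K + 2 * (nsq v + kin v)"
  have K': "2 * K + 2 * nsq v \<le> K'" "2 * K + 2 * kin v \<le> K'"
    unfolding K'_def by auto
  have dK: "nsq (d n) \<le> K'" "kin (d n) \<le> K'" for n
  proof -
    have "nsq (d n) \<le> 2 * nsq (w n) + 2 * nsq v"
      unfolding d_def[abs_def] by (rule nsq_diff_le[OF H1_L2[OF w(1)] v2])
    then show "nsq (d n) \<le> K'" using w(2)[of n] K'(1) by simp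
    have "kin (d n) \<le> 2 * kin (w n) + 2 * kin v"
      unfolding d_def[abs_def] by (rule H1_kin_diff_le[OF w(1) vH])
    then show "kin (d n) \<le> K'" using w(3)[of n] K'(2) by simp
  qed
  have dloc: "(\<lambda>n. loc_nsq R (d n)) \<longlonglongrightarrow> 0" for R using loc' by (simp add: d_def[abs_def])
  have g2: "weak_gradient (w n) \<in> Lp 2" "weak_gradient v \<in> Lp 2" for n
    by (rule H1_weak_gradient(2)[OF w(1)], rule H1_weak_gradient(2)[OF vH])
  have wdv: "w n x = v x + d n x" for n x by (simp add: d_def)
  have 1: "(\<lambda>n. nsq (w n) - nsq (d n)) \<longlonglongrightarrow> nsq v"
  proof -
    have "nsq (w n) - nsq (d n) = 2 * ip (d n) v + nsq v" for n
      using nsq_add[OF v2 H1_L2[OF dH[of n]]] by (simp add: wdv[symmetric] ip_commute)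
    moreover have "(\<lambda>n. 2 * ip (d n) v + nsq v) \<longlonglongrightarrow> 2 * 0 + nsq v"
      by (intro tendsto_intros ip_tendsto_0_loc[of d K'] H1_L2 dH dK dloc v2)
    ultimately show ?thesis by simp
  qed
  have 2: "(\<lambda>n. kin (w n) - kin (d n)) \<longlonglongrightarrow> kin v"
  proof -
    have "kin (w n) - kin (d n) = 2 * ip (weak_gradient (w n)) (weak_gradient v) - kin v" for n
      using H1_diff(2)[OF w(1) vH] nsq_diff[OF g2(1) g2(2), of n] by (simp add: d_def[abs_def])
    moreover have "(\<lambda>n. 2 * ip (weak_gradient (w n)) (weak_gradient v) - kin v) \<longlonglongrightarrow> 2 * kin v - kin v"
      by (intro tendsto_intros vg(2))
    ultimately show ?thesis by simp
  qed
  have van: "(\<lambda>n. \<integral>x. \<bar>W x\<bar> * (norm (d n x))^2 \<partial>lebesgue) \<longlonglongrightarrow> 0" if "tame_weight W" for W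
    by (rule tame_weight_vanish[OF that dH dK dloc])
  have meas: "v \<in> borel_measurable lebesgue" "d n \<in> borel_measurable lebesgue" "w n \<in> borel_measurable lebesgue" for n
    by (intro L2_meas H1_L2 vH dH w)+
  have 3: "(\<lambda>n. \<integral>x. W x * (norm (w n x))^2 \<partial>lebesgue) \<longlonglongrightarrow> (\<integral>x. W x * (norm (v x))^2 \<partial>lebesgue)" if W: "tame_weight W" for W
  proof -
    have Wm [measurable]: "W \<in> borel_measurable lebesgue" using W by (simp add: tame_weight_def)
    note [measurable] = meas
    have i: "integrable lebesgue (\<lambda>x. \<bar>W x\<bar> * (norm (f x))^2)" if "f \<in> H1" for f by (rule tame_weight_integrable[OF W that])
    have iW: "integrable lebesgue (\<lambda>x. W x * (norm (f x))^2)" if "f \<in> H1" for f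
    proof (rule Bochner_Integration.integrable_bound[OF i[OF that]])
      show "(\<lambda>x. W x * (norm (f x))^2) \<in> borel_measurable lebesgue" using L2_meas[OF H1_L2[OF that]] by measurable
    qed (simp add: abs_mult)
    \<comment> \<open>The cross term in the square of \<open>v x + d n x\<close> is estimated by
      Cauchy-Schwarz, with \<open>\<bar>W x\<bar>\<close> split evenly into two square roots; the
      factor containing \<open>d n\<close> vanishes in the limit.\<close>
    let ?s = "\<lambda>x. sqrt \<bar>W x\<bar>"
    define A where "A = (\<integral>x. \<bar>W x\<bar> * (norm (v x))^2 \<partial>lebesgue)"
    define D where "D n = (\<integral>x. \<bar>W x\<bar> * (norm (d n x))^2 \<partial>lebesgue)" for n
    have D0: "D \<longlonglongrightarrow> 0" unfolding D_def[abs_def] by (rule van[OF W])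
    have "\<bar>(\<integral>x. W x * (norm (w n x))^2 \<partial>lebesgue) - (\<integral>x. W x * (norm (v x))^2 \<partial>lebesgue)\<bar> \<le> D n + 2 * (sqrt A * sqrt (D n))" for n
    proof -
      have CSi: "integrable lebesgue (\<lambda>x. (?s x * norm (v x)) * (?s x * norm (d n x)))"
        and CS: "\<bar>\<integral>x. (?s x * norm (v x)) * (?s x * norm (d n x)) \<partial>lebesgue\<bar> \<le> sqrt A * sqrt (D n)"
        using integral_CS[of "\<lambda>x. ?s x * norm (v x)" "\<lambda>x. ?s x * norm (d n x)"] i[OF vH] i[OF dH[of n]] meas Wm
        by (auto simp: power_mult_distrib A_def D_def)
      let ?b = "\<lambda>x. \<bar>W x\<bar> * (norm (d n x))^2 + 2 * ((?s x * norm (v x)) * (?s x * norm (d n x)))"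
      have "\<bar>(\<integral>x. W x * (norm (w n x))^2 \<partial>lebesgue) - (\<integral>x. W x * (norm (v x))^2 \<partial>lebesgue)\<bar>
         = \<bar>\<integral>x. W x * (norm (w n x))^2 - W x * (norm (v x))^2 \<partial>lebesgue\<bar>"
        using iW[OF w(1)[of n]] iW[OF vH] by simp
      also have "\<dots> \<le> (\<integral>x. \<bar>W x * (norm (w n x))^2 - W x * (norm (v x))^2\<bar> \<partial>lebesgue)" by (rule integral_abs_bound)
      also have "\<dots> \<le> (\<integral>x. ?b x \<partial>lebesgue)"
      proof (rule integral_mono)
        show "integrable lebesgue (\<lambda>x. \<bar>W x * (norm (w n x))^2 - W x * (norm (v x))^2\<bar>)" using iW[OF w(1)[of n]] iW[OF vH] by simp
        show "integrable lebesgue ?b" using i[OF dH[of n]] CSi by simp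
        fix x
        have "W x * (norm (w n x))^2 - W x * (norm (v x))^2 = W x * ((norm (d n x))^2 + 2 * (v x \<bullet> d n x))"
          by (simp add: wdv power2_norm_eq_inner inner_add_left inner_add_right inner_commute algebra_simps)
        moreover have "\<bar>(norm (d n x))^2 + 2 * (v x \<bullet> d n x)\<bar> \<le> (norm (d n x))^2 + 2 * (norm (v x) * norm (d n x))"
          using Cauchy_Schwarz_ineq2[of "v x" "d n x"] zero_le_power2[of "norm (d n x)"] by linarith
        ultimately have "\<bar>W x * (norm (w n x))^2 - W x * (norm (v x))^2\<bar> \<le> \<bar>W x\<bar> * ((norm (d n x))^2 + 2 * (norm (v x) * norm (d n x)))"
          by (simp only: abs_mult) (rule mult_left_mono, simp_all)
        also have "\<dots> = ?b x" by (simp add: algebra_simps)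
        finally show "\<bar>W x * (norm (w n x))^2 - W x * (norm (v x))^2\<bar> \<le> ?b x" .
      qed
      also have "\<dots> = D n + 2 * (\<integral>x. (?s x * norm (v x)) * (?s x * norm (d n x)) \<partial>lebesgue)"
        using i[OF dH[of n]] CSi by (simp add: D_def)
      finally show ?thesis using CS by linarith
    qed
    then have "\<forall>\<^sub>F n in sequentially. norm ((\<integral>x. W x * (norm (w n x))^2 \<partial>lebesgue) - (\<integral>x. W x * (norm (v x))^2 \<partial>lebesgue)) \<le> D n + 2 * (sqrt A * sqrt (D n))"
      by simp
    moreover have "(\<lambda>n. D n + 2 * (sqrt A * sqrt (D n))) \<longlonglongrightarrow> 0 + 2 * (sqrt A * sqrt 0)" by (intro tendsto_intros D0)
    ultimately have "(\<lambda>n. (\<integral>x. W x * (norm (w n x))^2 \<partial>lebesgue) - (\<integral>x. W x * (norm (v x))^2 \<partial>lebesgue)) \<longlonglongrightarrow> 0"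
      by (auto intro: Lim_null_comparison)
    then show ?thesis by (simp add: LIM_zero_iff)
  qed
  have 4: "(\<lambda>n. quartic (w n) - quartic (d n)) \<longlonglongrightarrow> quartic v"
  proof -
    note [measurable] = meas
    obtain C where C: "C > 0" "\<forall>u\<in>H1. quartic u \<le> C * nsq u * kin u" using quartic_bound by blast
    \<comment> \<open>Every mixed term carries at least one factor that Cauchy-Schwarz turns into
      \<open>sqrt (D n)\<close>, the other factor being a bounded quartic integral.\<close>
    define D where "D n = (\<integral>x. (norm (v x))^2 * (norm (d n x))^2 \<partial>lebesgue)" for n
    have D0: "D \<longlonglongrightarrow> 0" using van[OF tame_weight_norm_sq[OF vH]] by (simp add: D_def[abs_def])
    have Di: "integrable lebesgue (\<lambda>x. (norm (v x))^2 * (norm (d n x))^2)" for n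
      using tame_weight_integrable[OF tame_weight_norm_sq[OF vH] dH[of n]] by simp
    have K'0: "0 \<le> K'" using dK(1)[of 0] nsq_nonneg[of "d 0"] by linarith
    have qd: "quartic (d n) \<le> C * K' * K'" for n
    proof -
      have "C * nsq (d n) * kin (d n) \<le> C * K' * K'" using dK C(1) K'0 by (intro mult_mono) auto
      then show ?thesis using C(2) dH[of n] by fastforce
    qed
    let ?E = "\<lambda>n. 6 * D n + 4 * (sqrt (D n) * sqrt (quartic v)) + 4 * (sqrt (D n) * sqrt (C * K' * K'))"
    have "\<bar>quartic (w n) - quartic (d n) - quartic v\<bar> \<le> ?E n" for n
    proof -
      note q = quartic_integrable[OF w(1)[of n]] quartic_integrable[OF dH[of n]] quartic_integrable[OF vH]
      let ?m = "\<lambda>x. norm (v x) * norm (d n x)"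
      have e4: "(t^2)^2 = t^4" for t :: real by (simp add: power_mult[symmetric])
      have CS1: "integrable lebesgue (\<lambda>x. ?m x * (norm (v x))^2)" "\<bar>\<integral>x. ?m x * (norm (v x))^2 \<partial>lebesgue\<bar> \<le> sqrt (D n) * sqrt (quartic v)"
        using integral_CS[of ?m "\<lambda>x. (norm (v x))^2"] Di[of n] q(3) meas by (auto simp: power_mult_distrib e4 D_def)
      have CS2: "integrable lebesgue (\<lambda>x. ?m x * (norm (d n x))^2)" "\<bar>\<integral>x. ?m x * (norm (d n x))^2 \<partial>lebesgue\<bar> \<le> sqrt (D n) * sqrt (quartic (d n))"
        using integral_CS[of ?m "\<lambda>x. (norm (d n x))^2"] Di[of n] q(2) meas by (auto simp: power_mult_distrib e4 D_def)
      let ?b = "\<lambda>x. 6 * ((norm (v x))^2 * (norm (d n x))^2) + 4 * (?m x * (norm (v x))^2) + 4 * (?m x * (norm (d n x))^2)"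
      have "\<bar>quartic (w n) - quartic (d n) - quartic v\<bar> = \<bar>\<integral>x. norm (w n x) ^ 4 - norm (v x) ^ 4 - norm (d n x) ^ 4 \<partial>lebesgue\<bar>"
        using q by simp
      also have "\<dots> \<le> (\<integral>x. \<bar>norm (w n x) ^ 4 - norm (v x) ^ 4 - norm (d n x) ^ 4\<bar> \<partial>lebesgue)" by (rule integral_abs_bound)
      also have "\<dots> \<le> (\<integral>x. ?b x \<partial>lebesgue)"
      proof (rule integral_mono)
        show "integrable lebesgue (\<lambda>x. \<bar>norm (w n x) ^ 4 - norm (v x) ^ 4 - norm (d n x) ^ 4\<bar>)" using q by simp
        show "integrable lebesgue ?b" using Di[of n] CS1 CS2 by simp
        show "\<bar>norm (w n x) ^ 4 - norm (v x) ^ 4 - norm (d n x) ^ 4\<bar> \<le> ?b x" for x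
          unfolding wdv by (rule norm_add_pow4)
      qed
      also have "\<dots> = 6 * D n + 4 * (\<integral>x. ?m x * (norm (v x))^2 \<partial>lebesgue) + 4 * (\<integral>x. ?m x * (norm (d n x))^2 \<partial>lebesgue)"
        using Di[of n] CS1 CS2 by (simp add: D_def)
      also have "\<dots> \<le> 6 * D n + 4 * (sqrt (D n) * sqrt (quartic v)) + 4 * (sqrt (D n) * sqrt (quartic (d n)))"
        using CS1(2) CS2(2) by linarith
      also have "\<dots> \<le> ?E n"
      proof -
        have "0 \<le> D n" unfolding D_def by (rule Bochner_Integration.integral_nonneg) auto
        then have "sqrt (D n) * sqrt (quartic (d n)) \<le> sqrt (D n) * sqrt (C * K' * K')"
          using qd[of n] by (intro mult_left_mono real_sqrt_le_mono) auto
        then show ?thesis by linarith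
      qed
      finally show ?thesis .
    qed
    then have "\<forall>\<^sub>F n in sequentially. norm (quartic (w n) - quartic (d n) - quartic v) \<le> ?E n" by simp
    moreover have "?E \<longlonglongrightarrow> 6 * 0 + 4 * (sqrt 0 * sqrt (quartic v)) + 4 * (sqrt 0 * sqrt (C * K' * K'))"
      by (intro tendsto_intros D0)
    ultimately have "(\<lambda>n. quartic (w n) - quartic (d n) - quartic v) \<longlonglongrightarrow> 0"
      by (auto intro: Lim_null_comparison)
    then show ?thesis by (simp add: LIM_zero_iff)
  qed
  show ?thesis
    using r vH ae loc 1 2 3 4 unfolding w_def d_def[abs_def] by (intro exI[of _ r] exI[of _ v] conjI allI impI) auto
qed

section \<open>Existence of minimizers when the ground state energy is negative\<close>

text \<open>The integral of a translate does not depend on the translation, so its derivative along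
  a coordinate line is zero.\<close>

lemma integral_pd_test: assumes \<phi>: "\<phi> \<in> test_functions" shows "(\<integral>x. pd i \<phi> x \<partial>lebesgue) = 0"
proof -
  have one: "locally_integrable (\<lambda>x. 1::real)" by (rule locally_integrable_bounded[where C=1]) auto
  have c: "corr \<phi> (\<lambda>x. 1::real) z = (\<integral>x. \<phi> x \<partial>lebesgue)" for z
    using corr_translate[OF one \<phi>, of z] by simp
  have "((\<lambda>t. corr \<phi> (\<lambda>x. 1::real) (0 + t *\<^sub>R axis i 1)) has_vector_derivative
           - (\<Sum>j\<in>UNIV. axis i 1 $ j *\<^sub>R corr (pd j \<phi>) (\<lambda>x. 1::real) (0 + 0 *\<^sub>R axis i 1))) (at 0)"
    by (rule corr_deriv_pd[OF \<phi> one])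
  moreover have "(\<Sum>j\<in>UNIV. axis i 1 $ j *\<^sub>R corr (pd j \<phi>) (\<lambda>x. 1::real) (0 + 0 *\<^sub>R axis i 1)) = (\<integral>x. pd i \<phi> x \<partial>lebesgue)"
    by (simp add: axis_def corr_def if_distrib[of "\<lambda>c. c * _"] cong: if_cong)
  ultimately have "((\<lambda>t::real. (\<integral>x. \<phi> x \<partial>lebesgue)) has_vector_derivative - (\<integral>x. pd i \<phi> x \<partial>lebesgue)) (at 0)"
    by (simp add: c)
  moreover have "((\<lambda>t::real. (\<integral>x. \<phi> x \<partial>lebesgue)) has_vector_derivative 0) (at 0)" by simp
  ultimately show ?thesis using vector_derivative_unique_at by fastforce
qed

lemma test_H1: assumes \<phi>: "\<phi> \<in> test_functions" shows "(\<lambda>x. complex_of_real (\<phi> x)) \<in> H1"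
proof -
  let ?u = "\<lambda>x. complex_of_real (\<phi> x)" and ?g = "\<lambda>x. (\<chi> i. complex_of_real (pd i \<phi> x)) :: complex ^ 2"
  have m: "(\<lambda>x. complex_of_real (\<psi> x)) \<in> borel_measurable lebesgue" if "\<psi> \<in> test_functions" for \<psi>
    using test_meas[OF that] by measurable
  have u2: "?u \<in> Lp 2" by (rule L2_dominated[OF test_L2[OF \<phi>] m[OF \<phi>], of 1]) simp
  have g2: "?g \<in> Lp 2"
  proof (rule L2_I)
    show gm: "?g \<in> borel_measurable lebesgue" by (intro borel_measurable_vec_lambda m test_pd \<phi>)
    show "integrable lebesgue (\<lambda>x. (norm (?g x))^2)"
      using L2_int[OF test_L2[OF test_pd[OF \<phi>, of 1]]] L2_int[OF test_L2[OF test_pd[OF \<phi>, of 2]]]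
      by (simp add: norm_vec2_sq)
  qed
  have "has_weak_gradient ?u ?g"
    unfolding has_weak_gradient_iff
  proof (intro conjI ballI allI locally_integrable_L2 u2 g2)
    fix \<psi> i assume \<psi>: "\<psi> \<in> test_functions"
    have t: "(\<lambda>x. \<psi> x * \<phi> x) \<in> test_functions" by (rule test_mult_smooth[OF \<psi> test_smooth[OF \<phi>]])
    have "0 = (\<integral>x. pd i (\<lambda>x. \<psi> x * \<phi> x) x \<partial>lebesgue)" using integral_pd_test[OF t] by simp
    also have "\<dots> = (\<integral>x. \<psi> x * pd i \<phi> x + pd i \<psi> x * \<phi> x \<partial>lebesgue)"
      by (simp only: pd_mult[OF test_smooth[OF \<psi>] test_smooth[OF \<phi>]])
    also have "\<dots> = (\<integral>x. \<psi> x * pd i \<phi> x \<partial>lebesgue) + (\<integral>x. pd i \<psi> x * \<phi> x \<partial>lebesgue)"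
      by (intro Bochner_Integration.integral_add test_mult_integrable test_pd \<phi> \<psi>)
    finally have "complex_of_real (\<integral>x. pd i \<psi> x * \<phi> x \<partial>lebesgue) = - complex_of_real (\<integral>x. \<psi> x * pd i \<phi> x \<partial>lebesgue)"
      by (simp flip: of_real_minus)
    then show "(\<integral>x. pd i \<psi> x *\<^sub>R ?u x \<partial>lebesgue) = - (\<integral>x. \<psi> x *\<^sub>R (?g x $ i) \<partial>lebesgue)"
      by (simp add: scaleR_conv_of_real flip: of_real_mult)
  qed
  with u2 g2 show ?thesis by (rule H1_I)
qed

section \<open>Normalization and the optimal constant\<close>

lemma l2_norm_nsq: "l2_norm u = sqrt (nsq u)"
  by (simp add: l2_norm_def nsq_def)

lemma H1_sphere_iff: "u \<in> H1_sphere \<longleftrightarrow> u \<in> H1 \<and> nsq u = 1"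
  by (simp add: H1_sphere_def l2_norm_nsq)

lemma normalize_H1:
  assumes "u \<in> H1" "nsq u > 0"
  shows "(\<lambda>x. (1 / sqrt (nsq u)) *\<^sub>R u x) \<in> H1_sphere" "kin (\<lambda>x. (1 / sqrt (nsq u)) *\<^sub>R u x) = kin u / nsq u"
    "quartic (\<lambda>x. (1 / sqrt (nsq u)) *\<^sub>R u x) = quartic u / (nsq u)^2"
proof -
  show "(\<lambda>x. (1 / sqrt (nsq u)) *\<^sub>R u x) \<in> H1_sphere"
    unfolding H1_sphere_iff using assms H1_scaleR[OF assms(1)] by (simp add: nsq_scaleR power_divide)
  show "kin (\<lambda>x. (1 / sqrt (nsq u)) *\<^sub>R u x) = kin u / nsq u"
    using assms H1_scaleR(2)[OF assms(1), of "1 / sqrt (nsq u)"] by (simp add: power_divide)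
  have e: "norm ((1 / sqrt (nsq u)) *\<^sub>R u x) ^ 4 = (1 / (nsq u)^2) * norm (u x) ^ 4" for x
  proof -
    have "sqrt (nsq u) ^ (2 * 2) = (nsq u)^2" by (simp only: power_mult real_sqrt_pow2[OF nsq_nonneg])
    then show ?thesis by (simp add: power_divide)
  qed
  show "quartic (\<lambda>x. (1 / sqrt (nsq u)) *\<^sub>R u x) = quartic u / (nsq u)^2"
    unfolding e by simp
qed

text \<open>The infimum defining \<open>gn_const\<close> is taken in the reals, where its two
  defining properties require a nonempty set.\<close>

lemma H1_sphere_nonempty: "H1_sphere \<noteq> {}"
proof -
  let ?u = "\<lambda>x. complex_of_real (cutoff 1 0 x)"
  have u: "?u \<in> H1" by (rule test_H1) (rule test_cutoff, simp)
  have "nsq ?u \<noteq> 0"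
  proof
    assume "nsq ?u = 0"
    then have "AE x in lebesgue. ?u x = 0" by (rule nsq_eq_0[OF H1_L2[OF u]])
    then have "AE x in lebesgue. cutoff 1 0 x = 0" by simp
    then have "(\<integral>x. cutoff 1 0 x \<partial>lebesgue) = (\<integral>x. 0 \<partial>(lebesgue::plane measure))"
      by (intro integral_cong_AE) (auto simp: test_meas test_cutoff)
    then show False using cutoff_integral_pos[of 1] by simp
  qed
  then have "nsq ?u > 0" by (simp add: less_le)
  from normalize_H1(1)[OF u this] show ?thesis by blast
qed

lemma quartic_eq_0: assumes "u \<in> H1" "quartic u = 0" shows "nsq u = 0"
proof -
  have "AE x in lebesgue. norm (u x) ^ 4 = 0"
    using integral_nonneg_eq_0_iff_AE[OF quartic_integrable[OF assms(1)]] assms(2) by simp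
  then have "AE x in lebesgue. u x = (\<lambda>x. 0) x" by simp
  then have "nsq u = nsq (\<lambda>x. 0 :: complex)" using L2_meas[OF H1_L2[OF assms(1)]] by (intro nsq_cong_AE) auto
  then show ?thesis by (simp add: nsq_def)
qed

lemma nsq_0_imp: assumes "u \<in> H1" "nsq u = 0" shows "AE x in lebesgue. u x = 0" "quartic u = 0" "kin u = 0"
proof -
  show z: "AE x in lebesgue. u x = 0" by (rule nsq_eq_0[OF H1_L2[OF assms(1)] assms(2)])
  obtain C where "\<forall>u\<in>H1. quartic u \<le> C * nsq u * kin u" using quartic_bound by blast
  then have "quartic u \<le> 0" using assms by force
  then show "quartic u = 0" using quartic_nonneg[of u] by linarith
  have "has_weak_gradient (\<lambda>x. 0) (\<lambda>x. 0)"
    using has_weak_gradient_diff[OF H1_weak_gradient(3)[OF assms(1)] H1_weak_gradient(3)[OF assms(1)]] by simp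
  then have "AE x in lebesgue. weak_gradient u x = 0"
    using weak_gradient_unique[OF H1_weak_gradient(3)[OF assms(1)], of "\<lambda>x. 0" "\<lambda>x. 0"] z by simp
  then have "kin u = nsq (\<lambda>x. 0 :: complex ^ 2)"
    using L2_meas[OF H1_weak_gradient(2)[OF assms(1)]] by (intro nsq_cong_AE) auto
  then show "kin u = 0" by (simp add: nsq_def)
qed

lemma gn_const_eq: "gn_const = (INF u\<in>H1_sphere. kin u / (1/2 * quartic u))"
  by (simp add: gn_const_def nsq_def)

lemma gn_bdd: "bdd_below ((\<lambda>u. kin u / (1/2 * quartic u)) ` H1_sphere)"
  by (intro bdd_belowI[of _ 0]) auto

lemma gn_const_pos: "0 < gn_const"
proof -
  obtain C where C: "C > 0" "\<forall>u\<in>H1. quartic u \<le> C * nsq u * kin u" using quartic_bound by blast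
  have "2 / C \<le> gn_const"
    unfolding gn_const_eq
  proof (rule cINF_greatest[OF H1_sphere_nonempty])
    fix u assume u: "u \<in> H1_sphere"
    then have "quartic u \<le> C * kin u" using C(2) by (auto simp: H1_sphere_iff)
    moreover have "quartic u > 0" using quartic_eq_0[of u] u quartic_nonneg[of u] unfolding H1_sphere_iff
      by (metis less_eq_real_def zero_neq_one)
    ultimately show "2 / C \<le> kin u / (1/2 * quartic u)" using C(1) by (simp add: field_simps)
  qed
  then show ?thesis using C(1) by (meson divide_pos_pos less_le_trans zero_less_numeral)
qed

text \<open>The homogeneous form. It is applied mostly to remainders and cut-off pieces, which are
  not normalized, and the factor \<open>nsq u\<close> records how much mass they carry.\<close>

lemma gagliardo_nirenberg: assumes u: "u \<in> H1" shows "gn_const / 2 * quartic u \<le> nsq u * kin u"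
proof (cases "nsq u = 0")
  case True
  then show ?thesis using nsq_0_imp(2)[OF u] by simp
next
  case False
  then have N: "nsq u > 0" by (simp add: less_le)
  let ?w = "\<lambda>x. (1 / sqrt (nsq u)) *\<^sub>R u x"
  note w = normalize_H1[OF u N]
  have "quartic u > 0" using quartic_eq_0[OF u] N quartic_nonneg[of u] by (metis less_eq_real_def less_irrefl)
  have "gn_const \<le> kin ?w / (1/2 * quartic ?w)"
    unfolding gn_const_eq by (rule cINF_lower[OF gn_bdd w(1)])
  also have "\<dots> = (kin u / nsq u) / (1/2 * (quartic u / (nsq u)^2))" by (simp only: w)
  also have "\<dots> = 2 * nsq u * kin u / quartic u" using N by (simp add: power2_eq_square)
  finally show ?thesis using \<open>quartic u > 0\<close> by (simp add: field_simps)
qed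

lemma gn_near_optimal:
  assumes "\<delta> > 0" shows "\<exists>u\<in>H1_sphere. kin u < (gn_const + \<delta>) * (1/2 * quartic u)"
proof -
  have "(INF u\<in>H1_sphere. kin u / (1/2 * quartic u)) < gn_const + \<delta>" using assms gn_const_eq by linarith
  then obtain u where u: "u \<in> H1_sphere" "kin u / (1/2 * quartic u) < gn_const + \<delta>"
    using cINF_less_iff[OF H1_sphere_nonempty gn_bdd] by blast
  have "quartic u > 0" using quartic_eq_0[of u] u(1) quartic_nonneg[of u] unfolding H1_sphere_iff
    by (metis less_eq_real_def zero_neq_one)
  then have "kin u < (gn_const + \<delta>) * (1/2 * quartic u)" using u(2) by (subst (asm) pos_divide_less_eq) auto
  with u(1) show ?thesis by blast
qed

section \<open>The energy functional and its coercivity\<close>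

abbreviation potential :: "(plane \<Rightarrow> real) \<Rightarrow> (plane \<Rightarrow> complex) \<Rightarrow> real" where
  "potential V u \<equiv> (\<integral>x. V x * (norm (u x))^2 \<partial>lebesgue)"

abbreviation (input) neg_part :: "(plane \<Rightarrow> real) \<Rightarrow> plane \<Rightarrow> real" where "neg_part V \<equiv> (\<lambda>x. max (- V x) 0)"
abbreviation (input) pos_part :: "(plane \<Rightarrow> real) \<Rightarrow> plane \<Rightarrow> real" where "pos_part V \<equiv> (\<lambda>x. max (V x) 0)"

definition real_energy :: "(plane \<Rightarrow> real) \<Rightarrow> real \<Rightarrow> (plane \<Rightarrow> complex) \<Rightarrow> real" where
  "real_energy V a u = kin u + potential V u - a / 2 * quartic u"

text \<open>The setting for the existence of minimizers and for the spectral argument; local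
  integrability of \<open>V\<close> enters separately, in the construction of trial states near the
  critical coupling.\<close>

locale admissible_potential =
  fixes V :: "plane \<Rightarrow> real"
  assumes V_meas [measurable]: "V \<in> borel_measurable lebesgue" and neg_tame: "tame_weight (neg_part V)"
begin

lemma neg_integrable: "u \<in> H1 \<Longrightarrow> integrable lebesgue (\<lambda>x. neg_part V x * (norm (u x))^2)"
  using tame_weight_integrable[OF neg_tame] by simp

lemma potential_split:
  assumes "u \<in> H1" "pos_potential_integrable V u"
  shows "integrable lebesgue (\<lambda>x. V x * (norm (u x))^2)" "potential V u = potential (pos_part V) u - potential (neg_part V) u"
proof -
  have e: "V x * (norm (u x))^2 = pos_part V x * (norm (u x))^2 - neg_part V x * (norm (u x))^2" for x
    by (simp add: max_def)
  show "integrable lebesgue (\<lambda>x. V x * (norm (u x))^2)"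
    unfolding e using assms neg_integrable by (auto simp: pos_potential_integrable_def)
  show "potential V u = potential (pos_part V) u - potential (neg_part V) u"
    unfolding e[abs_def] using assms neg_integrable[OF assms(1)] by (simp add: pos_potential_integrable_def)
qed

lemma energy_eq:
  assumes "u \<in> H1" shows "energy V a u = (if pos_potential_integrable V u then ereal (real_energy V a u) else \<infinity>)"
  using potential_split(1)[OF assms] L2_int[OF H1_weak_gradient(2)[OF assms]] quartic_integrable[OF assms]
  by (simp add: energy_def real_energy_def nsq_def)

text \<open>By Gagliardo-Nirenberg the quartic term consumes only the fraction
  \<open>a / gn_const\<close> of the kinetic energy.\<close>

lemma coercive:
  assumes a: "0 \<le> a" "a < gn_const"
  shows "\<exists>c>0. \<exists>C\<ge>0. \<forall>u\<in>H1_sphere. pos_potential_integrable V u \<longrightarrow> c * kin u - C \<le> real_energy V a u"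
proof -
  define q where "q = a / gn_const"
  \<comment> \<open>Half of the kinetic energy left over: one half pays for the negative part of
    \<open>V\<close>, the other half remains in the bound.\<close>
  define c where "c = (1 - q) / 2"
  have c: "c > 0" using a by (simp add: c_def q_def)
  obtain C where C: "C \<ge> 0" "\<forall>u\<in>H1. (\<integral>x. \<bar>neg_part V x\<bar> * (norm (u x))^2 \<partial>lebesgue) \<le> C * nsq u + c * kin u"
    using tame_weight_form_bound[OF neg_tame c] by blast
  have "c * kin u - C \<le> real_energy V a u" if u: "u \<in> H1_sphere" "pos_potential_integrable V u" for u
  proof -
    have uH: "u \<in> H1" and n: "nsq u = 1" using u by (auto simp: H1_sphere_iff)
    have "a / 2 * quartic u = (a / gn_const) * (gn_const / 2 * quartic u)" using gn_const_pos by simp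
    also have "\<dots> \<le> (a / gn_const) * kin u"
      using gagliardo_nirenberg[OF uH] n a gn_const_pos by (intro mult_left_mono) auto
    finally have "a / 2 * quartic u \<le> (a / gn_const) * kin u" .
    moreover have "potential (neg_part V) u \<le> C + c * kin u" using C(2) uH n by (auto simp: abs_of_nonneg)
    moreover have "0 \<le> potential (pos_part V) u" by (rule Bochner_Integration.integral_nonneg) auto
    moreover have "(a / gn_const) * kin u = kin u - 2 * (c * kin u)"
      unfolding c_def q_def[symmetric] by (simp add: algebra_simps add_divide_distrib diff_divide_distrib)
    ultimately show ?thesis unfolding real_energy_def potential_split(2)[OF uH u(2)] by linarith
  qed
  with c C(1) show ?thesis by blast
qed

theorem minimizer_exists:
  assumes a: "0 \<le> a" "a < gn_const" and neg: "ground_energy V a < 0"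
  shows "\<exists>u. is_minimizer V a u"
proof -
  \<comment> \<open>Restricting to states of finite potential energy makes the infimum a real
    number, so that the minimizing sequence has real energies and the splittings can be
    subtracted.\<close>
  define S where "S = {u \<in> H1_sphere. pos_potential_integrable V u}"
  have SH: "u \<in> H1" "nsq u = 1" "pos_potential_integrable V u" if "u \<in> S" for u
    using that by (auto simp: S_def H1_sphere_iff)
  let ?e = "real_energy V a"
  obtain c C where c: "c > 0" "C \<ge> 0" "\<forall>u\<in>S. c * kin u - C \<le> ?e u"
    using coercive[OF a] unfolding S_def by blast
  have "\<exists>u\<in>H1_sphere. energy V a u < 0" using neg unfolding ground_energy_def by (simp add: INF_less_iff)
  then obtain u0 where u0: "u0 \<in> H1_sphere" "energy V a u0 < 0" by blast
  have u0H: "u0 \<in> H1" using u0(1) by (simp add: H1_sphere_iff)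
  have u0S: "u0 \<in> S" "?e u0 < 0" using u0 unfolding energy_eq[OF u0H] by (auto simp: S_def split: if_splits)
  define m where "m = (INF u\<in>S. ?e u)"
  have low: "- C \<le> ?e u" if "u \<in> S" for u
  proof -
    have "0 \<le> c * kin u" using c(1) by simp
    then show ?thesis using c(3) that by force
  qed
  have bdd: "bdd_below (?e ` S)" using low by (intro bdd_belowI[of _ "-C"]) auto
  have m_le: "m \<le> ?e u" if "u \<in> S" for u unfolding m_def using bdd that by (rule cINF_lower)
  have m0: "m < 0" using m_le[OF u0S(1)] u0S(2) by linarith
  have "S \<noteq> {}" using u0S by blast
  then have "\<exists>u\<in>S. ?e u < m + 1 / real (Suc n)" for n
    using cINF_less_iff[OF _ bdd, of "m + 1 / real (Suc n)"] by (auto simp: m_def)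
  then obtain u where u: "\<And>n. u n \<in> S" "\<And>n. ?e (u n) < m + 1 / real (Suc n)" by metis
  have ulim: "(\<lambda>n. ?e (u n)) \<longlonglongrightarrow> m"
  proof (rule tendsto_sandwich[OF _ _ tendsto_const])
    show "(\<lambda>n. m + 1 / real (Suc n)) \<longlonglongrightarrow> m"
      using tendsto_add[OF tendsto_const[of m] LIMSEQ_inverse_real_of_nat] by (simp add: inverse_eq_divide)
  qed (use u m_le in \<open>auto simp: less_imp_le\<close>)
  \<comment> \<open>Members of the sequence have energy below \<open>m + 1\<close>, hence below 1,
    and coercivity turns this into a bound for \<open>kin\<close>.\<close>
  define K where "K = max 1 ((1 + C) / c)"
  have uK: "u n \<in> H1" "nsq (u n) \<le> K" "kin (u n) \<le> K" for n
  proof -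
    show "u n \<in> H1" "nsq (u n) \<le> K" using SH[OF u(1)] by (auto simp: K_def)
    have "1 / real (Suc n) \<le> 1" by (simp add: field_simps)
    then have "c * kin (u n) - C \<le> 1" using bspec[OF c(3) u(1)[of n]] u(2)[of n] m0 by linarith
    then have "kin (u n) \<le> (1 + C) / c" using c(1) by (simp add: field_simps)
    then show "kin (u n) \<le> K" by (simp add: K_def)
  qed
  obtain r v where r: "strict_mono r" and vH: "v \<in> H1" and ae: "AE x in lebesgue. (\<lambda>n. u (r n) x) \<longlonglongrightarrow> v x"
    and l1: "(\<lambda>n. nsq (u (r n)) - nsq (\<lambda>x. u (r n) x - v x)) \<longlonglongrightarrow> nsq v"
    and l2: "(\<lambda>n. kin (u (r n)) - kin (\<lambda>x. u (r n) x - v x)) \<longlonglongrightarrow> kin v"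
    and l3: "(\<lambda>n. quartic (u (r n)) - quartic (\<lambda>x. u (r n) x - v x)) \<longlonglongrightarrow> quartic v"
    and l4: "\<forall>W. tame_weight W \<longrightarrow> (\<lambda>n. \<integral>x. W x * (norm (u (r n) x))^2 \<partial>lebesgue) \<longlonglongrightarrow> (\<integral>x. W x * (norm (v x))^2 \<partial>lebesgue)"
    using H1_compactness[of u K, OF uK] by blast
  define d where "d n = (\<lambda>x. u (r n) x - v x)" for n
  have dH: "d n \<in> H1" for n unfolding d_def by (rule H1_diff(1)[OF uK(1) vH])
  have dn: "(\<lambda>n. nsq (d n)) \<longlonglongrightarrow> 1 - nsq v"
  proof -
    have "nsq (d n) = 1 - (nsq (u (r n)) - nsq (\<lambda>x. u (r n) x - v x))" for n using SH(2)[OF u(1)] by (simp add: d_def)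
    then show ?thesis using tendsto_diff[OF tendsto_const[of 1] l1] by simp
  qed
  have v1: "nsq v \<le> 1" using LIMSEQ_le_const[OF dn, of 0] by simp
  \<comment> \<open>The remainder has mass tending to \<open>1 - nsq v\<close>, which is at most 1.
    As \<open>a < gn_const\<close>, Gagliardo-Nirenberg eventually makes its kinetic energy dominate
    its quartic term.\<close>
  have "(\<lambda>n. a / gn_const * nsq (d n)) \<longlonglongrightarrow> a / gn_const * (1 - nsq v)" by (intro tendsto_intros dn)
  moreover have "a / gn_const * (1 - nsq v) < 1"
  proof -
    have "a / gn_const * (1 - nsq v) \<le> a / gn_const * 1" using a by (intro mult_left_mono) auto
    moreover have "a / gn_const * 1 < 1" using a gn_const_pos by simp
    ultimately show ?thesis by linarith
  qed
  ultimately have "\<forall>\<^sub>F n in sequentially. a / gn_const * nsq (d n) < 1" by (rule order_tendstoD)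
  then obtain N where N: "\<And>n. n \<ge> N \<Longrightarrow> a / gn_const * nsq (d n) < 1" unfolding eventually_sequentially by blast
  have dpos: "0 \<le> kin (d n) - a / 2 * quartic (d n)" if "n \<ge> N" for n
  proof -
    have "a / 2 * quartic (d n) = (a / gn_const) * (gn_const / 2 * quartic (d n))" using gn_const_pos by simp
    also have "\<dots> \<le> (a / gn_const) * (nsq (d n) * kin (d n))"
      using gagliardo_nirenberg[OF dH] a gn_const_pos by (intro mult_left_mono) auto
    also have "\<dots> = (a / gn_const * nsq (d n)) * kin (d n)" by simp
    also have "\<dots> \<le> 1 * kin (d n)" using N[OF that] by (intro mult_right_mono) auto
    finally show ?thesis by simp
  qed
  \<comment> \<open>The energy identity solved for the integral of the positive part of
    \<open>V\<close>, with the nonnegative remainder energy dropped. Every term converges, since the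
    kinetic and quartic terms occur only as differences.\<close>
  let ?C = "\<lambda>n. ?e (u (r n)) - (kin (u (r n)) - kin (d n)) + potential (neg_part V) (u (r n)) + a / 2 * (quartic (u (r n)) - quartic (d n))"
  have ulim': "(\<lambda>n. ?e (u (r n))) \<longlonglongrightarrow> m" using LIMSEQ_subseq_LIMSEQ[OF ulim r] by (simp add: o_def)
  have "?C \<longlonglongrightarrow> m - kin v + potential (neg_part V) v + a / 2 * quartic v"
    unfolding d_def using l2 l3 l4[rule_format, OF neg_tame] ulim' by (intro tendsto_intros)
  then have Clim: "(\<lambda>n. ?C (n + N)) \<longlonglongrightarrow> m - kin v + potential (neg_part V) v + a / 2 * quartic v"
    by (rule LIMSEQ_ignore_initial_segment)
  have vm: "v \<in> borel_measurable lebesgue" by (rule L2_meas[OF H1_L2[OF vH]])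
  \<comment> \<open>The positive part is treated by Fatou alone. This gives at once that
    \<open>v\<close> has finite potential energy and that its energy is at most
    \<open>m\<close>.\<close>
  have F: "integrable lebesgue (\<lambda>x. pos_part V x * (norm (v x))^2) \<and>
     potential (pos_part V) v \<le> m - kin v + potential (neg_part V) v + a / 2 * quartic v"
  proof (rule fatou_bound[where f = "\<lambda>n x. pos_part V x * (norm (u (r (n + N)) x))^2" and C = "\<lambda>n. ?C (n + N)"])
    show "integrable lebesgue (\<lambda>x. pos_part V x * (norm (u (r (n + N)) x))^2)" for n
      using SH(3)[OF u(1)] by (simp add: pos_potential_integrable_def)
    show "AE x in lebesgue. (\<lambda>n. pos_part V x * (norm (u (r (n + N)) x))^2) \<longlonglongrightarrow> pos_part V x * (norm (v x))^2"
      using ae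
    proof eventually_elim
      case (elim x)
      then have "(\<lambda>n. u (r (n + N)) x) \<longlonglongrightarrow> v x" by (rule LIMSEQ_ignore_initial_segment[where f = "\<lambda>n. u (r n) x"])
      then show ?case by (intro tendsto_intros)
    qed
    show "(\<lambda>x. pos_part V x * (norm (v x))^2) \<in> borel_measurable lebesgue" using vm by measurable
    show "potential (pos_part V) (u (r (n + N))) \<le> ?C (n + N)" for n
      using dpos[of "n + N"] potential_split(2)[OF SH(1)[OF u(1)] SH(3)[OF u(1)], of "r (n + N)"]
      unfolding real_energy_def by (simp add: algebra_simps)
    show "(\<lambda>n. ?C (n + N)) \<longlonglongrightarrow> m - kin v + potential (neg_part V) v + a / 2 * quartic v" by (rule Clim)
  qed auto
  have vp: "pos_potential_integrable V v" using F by (simp add: pos_potential_integrable_def)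
  have ev: "?e v \<le> m" using F potential_split(2)[OF vH vp] unfolding real_energy_def by linarith
  have "nsq v \<noteq> 0"
  proof
    assume 0: "nsq v = 0"
    note z = nsq_0_imp[OF vH 0]
    have "potential V v = (\<integral>x. 0 \<partial>(lebesgue::plane measure))"
      using z(1) vm by (intro integral_cong_AE) auto
    then have "?e v = 0" using z by (simp add: real_energy_def)
    then show False using ev m0 by simp
  qed
  then have vpos: "nsq v > 0" by (simp add: less_le)
  define w where "w = (\<lambda>x. (1 / sqrt (nsq v)) *\<^sub>R v x)"
  note w = normalize_H1[OF vH vpos, folded w_def]
  have wq: "quartic w = quartic v / (nsq v)^2"
    unfolding w_def by (rule normalize_H1(3)[OF vH vpos])
  have wn: "(norm (w x))^2 = (1 / nsq v) * (norm (v x))^2" for x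
    using vpos by (simp add: w_def power_divide)
  have wp: "pos_potential_integrable V w"
  proof -
    have "integrable lebesgue (\<lambda>x. (1 / nsq v) * (pos_part V x * (norm (v x))^2))"
      using F by (intro integrable_mult_right) simp
    then show ?thesis unfolding pos_potential_integrable_def wn by (simp add: mult.left_commute)
  qed
  have wS: "w \<in> S" using w(1) wp by (simp add: S_def)
  have pw: "potential V w = potential V v / nsq v"
  proof -
    have "potential V w = (\<integral>x. (1 / nsq v) * (V x * (norm (v x))^2) \<partial>lebesgue)"
      by (simp add: wn mult.left_commute)
    then show ?thesis by simp
  qed
  have "?e w = (kin v + potential V v) / nsq v - a / 2 * (quartic v / (nsq v)^2)"
    by (simp add: real_energy_def w(2) wq pw add_divide_distrib)
  \<comment> \<open>Normalization divides the kinetic and potential parts by \<open>nsq v\<close>,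
    but the attractive quartic part by its square; as \<open>nsq v\<close> is at most 1, the quartic
    gain is at least as large as under division by \<open>nsq v\<close>.\<close>
  also have "\<dots> \<le> (kin v + potential V v) / nsq v - a / 2 * (quartic v / nsq v)"
  proof -
    have "(nsq v)^2 \<le> nsq v" using v1 by (simp add: power2_eq_square mult_left_le)
    then have "quartic v / nsq v \<le> quartic v / (nsq v)^2" using vpos by (intro divide_left_mono) auto
    then have "a / 2 * (quartic v / nsq v) \<le> a / 2 * (quartic v / (nsq v)^2)" using a by (intro mult_left_mono) auto
    then show ?thesis by linarith
  qed
  also have "\<dots> = ?e v / nsq v" by (simp add: real_energy_def diff_divide_distrib)
  also have "\<dots> \<le> m / nsq v" using ev vpos by (intro divide_right_mono) auto
  also have "\<dots> \<le> m"
  proof -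
    have "m * 1 \<le> m * nsq v" using m0 v1 by (intro mult_left_mono_neg) auto
    then show ?thesis using vpos by (simp add: divide_le_eq)
  qed
  finally have ew: "?e w \<le> m" .
  have "energy V a w \<le> energy V a z" if z: "z \<in> H1_sphere" for z
  proof -
    have zH: "z \<in> H1" using z by (simp add: H1_sphere_iff)
    have "?e w \<le> ?e z" if "pos_potential_integrable V z" using m_le[of z] ew z that by (simp add: S_def)
    then show ?thesis using energy_eq[OF zH] energy_eq[OF SH(1)[OF wS]] wp by simp
  qed
  then have "energy V a w = ground_energy V a"
    unfolding ground_energy_def using w(1) by (intro antisym INF_greatest INF_lower) auto
  then show ?thesis using w(1) unfolding is_minimizer_def by blast
qed

end

section \<open>Optimizers of the Gagliardo--Nirenberg inequality\<close>

text \<open>The dilation that preserves mass. In two dimensions the kinetic and quartic terms scale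
  by the same factor, so the Gagliardo-Nirenberg quotient is invariant: the problem is
  mass-critical.\<close>

lemma H1_rescale:
  fixes t :: plane
  assumes u: "u \<in> H1" and l: "l > 0"
  defines "w \<equiv> (\<lambda>x. l *\<^sub>R u (t + l *\<^sub>R x))"
  shows "w \<in> H1" "nsq w = nsq u" "kin w = l^2 * kin u" "quartic w = l^2 * quartic u"
proof -
  note U = H1_weak_gradient[OF u]
  have sc: "(\<lambda>x. c *\<^sub>R f (t + l *\<^sub>R x)) \<in> Lp 2 \<and> nsq (\<lambda>x. c *\<^sub>R f (t + l *\<^sub>R x)) = (c / l)^2 * nsq f"
    if f: "f \<in> Lp 2" for f :: "plane \<Rightarrow> 'b::euclidean_space" and c
  proof -
    note [measurable] = L2_meas[OF f] affine_measurable[OF l, of t]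
    have m: "(\<lambda>x. (norm (f x))^2) \<in> borel_measurable lebesgue" by measurable
    have "integrable lebesgue (\<lambda>x. (norm (f (t + l *\<^sub>R x)))^2)"
      by (subst integrable_affine_iff[OF l m]) (rule L2_int[OF f])
    then have "(\<lambda>x. f (t + l *\<^sub>R x)) \<in> Lp 2" by (intro L2_I) measurable
    then have "(\<lambda>x. c *\<^sub>R f (t + l *\<^sub>R x)) \<in> Lp 2" by (rule L2_scaleR)
    moreover have "nsq f = l^2 * nsq (\<lambda>x. f (t + l *\<^sub>R x))"
      unfolding nsq_def using integral_affine[OF l m, of t] by simp
    ultimately show ?thesis using l by (simp add: nsq_scaleR power_divide)
  qed
  have wg: "has_weak_gradient w (\<lambda>x. (l * l) *\<^sub>R weak_gradient u (t + l *\<^sub>R x))"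
    using has_weak_gradient_scaleR[OF has_weak_gradient_affine[OF U(3) l, of t], of l] by (simp add: w_def)
  have w2: "w \<in> Lp 2" "nsq w = nsq u" using sc[OF U(1), of l] l by (auto simp: w_def)
  have g2: "(\<lambda>x. (l * l) *\<^sub>R weak_gradient u (t + l *\<^sub>R x)) \<in> Lp 2"
    "nsq (\<lambda>x. (l * l) *\<^sub>R weak_gradient u (t + l *\<^sub>R x)) = l^2 * kin u"
    using sc[OF U(2), of "l * l"] l by (auto simp: power2_eq_square)
  show "w \<in> H1" by (rule H1_I[OF w2(1) g2(1) wg])
  show "nsq w = nsq u" by (rule w2)
  show "kin w = l^2 * kin u" using kin_eq[OF g2(1) wg] g2(2) by simp
  have m4: "(\<lambda>x. norm (u x) ^ 4) \<in> borel_measurable lebesgue" using L2_meas[OF U(1)] by measurable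
  have "quartic w = l^4 * (\<integral>x. norm (u (t + l *\<^sub>R x)) ^ 4 \<partial>lebesgue)"
    using l by (simp add: w_def power_mult_distrib)
  moreover have "quartic u = l^2 * (\<integral>x. norm (u (t + l *\<^sub>R x)) ^ 4 \<partial>lebesgue)"
    using integral_affine[OF l m4, of t] by simp
  moreover have "l^4 = l^2 * l^2" by (simp add: power_add[symmetric])
  ultimately show "quartic w = l^2 * quartic u" by (simp only: mult.assoc)
qed

lemma H1_translate:
  assumes u: "u \<in> H1"
  shows "(\<lambda>x. u (x + t)) \<in> H1" "nsq (\<lambda>x. u (x + t)) = nsq u" "kin (\<lambda>x. u (x + t)) = kin u" "quartic (\<lambda>x. u (x + t)) = quartic u"
  using H1_rescale[OF u, of 1 t] by (simp_all add: add.commute)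

text \<open>Where \<open>u\<close> is close to its local average it is small; where it is not, the set is small.\<close>

lemma nonvanishing:
  assumes c: "c > 0"
  shows "\<exists>\<kappa>>0. \<exists>\<delta>>0. \<forall>u\<in>H1. nsq u = 1 \<longrightarrow> kin u = 1 \<longrightarrow> c \<le> quartic u \<longrightarrow> (\<exists>x. \<kappa> < norm (corr (moll \<delta>) u x))"
proof -
  obtain C where C: "C \<ge> 0" "\<forall>u\<in>H1. integrable lebesgue (\<lambda>x. norm (u x) ^ (2 * Suc 2)) \<and>
     (\<integral>x. norm (u x) ^ (2 * Suc 2) \<partial>lebesgue) \<le> C * nsq u * kin u ^ 2"
    using gagliardo_nirenberg_power[of 2] by blast
  \<comment> \<open>The three constants give one quarter of \<open>c\<close> to each region:
    \<kappa> where \<open>u\<close> is close to its average, \<open>M\<close> where \<open>u\<close>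
    is large, by means of the sixth power, and \<delta> on the remaining set, whose size is
    controlled by the mollification error. Together this stays below \<open>c\<close>.\<close>
  define \<kappa> where "\<kappa> = sqrt (c / 16)"
  define M where "M = sqrt (4 * (C + 1) / c)"
  define \<delta> where "\<delta> = sqrt (c * \<kappa>^2 / (128 * M^4))"
  have \<kappa>: "\<kappa> > 0" "4 * \<kappa>^2 = c / 4" using c by (auto simp: \<kappa>_def)
  have M: "M > 0" "C / M^2 \<le> c / 4" using c C(1) by (auto simp: M_def field_simps)
  have \<delta>: "\<delta> > 0" "32 * \<delta>^2 * (M^4 / \<kappa>^2) = c / 4"
  proof -
    have p: "0 < c * \<kappa>^2 / (128 * M^4)" using c \<kappa> M by simp
    then show "\<delta> > 0" by (simp add: \<delta>_def)
    have "\<delta>^2 = c * \<kappa>^2 / (128 * M^4)" using p by (simp add: \<delta>_def)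
    then show "32 * \<delta>^2 * (M^4 / \<kappa>^2) = c / 4" using \<kappa> M by (simp add: field_simps)
  qed
  have "\<exists>x. \<kappa> < norm (corr (moll \<delta>) u x)" if u: "u \<in> H1" "nsq u = 1" "kin u = 1" "c \<le> quartic u" for u
  proof (rule ccontr)
    assume "\<not> (\<exists>x. \<kappa> < norm (corr (moll \<delta>) u x))"
    then have U: "norm (corr (moll \<delta>) u x) \<le> \<kappa>" for x by (simp add: not_less)
    note H = H1_weak_gradient[OF u(1)]
    let ?e = "\<lambda>x. corr (moll \<delta>) u x - u x"
    have e2: "?e \<in> Lp 2" by (intro L2_diff corr_L2 moll \<delta> H)
    have en: "nsq ?e \<le> 32 * \<delta>^2" using corr_moll_close[OF \<delta>(1) H] u(3) by simp
    have six: "integrable lebesgue (\<lambda>x. norm (u x) ^ 6)" "(\<integral>x. norm (u x) ^ 6 \<partial>lebesgue) \<le> C"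
      using C(2) u by (auto simp: numeral_eq_Suc)
    let ?b = "\<lambda>x. 4 * \<kappa>^2 * (norm (u x))^2 + (1 / M^2) * norm (u x) ^ 6 + (M^4 / \<kappa>^2) * (norm (?e x))^2"
    have pw: "norm (u x) ^ 4 \<le> ?b x" for x
    proof -
      define s where "s = norm (u x)"
      have s0: "0 \<le> s" by (simp add: s_def)
      have s4: "s^4 = s^2 * s^2" by (simp add: power_add[symmetric])
      have s6: "s^6 = s^4 * s^2" by (simp add: power_add[symmetric])
      have nn: "0 \<le> 4 * \<kappa>^2 * s^2" "0 \<le> (1 / M^2) * s^6" "0 \<le> (M^4 / \<kappa>^2) * (norm (?e x))^2"
        using s0 by auto
      show ?thesis
      proof (cases "norm (?e x) \<le> \<kappa>")
        case True
        have "s \<le> 2 * \<kappa>" using U[of x] True norm_triangle_ineq4[of "corr (moll \<delta>) u x" "?e x"] by (simp add: s_def)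
        then have "s^2 \<le> 4 * \<kappa>^2" using power_mono[of s "2 * \<kappa>" 2] s0 by simp
        then have "s^4 \<le> 4 * \<kappa>^2 * s^2" unfolding s4 by (intro mult_right_mono) auto
        then show ?thesis using nn unfolding s_def by linarith
      next
        case False
        then have "\<kappa>^2 \<le> (norm (?e x))^2" using \<kappa> by (intro power_mono) auto
        then have one: "1 \<le> (norm (?e x))^2 / \<kappa>^2" using \<kappa> by simp
        show ?thesis
        proof (cases "s \<le> M")
          case True
          then have "s^4 \<le> M^4" using s0 by (intro power_mono) auto
          also have "M^4 * 1 \<le> M^4 * ((norm (?e x))^2 / \<kappa>^2)" using one by (intro mult_left_mono) auto
          finally have "s^4 \<le> (M^4 / \<kappa>^2) * (norm (?e x))^2" by simp
          then show ?thesis using nn unfolding s_def by linarith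
        next
          case False
          then have "M^2 \<le> s^2" using M by (intro power_mono) auto
          then have "s^4 * M^2 \<le> s^6" unfolding s6 by (intro mult_left_mono) auto
          then have "s^4 \<le> (1 / M^2) * s^6" using M by (simp add: field_simps)
          then show ?thesis using nn unfolding s_def by linarith
        qed
      qed
    qed
    have bi: "integrable lebesgue ?b" using L2_int[OF H(1)] L2_int[OF e2] six(1) by simp
    have "quartic u \<le> (\<integral>x. ?b x \<partial>lebesgue)" by (intro integral_mono quartic_integrable u bi pw)
    also have "\<dots> = 4 * \<kappa>^2 * nsq u + (1 / M^2) * (\<integral>x. norm (u x) ^ 6 \<partial>lebesgue) + (M^4 / \<kappa>^2) * nsq ?e"
      using L2_int[OF H(1)] L2_int[OF e2] six(1) by (simp add: nsq_def)
    also have "\<dots> \<le> c / 4 + C / M^2 + 32 * \<delta>^2 * (M^4 / \<kappa>^2)"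
    proof -
      have "(1 / M^2) * (\<integral>x. norm (u x) ^ 6 \<partial>lebesgue) \<le> (1 / M^2) * C" using six(2) by (intro mult_left_mono) auto
      moreover have "(M^4 / \<kappa>^2) * nsq ?e \<le> (M^4 / \<kappa>^2) * (32 * \<delta>^2)" using en by (intro mult_left_mono) auto
      ultimately show ?thesis using \<kappa>(2) u(2) by (simp add: mult.commute)
    qed
    also have "\<dots> < c" using M(2) \<delta>(2) c by linarith
    finally show False using u(4) by simp
  qed
  then show ?thesis using \<kappa>(1) \<delta>(1) by blast
qed

text \<open>Near optimizers can escape by dilation or by translation. The first is fixed by the
  normalization \<open>kin = 1\<close>, the second by translating to a point supplied by
  \<open>nonvanishing\<close>. What prevents a splitting into two pieces is the product structure of
  \<open>nsq v * kin v\<close>.\<close>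

theorem gn_optimizer: "\<exists>Q\<in>H1. nsq Q = 1 \<and> kin Q = 1 \<and> gn_const / 2 * quartic Q = 1"
proof -
  define \<delta> where "\<delta> n = 1 / real (Suc n)" for n
  have \<delta>0: "\<delta> n > 0" for n by (simp add: \<delta>_def)
  have \<delta>lim: "\<delta> \<longlonglongrightarrow> 0" unfolding \<delta>_def[abs_def] using LIMSEQ_inverse_real_of_nat by (simp add: inverse_eq_divide)
  have "\<exists>w\<in>H1. nsq w = 1 \<and> kin w = 1 \<and> 2 / (gn_const + \<delta> n) \<le> quartic w" for n
  proof -
    obtain u where u: "u \<in> H1_sphere" "kin u < (gn_const + \<delta> n) * (1/2 * quartic u)"
      using gn_near_optimal[OF \<delta>0] by blast
    have uH: "u \<in> H1" "nsq u = 1" using u(1) by (auto simp: H1_sphere_iff)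
    have "quartic u \<noteq> 0" using quartic_eq_0[OF uH(1)] uH(2) by auto
    then have "quartic u > 0" using quartic_nonneg[of u] by (simp add: less_le)
    then have "0 < gn_const / 2 * quartic u" using gn_const_pos by simp
    also have "\<dots> \<le> kin u" using gagliardo_nirenberg[OF uH(1)] uH(2) by simp
    finally have kp: "kin u > 0" .
    \<comment> \<open>The dilation that normalizes the kinetic energy to 1; the mass stays
      1.\<close>
    have l: "1 / sqrt (kin u) > 0" "(1 / sqrt (kin u))^2 = 1 / kin u" using kp by (auto simp: power_divide)
    note w = H1_rescale[OF uH(1) l(1), of 0]
    have "2 / (gn_const + \<delta> n) \<le> (1 / kin u) * quartic u"
      using u(2) kp gn_const_pos \<delta>0[of n] by (simp add: field_simps)
    then show ?thesis using w l(2) uH(2) kp by (intro bexI[OF _ w(1)]) simp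
  qed
  then obtain w where w: "\<And>n. w n \<in> H1" "\<And>n. nsq (w n) = 1" "\<And>n. kin (w n) = 1" "\<And>n. 2 / (gn_const + \<delta> n) \<le> quartic (w n)"
    by metis
  define c where "c = 2 / (gn_const + 1)"
  have c: "c > 0" using gn_const_pos by (simp add: c_def)
  have wc: "c \<le> quartic (w n)" for n
  proof -
    have "\<delta> n \<le> 1" by (simp add: \<delta>_def field_simps)
    then have "c \<le> 2 / (gn_const + \<delta> n)" unfolding c_def using gn_const_pos \<delta>0[of n] by (intro divide_left_mono) auto
    then show ?thesis using w(4)[of n] by linarith
  qed
  obtain \<kappa> \<epsilon> where \<kappa>: "\<kappa> > 0" and \<epsilon>: "\<epsilon> > 0"
    and nv: "\<forall>u\<in>H1. nsq u = 1 \<longrightarrow> kin u = 1 \<longrightarrow> c \<le> quartic u \<longrightarrow> (\<exists>x. \<kappa> < norm (corr (moll \<epsilon>) u x))"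
    using nonvanishing[OF c] by blast
  have "\<exists>x. \<kappa> < norm (corr (moll \<epsilon>) (w n) x)" for n using nv w wc by blast
  then obtain z where z: "\<And>n. \<kappa> < norm (corr (moll \<epsilon>) (w n) (z n))" by metis
  define u where "u n = (\<lambda>x. w n (x + z n))" for n
  have u: "u n \<in> H1" "nsq (u n) = 1" "kin (u n) = 1" "2 / (gn_const + \<delta> n) \<le> quartic (u n)" for n
    unfolding u_def using H1_translate[OF w(1), of n "z n"] w(2-4)[of n] by auto
  have uc: "\<kappa> < norm (\<integral>x. moll \<epsilon> x *\<^sub>R u n x \<partial>lebesgue)" for n
    using z[of n] corr_translate[OF locally_integrable_L2[OF H1_L2[OF w(1)]] test_moll[OF \<epsilon>], of n "z n"] by (simp add: u_def)
  obtain r v where r: "strict_mono r" and vH: "v \<in> H1" and loc: "\<forall>R. (\<lambda>n. loc_nsq R (\<lambda>x. u (r n) x - v x)) \<longlonglongrightarrow> 0"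
    and l1: "(\<lambda>n. nsq (u (r n)) - nsq (\<lambda>x. u (r n) x - v x)) \<longlonglongrightarrow> nsq v"
    and l2: "(\<lambda>n. kin (u (r n)) - kin (\<lambda>x. u (r n) x - v x)) \<longlonglongrightarrow> kin v"
    and l3: "(\<lambda>n. quartic (u (r n)) - quartic (\<lambda>x. u (r n) x - v x)) \<longlonglongrightarrow> quartic v"
    using H1_compactness[of u 1] u by auto
  define d where "d n = (\<lambda>x. u (r n) x - v x)" for n
  have dH: "d n \<in> H1" for n unfolding d_def by (rule H1_diff(1)[OF u(1) vH])
  have dn: "(\<lambda>n. nsq (d n)) \<longlonglongrightarrow> 1 - nsq v"
    using tendsto_diff[OF tendsto_const[of 1] l1] by (simp add: u d_def)
  have dk: "(\<lambda>n. kin (d n)) \<longlonglongrightarrow> 1 - kin v"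
    using tendsto_diff[OF tendsto_const[of 1] l2] by (simp add: u d_def)
  have A: "0 \<le> nsq v" "nsq v \<le> 1" and B: "0 \<le> kin v" "kin v \<le> 1"
    using LIMSEQ_le_const[OF dn, of 0] LIMSEQ_le_const[OF dk, of 0] by auto
  \<comment> \<open>Gagliardo-Nirenberg for the remainder, in the limit. The sequence is optimal, so
    the remainder carries the quartic integral that \<open>v\<close> lacks.\<close>
  have key: "1 - gn_const / 2 * quartic v \<le> (1 - nsq v) * (1 - kin v)"
  proof (rule LIMSEQ_le)
    have rl: "(\<lambda>n. \<delta> (r n)) \<longlonglongrightarrow> 0" using LIMSEQ_subseq_LIMSEQ[OF \<delta>lim r] by (simp add: o_def)
    have "(\<lambda>n. gn_const / 2 * (2 / (gn_const + \<delta> (r n)) - (quartic (u (r n)) - quartic (d n)))) \<longlonglongrightarrow>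
        gn_const / 2 * (2 / (gn_const + 0) - quartic v)"
      unfolding d_def using gn_const_pos by (intro tendsto_intros rl l3) auto
    then show "(\<lambda>n. gn_const / 2 * (2 / (gn_const + \<delta> (r n)) - (quartic (u (r n)) - quartic (d n)))) \<longlonglongrightarrow> 1 - gn_const / 2 * quartic v"
      using gn_const_pos by (simp add: right_diff_distrib)
    show "(\<lambda>n. nsq (d n) * kin (d n)) \<longlonglongrightarrow> (1 - nsq v) * (1 - kin v)" by (intro tendsto_intros dn dk)
    have "gn_const / 2 * (2 / (gn_const + \<delta> (r n)) - (quartic (u (r n)) - quartic (d n))) \<le> nsq (d n) * kin (d n)" for n
    proof -
      have "gn_const / 2 * (2 / (gn_const + \<delta> (r n)) - (quartic (u (r n)) - quartic (d n))) \<le> gn_const / 2 * quartic (d n)"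
        using u(4)[of "r n"] gn_const_pos by (intro mult_left_mono) auto
      then show ?thesis using gagliardo_nirenberg[OF dH[of n]] by linarith
    qed
    then show "\<exists>N. \<forall>n\<ge>N. gn_const / 2 * (2 / (gn_const + \<delta> (r n)) - (quartic (u (r n)) - quartic (d n))) \<le> nsq (d n) * kin (d n)" by blast
  qed
  have gv: "gn_const / 2 * quartic v \<le> nsq v * kin v" by (rule gagliardo_nirenberg[OF vH])
  have v0: "nsq v \<noteq> 0"
  proof
    assume "nsq v = 0"
    then have v0: "AE x in lebesgue. v x = 0" by (rule nsq_0_imp(1)[OF vH])
    have \<rho>: "moll \<epsilon> \<in> test_functions" by (rule test_moll[OF \<epsilon>])
    have vl: "locally_integrable v" by (rule locally_integrable_L2[OF H1_L2[OF vH]])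
    have "(\<integral>x. moll \<epsilon> x *\<^sub>R v x \<partial>lebesgue) = (\<integral>x. 0 \<partial>(lebesgue :: plane measure))"
      using v0 L2_meas[OF H1_L2[OF vH]] test_meas[OF \<rho>] by (intro integral_cong_AE) auto
    moreover have "(\<integral>x. moll \<epsilon> x *\<^sub>R d n x \<partial>lebesgue) = (\<integral>x. moll \<epsilon> x *\<^sub>R u (r n) x \<partial>lebesgue) - (\<integral>x. moll \<epsilon> x *\<^sub>R v x \<partial>lebesgue)" for n
      using test_scaleR_integrable[OF locally_integrable_L2[OF H1_L2[OF u(1)[of "r n"]]] \<rho>] test_scaleR_integrable[OF vl \<rho>]
      by (simp add: d_def scaleR_diff_right)
    moreover have "(\<lambda>n. \<integral>x. moll \<epsilon> x *\<^sub>R d n x \<partial>lebesgue) \<longlonglongrightarrow> 0"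
      by (rule test_integral_tendsto_loc[OF \<rho> H1_L2[OF dH]]) (use loc in \<open>simp add: d_def\<close>)
    ultimately have "(\<lambda>n. \<integral>x. moll \<epsilon> x *\<^sub>R u (r n) x \<partial>lebesgue) \<longlonglongrightarrow> 0" by simp
    then have "(\<lambda>n. norm (\<integral>x. moll \<epsilon> x *\<^sub>R u (r n) x \<partial>lebesgue)) \<longlonglongrightarrow> 0" by (rule tendsto_norm_zero)
    then have "\<kappa> \<le> 0" by (rule LIMSEQ_le_const) (use uc in \<open>auto intro: less_imp_le\<close>)
    then show False using \<kappa> by simp
  qed
  \<comment> \<open>With mass \<open>A\<close> and kinetic energy \<open>B\<close> of the limit,
    both in the unit interval, this says that \<open>A + B\<close> is at most
    \<open>2 * A * B\<close>. Since \<open>A * B\<close> is at most \<open>A\<close> and at most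
    \<open>B\<close>, all three coincide, and a nonzero limit has \<open>A = B = 1\<close>.\<close>
  have "1 \<le> nsq v * kin v + (1 - nsq v) * (1 - kin v)" using key gv by linarith
  then have s: "nsq v + kin v \<le> 2 * (nsq v * kin v)" by (simp add: algebra_simps)
  have p1: "nsq v * kin v \<le> nsq v * 1" using A B by (intro mult_left_mono) auto
  have p2: "nsq v * kin v \<le> 1 * kin v" using A B by (intro mult_right_mono) auto
  have "nsq v * kin v = nsq v" "nsq v * kin v = kin v" using s p1 p2 by linarith+
  then have k1: "kin v = 1" and n1: "nsq v = 1" using v0 by auto
  then have "gn_const / 2 * quartic v = 1" using key gv by simp
  with vH k1 n1 show ?thesis by blast
qed

section \<open>Localization of an optimizer\<close>

lemma D_k_sin_cos: "D_k k sin \<and> D_k k cos"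
proof (induction k)
  case 0
  then show ?case by (auto intro!: continuous_intros)
next
  case (Suc k)
  have "D_k k (\<lambda>x. (-1) * sin x)" by (intro D_k_mult D_k_const Suc[THEN conjunct1])
  then have "D_k (Suc k) cos" by (auto intro!: exI[of _ "\<lambda>x. - sin x"] derivative_eq_intros)
  moreover have "D_k (Suc k) sin" using Suc by (auto intro!: exI[of _ cos] derivative_eq_intros)
  ultimately show ?case by blast
qed

lemma pd_chain:
  assumes "\<And>t. (h has_real_derivative h' t) (at t)" "smooth f"
  shows "pd i (\<lambda>x. h (f x)) x = h' (f x) * pd i f x"
proof -
  have "((\<lambda>x. h (f x)) has_derivative (\<lambda>v. h' (f x) * frechet_derivative f (at x) v)) (at x)"
    using has_derivative_compose[OF smooth_has_derivative[OF assms(2)], of h "times (h' (f x))"] assms(1)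
    by (simp add: has_field_derivative_def)
  from pd_eqI[OF this] show ?thesis by (simp add: pd_def)
qed

lemma cutoff_pd_0: assumes "r > 0" "norm x < r" shows "pd i (cutoff r 0) x = 0"
proof -
  have "(cutoff r 0 has_derivative (\<lambda>v. 0)) (at x)"
    by (rule has_derivative_transform_within_open[of "\<lambda>x. 1" _ _ _ "ball 0 r"])
      (use assms in \<open>auto simp: cutoff_1\<close>)
  then show ?thesis by (simp add: pd_eqI)
qed

lemma smooth_multiplier_H1:
  assumes u: "u \<in> H1" and c: "smooth c" "\<And>x. \<bar>c x\<bar> \<le> C" "\<And>i x. \<bar>pd i c x\<bar> \<le> C"
  shows "(\<lambda>x. c x *\<^sub>R u x) \<in> H1"
    "kin (\<lambda>x. c x *\<^sub>R u x) = (\<integral>x. (norm (c x *\<^sub>R (weak_gradient u x $ 1) + pd 1 c x *\<^sub>R u x))^2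
        + (norm (c x *\<^sub>R (weak_gradient u x $ 2) + pd 2 c x *\<^sub>R u x))^2 \<partial>lebesgue)"
    "(\<lambda>x. c x *\<^sub>R (weak_gradient u x $ i) + pd i c x *\<^sub>R u x) \<in> Lp 2"
proof -
  note U = H1_weak_gradient[OF u]
  have cm: "c \<in> borel_measurable lebesgue" "pd i c \<in> borel_measurable lebesgue" for i
    by (intro continuous_measurable_lebesgue smooth_continuous smooth_pd c)+
  have g: "(\<lambda>x. c x *\<^sub>R (weak_gradient u x $ i) + pd i c x *\<^sub>R u x) \<in> Lp 2" for i
    by (intro L2_add L2_mult_bounded(1)[OF L2_nth(1)[OF U(2)] cm(1) c(2)] L2_mult_bounded(1)[OF U(1) cm(2) c(3)])
  let ?G = "\<lambda>x. c x *\<^sub>R weak_gradient u x + (\<chi> i. pd i c x *\<^sub>R u x)"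
  have G: "?G \<in> Lp 2"
  proof (rule L2_I)
    show "?G \<in> borel_measurable lebesgue"
      using cm L2_meas[OF U(1)] L2_meas[OF U(2)]
      by (intro borel_measurable_add borel_measurable_scaleR borel_measurable_vec_lambda) auto
    show "integrable lebesgue (\<lambda>x. (norm (?G x))^2)"
      using L2_int[OF g[of 1]] L2_int[OF g[of 2]] by (simp add: norm_vec2_sq)
  qed
  have wg: "has_weak_gradient (\<lambda>x. c x *\<^sub>R u x) ?G" by (rule has_weak_gradient_mult_smooth[OF U(3) c])
  show "(\<lambda>x. c x *\<^sub>R u x) \<in> H1" by (rule H1_I[OF L2_mult_bounded(1)[OF U(1) cm(1) c(2)] G wg])
  show "kin (\<lambda>x. c x *\<^sub>R u x) = (\<integral>x. (norm (c x *\<^sub>R (weak_gradient u x $ 1) + pd 1 c x *\<^sub>R u x))^2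
        + (norm (c x *\<^sub>R (weak_gradient u x $ 2) + pd 2 c x *\<^sub>R u x))^2 \<partial>lebesgue)"
    unfolding kin_eq[OF G wg] by (simp add: nsq_def norm_vec2_sq)
  show "(\<lambda>x. c x *\<^sub>R (weak_gradient u x $ i) + pd i c x *\<^sub>R u x) \<in> Lp 2" by (rule g)
qed

text \<open>The angle \<open>R\<close>, with \<open>cos\<close> and \<open>sin\<close> of it forming a quadratic partition of unity. In polar form the
  IMS localization formula is the invariance of the norm under rotations.\<close>

definition ims_angle :: "real \<Rightarrow> plane \<Rightarrow> real" where
  "ims_angle r x = pi / 2 * (1 - cutoff r 0 x)"

lemma smooth_ims_angle: "smooth (ims_angle r)"
  unfolding ims_angle_def[abs_def] by (intro smooth_mult smooth_const smooth_diff smooth_cutoff)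

lemma pd_ims_angle: "pd i (ims_angle r) x = - (pi / 2) * pd i (cutoff r 0) x"
proof -
  have "((\<lambda>t. pi / 2 * (1 - t)) has_real_derivative - (pi / 2)) (at t)" for t
    by (auto intro!: derivative_eq_intros)
  from pd_chain[OF this smooth_cutoff] show ?thesis by (simp add: ims_angle_def[abs_def])
qed

text \<open>Here \<open>a\<close> is a partial derivative of \<open>u\<close>, \<open>b\<close> is
  \<open>u\<close> itself and \<open>t\<close> the derivative of the angle. The cross terms of the
  two localized derivatives cancel, so the error is quadratic in \<open>t\<close>.\<close>

lemma rotation_norm:
  fixes a b :: complex
  assumes "c^2 + s^2 = 1"
  shows "(norm (c *\<^sub>R a + (- s * t) *\<^sub>R b))^2 + (norm (s *\<^sub>R a + (c * t) *\<^sub>R b))^2 = (norm a)^2 + t^2 * (norm b)^2"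
proof -
  have "(norm (c *\<^sub>R a + (- s * t) *\<^sub>R b))^2 + (norm (s *\<^sub>R a + (c * t) *\<^sub>R b))^2
      = (c^2 + s^2) * (norm a)^2 + (c^2 + s^2) * (t^2 * (norm b)^2)"
    unfolding cmod_power2 by (simp add: power2_eq_square algebra_simps)
  then show ?thesis using assms by simp
qed

text \<open>The angle is constant inside the ball and its gradient is of order \<open>1 / r\<close>.
  The error therefore carries, besides \<open>1 / r^2\<close>, the mass of \<open>u\<close> outside
  the ball; for a fixed function this additional factor tends to 0 as \<open>r\<close>
  grows.\<close>

lemma ims_localization:
  "\<exists>C\<ge>0. \<forall>u\<in>H1. \<forall>r\<ge>1.
    (\<lambda>x. cos (ims_angle r x) *\<^sub>R u x) \<in> H1 \<and> (\<lambda>x. sin (ims_angle r x) *\<^sub>R u x) \<in> H1 \<and>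
    kin (\<lambda>x. cos (ims_angle r x) *\<^sub>R u x) + kin (\<lambda>x. sin (ims_angle r x) *\<^sub>R u x) \<le>
      kin u + C / r^2 * (\<integral>x. (1 - indicator (ball 0 r) x) * (norm (u x))^2 \<partial>lebesgue)"
proof -
  obtain K where K: "K > 0" "\<forall>r>0. \<forall>a i x. \<bar>pd i (cutoff r a) x\<bar> \<le> K / r" using cutoff_pd_bound by blast
  \<comment> \<open>The factor 2 accounts for the two coordinates, and \<open>pi / 2\<close> is the
    range of the angle.\<close>
  define C where "C = 2 * (pi / 2 * K)^2"
  have "(\<lambda>x. cos (ims_angle r x) *\<^sub>R u x) \<in> H1 \<and> (\<lambda>x. sin (ims_angle r x) *\<^sub>R u x) \<in> H1 \<and>
    kin (\<lambda>x. cos (ims_angle r x) *\<^sub>R u x) + kin (\<lambda>x. sin (ims_angle r x) *\<^sub>R u x) \<le>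
      kin u + C / r^2 * (\<integral>x. (1 - indicator (ball 0 r) x) * (norm (u x))^2 \<partial>lebesgue)" if u: "u \<in> H1" and r: "r \<ge> 1" for u r
  proof -
    let ?\<theta> = "ims_angle r"
    note U = H1_weak_gradient[OF u]
    have sm: "smooth (\<lambda>x. cos (?\<theta> x))" "smooth (\<lambda>x. sin (?\<theta> x))"
      using D_k_sin_cos smooth_ims_angle by (auto intro: smooth_D_k)
    have pdc: "pd i (\<lambda>x. cos (?\<theta> x)) x = - sin (?\<theta> x) * pd i ?\<theta> x" "pd i (\<lambda>x. sin (?\<theta> x)) x = cos (?\<theta> x) * pd i ?\<theta> x" for i x
      using pd_chain[of cos "\<lambda>t. - sin t" ?\<theta> i x] pd_chain[of sin cos ?\<theta> i x] smooth_ims_angle DERIV_cos DERIV_sin by auto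
    have tb: "\<bar>pd i ?\<theta> x\<bar> \<le> pi / 2 * K / r" for i x
    proof -
      have "\<bar>pd i ?\<theta> x\<bar> = pi / 2 * \<bar>pd i (cutoff r 0) x\<bar>" by (simp add: pd_ims_angle abs_mult)
      also have "\<dots> \<le> pi / 2 * (K / r)" using K(2) r by (intro mult_left_mono) auto
      finally show ?thesis by simp
    qed
    have tb1: "pi / 2 * K / r \<le> pi / 2 * K"
    proof -
      have "0 \<le> pi / 2 * K" using K(1) by simp
      then have "pi / 2 * K / r \<le> pi / 2 * K / 1" using r by (intro divide_left_mono) auto
      then show ?thesis by simp
    qed
    \<comment> \<open>One bound for both multipliers and their derivatives; \<open>r\<close> being
      at least 1 keeps the derivatives bounded independently of \<open>r\<close>.\<close>
    define B where "B = max 1 (pi / 2 * K)"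
    have le: "\<bar>x * pd i ?\<theta> y\<bar> \<le> B" if "\<bar>x\<bar> \<le> 1" for x i y
    proof -
      have "\<bar>x * pd i ?\<theta> y\<bar> \<le> 1 * \<bar>pd i ?\<theta> y\<bar>" unfolding abs_mult using that by (intro mult_right_mono) auto
      also have "\<dots> \<le> pi / 2 * K" using order_trans[OF tb tb1] by simp
      also have "\<dots> \<le> B" unfolding B_def by (rule max.cobounded2)
      finally show ?thesis .
    qed
    have b: "\<bar>cos (?\<theta> x)\<bar> \<le> B" "\<bar>sin (?\<theta> x)\<bar> \<le> B" "\<bar>pd i (\<lambda>x. cos (?\<theta> x)) x\<bar> \<le> B" "\<bar>pd i (\<lambda>x. sin (?\<theta> x)) x\<bar> \<le> B" for i x
      using le[of "- sin (?\<theta> x)" i x] le[of "cos (?\<theta> x)" i x] abs_cos_le_one[of "?\<theta> x"] abs_sin_le_one[of "?\<theta> x"]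
      by (auto simp: pdc B_def intro: order_trans[OF abs_cos_le_one] order_trans[OF abs_sin_le_one])
    note c = smooth_multiplier_H1[OF u sm(1) b(1) b(3)] and s = smooth_multiplier_H1[OF u sm(2) b(2) b(4)]
    let ?g = "weak_gradient u"
    have rot: "(norm (cos (?\<theta> x) *\<^sub>R (?g x $ i) + pd i (\<lambda>x. cos (?\<theta> x)) x *\<^sub>R u x))^2 +
        (norm (sin (?\<theta> x) *\<^sub>R (?g x $ i) + pd i (\<lambda>x. sin (?\<theta> x)) x *\<^sub>R u x))^2 = (norm (?g x $ i))^2 + (pd i ?\<theta> x)^2 * (norm (u x))^2" for i x
      unfolding pdc by (rule rotation_norm) simp
    let ?t = "\<lambda>x. (1 - indicator (ball 0 r) x) * (norm (u x))^2"
    have ti: "integrable lebesgue ?t"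
    proof (rule Bochner_Integration.integrable_bound[OF L2_int[OF U(1)]])
      have "ball (0::plane) r \<in> sets lebesgue" by (simp add: fmeasurableD)
      then show "?t \<in> borel_measurable lebesgue" using L2_meas[OF U(1)] by measurable
    qed (auto simp: indicator_def)
    have ci: "integrable lebesgue (\<lambda>x. (norm (cos (?\<theta> x) *\<^sub>R (?g x $ i) + pd i (\<lambda>x. cos (?\<theta> x)) x *\<^sub>R u x))^2)" for i
      by (rule L2_int[OF c(3)])
    have si: "integrable lebesgue (\<lambda>x. (norm (sin (?\<theta> x) *\<^sub>R (?g x $ i) + pd i (\<lambda>x. sin (?\<theta> x)) x *\<^sub>R u x))^2)" for i
      by (rule L2_int[OF s(3)])
    have "kin (\<lambda>x. cos (?\<theta> x) *\<^sub>R u x) + kin (\<lambda>x. sin (?\<theta> x) *\<^sub>R u x) =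
       (\<integral>x. ((norm (cos (?\<theta> x) *\<^sub>R (?g x $ 1) + pd 1 (\<lambda>x. cos (?\<theta> x)) x *\<^sub>R u x))^2 +
        (norm (sin (?\<theta> x) *\<^sub>R (?g x $ 1) + pd 1 (\<lambda>x. sin (?\<theta> x)) x *\<^sub>R u x))^2) +
        ((norm (cos (?\<theta> x) *\<^sub>R (?g x $ 2) + pd 2 (\<lambda>x. cos (?\<theta> x)) x *\<^sub>R u x))^2 +
        (norm (sin (?\<theta> x) *\<^sub>R (?g x $ 2) + pd 2 (\<lambda>x. sin (?\<theta> x)) x *\<^sub>R u x))^2) \<partial>lebesgue)"
      unfolding c(2) s(2) using ci si by simp
    also have "\<dots> \<le> (\<integral>x. (norm (?g x))^2 + C / r^2 * ?t x \<partial>lebesgue)"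
    proof (rule integral_mono)
      show "integrable lebesgue (\<lambda>x. (norm (?g x))^2 + C / r^2 * ?t x)" using L2_int[OF U(2)] ti by simp
      fix x
      have sq: "(pd i ?\<theta> x)^2 * (norm (u x))^2 \<le> C / r^2 / 2 * ?t x" for i
      proof (cases "norm x < r")
        case True
        then show ?thesis using cutoff_pd_0[of r x i] r by (simp add: pd_ims_angle)
      next
        case False
        have "(pd i ?\<theta> x)^2 \<le> (pi / 2 * K / r)^2" using power_mono[OF tb[of i x], of 2] by simp
        also have "\<dots> = C / r^2 / 2" by (simp add: C_def power_divide)
        finally have "(pd i ?\<theta> x)^2 * (norm (u x))^2 \<le> C / r^2 / 2 * (norm (u x))^2" by (rule mult_right_mono) simp
        then show ?thesis using False by simp
      qed
      show "((norm (cos (?\<theta> x) *\<^sub>R (?g x $ 1) + pd 1 (\<lambda>x. cos (?\<theta> x)) x *\<^sub>R u x))^2 +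
        (norm (sin (?\<theta> x) *\<^sub>R (?g x $ 1) + pd 1 (\<lambda>x. sin (?\<theta> x)) x *\<^sub>R u x))^2) +
        ((norm (cos (?\<theta> x) *\<^sub>R (?g x $ 2) + pd 2 (\<lambda>x. cos (?\<theta> x)) x *\<^sub>R u x))^2 +
        (norm (sin (?\<theta> x) *\<^sub>R (?g x $ 2) + pd 2 (\<lambda>x. sin (?\<theta> x)) x *\<^sub>R u x))^2) \<le> (norm (?g x))^2 + C / r^2 * ?t x"
        unfolding rot norm_vec2_sq using sq[of 1] sq[of 2] by linarith
    qed (use ci si in simp)
    also have "\<dots> = kin u + C / r^2 * (\<integral>x. ?t x \<partial>lebesgue)" using L2_int[OF U(2)] ti by (simp add: nsq_def)
    finally show ?thesis using c(1) s(1) by blast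
  qed
  then show ?thesis by (intro exI[of _ C]) (auto simp: C_def)
qed

lemma tail_tendsto_0:
  fixes f :: "plane \<Rightarrow> real"
  assumes "integrable lebesgue f"
  shows "(\<lambda>n. \<integral>x. (1 - indicator (ball 0 (real (Suc n))) x) * f x \<partial>lebesgue) \<longlonglongrightarrow> 0"
proof (rule integral_vanishing_weight[OF assms])
  show "(\<lambda>x. 1 - indicator (ball 0 (real (Suc n))) x :: real) \<in> borel_measurable (lebesgue :: plane measure)" for n
    by (intro borel_measurable_diff borel_measurable_const borel_measurable_indicator) (simp add: fmeasurableD)
  show "(\<lambda>n. 1 - indicator (ball 0 (real (Suc n))) x :: real) \<longlonglongrightarrow> 0" for x :: plane
  proof -
    obtain N where "norm x \<le> real N" using real_arch_simple by blast
    then have "1 - indicator (ball 0 (real (Suc n))) x = (0::real)" if "n \<ge> N" for n using that by simp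
    then show ?thesis by (intro tendsto_eventually) (auto simp: eventually_sequentially)
  qed
qed (auto simp: indicator_def)

text \<open>Cutting off an optimizer at radius \<open>r\<close>: the terms of first order in the cut-off mass have a good sign,
  so the Gagliardo--Nirenberg deficit is only \<open>o(r\<^sup>-\<^sup>2)\<close> and remains small after rescaling to a fixed ball.\<close>

lemma localized_optimizer:
  assumes \<epsilon>: "\<epsilon> > 0"
  shows "\<exists>r\<ge>1. \<exists>w\<in>H1. (\<forall>x. norm x \<ge> 2 * r \<longrightarrow> w x = 0) \<and> 1/2 \<le> nsq w \<and>
    r^2 * (nsq w * kin w - gn_const / 2 * quartic w) < \<epsilon>"
proof -
  obtain Q where Q: "Q \<in> H1" "nsq Q = 1" "kin Q = 1" "gn_const / 2 * quartic Q = 1" using gn_optimizer by blast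
  obtain C where C: "C \<ge> 0" "\<forall>u\<in>H1. \<forall>r\<ge>1.
    (\<lambda>x. cos (ims_angle r x) *\<^sub>R u x) \<in> H1 \<and> (\<lambda>x. sin (ims_angle r x) *\<^sub>R u x) \<in> H1 \<and>
    kin (\<lambda>x. cos (ims_angle r x) *\<^sub>R u x) + kin (\<lambda>x. sin (ims_angle r x) *\<^sub>R u x) \<le>
      kin u + C / r^2 * (\<integral>x. (1 - indicator (ball 0 r) x) * (norm (u x))^2 \<partial>lebesgue)"
    using ims_localization by blast
  define T where "T n = (\<integral>x. (1 - indicator (ball 0 (real (Suc n))) x) * (norm (Q x))^2 \<partial>lebesgue)" for n
  define S where "S n = (\<integral>x. (1 - indicator (ball 0 (real (Suc n))) x) * norm (Q x) ^ 4 \<partial>lebesgue)" for n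
  have T: "T \<longlonglongrightarrow> 0" unfolding T_def[abs_def] by (rule tail_tendsto_0[OF L2_int[OF H1_L2[OF Q(1)]]])
  have S: "S \<longlonglongrightarrow> 0" unfolding S_def[abs_def] by (rule tail_tendsto_0[OF quartic_integrable[OF Q(1)]])
  have gn: "gn_const > 0" by (rule gn_const_pos)
  \<comment> \<open>Three demands on the radius: a small tail of the fourth power, for the mixed
    quartic term; a tail mass below \<open>1/8\<close>, so that the inner piece keeps most of the
    mass; and an IMS error, multiplied by \<open>r^2\<close>, below \<epsilon>.\<close>
  have "(\<lambda>n. gn_const * sqrt (2 / gn_const) * sqrt (S n)) \<longlonglongrightarrow> gn_const * sqrt (2 / gn_const) * sqrt 0"
    by (intro tendsto_intros S)
  then have ev1: "\<forall>\<^sub>F n in sequentially. gn_const * sqrt (2 / gn_const) * sqrt (S n) < 1/2" by (rule order_tendstoD) simp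
  have ev2: "\<forall>\<^sub>F n in sequentially. T n < 1/8" by (rule order_tendstoD[OF T]) simp
  have "(\<lambda>n. C * T n) \<longlonglongrightarrow> C * 0" by (intro tendsto_intros T)
  then have ev3: "\<forall>\<^sub>F n in sequentially. C * T n < \<epsilon>" by (rule order_tendstoD) (use \<epsilon> in simp)
  obtain n where n: "gn_const * sqrt (2 / gn_const) * sqrt (S n) < 1/2" "T n < 1/8" "C * T n < \<epsilon>"
    using eventually_happens'[OF sequentially_bot eventually_conj[OF ev1 eventually_conj[OF ev2 ev3]]] by blast
  define r where "r = real (Suc n)"
  have r: "r \<ge> 1" by (simp add: r_def)
  define c where "c x = cos (ims_angle r x)" for x
  define s where "s x = sin (ims_angle r x)" for x
  have cs: "(c x)^2 + (s x)^2 = 1" for x by (simp add: c_def s_def)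
  have c1: "\<bar>c x\<bar> \<le> 1" "\<bar>s x\<bar> \<le> 1" for x by (auto simp: c_def s_def)
  have s_in: "s x = 0" if "norm x < r" for x using that cutoff_1[of r x 0] r by (simp add: s_def ims_angle_def)
  have c_out: "c x = 0" if "norm x \<ge> 2 * r" for x using that cutoff_0[of r x 0] r by (simp add: c_def ims_angle_def)
  define w where "w x = c x *\<^sub>R Q x" for x
  define z where "z x = s x *\<^sub>R Q x" for x
  define e where "e = C / r^2 * T n"
  have wH: "w \<in> H1" and zH: "z \<in> H1" and kk: "kin w + kin z \<le> 1 + e"
    using C(2)[rule_format, OF Q(1) r] Q(3) unfolding w_def[abs_def] z_def[abs_def] c_def s_def e_def T_def r_def by auto
  have Qm [measurable]: "Q \<in> borel_measurable lebesgue" by (rule L2_meas[OF H1_L2[OF Q(1)]])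
  have nn: "nsq w + nsq z = 1"
  proof -
    have "nsq w + nsq z = (\<integral>x. (norm (w x))^2 + (norm (z x))^2 \<partial>lebesgue)"
      using L2_int[OF H1_L2[OF wH]] L2_int[OF H1_L2[OF zH]] by (simp add: nsq_def)
    also have "\<dots> = (\<integral>x. (norm (Q x))^2 \<partial>lebesgue)"
      by (rule Bochner_Integration.integral_cong)
        (simp_all add: w_def z_def power_mult_distrib distrib_right[symmetric] cs)
    finally show ?thesis using Q(2) by (simp add: nsq_def)
  qed
  have bsets: "ball (0::plane) (real (Suc n)) \<in> sets lebesgue" by (simp add: fmeasurableD)
  have ti: "integrable lebesgue (\<lambda>x. (1 - indicator (ball 0 (real (Suc n))) x) * f x)" if "integrable lebesgue f" for f :: "plane \<Rightarrow> real"
  proof (rule Bochner_Integration.integrable_bound[OF that])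
    show "(\<lambda>x. (1 - indicator (ball 0 (real (Suc n))) x) * f x) \<in> borel_measurable lebesgue" using bsets that by measurable
  qed (auto simp: indicator_def)
  have zT: "nsq z \<le> T n"
    unfolding nsq_def T_def
  proof (rule integral_mono)
    show "(norm (z x))^2 \<le> (1 - indicator (ball 0 (real (Suc n))) x) * (norm (Q x))^2" for x
    proof (cases "norm x < r")
      case True then show ?thesis using s_in[of x] by (auto simp: z_def indicator_def)
    next
      case False
      have "(s x)^2 \<le> 1" using cs[of x] zero_le_power2[of "c x"] by linarith
      then have "(s x)^2 * (norm (Q x))^2 \<le> 1 * (norm (Q x))^2" by (intro mult_right_mono) auto
      then show ?thesis using False by (simp add: z_def power_mult_distrib r_def)
    qed
  qed (intro L2_int H1_L2 zH ti Q)+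
  define X where "X = (\<integral>x. (norm (w x))^2 * (norm (z x))^2 \<partial>lebesgue)"
  have Xi: "integrable lebesgue (\<lambda>x. (norm (w x))^2 * (norm (z x))^2)"
    using tame_weight_integrable[OF tame_weight_norm_sq[OF wH] zH] by simp
  \<comment> \<open>Pointwise \<open>|Q|^2 = |w|^2 + |z|^2\<close>, so the expansion is exact and
    \<open>X\<close> is the only mixed term.\<close>
  have q: "quartic Q = quartic w + quartic z + 2 * X"
  proof -
    have "norm (Q x) ^ 4 = norm (w x) ^ 4 + norm (z x) ^ 4 + 2 * ((norm (w x))^2 * (norm (z x))^2)" for x
    proof -
      have p4: "t^4 = (t^2)^2" for t :: real by (simp add: power_mult[symmetric])
      have "(norm (Q x))^2 = (norm (w x))^2 + (norm (z x))^2"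
        by (simp add: w_def z_def power_mult_distrib distrib_right[symmetric] cs)
      then show ?thesis unfolding p4 by (simp add: power2_sum)
    qed
    then have "quartic Q = (\<integral>x. norm (w x) ^ 4 + norm (z x) ^ 4 + 2 * ((norm (w x))^2 * (norm (z x))^2) \<partial>lebesgue)" by simp
    then show ?thesis using quartic_integrable[OF wH] quartic_integrable[OF zH] Xi by (simp add: X_def)
  qed
  \<comment> \<open>\<open>z\<close> vanishes inside the ball and \<open>|w|\<close> is at most
    \<open>|Q|\<close>, so the mixed term sees only the tail of \<open>Q\<close>.\<close>
  have XS: "X \<le> sqrt (S n) * sqrt (quartic z)"
  proof -
    let ?f = "\<lambda>x. (1 - indicator (ball 0 (real (Suc n))) x) * (norm (Q x))^2" and ?h = "\<lambda>x. (norm (z x))^2"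
    have f2: "(?f x)^2 = (1 - indicator (ball 0 (real (Suc n))) x) * norm (Q x) ^ 4" for x
      by (auto simp: indicator_def power_mult[symmetric])
    have h2: "(?h x)^2 = norm (z x) ^ 4" for x by (simp add: power_mult[symmetric])
    have fm: "?f \<in> borel_measurable lebesgue" using bsets by measurable
    have hm: "?h \<in> borel_measurable lebesgue" using L2_meas[OF H1_L2[OF zH]] by measurable
    note CS = integral_CS[OF fm hm, unfolded f2 h2, OF ti[OF quartic_integrable[OF Q(1)]] quartic_integrable[OF zH]]
    have "X \<le> (\<integral>x. ?f x * ?h x \<partial>lebesgue)"
      unfolding X_def
    proof (rule integral_mono[OF Xi CS(1)])
      show "(norm (w x))^2 * (norm (z x))^2 \<le> ?f x * ?h x" for x
      proof (cases "norm x < r")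
        case True then show ?thesis using s_in[of x] by (simp add: z_def)
      next
        case False
        have "(c x)^2 \<le> 1" using cs[of x] zero_le_power2[of "s x"] by linarith
        then have "(c x)^2 * (norm (Q x))^2 \<le> 1 * (norm (Q x))^2" by (intro mult_right_mono) auto
        then have "(norm (w x))^2 \<le> ?f x" using False by (simp add: w_def power_mult_distrib r_def)
        then show ?thesis by (intro mult_right_mono) auto
      qed
    qed
    also have "\<dots> \<le> sqrt (S n) * sqrt (quartic z)" using CS(2) unfolding S_def by linarith
    finally show ?thesis .
  qed
  define \<alpha> \<beta> where "\<alpha> = nsq z" and "\<beta> = kin z"
  have ab: "0 \<le> \<alpha>" "0 \<le> \<beta>" "\<alpha> \<le> 1/8" using zT n(2) by (auto simp: \<alpha>_def \<beta>_def)
  have gz: "gn_const / 2 * quartic z \<le> \<alpha> * \<beta>" unfolding \<alpha>_def \<beta>_def by (rule gagliardo_nirenberg[OF zH])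
  have "0 \<le> T n" using zT nsq_nonneg[of z] by linarith
  then have e0: "0 \<le> e" using C(1) by (simp add: e_def)
  \<comment> \<open>Gagliardo-Nirenberg for \<open>z\<close> and the arithmetic-geometric mean
    inequality bound \<open>sqrt (quartic z)\<close> by a multiple of
    \<open>\<alpha> + \<beta>\<close>. The mixed term is thus of first order, but with a coefficient
    that the tail of \<open>Q\<close> makes small.\<close>
  have gX: "gn_const * X \<le> (\<alpha> + \<beta>) / 2"
  proof -
    have "quartic z \<le> 2 / gn_const * (\<alpha> * \<beta>)" using gz gn by (simp add: field_simps)
    then have "sqrt (quartic z) \<le> sqrt (2 / gn_const * (\<alpha> * \<beta>))" by (rule real_sqrt_le_mono)
    also have "\<dots> = sqrt (2 / gn_const) * sqrt (\<alpha> * \<beta>)" by (rule real_sqrt_mult)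
    also have "sqrt (\<alpha> * \<beta>) \<le> (\<alpha> + \<beta>) / 2" using arith_geo_mean_sqrt[OF ab(1,2)] .
    finally have "sqrt (quartic z) \<le> sqrt (2 / gn_const) * ((\<alpha> + \<beta>) / 2)" using gn by (simp add: mult_left_mono)
    then have "sqrt (S n) * sqrt (quartic z) \<le> sqrt (S n) * (sqrt (2 / gn_const) * ((\<alpha> + \<beta>) / 2))"
      by (intro mult_left_mono) (auto simp: S_def intro!: Bochner_Integration.integral_nonneg simp: indicator_def)
    then have "gn_const * X \<le> gn_const * (sqrt (S n) * (sqrt (2 / gn_const) * ((\<alpha> + \<beta>) / 2)))"
      using XS gn by (intro mult_left_mono) auto
    also have "\<dots> = (gn_const * sqrt (2 / gn_const) * sqrt (S n)) * ((\<alpha> + \<beta>) / 2)" by simp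
    also have "\<dots> \<le> (1/2) * ((\<alpha> + \<beta>) / 2)" using n(1) ab by (intro mult_right_mono) auto
    also have "\<dots> \<le> (\<alpha> + \<beta>) / 2" using ab by (simp add: field_simps)
    finally show ?thesis .
  qed
  have kw: "kin w \<le> 1 + e - \<beta>" using kk by (simp add: \<beta>_def)
  have nw: "nsq w = 1 - \<alpha>" using nn by (simp add: \<alpha>_def)
  have "nsq w * kin w \<le> (1 - \<alpha>) * (1 + e - \<beta>)" unfolding nw using kw ab by (intro mult_left_mono) auto
  moreover have "gn_const / 2 * quartic w = 1 - gn_const / 2 * quartic z - gn_const * X"
    using Q(4) unfolding q by (simp add: algebra_simps)
  moreover have "(1 - \<alpha>) * (1 + e - \<beta>) = 1 + e - \<beta> - \<alpha> - \<alpha> * e + \<alpha> * \<beta>" by (simp add: algebra_simps)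
  moreover have "0 \<le> \<alpha> * e" using ab e0 by simp
  moreover have "\<alpha> * \<beta> \<le> (1/8) * \<beta>" using ab by (intro mult_right_mono) auto
  \<comment> \<open>The deficit is at most
    \<open>e - (\<alpha> + \<beta>) / 2 + 2 * \<alpha> * \<beta>\<close>. As \<alpha> is at most
    \<open>1/8\<close>, the last product is at most \<open>\<beta> / 4\<close> and is absorbed by
    the negative term.\<close>
  moreover have "P - W \<le> e" if "P \<le> L" "W = 1 - Z - Y" "L = 1 + e - \<beta> - \<alpha> - p + q" "0 \<le> p" "q \<le> (1/8) * \<beta>"
    "Z \<le> q" "Y \<le> (\<alpha> + \<beta>) / 2" for P L W Z Y p q
    using that ab(1,2) by (simp add: field_simps)
  ultimately have G: "nsq w * kin w - gn_const / 2 * quartic w \<le> e"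
    using gz gX by blast
  have "r^2 * (nsq w * kin w - gn_const / 2 * quartic w) \<le> r^2 * e" using G by (intro mult_left_mono) auto
  also have "\<dots> = C * T n" using r by (simp add: e_def)
  finally have fin: "r^2 * (nsq w * kin w - gn_const / 2 * quartic w) < \<epsilon>" using n(3) by linarith
  have "1/2 \<le> nsq w" using nw ab by linarith
  moreover have "\<forall>x. norm x \<ge> 2 * r \<longrightarrow> w x = 0" using c_out by (simp add: w_def)
  ultimately show ?thesis using r wH fin by blast
qed

text \<open>Shrinking the support from radius \<open>2 * r\<close> to \<rho> multiplies the deficit
  by \<open>(2 * r / \<rho>)^2\<close>; for this reason \<open>localized_optimizer\<close> bounds
  \<open>r^2\<close> times the deficit and not the deficit alone.\<close>

lemma concentrated_near_optimizer:
  assumes \<rho>: "\<rho> > 0" and \<epsilon>: "\<epsilon> > 0"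
  shows "\<exists>u\<in>H1_sphere. (\<forall>x. norm x \<ge> \<rho> \<longrightarrow> u x = 0) \<and> kin u - gn_const / 2 * quartic u < \<epsilon>"
proof -
  \<comment> \<open>One factor 4 comes from the dilation by \<open>2 * r / \<rho>\<close>, the other
    from normalizing a function of mass at least \<open>1/2\<close>.\<close>
  have "\<epsilon> * \<rho>^2 / 16 > 0" using \<rho> \<epsilon> by simp
  from localized_optimizer[OF this] obtain r w where r: "r \<ge> 1" and w: "w \<in> H1" and supp: "\<forall>x. norm x \<ge> 2 * r \<longrightarrow> w x = 0"
    and n: "1/2 \<le> nsq w" and G: "r^2 * (nsq w * kin w - gn_const / 2 * quartic w) < \<epsilon> * \<rho>^2 / 16" by blast
  have n0: "nsq w > 0" using n by linarith
  define v where "v = (\<lambda>x. (1 / sqrt (nsq w)) *\<^sub>R w x)"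
  have v: "v \<in> H1" "nsq v = 1" "kin v = kin w / nsq w" "quartic v = quartic w / (nsq w)^2"
    using normalize_H1[OF w n0] unfolding v_def H1_sphere_iff by auto
  define l where "l = 2 * r / \<rho>"
  have l: "l > 0" using r \<rho> by (simp add: l_def)
  define u where "u = (\<lambda>x. l *\<^sub>R v (0 + l *\<^sub>R x))"
  have u: "u \<in> H1" "nsq u = 1" "kin u = l^2 * kin v" "quartic u = l^2 * quartic v"
    using H1_rescale[OF v(1) l, of 0] v(2) unfolding u_def by auto
  define g where "g = nsq w * kin w - gn_const / 2 * quartic w"
  have g0: "0 \<le> g" using gagliardo_nirenberg[OF w] by (simp add: g_def)
  have "kin u - gn_const / 2 * quartic u = l^2 * (kin v - gn_const / 2 * quartic v)" by (simp add: u algebra_simps)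
  also have "kin v - gn_const / 2 * quartic v = g / (nsq w)^2"
    using n0 by (simp add: v g_def diff_divide_distrib power2_eq_square)
  also have "l^2 * (g / (nsq w)^2) \<le> l^2 * (4 * g)"
  proof (rule mult_left_mono)
    have "(1/2)^2 \<le> (nsq w)^2" using n by (intro power_mono) auto
    then have "g * 1 \<le> g * (4 * (nsq w)^2)" using g0 by (intro mult_left_mono) (auto simp: power2_eq_square)
    then show "g / (nsq w)^2 \<le> 4 * g" using n0 by (simp add: divide_le_eq mult_ac)
  qed simp
  also have "\<dots> = 16 / \<rho>^2 * (r^2 * g)" by (simp add: l_def power_divide power_mult_distrib)
  also have "\<dots> < 16 / \<rho>^2 * (\<epsilon> * \<rho>^2 / 16)" using G \<rho> by (intro mult_strict_left_mono) (auto simp: g_def)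
  also have "\<dots> = \<epsilon>" using \<rho> by simp
  finally have "kin u - gn_const / 2 * quartic u < \<epsilon>" .
  moreover have "u x = 0" if "norm x \<ge> \<rho>" for x
  proof -
    have "2 * r \<le> norm (l *\<^sub>R x)" using that l \<rho> r by (simp add: l_def field_simps)
    then have "w (l *\<^sub>R x) = 0" using supp by blast
    then show ?thesis by (simp add: u_def v_def)
  qed
  ultimately show ?thesis using u by (intro bexI[of _ u]) (auto simp: H1_sphere_iff)
qed

section \<open>Negative energy at the critical coupling\<close>

lemma H1_AE_cong:
  assumes u: "u \<in> H1" and u': "u' \<in> borel_measurable lebesgue" "AE x in lebesgue. u x = u' x"
  shows "u' \<in> H1" "nsq u' = nsq u" "kin u' = kin u" "quartic u' = quartic u"
proof -
  note U = H1_weak_gradient[OF u]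
  have 2: "u' \<in> Lp 2" by (rule L2_AE_cong[OF U(1) u'(1)]) (use u'(2) in eventually_elim, simp)
  have wg: "has_weak_gradient u' (weak_gradient u)"
    by (rule has_weak_gradient_cong[OF U(3) u'(1) L2_meas[OF U(2)] u'(2)]) simp
  show "u' \<in> H1" by (rule H1_I[OF 2 U(2) wg])
  show "kin u' = kin u" by (rule kin_eq[OF U(2) wg])
  show "nsq u' = nsq u" using L2_meas[OF U(1)] u' by (intro nsq_cong_AE) auto
  show "quartic u' = quartic u" using L2_meas[OF U(1)] u' by (intro integral_cong_AE) auto
qed

text \<open>Instead of a Lebesgue point of \<open>V\<close> the proof averages over translations with a weight \<open>w\<close> such that
  \<open>\<integral> V w < 0\<close>: the averaged potential is continuous, so it is negative on a ball that does not depend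
  on the near optimizer supported there.\<close>

lemma negative_energy_at_critical:
  assumes V: "locally_integrable V" and neg: "\<not> (AE x in lebesgue. 0 \<le> V x)"
  shows "\<exists>u\<in>H1_sphere. integrable lebesgue (\<lambda>x. V x * (norm (u x))^2) \<and> real_energy V gn_const u < 0"
proof -
  have "\<exists>w\<in>test_functions. (\<forall>x. 0 \<le> w x) \<and> (\<integral>x. w x * V x \<partial>lebesgue) < 0"
    using ae_nonneg_if_test_nonneg[OF V] neg by (meson not_less)
  then obtain w where w: "w \<in> test_functions" "\<And>x. 0 \<le> w x" "(\<integral>x. w x * V x \<partial>lebesgue) < 0" by blast
  have Va: "locally_integrable (\<lambda>x. \<bar>V x\<bar>)"
    by (rule locally_integrable_bound[OF V, of _ 1]) (use locally_integrable_meas[OF V] in auto)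
  \<comment> \<open>Half of the negative average at the origin, so that by continuity the average
    stays below \<open>- c\<close> on a whole ball.\<close>
  define c where "c = - (\<integral>x. w x * V x \<partial>lebesgue) / 2"
  have c: "c > 0" using w(3) by (simp add: c_def)
  have F0: "corr w V 0 < - c" using w(3) by (simp add: corr_def c_def)
  have "isCont (corr w V) 0" using corr_continuous[OF w(1) V] by (simp add: continuous_on_eq_continuous_at)
  then have "\<forall>\<^sub>F y in nhds 0. corr w V y < - c"
    using F0 by (intro order_tendstoD(2)[of _ "corr w V 0"]) (auto simp: isCont_def tendsto_nhds_iff)
  then obtain \<rho> where \<rho>: "\<rho> > 0" "\<And>y. norm y < \<rho> \<Longrightarrow> corr w V y < - c"
    unfolding eventually_nhds_metric by (auto simp: dist_norm)
  define I where "I = (\<integral>x. w x \<partial>lebesgue)"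
  have I0: "0 \<le> I" unfolding I_def using w(2) by (intro Bochner_Integration.integral_nonneg) auto
  \<comment> \<open>In the average over translations the deficit is counted with total weight
    \<open>I\<close>; the denominator \<open>I + 1\<close> keeps the result strictly below
    \<open>c\<close>.\<close>
  have "c / (I + 1) > 0" using c I0 by simp
  from concentrated_near_optimizer[OF \<rho>(1) this] obtain u0 where
    u0: "u0 \<in> H1_sphere" "\<And>x. norm x \<ge> \<rho> \<Longrightarrow> u0 x = 0" "kin u0 - gn_const / 2 * quartic u0 < c / (I + 1)" by blast
  have u0H: "u0 \<in> H1" "nsq u0 = 1" using u0(1) by (auto simp: H1_sphere_iff)
  \<comment> \<open>Fubini asks for Borel functions of two variables. The indicator restores, at
    every point, the support property that the representative has only almost everywhere.\<close>
  obtain u1 where u1: "u1 \<in> borel_measurable borel" "AE x in lebesgue. u0 x = u1 x"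
    using borel_representative[OF L2_meas[OF H1_L2[OF u0H(1)]]] by blast
  define u where "u x = indicator (ball 0 \<rho>) x *\<^sub>R u1 x" for x
  have ub [measurable]: "u \<in> borel_measurable borel" unfolding u_def[abs_def] using u1(1) by (intro borel_measurable_scaleR borel_measurable_indicator) auto
  have uae: "AE x in lebesgue. u0 x = u x" using u1(2)
  proof eventually_elim
    case (elim x)
    then show ?case using u0(2)[of x] by (cases "norm x < \<rho>") (auto simp: u_def)
  qed
  note u = H1_AE_cong[OF u0H(1) borel_lebesgue[OF ub] uae]
  have usupp: "u x = 0" if "norm x \<ge> \<rho>" for x using that by (simp add: u_def)
  define D where "D = kin u - gn_const / 2 * quartic u"
  have D: "D < c / (I + 1)" using u0(3) by (simp add: D_def u)
  have un: "nsq u = 1" using u(2) u0H(2) by simp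
  obtain V' where V'b [measurable]: "V' \<in> borel_measurable borel" and V'ae: "AE x in lebesgue. V x = V' x"
    using borel_representative[OF locally_integrable_meas[OF V]] by blast
  have wb [measurable]: "w \<in> borel_measurable borel"
    using test_continuous[OF w(1)] by (simp add: borel_measurable_continuous_onI)
  have V'l: "locally_integrable V'"
    unfolding locally_integrable_def set_integrable_def
  proof (intro conjI allI impI borel_lebesgue[OF V'b])
    fix K :: "plane set" assume K: "compact K"
    have "K \<in> sets lebesgue" using lmeasurable_compact[OF K] by (rule fmeasurableD)
    then have "(\<lambda>x. indicator K x *\<^sub>R V' x) \<in> borel_measurable lebesgue" using borel_lebesgue[OF V'b] by measurable
    then show "integrable lebesgue (\<lambda>x. indicator K x *\<^sub>R V' x)"
      by (rule integrable_cong_AE_imp[OF locally_integrable_set[OF V K]]) (use V'ae in eventually_elim, simp)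
  qed
  have V'al: "locally_integrable (\<lambda>x. \<bar>V' x\<bar>)"
    by (rule locally_integrable_bound[OF V'l, of _ 1]) (use locally_integrable_meas[OF V'l] in auto)
  have cV: "corr w V = corr w V'"
    by (rule corr_cong_AE[OF w(1) locally_integrable_meas[OF V] borel_lebesgue[OF V'b] V'ae])
  \<comment> \<open>Integrating over \<open>y\<close> first gives the weighted potential energies of
    the translates of \<open>u\<close>; integrating over \<open>t\<close> first gives the continuous
    average \<open>corr w V\<close> against \<open>|u|^2\<close>, which is negative on the support
    of \<open>u\<close>.\<close>
  define H where "H = (\<lambda>(y, t). w t * V' (y + t) * (norm (u y))^2)"
  have Hm [measurable]: "H \<in> borel_measurable (lborel \<Otimes>\<^sub>M lborel)"
    unfolding H_def by measurable
  have ti: "integrable lborel (\<lambda>t. w t * f (y + t))" if f: "locally_integrable f" "f \<in> borel_measurable borel" for f :: "plane \<Rightarrow> real" and y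
  proof -
    note [measurable] = f(2)
    have "integrable lebesgue (\<lambda>x. w (x - y) *\<^sub>R f x)" by (rule test_scaleR_integrable[OF f(1) test_shift[OF w(1)]])
    moreover have m: "(\<lambda>x. w (x - y) *\<^sub>R f x) \<in> borel_measurable lebesgue" by (intro borel_lebesgue) measurable
    ultimately have "integrable lebesgue (\<lambda>t. w (y + 1 *\<^sub>R t - y) *\<^sub>R f (y + 1 *\<^sub>R t))"
      by (subst integrable_affine_iff[OF _ m]) auto
    then have "integrable lebesgue (\<lambda>t. w t * f (y + t))" by simp
    then show ?thesis by (subst (asm) integrable_completion) measurable
  qed
  have tv: "(\<integral>t. w t * f (y + t) \<partial>lborel) = corr w f y" if f: "locally_integrable f" "f \<in> borel_measurable borel" for f :: "plane \<Rightarrow> real" and y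
  proof -
    note [measurable] = f(2)
    have "(\<integral>t. w t * f (y + t) \<partial>lborel) = (\<integral>t. w t * f (y + t) \<partial>lebesgue)"
      by (intro integral_completion[symmetric]) measurable
    then show ?thesis using corr_translate[OF f(1) w(1), of y] by (simp add: add.commute)
  qed
  have absb: "(\<lambda>x. \<bar>V' x\<bar>) \<in> borel_measurable borel" by measurable
  obtain B where B: "\<And>y. norm y \<le> \<rho> \<Longrightarrow> \<bar>corr w (\<lambda>x. \<bar>V' x\<bar>) y\<bar> \<le> B"
  proof -
    have "compact (corr w (\<lambda>x. \<bar>V' x\<bar>) ` cball 0 \<rho>)"
      by (intro compact_continuous_image continuous_on_subset[OF corr_continuous[OF w(1) V'al]]) auto
    then show ?thesis using that compact_imp_bounded[of "corr w (\<lambda>x. \<bar>V' x\<bar>) ` cball 0 \<rho>"] by (force simp: bounded_iff)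
  qed
  have bd_int: "integrable lborel (\<lambda>y. k y * (norm (u y))^2)"
    if k: "k \<in> borel_measurable borel" "\<And>y. norm y \<le> \<rho> \<Longrightarrow> \<bar>k y\<bar> \<le> B'" for k B'
  proof -
    have "integrable lebesgue (\<lambda>y. B' * (norm (u y))^2)" using L2_int[OF H1_L2[OF u(1)]] by simp
    then have "integrable lborel (\<lambda>y. B' * (norm (u y))^2)" by (subst (asm) integrable_completion) measurable
    then show ?thesis
    proof (rule Bochner_Integration.integrable_bound)
      show "AE y in lborel. norm (k y * (norm (u y))^2) \<le> norm (B' * (norm (u y))^2)"
      proof (rule AE_I2)
        fix y
        show "norm (k y * (norm (u y))^2) \<le> norm (B' * (norm (u y))^2)"
        proof (cases "norm y \<le> \<rho>")
          case True
          then have "\<bar>k y\<bar> \<le> \<bar>B'\<bar>" using k(2)[of y] by linarith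
          then show ?thesis by (simp add: abs_mult mult_right_mono)
        next
          case False then show ?thesis using usupp[of y] by simp
        qed
      qed
    qed (use k(1) in measurable)
  qed
  have corr_b: "corr w f \<in> borel_measurable borel" if "locally_integrable f" for f :: "plane \<Rightarrow> real"
    using corr_continuous[OF w(1) that] by (rule borel_measurable_continuous_onI)
  have Hi: "integrable (lborel \<Otimes>\<^sub>M lborel) H"
  proof (rule lborel_pair.Fubini_integrable[OF Hm])
    have "(\<integral>t. norm (H (y, t)) \<partial>lborel) = corr w (\<lambda>x. \<bar>V' x\<bar>) y * (norm (u y))^2" for y
    proof -
      have "(\<integral>t. norm (H (y, t)) \<partial>lborel) = (\<integral>t. (w t * \<bar>V' (y + t)\<bar>) * (norm (u y))^2 \<partial>lborel)"
        using w(2) by (simp add: H_def abs_mult)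
      also have "\<dots> = (\<integral>t. w t * \<bar>V' (y + t)\<bar> \<partial>lborel) * (norm (u y))^2" by (rule integral_mult_left_zero)
      finally show ?thesis using tv[OF V'al absb] by simp
    qed
    then show "integrable lborel (\<lambda>y. \<integral>t. norm (H (y, t)) \<partial>lborel)"
      using bd_int[OF corr_b[OF V'al] B] by simp
    show "AE y in lborel. integrable lborel (\<lambda>t. H (y, t))"
      unfolding H_def using ti[OF V'l V'b] by (intro AE_I2) simp
  qed
  \<comment> \<open>The potential energy of the translate of \<open>u\<close> by
    \<open>t\<close>.\<close>
  define J where "J t = (\<integral>y. V' (y + t) * (norm (u y))^2 \<partial>lborel)" for t
  have Hi': "integrable (lborel \<Otimes>\<^sub>M lborel) (case_prod (\<lambda>y t. w t * V' (y + t) * (norm (u y))^2))"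
    using Hi unfolding H_def .
  have Hy: "(\<integral>y. w t * V' (y + t) * (norm (u y))^2 \<partial>lborel) = w t * J t" for t
    by (simp add: J_def mult.assoc)
  have wJ: "integrable lborel (\<lambda>t. w t * J t)"
    using lborel_pair.integrable_snd[OF Hi'] unfolding Hy .
  have aei: "AE t in lborel. integrable lborel (\<lambda>y. w t * V' (y + t) * (norm (u y))^2)"
    using lborel_pair.AE_integrable_snd[OF Hi'] .
  have "(\<integral>t. w t * J t \<partial>lborel) = (\<integral>y. (\<integral>t. w t * V' (y + t) * (norm (u y))^2 \<partial>lborel) \<partial>lborel)"
    using lborel_pair.Fubini_integral[OF Hi'] unfolding Hy .
  also have "\<dots> = (\<integral>y. corr w V y * (norm (u y))^2 \<partial>lborel)"
    using tv[OF V'l V'b] by (simp add: cV)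
  also have "\<dots> \<le> (\<integral>y. - c * (norm (u y))^2 \<partial>lborel)"
  proof (rule integral_mono)
    obtain B' where "\<And>y. norm y \<le> \<rho> \<Longrightarrow> \<bar>corr w V y\<bar> \<le> B'"
    proof -
      have "compact (corr w V ` cball 0 \<rho>)"
        by (intro compact_continuous_image continuous_on_subset[OF corr_continuous[OF w(1) V]]) auto
      then show ?thesis using that compact_imp_bounded[of "corr w V ` cball 0 \<rho>"] by (force simp: bounded_iff)
    qed
    then show "integrable lborel (\<lambda>y. corr w V y * (norm (u y))^2)" by (rule bd_int[OF corr_b[OF V]])
    show "integrable lborel (\<lambda>y. - c * (norm (u y))^2)" by (rule bd_int[of _ "\<bar>c\<bar>"]) auto
    show "corr w V y * (norm (u y))^2 \<le> - c * (norm (u y))^2" for y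
    proof (cases "norm y < \<rho>")
      case True
      show ?thesis using \<rho>(2)[OF True] by (intro mult_right_mono) auto
    next
      case False then show ?thesis using usupp[of y] by simp
    qed
  qed
  also have "\<dots> = - c"
  proof -
    have "(\<integral>y. (norm (u y))^2 \<partial>lborel) = nsq u" unfolding nsq_def by (rule integral_completion[symmetric]) measurable
    then show ?thesis using un by simp
  qed
  finally have avg: "(\<integral>t. w t * J t \<partial>lborel) \<le> - c" .
  have wi: "integrable lborel w" "(\<integral>t. w t \<partial>lborel) = I"
    using test_integrable[OF w(1)] wb unfolding I_def
    by (simp_all add: integrable_completion integral_completion)
  \<comment> \<open>If every translate had nonnegative energy at the critical coupling, the weighted
    average would give that \<open>c\<close> is at most \<open>I * D\<close>, against the choice of
    the deficit.\<close>
  have "\<not> (AE t in lborel. 0 \<le> w t * D + w t * J t)"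
  proof
    assume "AE t in lborel. 0 \<le> w t * D + w t * J t"
    then have "0 \<le> (\<integral>t. w t * D + w t * J t \<partial>lborel)" by (rule integral_nonneg_AE)
    also have "\<dots> = I * D + (\<integral>t. w t * J t \<partial>lborel)" using wi wJ by simp
    also have "\<dots> \<le> I * D + - c" using avg by simp
    finally have "c \<le> I * D" by simp
    also have "I * D \<le> I * (c / (I + 1))" using D I0 by (intro mult_left_mono) auto
    also have "\<dots> < c" using c I0 by (simp add: field_simps)
    finally show False by simp
  qed
  \<comment> \<open>The two conditions are met simultaneously, since the integrability holds for
    almost every \<open>t\<close>. The strict inequality also forces \<open>w t\<close> to be
    nonzero, so the weight can be divided out of the integrability statement.\<close>
  then obtain t where t: "integrable lborel (\<lambda>y. w t * V' (y + t) * (norm (u y))^2)" "w t * D + w t * J t < 0"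
    using aei by (metis (mono_tags, lifting) eventually_mono not_less)
  have "w t \<noteq> 0" using t(2) by auto
  then have wt: "w t > 0" using w(2)[of t] by simp
  have DJ: "D + J t < 0" using t(2) wt by (simp add: distrib_left[symmetric] mult_less_0_iff)
  define z where "z = (\<lambda>x. u (x + (- t)))"
  note z = H1_translate[OF u(1), of "- t", folded z_def]
  have zq: "quartic z = quartic u" unfolding z_def by (rule H1_translate(4)[OF u(1)])
  have zb [measurable]: "z \<in> borel_measurable borel" unfolding z_def by measurable
  have Vi: "integrable lborel (\<lambda>y. V' (y + t) * (norm (u y))^2)"
  proof -
    have "integrable lborel (\<lambda>y. (1 / w t) * (w t * V' (y + t) * (norm (u y))^2))"
      by (rule integrable_mult_right) (rule t(1))
    then show ?thesis using wt by simp
  qed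
  have m: "(\<lambda>x. V' x * (norm (z x))^2) \<in> borel_measurable lebesgue" by (intro borel_lebesgue) measurable
  have e: "V' (t + 1 *\<^sub>R y) * (norm (z (t + 1 *\<^sub>R y)))^2 = V' (y + t) * (norm (u y))^2" for y
    by (simp add: z_def add.commute)
  have Vil: "integrable lebesgue (\<lambda>y. V' (y + t) * (norm (u y))^2)"
    using Vi by (subst integrable_completion) measurable
  have i': "integrable lebesgue (\<lambda>x. V' x * (norm (z x))^2)"
    using integrable_affine_iff[OF _ m, of 1 t] Vil unfolding e by simp
  have J': "(\<integral>x. V' x * (norm (z x))^2 \<partial>lebesgue) = J t"
  proof -
    have "(\<integral>x. V' x * (norm (z x))^2 \<partial>lebesgue) = (\<integral>y. V' (y + t) * (norm (u y))^2 \<partial>lebesgue)"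
      using integral_affine[OF _ m, of 1 t] unfolding e by simp
    also have "\<dots> = J t" unfolding J_def by (rule integral_completion) measurable
    finally show ?thesis .
  qed
  have ae: "AE x in lebesgue. V' x * (norm (z x))^2 = V x * (norm (z x))^2" using V'ae by eventually_elim simp
  have m2: "(\<lambda>x. V x * (norm (z x))^2) \<in> borel_measurable lebesgue"
    using locally_integrable_meas[OF V] borel_lebesgue[OF zb] by measurable
  have i: "integrable lebesgue (\<lambda>x. V x * (norm (z x))^2)" by (rule integrable_cong_AE_imp[OF i' m2 ae])
  have "potential V z = J t" using integral_cong_AE[OF m m2 ae] J' by simp
  then have "real_energy V gn_const z = D + J t" by (simp add: real_energy_def D_def z(3) zq)
  then show ?thesis using DJ i z un by (intro bexI[of _ z]) (auto simp: H1_sphere_iff)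
qed

section \<open>The spectrum of the Schroedinger operator\<close>

text \<open>The gradient is a closed operator; thus a sequence that is Cauchy in the form norm has
  its limit in \<open>H1\<close>.\<close>

lemma weak_gradient_closed:
  fixes u :: "nat \<Rightarrow> plane \<Rightarrow> complex"
  assumes u: "\<And>n. u n \<in> Lp 2" "\<And>n. g n \<in> Lp 2" "\<And>n. has_weak_gradient (u n) (g n)"
    and v: "v \<in> Lp 2" "h \<in> Lp 2" and lim: "(\<lambda>n. nsq (\<lambda>x. u n x - v x)) \<longlonglongrightarrow> 0" "(\<lambda>n. nsq (\<lambda>x. g n x - h x)) \<longlonglongrightarrow> 0"
  shows "has_weak_gradient v h"
  unfolding has_weak_gradient_iff
proof (intro conjI ballI allI locally_integrable_L2 v)
  have conv: "(\<lambda>n. \<integral>x. \<phi> x *\<^sub>R f n x \<partial>lebesgue) \<longlonglongrightarrow> (\<integral>x. \<phi> x *\<^sub>R F x \<partial>lebesgue)"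
    if \<phi>: "\<phi> \<in> test_functions" and f: "\<And>n. f n \<in> Lp 2" "F \<in> Lp 2" "(\<lambda>n. nsq (\<lambda>x. f n x - F x)) \<longlonglongrightarrow> 0"
    for \<phi> and f :: "nat \<Rightarrow> plane \<Rightarrow> complex" and F
  proof -
    have "(\<lambda>n. loc_nsq R (\<lambda>x. f n x - F x)) \<longlonglongrightarrow> 0" for R
    proof (rule tendsto_sandwich[OF _ _ tendsto_const f(3)])
      show "\<forall>\<^sub>F n in sequentially. loc_nsq R (\<lambda>x. f n x - F x) \<le> nsq (\<lambda>x. f n x - F x)"
        by (intro always_eventually allI loc_nsq_le L2_diff f)
    qed simp
    from test_integral_tendsto_loc[OF \<phi> L2_diff[OF f(1,2)] this]
    have "(\<lambda>n. \<integral>x. \<phi> x *\<^sub>R (f n x - F x) \<partial>lebesgue) \<longlonglongrightarrow> 0" .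
    moreover have "(\<integral>x. \<phi> x *\<^sub>R (f n x - F x) \<partial>lebesgue) = (\<integral>x. \<phi> x *\<^sub>R f n x \<partial>lebesgue) - (\<integral>x. \<phi> x *\<^sub>R F x \<partial>lebesgue)" for n
      using test_scaleR_integrable[OF locally_integrable_L2[OF f(1)[of n]] \<phi>] test_scaleR_integrable[OF locally_integrable_L2[OF f(2)] \<phi>]
      by (simp add: scaleR_diff_right)
    ultimately show ?thesis by (simp add: LIM_zero_iff)
  qed
  fix \<phi> i assume \<phi>: "\<phi> \<in> test_functions"
  have "(\<lambda>n. nsq (\<lambda>x. g n x $ i - h x $ i)) \<longlonglongrightarrow> 0"
  proof (rule tendsto_sandwich[OF _ _ tendsto_const lim(2)])
    show "\<forall>\<^sub>F n in sequentially. nsq (\<lambda>x. g n x $ i - h x $ i) \<le> nsq (\<lambda>x. g n x - h x)"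
      using L2_nth(2)[OF L2_diff[OF u(2) v(2)], of _ i] by simp
  qed simp
  then have "(\<lambda>n. \<integral>x. \<phi> x *\<^sub>R (g n x $ i) \<partial>lebesgue) \<longlonglongrightarrow> (\<integral>x. \<phi> x *\<^sub>R (h x $ i) \<partial>lebesgue)"
    by (intro conv \<phi> L2_nth(1) u v)
  then have "(\<lambda>n. - (\<integral>x. \<phi> x *\<^sub>R (g n x $ i) \<partial>lebesgue)) \<longlonglongrightarrow> - (\<integral>x. \<phi> x *\<^sub>R (h x $ i) \<partial>lebesgue)" by (rule tendsto_minus)
  moreover have "(\<lambda>n. \<integral>x. pd i \<phi> x *\<^sub>R u n x \<partial>lebesgue) \<longlonglongrightarrow> (\<integral>x. pd i \<phi> x *\<^sub>R v x \<partial>lebesgue)"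
    by (intro conv test_pd \<phi> u v lim)
  moreover have "(\<integral>x. pd i \<phi> x *\<^sub>R u n x \<partial>lebesgue) = - (\<integral>x. \<phi> x *\<^sub>R (g n x $ i) \<partial>lebesgue)" for n
    using u(3)[of n] \<phi> by (simp add: has_weak_gradient_iff)
  ultimately show "(\<integral>x. pd i \<phi> x *\<^sub>R v x \<partial>lebesgue) = - (\<integral>x. \<phi> x *\<^sub>R (h x $ i) \<partial>lebesgue)"
    using LIMSEQ_unique by force
qed

section \<open>The Schroedinger form and its real part\<close>

lemma Re_mult_cnj_inner: "Re (a * cnj b) = a \<bullet> b"
  by (simp add: inner_complex_def)

lemma L2_mult_cnj_integrable:
  fixes f g :: "plane \<Rightarrow> complex"
  assumes "f \<in> Lp 2" "g \<in> Lp 2" shows "integrable lebesgue (\<lambda>x. f x * cnj (g x))"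
proof (rule L2_bilinear_integrable[OF assms])
  have "(\<lambda>x. cnj (g x)) \<in> borel_measurable lebesgue"
    by (rule borel_measurable_continuous_on[of cnj]) (auto intro: continuous_intros L2_meas assms)
  then show "(\<lambda>x. f x * cnj (g x)) \<in> borel_measurable lebesgue" using L2_meas[OF assms(1)] by simp
qed (simp add: norm_mult)

lemma Re_l2_inner: "f \<in> Lp 2 \<Longrightarrow> g \<in> Lp 2 \<Longrightarrow> Re (l2_inner f g) = ip f g"
  unfolding l2_inner_def ip_def using integral_Re[OF L2_mult_cnj_integrable[of f g]] by (simp only: Re_mult_cnj_inner)

lemma l2_inner_i: "l2_inner f (\<lambda>x. \<i> * g x) = - \<i> * l2_inner f g"
  unfolding l2_inner_def by (simp add: mult.left_commute flip: integral_mult_right_zero)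

context admissible_potential
begin

text \<open>Together with \<open>sgnV\<close> it factors \<open>V\<close> as
  \<open>sqrt \<bar>V\<bar> * sgn V * sqrt \<bar>V\<bar>\<close>. The potential part of the form
  becomes an inner product of square integrable functions, to which Cauchy-Schwarz, completeness and
  \<open>ip_tendsto\<close> apply.\<close>

definition sqrtV :: "(plane \<Rightarrow> complex) \<Rightarrow> plane \<Rightarrow> complex" where
  "sqrtV u x = sqrt \<bar>V x\<bar> *\<^sub>R u x"

definition sgnV :: "(plane \<Rightarrow> complex) \<Rightarrow> plane \<Rightarrow> complex" where
  "sgnV u x = sgn (V x) *\<^sub>R u x"

text \<open>The negative part of \<open>V\<close> contributes an integrable function for every
  \<open>u\<close> in \<open>H1\<close>, so integrability with \<open>\<bar>V\<bar>\<close> and with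
  the positive part are equivalent.\<close>

lemma form_domain_iff: "u \<in> form_domain V \<longleftrightarrow> u \<in> H1 \<and> sqrtV u \<in> Lp 2"
proof -
  have "pos_potential_integrable V u \<longleftrightarrow> sqrtV u \<in> Lp 2" if u: "u \<in> H1"
  proof -
    note [measurable] = L2_meas[OF H1_L2[OF u]]
    have e: "(norm (sqrtV u x))^2 = pos_part V x * (norm (u x))^2 + neg_part V x * (norm (u x))^2" for x
    proof -
      have "\<bar>V x\<bar> = pos_part V x + neg_part V x" by (simp add: max_def)
      then show ?thesis by (simp add: sqrtV_def power_mult_distrib distrib_right)
    qed
    have "sqrtV u \<in> borel_measurable lebesgue" unfolding sqrtV_def[abs_def] by measurable
    then have "sqrtV u \<in> Lp 2 \<longleftrightarrow> integrable lebesgue (\<lambda>x. pos_part V x * (norm (u x))^2 + neg_part V x * (norm (u x))^2)"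
      by (simp only: L2_iff e) simp
    also have "\<dots> \<longleftrightarrow> integrable lebesgue (\<lambda>x. pos_part V x * (norm (u x))^2)"
      using neg_integrable[OF u] Bochner_Integration.integrable_diff[of lebesgue "\<lambda>x. pos_part V x * (norm (u x))^2 + neg_part V x * (norm (u x))^2" "\<lambda>x. neg_part V x * (norm (u x))^2"]
      by auto
    finally show ?thesis by (simp add: pos_potential_integrable_def)
  qed
  then show ?thesis by (auto simp: form_domain_def)
qed

lemma form_domainD:
  assumes "u \<in> form_domain V"
  shows "u \<in> H1" "sqrtV u \<in> Lp 2" "u \<in> Lp 2" "weak_gradient u \<in> Lp 2" "sgnV (sqrtV u) \<in> Lp 2"
proof -
  show "u \<in> H1" and s: "sqrtV u \<in> Lp 2" using assms by (auto simp: form_domain_iff)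
  then show "u \<in> Lp 2" "weak_gradient u \<in> Lp 2" by (auto intro: H1_weak_gradient)
  show "sgnV (sqrtV u) \<in> Lp 2" unfolding sgnV_def[abs_def]
    by (rule L2_mult_bounded(1)[OF s, where C = 1]) (auto simp: sgn_if)
qed

lemma V_inner: "V x * (u x \<bullet> v x) = sqrtV u x \<bullet> sgnV (sqrtV v) x"
proof -
  have "V x = sqrt \<bar>V x\<bar> * sqrt \<bar>V x\<bar> * sgn (V x)" by (simp add: abs_mult_sgn)
  then show ?thesis by (simp add: sqrtV_def sgnV_def mult_ac)
qed

lemma form_domain_lincomb:
  assumes "u \<in> form_domain V" "v \<in> form_domain V"
  shows "(\<lambda>x. a *\<^sub>R u x + b *\<^sub>R v x) \<in> form_domain V"
proof -
  have "sqrtV (\<lambda>x. a *\<^sub>R u x + b *\<^sub>R v x) = (\<lambda>x. a *\<^sub>R sqrtV u x + b *\<^sub>R sqrtV v x)"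
    by (simp add: sqrtV_def fun_eq_iff scaleR_add_right mult.commute)
  moreover have "(\<lambda>x. a *\<^sub>R sqrtV u x + b *\<^sub>R sqrtV v x) \<in> Lp 2"
    by (intro L2_add L2_scaleR form_domainD assms)
  ultimately show ?thesis using H1_lincomb(1)[OF form_domainD(1)[OF assms(1)] form_domainD(1)[OF assms(2)]]
    by (simp add: form_domain_iff)
qed

lemma form_domain_i:
  assumes "v \<in> form_domain V"
  shows "(\<lambda>x. \<i> * v x) \<in> form_domain V" "AE x in lebesgue. weak_gradient (\<lambda>x. \<i> * v x) x = \<i> *s weak_gradient v x"
proof -
  note D = form_domainD[OF assms]
  have wg: "has_weak_gradient (\<lambda>x. \<i> * v x) (\<lambda>x. \<i> *s weak_gradient v x)"
    using has_weak_gradient_lincomb[OF H1_weak_gradient(3)[OF D(1)] H1_weak_gradient(3)[OF D(1)], of \<i> 0] by simp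
  have g: "(\<lambda>x. \<i> *s weak_gradient v x) \<in> Lp 2"
    by (rule L2_dominated[OF D(4), of _ 1])
      (use L2_meas[OF D(4)] in \<open>auto simp: norm_smult_vec intro!: borel_measurable_smult_vec\<close>)
  have h: "(\<lambda>x. \<i> * v x) \<in> H1" by (rule H1_I[OF L2_cmult[OF D(3)] g wg])
  have "sqrtV (\<lambda>x. \<i> * v x) = (\<lambda>x. \<i> * sqrtV v x)" by (simp add: sqrtV_def fun_eq_iff)
  then have "sqrtV (\<lambda>x. \<i> * v x) \<in> Lp 2" using L2_cmult[OF D(2)] by simp
  with h show "(\<lambda>x. \<i> * v x) \<in> form_domain V" by (simp add: form_domain_iff)
  show "AE x in lebesgue. weak_gradient (\<lambda>x. \<i> * v x) x = \<i> *s weak_gradient v x" by (rule weak_gradient_AE[OF wg])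
qed

lemma form_integrable:
  assumes u: "u \<in> form_domain V" and v: "v \<in> form_domain V"
  shows "integrable lebesgue (\<lambda>x. (\<Sum>i\<in>UNIV. weak_gradient u x $ i * cnj (weak_gradient v x $ i)) + complex_of_real (V x) * u x * cnj (v x))"
proof (intro Bochner_Integration.integrable_add Bochner_Integration.integrable_sum)
  show "integrable lebesgue (\<lambda>x. weak_gradient u x $ i * cnj (weak_gradient v x $ i))" for i
    by (rule L2_mult_cnj_integrable[OF L2_nth(1)[OF form_domainD(4)[OF u]] L2_nth(1)[OF form_domainD(4)[OF v]]])
  have "complex_of_real (V x) * u x * cnj (v x) = sqrtV u x * cnj (sgnV (sqrtV v) x)" for x
  proof -
    have "V x = sqrt \<bar>V x\<bar> * sqrt \<bar>V x\<bar> * sgn (V x)" by (simp add: abs_mult_sgn)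
    then have "complex_of_real (V x) = complex_of_real (sqrt \<bar>V x\<bar>) * complex_of_real (sqrt \<bar>V x\<bar>) * complex_of_real (sgn (V x))"
      by (metis of_real_mult)
    then show ?thesis by (simp add: sqrtV_def sgnV_def scaleR_conv_of_real mult_ac)
  qed
  then show "integrable lebesgue (\<lambda>x. complex_of_real (V x) * u x * cnj (v x))"
    using L2_mult_cnj_integrable[OF form_domainD(2)[OF u] form_domainD(5)[OF v]] by simp
qed

lemma Re_form:
  assumes u: "u \<in> form_domain V" and v: "v \<in> form_domain V"
  shows "Re (schroedinger_form V u v) = ip (weak_gradient u) (weak_gradient v) + ip (sqrtV u) (sgnV (sqrtV v))"
proof -
  have "Re (schroedinger_form V u v) = (\<integral>x. weak_gradient u x \<bullet> weak_gradient v x + sqrtV u x \<bullet> sgnV (sqrtV v) x \<partial>lebesgue)"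
    unfolding schroedinger_form_def integral_Re[OF form_integrable[OF u v], symmetric]
  proof (rule Bochner_Integration.integral_cong)
    fix x
    have "Re (complex_of_real (V x) * u x * cnj (v x)) = V x * (u x \<bullet> v x)"
      by (simp add: inner_complex_def algebra_simps)
    moreover have "Re (\<Sum>i\<in>UNIV. weak_gradient u x $ i * cnj (weak_gradient v x $ i)) = weak_gradient u x \<bullet> weak_gradient v x"
      by (simp add: inner_vec_def inner_complex_def)
    ultimately show "Re ((\<Sum>i\<in>UNIV. weak_gradient u x $ i * cnj (weak_gradient v x $ i)) + complex_of_real (V x) * u x * cnj (v x)) =
        weak_gradient u x \<bullet> weak_gradient v x + sqrtV u x \<bullet> sgnV (sqrtV v) x"
      by (simp only: plus_complex.sel V_inner)
  qed simp
  also have "\<dots> = ip (weak_gradient u) (weak_gradient v) + ip (sqrtV u) (sgnV (sqrtV v))"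
    unfolding ip_def by (intro Bochner_Integration.integral_add ip_integrable form_domainD u v)
  finally show ?thesis .
qed

lemma Re_form_self:
  assumes u: "u \<in> form_domain V"
  shows "Re (schroedinger_form V u u) = kin u + potential V u"
proof -
  have "ip (sqrtV u) (sgnV (sqrtV u)) = potential V u"
    unfolding ip_def V_inner[symmetric] by (simp add: power2_norm_eq_inner)
  then show ?thesis using Re_form[OF u u] by (simp add: ip_self)
qed

text \<open>Replacing \<open>v\<close> by \<open>\<i> * v\<close> turns imaginary parts into real
  parts, so identities of complex forms follow from identities of their real parts.\<close>

lemma form_i:
  assumes u: "u \<in> form_domain V" and v: "v \<in> form_domain V"
  shows "schroedinger_form V u (\<lambda>x. \<i> * v x) = - \<i> * schroedinger_form V u v"
proof -
  have "schroedinger_form V u (\<lambda>x. \<i> * v x) = (\<integral>x. - \<i> * ((\<Sum>i\<in>UNIV. weak_gradient u x $ i * cnj (weak_gradient v x $ i)) + complex_of_real (V x) * u x * cnj (v x)) \<partial>lebesgue)"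
    unfolding schroedinger_form_def
  proof (rule integral_cong_AE)
    show "AE x in lebesgue. (\<Sum>i\<in>UNIV. weak_gradient u x $ i * cnj (weak_gradient (\<lambda>x. \<i> * v x) x $ i)) + complex_of_real (V x) * u x * cnj (\<i> * v x) =
      - \<i> * ((\<Sum>i\<in>UNIV. weak_gradient u x $ i * cnj (weak_gradient v x $ i)) + complex_of_real (V x) * u x * cnj (v x))"
      using form_domain_i(2)[OF v] by eventually_elim (simp add: sum_distrib_left sum_negf algebra_simps)
  qed (use form_integrable[OF u form_domain_i(1)[OF v]] form_integrable[OF u v] in auto)
  then show ?thesis by (simp add: schroedinger_form_def)
qed

lemma form_ip_AE:
  assumes "has_weak_gradient u g" "g \<in> Lp 2" "h \<in> Lp 2"
  shows "ip (weak_gradient u) h = ip g h"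
proof -
  have "weak_gradient u \<in> borel_measurable lebesgue"
    using someI[of "has_weak_gradient u", OF assms(1)] unfolding weak_gradient_def[symmetric]
    by (auto simp: has_weak_gradient_iff intro: locally_integrable_meas)
  note [measurable] = this L2_meas[OF assms(2)] L2_meas[OF assms(3)]
  show ?thesis unfolding ip_def
  proof (rule integral_cong_AE)
    show "AE x in lebesgue. weak_gradient u x \<bullet> h x = g x \<bullet> h x"
      using weak_gradient_AE[OF assms(1)] by eventually_elim simp
  qed measurable
qed

text \<open>If the form is nonnegative and \<open>t < 0\<close>, the equation \<open>(T - t) u = f\<close> is solved with
  \<open>riesz_sequence\<close>; the minimizing sequence converges because the form controls the \<open>H\<^sup>1\<close> norm.\<close>

lemma resolvent_solvable:
  assumes pos: "\<And>u. u \<in> form_domain V \<Longrightarrow> 0 \<le> kin u + potential V u" and t: "t < 0" and f: "f \<in> Lp 2"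
  shows "\<exists>u\<in>form_domain V. \<forall>v\<in>form_domain V. schroedinger_form V u v - complex_of_real t * l2_inner u v = l2_inner f v"
proof -
  \<comment> \<open>\<open>riesz_sequence\<close> works over the reals, so the equation is solved
    for real parts first; the imaginary parts follow at the end by testing with
    \<open>\<i> * v\<close>.\<close>
  define B where "B u v = Re (schroedinger_form V u v) - t * ip u v" for u v
  have B: "B u v = ip (weak_gradient u) (weak_gradient v) + ip (sqrtV u) (sgnV (sqrtV v)) - t * ip u v"
    if "u \<in> form_domain V" "v \<in> form_domain V" for u v
    using Re_form[OF that] by (simp add: B_def)
  have Bself: "B u u = kin u + potential V u - t * nsq u" if "u \<in> form_domain V" for u
    using Re_form_self[OF that] by (simp add: B_def ip_self)
  have Blow: "- t * nsq u \<le> B u u" if "u \<in> form_domain V" for u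
    using pos[OF that] Bself[OF that] by simp
  obtain C where C: "C \<ge> 0" "\<forall>u\<in>H1. (\<integral>x. \<bar>neg_part V x\<bar> * (norm (u x))^2 \<partial>lebesgue) \<le> C * nsq u + 1/2 * kin u"
    using tame_weight_form_bound[OF neg_tame, of "1/2"] by auto
  \<comment> \<open>Positivity of the form gives \<open>- t * nsq u\<close> at most
    \<open>B u u\<close>. The negative part of \<open>V\<close> costs half of \<open>kin u\<close>
    and \<open>C * nsq u\<close>, so the kinetic energy and the integral with
    \<open>\<bar>V\<bar>\<close> are at most \<open>4 * (1 + C / (- t))\<close> times
    \<open>B u u\<close>.\<close>
  define L where "L = max (1 / (- t)) (4 * (1 + C / (- t)))"
  have ctrl: "nsq u \<le> L * B u u" "kin u \<le> L * B u u" "nsq (sqrtV u) \<le> L * B u u" if u: "u \<in> form_domain V" for u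
  proof -
    note D = form_domainD[OF u]
    have b0: "0 \<le> B u u" using Blow[OF u] mult_nonneg_nonneg[of "- t" "nsq u"] t nsq_nonneg[of u] by linarith
    have n: "nsq u \<le> B u u / (- t)" using Blow[OF u] t by (simp add: field_simps)
    have p: "pos_potential_integrable V u" using u by (simp add: form_domain_def)
    have neg: "potential (neg_part V) u \<le> C * nsq u + 1/2 * kin u" using C(2) D(1) by simp
    have Cn: "C * nsq u \<le> C * (B u u / (- t))" using n C(1) by (rule mult_left_mono)
    have ppos: "0 \<le> potential (pos_part V) u" "0 \<le> potential (neg_part V) u"
      by (auto intro!: Bochner_Integration.integral_nonneg)
    have kq: "kin u + potential (pos_part V) u - potential (neg_part V) u \<le> B u u"
    proof -
      have "t * nsq u \<le> 0" using t by (simp add: mult_le_0_iff)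
      then show ?thesis using Bself[OF u] potential_split(2)[OF D(1) p] by linarith
    qed
    define M where "M = B u u + C * (B u u / (- t))"
    have Me: "M = (1 + C / (- t)) * B u u" by (simp add: M_def algebra_simps)
    have k2: "kin u / 2 + potential (pos_part V) u \<le> M" using kq neg Cn unfolding M_def by linarith
    have kM: "kin u \<le> 2 * M" using k2 ppos by linarith
    have nq: "nsq (sqrtV u) = potential (pos_part V) u + potential (neg_part V) u"
    proof -
      have "(norm (sqrtV u x))^2 = pos_part V x * (norm (u x))^2 + neg_part V x * (norm (u x))^2" for x
      proof -
        have "\<bar>V x\<bar> = pos_part V x + neg_part V x" by (simp add: max_def)
        then show ?thesis by (simp add: sqrtV_def power_mult_distrib distrib_right)
      qed
      then show ?thesis unfolding nsq_def using p neg_integrable[OF D(1)] by (simp add: pos_potential_integrable_def)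
    qed
    have sM: "nsq (sqrtV u) \<le> 4 * M"
    proof -
      have "C * nsq u \<le> M" using Cn b0 by (simp add: M_def)
      then show ?thesis using nq k2 neg kM nsq_nonneg[of "weak_gradient u"] by linarith
    qed
    have M0: "0 \<le> M" using kM nsq_nonneg[of "weak_gradient u"] by linarith
    have "4 * M = (4 * (1 + C / (- t))) * B u u" by (simp only: Me mult.assoc)
    also have "\<dots> \<le> L * B u u" unfolding L_def using b0 by (intro mult_right_mono) auto
    finally have m4: "4 * M \<le> L * B u u" .
    have "B u u / (- t) = (1 / (- t)) * B u u" by simp
    also have "\<dots> \<le> L * B u u" unfolding L_def using b0 by (intro mult_right_mono) auto
    finally show "nsq u \<le> L * B u u" using n by linarith
    show "kin u \<le> L * B u u" "nsq (sqrtV u) \<le> L * B u u" using kM sM m4 M0 by linarith+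
  qed
  have ne: "form_domain V \<noteq> {}"
  proof -
    have "has_weak_gradient (\<lambda>x. 0) (\<lambda>x. 0)" by (simp add: has_weak_gradient_iff locally_integrable_L2)
    then have "(\<lambda>x. 0) \<in> H1" by (intro H1_I[of _ "\<lambda>x. 0"]) auto
    moreover have "sqrtV (\<lambda>x. 0) = (\<lambda>x. 0)" by (simp add: sqrtV_def fun_eq_iff)
    ultimately have "(\<lambda>x. 0) \<in> form_domain V" unfolding form_domain_iff by simp
    then show ?thesis by blast
  qed
  have sq_comb: "sqrtV (\<lambda>x. a *\<^sub>R u x + b *\<^sub>R v x) = (\<lambda>x. a *\<^sub>R sqrtV u x + b *\<^sub>R sqrtV v x)" for a b u v
    by (simp add: sqrtV_def fun_eq_iff scaleR_add_right mult.commute)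
  have Blin: "B (\<lambda>x. a *\<^sub>R u x + b *\<^sub>R v x) z = a * B u z + b * B v z"
    if u: "u \<in> form_domain V" and v: "v \<in> form_domain V" and z: "z \<in> form_domain V" for u v z a b
  proof -
    note U = form_domainD[OF u] and V' = form_domainD[OF v] and Z = form_domainD[OF z]
    have "ip (weak_gradient (\<lambda>x. a *\<^sub>R u x + b *\<^sub>R v x)) (weak_gradient z) = ip (\<lambda>x. a *\<^sub>R weak_gradient u x + b *\<^sub>R weak_gradient v x) (weak_gradient z)"
      by (rule form_ip_AE[OF H1_lincomb(2)[OF U(1) V'(1)]]) (intro L2_add L2_scaleR U V' Z)+
    also have "\<dots> = a * ip (weak_gradient u) (weak_gradient z) + b * ip (weak_gradient v) (weak_gradient z)"
      by (simp add: ip_add_left L2_scaleR U V' Z ip_scaleR_left)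
    finally have 1: "ip (weak_gradient (\<lambda>x. a *\<^sub>R u x + b *\<^sub>R v x)) (weak_gradient z) = \<dots>" .
    have 2: "ip (sqrtV (\<lambda>x. a *\<^sub>R u x + b *\<^sub>R v x)) (sgnV (sqrtV z)) = a * ip (sqrtV u) (sgnV (sqrtV z)) + b * ip (sqrtV v) (sgnV (sqrtV z))"
      unfolding sq_comb by (simp add: ip_add_left L2_scaleR U V' Z ip_scaleR_left)
    have 3: "ip (\<lambda>x. a *\<^sub>R u x + b *\<^sub>R v x) z = a * ip u z + b * ip v z"
      by (simp add: ip_add_left L2_scaleR U V' Z ip_scaleR_left)
    show ?thesis unfolding B[OF form_domain_lincomb[OF u v] z] B[OF u z] B[OF v z] 1 2 3 by (simp add: algebra_simps)
  qed
  have Bsym: "B u v = B v u" if "u \<in> form_domain V" "v \<in> form_domain V" for u v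
  proof -
    have "ip (sqrtV u) (sgnV (sqrtV v)) = ip (sqrtV v) (sgnV (sqrtV u))"
      unfolding ip_def V_inner[symmetric] by (simp add: inner_commute)
    then show ?thesis unfolding B[OF that] B[OF that(2,1)] by (simp add: ip_commute)
  qed
  have B0: "0 \<le> B u u" if "u \<in> form_domain V" for u
    using Blow[OF that] mult_nonneg_nonneg[of "- t" "nsq u"] t nsq_nonneg[of u] by linarith
  have fl: "ip f (\<lambda>x. a *\<^sub>R u x + b *\<^sub>R v x) = a * ip f u + b * ip f v" if "u \<in> form_domain V" "v \<in> form_domain V" for u v a b
    using form_domainD(3)[OF that(1)] form_domainD(3)[OF that(2)] f by (simp add: ip_add_right L2_scaleR ip_scaleR_right)
  have fb: "(ip f u)^2 \<le> (nsq f / (- t)) * B u u" if u: "u \<in> form_domain V" for u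
  proof -
    have "(ip f u)^2 \<le> nsq f * nsq u" by (rule ip_CS[OF f form_domainD(3)[OF u]])
    also have "\<dots> \<le> nsq f * (B u u / (- t))" using Blow[OF u] t by (intro mult_left_mono) (auto simp: field_simps)
    finally show ?thesis by simp
  qed
  have "\<exists>s. (\<forall>n. s n \<in> form_domain V) \<and> (\<forall>e>0. \<exists>N. \<forall>m\<ge>N. \<forall>n\<ge>N. B (\<lambda>x. s m x - s n x) (\<lambda>x. s m x - s n x) < e)
      \<and> (\<forall>v\<in>form_domain V. (\<lambda>n. B (s n) v) \<longlonglongrightarrow> ip f v)"
  proof (rule riesz_sequence[of "form_domain V" B "ip f" "nsq f / (- t)"])
    fix s assume s: "\<And>n. s n \<in> form_domain V" "\<And>e. e > 0 \<Longrightarrow> \<exists>N. \<forall>m\<ge>N. \<forall>n\<ge>N. B (\<lambda>x. s m x - s n x) (\<lambda>x. s m x - s n x) < e"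
      "\<And>v. v \<in> form_domain V \<Longrightarrow> (\<lambda>n. B (s n) v) \<longlonglongrightarrow> ip f v"
    show ?thesis by (intro exI[of _ s] conjI allI impI ballI s)
  qed (use ne form_domain_lincomb Blin Bsym B0 fl fb t in \<open>auto simp: divide_nonneg_neg\<close>)
  then obtain s where s: "\<And>n. s n \<in> form_domain V" "\<forall>e>0. \<exists>N. \<forall>m\<ge>N. \<forall>n\<ge>N. B (\<lambda>x. s m x - s n x) (\<lambda>x. s m x - s n x) < e"
    "\<forall>v\<in>form_domain V. (\<lambda>n. B (s n) v) \<longlonglongrightarrow> ip f v" by blast
  note S = form_domainD[OF s(1)]
  have L0: "L > 0"
  proof -
    have "0 < 1 / (- t)" using t by simp
    then show ?thesis unfolding L_def by linarith
  qed
  have sdiff: "(\<lambda>x. s m x - s n x) \<in> form_domain V" for m n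
    using form_domain_lincomb[OF s(1) s(1), of 1 m "-1" n] by simp
  have cauchy: "\<exists>N. \<forall>m\<ge>N. \<forall>n\<ge>N. F m n < e" if F: "\<And>m n. F m n \<le> L * B (\<lambda>x. s m x - s n x) (\<lambda>x. s m x - s n x)" and e: "e > 0" for F :: "nat \<Rightarrow> nat \<Rightarrow> real" and e
  proof -
    have "e / L > 0" using e L0 by simp
    then obtain N where N: "\<forall>m\<ge>N. \<forall>n\<ge>N. B (\<lambda>x. s m x - s n x) (\<lambda>x. s m x - s n x) < e / L" using s(2) by blast
    have "F m n < e" if "m \<ge> N" "n \<ge> N" for m n
    proof -
      have "L * B (\<lambda>x. s m x - s n x) (\<lambda>x. s m x - s n x) < L * (e / L)" using N that L0 by (intro mult_strict_left_mono) auto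
      then show ?thesis using F[of m n] L0 by simp
    qed
    then show ?thesis by blast
  qed
  have c1: "\<exists>N. \<forall>m\<ge>N. \<forall>n\<ge>N. nsq (\<lambda>x. s m x - s n x) < e" if "e > 0" for e
    by (rule cauchy[OF ctrl(1)[OF sdiff] that])
  have c2: "\<exists>N. \<forall>m\<ge>N. \<forall>n\<ge>N. nsq (\<lambda>x. weak_gradient (s m) x - weak_gradient (s n) x) < e" if "e > 0" for e
    by (rule cauchy[OF ctrl(2)[OF sdiff, unfolded H1_diff(2)[OF S(1) S(1)]] that])
  have sqd: "sqrtV (\<lambda>x. s m x - s n x) = (\<lambda>x. sqrtV (s m) x - sqrtV (s n) x)" for m n
    by (simp add: sqrtV_def fun_eq_iff scaleR_diff_right)
  have c3: "\<exists>N. \<forall>m\<ge>N. \<forall>n\<ge>N. nsq (\<lambda>x. sqrtV (s m) x - sqrtV (s n) x) < e" if "e > 0" for e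
    by (rule cauchy[OF ctrl(3)[OF sdiff, unfolded sqd] that])
  obtain u where u: "u \<in> Lp 2" "(\<lambda>n. nsq (\<lambda>x. s n x - u x)) \<longlonglongrightarrow> 0" using L2_complete[OF S(3) c1] by blast
  obtain g where g: "g \<in> Lp 2" "(\<lambda>n. nsq (\<lambda>x. weak_gradient (s n) x - g x)) \<longlonglongrightarrow> 0" using L2_complete[OF S(4) c2] by blast
  obtain p where p: "p \<in> Lp 2" "(\<lambda>n. nsq (\<lambda>x. sqrtV (s n) x - p x)) \<longlonglongrightarrow> 0" using L2_complete[OF S(2) c3] by blast
  have wg: "has_weak_gradient u g"
    by (rule weak_gradient_closed[OF S(3) S(4) H1_weak_gradient(3)[OF S(1)] u(1) g(1) u(2) g(2)])
  have uH: "u \<in> H1" by (rule H1_I[OF u(1) g(1) wg])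
  \<comment> \<open>The weighted sequence converges in mean square to some \<open>p\<close>, which
    is identified with \<open>sqrtV u\<close> along a common subsequence on which both sequences
    converge almost everywhere.\<close>
  have pae: "AE x in lebesgue. p x = sqrtV u x"
  proof -
    obtain r where r: "strict_mono r" "AE x in lebesgue. (\<lambda>n. s (r n) x) \<longlonglongrightarrow> u x"
      using L2_AE_subseq[OF S(3) u] by blast
    have "(\<lambda>n. nsq (\<lambda>x. sqrtV (s (r n)) x - p x)) \<longlonglongrightarrow> 0" using LIMSEQ_subseq_LIMSEQ[OF p(2) r(1)] by (simp add: o_def)
    then obtain r' where r': "strict_mono r'" "AE x in lebesgue. (\<lambda>n. sqrtV (s (r (r' n))) x) \<longlonglongrightarrow> p x"
      using L2_AE_subseq[of "\<lambda>n. sqrtV (s (r n))" p] S(2) p(1) by blast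
    show ?thesis using r(2) r'(2)
    proof eventually_elim
      case (elim x)
      have "(\<lambda>n. s (r (r' n)) x) \<longlonglongrightarrow> u x" using LIMSEQ_subseq_LIMSEQ[OF elim(1) r'(1)] by (simp add: o_def)
      then have "(\<lambda>n. sqrtV (s (r (r' n))) x) \<longlonglongrightarrow> sqrtV u x" unfolding sqrtV_def by (intro tendsto_intros)
      then show ?case using elim(2) LIMSEQ_unique by blast
    qed
  qed
  have sqm: "sqrtV u \<in> borel_measurable lebesgue"
    using L2_meas[OF u(1)] unfolding sqrtV_def[abs_def] by measurable
  have sq2: "sqrtV u \<in> Lp 2" by (rule L2_AE_cong[OF p(1) sqm]) (use pae in eventually_elim, simp)
  have uD: "u \<in> form_domain V" using uH sq2 by (simp add: form_domain_iff)
  have Buv: "B u v = ip f v" if v: "v \<in> form_domain V" for v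
  proof -
    note V' = form_domainD[OF v]
    have "(\<lambda>n. B (s n) v) \<longlonglongrightarrow> ip g (weak_gradient v) + ip p (sgnV (sqrtV v)) - t * ip u v"
      unfolding B[OF s(1) v]
      by (intro tendsto_intros ip_tendsto[OF S(4) g(1) V'(4) g(2)] ip_tendsto[OF S(2) p(1) V'(5) p(2)] ip_tendsto[OF S(3) u(1) V'(3) u(2)])
    then have "ip f v = ip g (weak_gradient v) + ip p (sgnV (sqrtV v)) - t * ip u v"
      using s(3) v LIMSEQ_unique by blast
    moreover have "ip p (sgnV (sqrtV v)) = ip (sqrtV u) (sgnV (sqrtV v))"
      unfolding ip_def using pae L2_meas[OF p(1)] sqm L2_meas[OF V'(5)] by (intro integral_cong_AE) auto
    ultimately show ?thesis using B[OF uD v] form_ip_AE[OF wg g(1) V'(4)] by simp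
  qed
  have Re_eq: "Re (schroedinger_form V u v - complex_of_real t * l2_inner u v) = Re (l2_inner f v)" if v: "v \<in> form_domain V" for v
    using Buv[OF v] Re_l2_inner[OF u(1) form_domainD(3)[OF v]] Re_l2_inner[OF f form_domainD(3)[OF v]] by (simp add: B_def)
  have "schroedinger_form V u v - complex_of_real t * l2_inner u v = l2_inner f v" if v: "v \<in> form_domain V" for v
  proof (rule complex_eqI)
    show "Re (schroedinger_form V u v - complex_of_real t * l2_inner u v) = Re (l2_inner f v)" by (rule Re_eq[OF v])
    show "Im (schroedinger_form V u v - complex_of_real t * l2_inner u v) = Im (l2_inner f v)"
      using Re_eq[OF form_domain_i(1)[OF v]] unfolding form_i[OF uD v] l2_inner_i by simp
  qed
  with uD show ?thesis by blast
qed

theorem negative_spectrum_imp_negative_form: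
  assumes "inf_spectrum (schroedinger_op V) < 0"
  shows "\<exists>u\<in>form_domain V. kin u + potential V u < 0"
proof (rule ccontr)
  assume "\<not> ?thesis"
  then have pos: "0 \<le> kin u + potential V u" if "u \<in> form_domain V" for u using that by (force simp: not_less)
  let ?T = "schroedinger_op V"
  have "complex_of_real t \<in> resolvent_set ?T" if t: "t < 0" for t
  proof -
    \<comment> \<open>The operator equation tested with \<open>u\<close> itself, followed by
      Cauchy-Schwarz. The same estimate yields injectivity and boundedness of the inverse, with
      constant \<open>1 / (- t)\<close>.\<close>
    have bd: "sqrt (nsq u) \<le> (1 / (- t)) * sqrt (nsq (\<lambda>x. w x - complex_of_real t * u x))" if uw: "(u, w) \<in> ?T" for u w
    proof -
      have u: "u \<in> form_domain V" and w: "w \<in> Lp 2" and eq: "schroedinger_form V u u = l2_inner w u"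
        using uw by (auto simp: schroedinger_op_def)
      note D = form_domainD[OF u]
      have tu: "(\<lambda>x. complex_of_real t * u x) \<in> Lp 2" by (rule L2_cmult[OF D(3)])
      have "kin u + potential V u = ip w u"
        using Re_form_self[OF u] eq Re_l2_inner[OF w D(3)] by simp
      then have "- t * nsq u \<le> ip w u - t * nsq u" using pos[OF u] by simp
      also have "\<dots> = ip (\<lambda>x. w x - complex_of_real t * u x) u"
      proof -
        have "ip (\<lambda>x. complex_of_real t * u x) u = t * nsq u"
          using ip_scaleR_left[of t u u] by (simp add: ip_self scaleR_conv_of_real)
        then show ?thesis by (simp add: ip_diff_left[OF w tu D(3)])
      qed
      also have "\<dots> \<le> sqrt (nsq (\<lambda>x. w x - complex_of_real t * u x)) * sqrt (nsq u)"
        using ip_abs_le[OF L2_diff[OF w tu] D(3)] by linarith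
      finally have *: "(- t * sqrt (nsq u)) * sqrt (nsq u) \<le> sqrt (nsq (\<lambda>x. w x - complex_of_real t * u x)) * sqrt (nsq u)"
        by (simp add: mult.assoc)
      have "- t * sqrt (nsq u) \<le> sqrt (nsq (\<lambda>x. w x - complex_of_real t * u x))"
      proof (cases "nsq u = 0")
        case False
        then have "0 < sqrt (nsq u)" by (simp add: less_le)
        with * show ?thesis by (rule mult_right_le_imp_le)
      qed simp
      then show ?thesis using t by (simp add: field_simps)
    qed
    show ?thesis
      unfolding resolvent_set_def mem_Collect_eq
    proof (intro conjI)
      show "\<forall>(u, w)\<in>?T. (AE x in lebesgue. w x - complex_of_real t * u x = 0) \<longrightarrow> (AE x in lebesgue. u x = 0)"
      proof -
        have "AE x in lebesgue. u x = 0" if uw: "(u, w) \<in> ?T" and z: "AE x in lebesgue. w x - complex_of_real t * u x = 0" for u w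
        proof -
          have u: "u \<in> form_domain V" and w: "w \<in> Lp 2" using uw by (auto simp: schroedinger_op_def)
          have d: "(\<lambda>x. w x - complex_of_real t * u x) \<in> Lp 2" by (intro L2_diff w L2_cmult form_domainD(3)[OF u])
          have "nsq (\<lambda>x. w x - complex_of_real t * u x) = nsq (\<lambda>x. 0 :: complex)"
            using z L2_meas[OF d] by (intro nsq_cong_AE) auto
          also have "\<dots> = 0" by (simp add: nsq_def)
          finally have "sqrt (nsq u) \<le> 0" using bd[OF uw] by simp
          then have "nsq u = 0" using nsq_nonneg[of u] by simp
          then show ?thesis by (rule nsq_eq_0[OF form_domainD(3)[OF u]])
        qed
        then show ?thesis by blast
      qed
      show "\<exists>C. \<forall>(u, w)\<in>?T. l2_norm u \<le> C * l2_norm (\<lambda>x. w x - complex_of_real t * u x)"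
        using bd by (intro exI[of _ "1 / (- t)"]) (auto simp: l2_norm_nsq)
      show "\<forall>f\<in>Lp 2. \<exists>(u, w)\<in>?T. AE x in lebesgue. w x - complex_of_real t * u x = f x"
      proof
        fix f :: "plane \<Rightarrow> complex" assume f: "f \<in> Lp 2"
        obtain u where u: "u \<in> form_domain V" and eq: "\<forall>v\<in>form_domain V. schroedinger_form V u v - complex_of_real t * l2_inner u v = l2_inner f v"
          using resolvent_solvable[OF pos t f] by blast
        define w where "w x = f x + complex_of_real t * u x" for x
        have w: "w \<in> Lp 2" unfolding w_def[abs_def] by (intro L2_add f L2_cmult form_domainD(3)[OF u])
        have "schroedinger_form V u v = l2_inner w v" if v: "v \<in> form_domain V" for v
        proof -
          have "l2_inner w v = l2_inner f v + complex_of_real t * l2_inner u v"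
            unfolding l2_inner_def w_def
            using L2_mult_cnj_integrable[OF f form_domainD(3)[OF v]] L2_mult_cnj_integrable[OF form_domainD(3)[OF u] form_domainD(3)[OF v]]
            by (simp add: distrib_right mult.assoc)
          then show ?thesis using eq v by (metis diff_add_cancel)
        qed
        then have "(u, w) \<in> ?T" using u w by (simp add: schroedinger_op_def)
        moreover have "AE x in lebesgue. w x - complex_of_real t * u x = f x" by (simp add: w_def)
        ultimately show "\<exists>(u, w)\<in>?T. AE x in lebesgue. w x - complex_of_real t * u x = f x" by blast
      qed
    qed
  qed
  then have "0 \<le> inf_spectrum ?T"
    unfolding inf_spectrum_def spectrum_def by (intro INF_greatest) (auto simp: not_less[symmetric])
  then show False using assms by simp
qed

end

section \<open>Thresholds for the coupling constant\<close>

lemma essinf_nonneg: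
  assumes "V \<in> borel_measurable lebesgue" "AE x in lebesgue. 0 \<le> V x" shows "0 \<le> essinf V"
proof -
  have "esssup lebesgue (\<lambda>x. - ereal (V x)) \<le> 0"
    using assms by (intro esssup_I) (auto elim: eventually_mono)
  then show ?thesis unfolding essinf_def using ereal_uminus_le_reorder by force
qed

lemma tame_weight_Lp_plus_Lq:
  assumes "W \<in> Lp_plus_Lq p q" "W \<in> borel_measurable lebesgue" "1 < p" "1 < q" shows "tame_weight W"
proof -
  obtain g h where gh: "g \<in> Lp p" "h \<in> Lp q" "AE x in lebesgue. W x = g x + h x"
    using assms(1) by (auto simp: Lp_plus_Lq_def)
  show ?thesis
    by (rule tame_weight_dominated[OF tame_weight_Lp[OF gh(1) assms(3)] tame_weight_Lp[OF gh(2) assms(4)] assms(2)])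
      (use gh(3) in \<open>eventually_elim, simp add: abs_triangle_ineq\<close>)
qed

context admissible_potential
begin

lemma minimizer_if_negative:
  assumes "u \<in> H1_sphere" "pos_potential_integrable V u" "real_energy V a u < 0" "0 \<le> a" "a < gn_const"
  shows "\<exists>u. is_minimizer V a u"
proof (rule minimizer_exists[OF assms(4,5)])
  have "ground_energy V a \<le> energy V a u" unfolding ground_energy_def by (rule INF_lower[OF assms(1)])
  also have "\<dots> < 0" using assms(1-3) by (simp add: energy_eq H1_sphere_iff)
  finally show "ground_energy V a < 0" .
qed

text \<open>Lowering \<open>a\<close> from \<open>gn_const\<close> raises the energy of the fixed
  state \<open>u\<close> linearly, so a strictly negative value survives for a while.\<close>

lemma minimizer_near_critical:
  assumes u: "u \<in> H1_sphere" "integrable lebesgue (\<lambda>x. V x * (norm (u x))^2)" "real_energy V gn_const u < 0"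
  shows "\<exists>a0\<in>{0..<gn_const}. \<forall>a\<in>{a0..<gn_const}. \<exists>u. is_minimizer V a u"
proof -
  have uH: "u \<in> H1" using u(1) by (simp add: H1_sphere_iff)
  note [measurable] = L2_meas[OF H1_L2[OF uH]]
  have p: "pos_potential_integrable V u"
    unfolding pos_potential_integrable_def
    by (rule Bochner_Integration.integrable_bound[OF u(2)]) (auto simp: abs_mult mult_right_mono intro!: AE_I2)
  define q where "q = quartic u"
  have q: "q \<ge> 0" unfolding q_def by (rule quartic_nonneg)
  \<comment> \<open>The admissible decrease of \<open>a\<close>; the added 1 ensures a positive
    denominator and a strict inequality.\<close>
  define s where "s = - real_energy V gn_const u / (q + 1)"
  have s: "s > 0" using u(3) q unfolding s_def by (intro divide_pos_pos) auto
  define a0 where "a0 = max 0 (gn_const - s)"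
  have "\<exists>u. is_minimizer V a u" if a: "a0 \<le> a" "a < gn_const" for a
  proof (rule minimizer_if_negative[OF u(1) p])
    have "(gn_const - a) / 2 * q \<le> s * q" using a q s by (intro mult_right_mono) (auto simp: a0_def)
    also have "s * q < s * (q + 1)" using s by simp
    also have "s * (q + 1) = - real_energy V gn_const u" using q by (simp add: s_def)
    finally have "(gn_const - a) / 2 * q < - real_energy V gn_const u" .
    moreover have "real_energy V a u = real_energy V gn_const u + (gn_const - a) / 2 * q"
      by (simp add: real_energy_def q_def field_simps)
    ultimately show "real_energy V a u < 0" by linarith
  qed (use a in \<open>auto simp: a0_def\<close>)
  moreover have "a0 \<in> {0..<gn_const}" using s gn_const_pos by (simp add: a0_def)
  ultimately show ?thesis by (intro bexI[of _ a0]) auto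
qed

text \<open>For nonnegative \<open>a\<close> the quartic term only lowers the energy, so a negative
  value of the quadratic form is enough for every coupling below \<open>gn_const\<close>.\<close>

lemma minimizer_if_negative_form:
  assumes u: "u \<in> form_domain V" "kin u + potential V u < 0" and a: "0 \<le> a" "a < gn_const"
  shows "\<exists>u. is_minimizer V a u"
proof -
  have uH: "u \<in> H1" and p: "pos_potential_integrable V u" using u(1) by (auto simp: form_domain_def)
  have "nsq u \<noteq> 0"
  proof
    assume "nsq u = 0"
    note z = nsq_0_imp[OF uH this]
    have "AE x in lebesgue. V x * (norm (u x))^2 = 0" using z(1) by eventually_elim simp
    then have "potential V u = 0" by (rule integral_eq_zero_AE)
    with z(3) u(2) show False by simp
  qed
  then have n: "nsq u > 0" using nsq_nonneg[of u] by linarith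
  define w where "w = (\<lambda>x. (1 / sqrt (nsq u)) *\<^sub>R u x)"
  note w = normalize_H1[OF uH n, folded w_def]
  have wn: "(norm (w x))^2 = (norm (u x))^2 / nsq u" for x using n by (simp add: w_def power_divide)
  have "pos_potential_integrable V w"
    using p unfolding pos_potential_integrable_def wn by (simp add: times_divide_eq_right)
  moreover have "potential V w = potential V u / nsq u" unfolding wn by simp
  then have "kin w + potential V w < 0" using u(2) n w(2) by (simp add: add_divide_distrib[symmetric] divide_neg_pos)
  then have "real_energy V a w < 0" unfolding real_energy_def
    using mult_nonneg_nonneg[of "a / 2" "quartic w"] quartic_nonneg[of w] a(1) by linarith
  ultimately show ?thesis using minimizer_if_negative[OF w(1)] a by blast
qed

end

theorem theorem1:
  fixes V :: "plane \<Rightarrow> real" and p q :: real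
  assumes "locally_integrable V"
    and "essinf V < 0"
    and "1 < p" and "p < q"
    and "(\<lambda>x. max (- V x) 0) \<in> Lp_plus_Lq p q"
  shows "(\<exists>a0\<in>{0..<gn_const}. \<forall>a\<in>{a0..<gn_const}. \<exists>u. is_minimizer V a u) \<and>
         (inf_spectrum (schroedinger_op V) < 0 \<longrightarrow>
            0 \<in> {0..<gn_const} \<and> (\<forall>a\<in>{0..<gn_const}. \<exists>u. is_minimizer V a u))"
proof -
  note V [measurable] = locally_integrable_meas[OF assms(1)]
  have "neg_part V \<in> borel_measurable lebesgue" by measurable
  from tame_weight_Lp_plus_Lq[OF assms(5) this] interpret admissible_potential V
    using V assms(3,4) by unfold_locales auto
  have "\<not> (AE x in lebesgue. 0 \<le> V x)" using essinf_nonneg[OF V] assms(2) by (auto simp: not_le[symmetric])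
  from negative_energy_at_critical[OF assms(1) this] obtain u where
    "u \<in> H1_sphere" "integrable lebesgue (\<lambda>x. V x * (norm (u x))^2)" "real_energy V gn_const u < 0" by blast
  from minimizer_near_critical[OF this] show ?thesis
    using negative_spectrum_imp_negative_form minimizer_if_negative_form gn_const_pos by fastforce
qed

end
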